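(* Let $k$ be a field and let $A=k[x]/(x^2)$ with basis $\bar 1=1+(x^2)$, $\bar x=x+(x^2)$. Then every unital Hopf algebra action on $A$ is equivalent to one of the following five unital actions: (1) $\psi_1\colon k\otimes A\to A$, $\psi_1(\lambda\otimes a)=\lambda a$ for all $\lambda\in k$, $a\in A$. The cosupport $\mathrm{cosupp}\,\psi_1$ is one-dimensional and consists of all scalar operators on $A$. (2) (if $\mathrm{char}\,k=2$) $\psi_2\colon k[x]/(x^2)\otimes A\to A$, where the structure of a Hopf algebra on $k[x]/(x^2)$ is defined by $\Delta\bar x=\bar x\otimes\bar1+\bar1\otimes\bar x$, $\varepsilon(\bar x)=0$, $S\bar x=\bar x$, and $\psi_2(\bar x\otimes\bar x)=\bar1$. The cosupport $\mathrm{cosupp}\,\psi_2$ consists of all linear operators on $A$ that have matrices of the form $\left(\begin{smallmatrix}\alpha&\beta\\0&\alpha\end{smallmatrix}\right)$, $\alpha,\beta\in k$, in the basis $\bar1,\bar x$. (3) (if $\mathrm{char}\,k=2$) $\psi_{3,\theta}\colon(k\times k)\otimes A\to A$, where $k\times k$ is endowed with the Hopf algebra structure transported from $(kC_2)^*$, $C_2=\langle c\rangle$ cyclic of order $2$, via $(1,0)\mapsto\delta_1$, $(0,1)\mapsto\delta_c$ ($\delta_1,\delta_c$ being the basis dual to the basis $1,c$ of $kC_2$), and $$\psi_{3,\theta}\bigl((\alpha,\beta)\otimes\bar1\bigr)=\alpha\bar1,\qquad\psi_{3,\theta}\bigl((\alpha,\beta)\otimes\bar x\bigr)=\theta(\alpha+\beta)\bar1+\beta\bar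 x\quad\text{for all }\alpha,\beta\in k,$$ where $\theta\in k\setminus\{0\}$ is a fixed element. The cosupport $\mathrm{cosupp}\,\psi_{3,\theta}$ consists of all linear operators on $A$ that have matrices of the form $\left(\begin{smallmatrix}\alpha&\theta(\alpha+\beta)\\0&\beta\end{smallmatrix}\right)$, $\alpha,\beta\in k$, in the basis $\bar1,\bar x$. (4) $\psi_4\colon(kC_\infty)^\circ\otimes A\to A$, where $C_\infty=\langle c\rangle$ is the infinite cyclic group and $\psi_4(\lambda\otimes\bar x)=\lambda(c)\bar x$ for all $\lambda\in(kC_\infty)^\circ$. The cosupport $\mathrm{cosupp}\,\psi_4$ is two-dimensional and consists of all linear operators on $A$ that have diagonal matrices in the basis $\bar1,\bar x$. If $\mathrm{char}\,k\neq2$, then this class of equivalent actions contains the action $\psi_{4a}\colon kC_2\otimes A\to A$ where $C_2=\langle c\rangle$ and $\psi_{4a}(c\otimes\bar x)=-\bar x$. (5) $\psi_5=\rho_5^\vee(\varkappa\otimes\mathrm{id}_A)\colon(k\langle c,d,h\rangle/I_0)^\circ\otimes A\to A$, where $\rho_5\colon A\to A\otimes k\langle c,d,h\rangle/I_0$ is the unital coaction with $\rho_5(\bar x)=\bar1\otimes\bar h+\bar x\otimes\bar c$, $k\langle c,d,h\rangle/I_0$ is the Hopf algebra defined in the context, and $\varkappa\colon(k\langle c,d,h\rangle/I_0)^\circ\hookrightarrow(k\langle c,d,h\rangle/I_0)^*$ is the inclusion. The cosupport $\mathrm{cosupp}\,\psi_5$ is three-dimensional and consists of all linear operators on $A$ that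 have upper triangular matrices in the basis $\bar1,\bar x$. If $\mathrm{char}\,k\neq2$, then this class of equivalent actions contains the action $\psi_{5a}\colon H_4\otimes A\to A$ of the Sweedler algebra $H_4$ where $\psi_{5a}(c\otimes\bar x)=-\bar x$, $\psi_{5a}(v\otimes\bar x)=\bar1$. (Moreover, $\psi_{5a}=\rho_{5a}^\vee$, where $\rho_{5a}\colon A\to A\otimes H_4$ is the unital coaction with $\rho_{5a}(\bar x)=\bar x\otimes c+\bar1\otimes cv$, if $H_4$ and $H_4^*$ are identified via the Hopf algebra isomorphism $\xi$ defined in the context.) Finally, the actions $\psi_1,\psi_2,\psi_{3,\theta},\psi_4,\psi_5$ and the corresponding Hopf algebras are $V$-universal for their cosupports $V$.
   Context: Actions. For a Hopf algebra $H$ over $k$ and a unital $k$-algebra $A$, an $H$-action on $A$ is a linear map $\psi\colon H\otimes A\to A$, written $\psi(h\otimes a)=ha$, making $A$ a left $H$-module with $h(ab)=(h_{(1)}a)(h_{(2)}b)$; it is unital if $h1_A=\varepsilon(h)1_A$ for all $h\in H$. A (unital) Hopf algebra action on $A$ is a (unital) $H$-action for some Hopf algebra $H$. An $H$-coaction on $A$ is an algebra homomorphism $\rho\colon A\to A\otimes H$ making $A$ a right $H$-comodule; it is unital if $\rho(1_A)=1_A\otimes1_H$; for it, $\rho^\vee\colon H^*\otimes A\to A$ is $\rho^\vee(\lambda\otimes a)=\lambda(a_{(1)})a_{(0)}$ where $\rho(a)=a_{(0)}\otimes a_{(1)}$. $H^\circ$ is the finite (Sweedler) dual of $H$: all $\lambda\in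 H^*$ vanishing on some two-sided ideal of finite codimension; it is a Hopf algebra. Cosupport and equivalence. $\mathrm{cosupp}\,\psi=\{\psi(h\otimes(-))\mid h\in H\}\subseteq\mathrm{End}_k(A)$, a unital subalgebra. Actions $\psi_1$ on $A_1$ and $\psi_2$ on $A_2$ are equivalent (via $\varphi$) if there is an algebra isomorphism $\varphi\colon A_1\to A_2$ with $\varphi(\mathrm{cosupp}\,\psi_1)\varphi^{-1}=\mathrm{cosupp}\,\psi_2$. Matrices of operators: the $j$-th column contains the coordinates of the image of the $j$-th basis vector. Universality. For a unital subalgebra $V\subseteq\mathrm{End}_k(A)$, a Hopf algebra $H_0$ with an $H_0$-action $\psi_0$ on $A$, $\mathrm{cosupp}\,\psi_0\subseteq V$, is $V$-universal if for every Hopf algebra $H$ and every $H$-action $\psi$ on $A$ with $\mathrm{cosupp}\,\psi\subseteq V$ there is a unique Hopf algebra homomorphism $\varphi\colon H\to H_0$ with $\psi=\psi_0(\varphi\otimes\mathrm{id}_A)$. Convention: (co)actions on unital associative algebras are assumed unital (so $h\bar1=\varepsilon(h)\bar1$ whenever the action on $\bar1$ is not specified). The Hopf algebra $k\langle c,d,h\rangle/I_0$: $k\langle c,d,h\rangle$ is the free unital associative algebra, $I_0$ is the two-sided ideal generated by $cd-1$, $dc-1$, $h^2$, $hc+ch$; $\Delta,\varepsilon$ are induced by the unital algebra homomorphisms with $\Delta c=c\otimes c$, $\Delta d=d\otimes d$, $\Delta h=h\otimes c+1\otimes h$, $\varepsilon(c)=\varepsilon(d)=1$, $\varepsilon(h)=0$,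 and $S$ by the unital anti-homomorphism with $Sc=d$, $Sd=c$, $Sh=-hd$. In $\bar c,\bar h$ the bars denote images in this quotient. Sweedler algebra $H_4$: generated as a unital algebra by $c,v$ with $c^2=1$, $v^2=0$, $vc=-cv$, basis $1,c,v,cv$; $\Delta c=c\otimes c$, $\Delta v=c\otimes v+v\otimes 1$, $\varepsilon(c)=1$, $\varepsilon(v)=0$, $Sc=c$, $Sv=-cv$. For $\mathrm{char}\,k\ne2$, $\xi\colon H_4\to H_4^*$ is the Hopf algebra isomorphism $\xi(1)=\delta_1+\delta_c$, $\xi(c)=\delta_1-\delta_c$, $\xi(v)=\delta_{cv}-\delta_v$, $\xi(cv)=\delta_v+\delta_{cv}$, where $\delta_1,\delta_c,\delta_v,\delta_{cv}$ is the basis dual to $1,c,v,cv$. *)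

theory Defs
  imports
    "HOL-Algebra.Algebraic_Closure_Type"
    "HOL-Algebra.QuotRing"
    "HOL-Algebra.Elementary_Groups"
    "HOL-Library.Poly_Mapping"
    "HOL-Library.FuncSet"
begin

section \<open>Formal linear combinations and tensors\<close>

text \<open>
  The base field is a type \<open>'k\<close> of class \<open>field\<close>; algebras and Hopf algebras over it are
  \<open>HOL-Algebra\<close> records with a carrier.  An element of a tensor product \<open>A \<otimes> B\<close> is written as a
  formal \<open>'k\<close>-linear combination of pairs, that is, as an element of the free vector space on the
  pairs, and two of them denote the same tensor iff they are congruent modulo the subspace spanned
  by the bilinearity relations.  Maps into a tensor product return such a representative, and every
  identity between tensors below is stated modulo this congruence.
\<close>

definition fscale :: "'k::field \<Rightarrow> ('x \<Rightarrow>\<^sub>0 'k) \<Rightarrow> ('x \<Rightarrow>\<^sub>0 'k)"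
  where "fscale c t = Poly_Mapping.map ((*) c) t"

text \<open>Linear extensions of a map given on basis elements, with values in a free vector space,
  in a \<open>'k\<close>-module with a carrier, and in \<open>'k\<close>.\<close>

definition flift :: "('x \<Rightarrow> ('y \<Rightarrow>\<^sub>0 'k)) \<Rightarrow> ('x \<Rightarrow>\<^sub>0 'k) \<Rightarrow> ('y \<Rightarrow>\<^sub>0 'k::field)"
  where "flift f t = (\<Sum>x\<in>Poly_Mapping.keys t. fscale (Poly_Mapping.lookup t x) (f x))"

definition mlift :: "('k::field, 'a, 'm) module_scheme \<Rightarrow> ('x \<Rightarrow> 'a) \<Rightarrow> ('x \<Rightarrow>\<^sub>0 'k) \<Rightarrow> 'a"
  where "mlift A f t =
    (\<Oplus>\<^bsub>A\<^esub>x\<in>Poly_Mapping.keys t. Poly_Mapping.lookup t x \<odot>\<^bsub>A\<^esub> f x)"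

definition slift :: "('x \<Rightarrow> 'k) \<Rightarrow> ('x \<Rightarrow>\<^sub>0 'k) \<Rightarrow> 'k::field"
  where "slift f t = (\<Sum>x\<in>Poly_Mapping.keys t. Poly_Mapping.lookup t x * f x)"

definition tens :: "'a \<Rightarrow> 'b \<Rightarrow> ('a \<times> 'b \<Rightarrow>\<^sub>0 'k::field)"
  where "tens a b = Poly_Mapping.single (a, b) 1"

definition tensor_carrier ::
    "('k::field, 'a, 'm) module_scheme \<Rightarrow> ('k, 'b, 'n) module_scheme \<Rightarrow> ('a \<times> 'b \<Rightarrow>\<^sub>0 'k) set"
  where "tensor_carrier A B = {t. Poly_Mapping.keys t \<subseteq> carrier A \<times> carrier B}"

definition tensor_relators ::
    "('k::field, 'a, 'm) module_scheme \<Rightarrow> ('k, 'b, 'n) module_scheme \<Rightarrow> ('a \<times> 'b \<Rightarrow>\<^sub>0 'k) set"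
  where "tensor_relators A B =
      {tens (a \<oplus>\<^bsub>A\<^esub> a') b - tens a b - tens a' b |a a' b.
         a \<in> carrier A \<and> a' \<in> carrier A \<and> b \<in> carrier B}
    \<union> {tens a (b \<oplus>\<^bsub>B\<^esub> b') - tens a b - tens a b' |a b b'.
         a \<in> carrier A \<and> b \<in> carrier B \<and> b' \<in> carrier B}
    \<union> {tens (c \<odot>\<^bsub>A\<^esub> a) b - fscale c (tens a b) |c a b. a \<in> carrier A \<and> b \<in> carrier B}
    \<union> {tens a (c \<odot>\<^bsub>B\<^esub> b) - fscale c (tens a b) |c a b. a \<in> carrier A \<and> b \<in> carrier B}"

definition tensor_eq ::
    "('k::field, 'a, 'm) module_scheme \<Rightarrow> ('k, 'b, 'n) module_scheme
      \<Rightarrow> ('a \<times> 'b \<Rightarrow>\<^sub>0 'k) \<Rightarrow> ('a \<times> 'b \<Rightarrow>\<^sub>0 'k) \<Rightarrow> bool"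
  where "tensor_eq A B s t \<longleftrightarrow> s - t \<in> module.span fscale (tensor_relators A B)"

text \<open>Threefold tensors are formal combinations of triples; \<open>tens_l a t\<close> is \<open>a \<otimes> t\<close> and
  \<open>tens_r t c\<close> is \<open>t \<otimes> c\<close>.\<close>

definition tens_l :: "'a \<Rightarrow> ('b \<times> 'c \<Rightarrow>\<^sub>0 'k) \<Rightarrow> ('a \<times> 'b \<times> 'c \<Rightarrow>\<^sub>0 'k::field)"
  where "tens_l a = flift (\<lambda>(b, c). Poly_Mapping.single (a, b, c) 1)"

definition tens_r :: "('a \<times> 'b \<Rightarrow>\<^sub>0 'k) \<Rightarrow> 'c \<Rightarrow> ('a \<times> 'b \<times> 'c \<Rightarrow>\<^sub>0 'k::field)"
  where "tens_r t c = flift (\<lambda>(a, b). Poly_Mapping.single (a, b, c) 1) t"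

definition tensor3_eq ::
    "('k::field, 'a, 'm) module_scheme \<Rightarrow> ('k, 'b, 'n) module_scheme \<Rightarrow> ('k, 'c, 'o) module_scheme
      \<Rightarrow> ('a \<times> 'b \<times> 'c \<Rightarrow>\<^sub>0 'k) \<Rightarrow> ('a \<times> 'b \<times> 'c \<Rightarrow>\<^sub>0 'k) \<Rightarrow> bool"
  where "tensor3_eq A B C s t \<longleftrightarrow> s - t \<in> module.span fscale
      ({tens_r r c |r c. r \<in> tensor_relators A B \<and> c \<in> carrier C}
       \<union> {tens_l a r |a r. a \<in> carrier A \<and> r \<in> tensor_relators B C})"

definition tmap ::
    "('a \<Rightarrow> 'c) \<Rightarrow> ('b \<Rightarrow> 'd) \<Rightarrow> ('a \<times> 'b \<Rightarrow>\<^sub>0 'k) \<Rightarrow> ('c \<times> 'd \<Rightarrow>\<^sub>0 'k::field)"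
  where "tmap f g = flift (\<lambda>(a, b). tens (f a) (g b))"

definition tmult ::
    "('k::field, 'a, 'm) module_scheme \<Rightarrow> ('k, 'b, 'n) module_scheme
      \<Rightarrow> ('a \<times> 'b \<Rightarrow>\<^sub>0 'k) \<Rightarrow> ('a \<times> 'b \<Rightarrow>\<^sub>0 'k) \<Rightarrow> ('a \<times> 'b \<Rightarrow>\<^sub>0 'k)"
  where "tmult A B s t =
    flift (\<lambda>(a, b). flift (\<lambda>(a', b'). tens (a \<otimes>\<^bsub>A\<^esub> a') (b \<otimes>\<^bsub>B\<^esub> b')) t) s"


section \<open>Algebras, Hopf algebras, actions, coactions\<close>

text \<open>Associative unital algebras; unlike the library locale \<open>algebra\<close>, not assumed commutative.\<close>

locale k_algebra =
  module ring_of_type_algebra A + ring A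
  for A :: "('k::field, 'a, 'm) module_scheme" (structure) +
  assumes smult_mult_l: "\<lbrakk>x \<in> carrier A; y \<in> carrier A\<rbrakk> \<Longrightarrow> (c \<odot> x) \<otimes> y = c \<odot> (x \<otimes> y)"
    and smult_mult_r: "\<lbrakk>x \<in> carrier A; y \<in> carrier A\<rbrakk> \<Longrightarrow> x \<otimes> (c \<odot> y) = c \<odot> (x \<otimes> y)"

definition k_linear ::
    "('k::field, 'a, 'm) module_scheme \<Rightarrow> ('k, 'b, 'n) module_scheme \<Rightarrow> ('a \<Rightarrow> 'b) \<Rightarrow> bool"
  where "k_linear A B f \<longleftrightarrow> f \<in> carrier A \<rightarrow> carrier B
    \<and> (\<forall>x\<in>carrier A. \<forall>y\<in>carrier A. f (x \<oplus>\<^bsub>A\<^esub> y) = f x \<oplus>\<^bsub>B\<^esub> f y)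
    \<and> (\<forall>c. \<forall>x\<in>carrier A. f (c \<odot>\<^bsub>A\<^esub> x) = c \<odot>\<^bsub>B\<^esub> f x)"

definition k_functional :: "('k::field, 'a, 'm) module_scheme \<Rightarrow> ('a \<Rightarrow> 'k) \<Rightarrow> bool"
  where "k_functional A f \<longleftrightarrow>
      (\<forall>x\<in>carrier A. \<forall>y\<in>carrier A. f (x \<oplus>\<^bsub>A\<^esub> y) = f x + f y)
    \<and> (\<forall>c. \<forall>x\<in>carrier A. f (c \<odot>\<^bsub>A\<^esub> x) = c * f x)"

text \<open>A linear map from \<open>A\<close> into \<open>B \<otimes> C\<close>.\<close>

definition tensor_linear ::
    "('k::field, 'a, 'm) module_scheme \<Rightarrow> ('k, 'b, 'n) module_scheme \<Rightarrow> ('k, 'c, 'o) module_scheme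
      \<Rightarrow> ('a \<Rightarrow> ('b \<times> 'c \<Rightarrow>\<^sub>0 'k)) \<Rightarrow> bool"
  where "tensor_linear A B C f \<longleftrightarrow> f \<in> carrier A \<rightarrow> tensor_carrier B C
    \<and> (\<forall>x\<in>carrier A. \<forall>y\<in>carrier A. tensor_eq B C (f (x \<oplus>\<^bsub>A\<^esub> y)) (f x + f y))
    \<and> (\<forall>c. \<forall>x\<in>carrier A. tensor_eq B C (f (c \<odot>\<^bsub>A\<^esub> x)) (fscale c (f x)))"

record (overloaded) ('k::zero, 'h) hopf = "('k, 'h) module" +
  comult :: "'h \<Rightarrow> ('h \<times> 'h \<Rightarrow>\<^sub>0 'k)"
  counit :: "'h \<Rightarrow> 'k"
  antipode :: "'h \<Rightarrow> 'h"

locale hopf_algebra = k_algebra H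
  for H :: "('k::field, 'h, 'm) hopf_scheme" (structure) +
  assumes comult_linear: "tensor_linear H H H (comult H)"
    and comult_one: "tensor_eq H H (comult H \<one>) (tens \<one> \<one>)"
    and comult_mult: "\<lbrakk>x \<in> carrier H; y \<in> carrier H\<rbrakk> \<Longrightarrow>
      tensor_eq H H (comult H (x \<otimes> y)) (tmult H H (comult H x) (comult H y))"
    and counit_linear: "k_functional H (counit H)"
    and counit_one: "counit H \<one> = 1"
    and counit_mult: "\<lbrakk>x \<in> carrier H; y \<in> carrier H\<rbrakk> \<Longrightarrow>
      counit H (x \<otimes> y) = counit H x * counit H y"
    and coassoc: "x \<in> carrier H \<Longrightarrow> tensor3_eq H H H
      (flift (\<lambda>(a, b). tens_r (comult H a) b) (comult H x))
      (flift (\<lambda>(a, b). tens_l a (comult H b)) (comult H x))"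
    and counit_l: "x \<in> carrier H \<Longrightarrow> mlift H (\<lambda>(a, b). counit H a \<odot> b) (comult H x) = x"
    and counit_r: "x \<in> carrier H \<Longrightarrow> mlift H (\<lambda>(a, b). counit H b \<odot> a) (comult H x) = x"
    and antipode_linear: "k_linear H H (antipode H)"
    and antipode_l: "x \<in> carrier H \<Longrightarrow>
      mlift H (\<lambda>(a, b). antipode H a \<otimes> b) (comult H x) = counit H x \<odot> \<one>"
    and antipode_r: "x \<in> carrier H \<Longrightarrow>
      mlift H (\<lambda>(a, b). a \<otimes> antipode H b) (comult H x) = counit H x \<odot> \<one>"

definition hopf_hom ::
    "('k::field, 'h, 'm) hopf_scheme \<Rightarrow> ('k, 'g, 'n) hopf_scheme \<Rightarrow> ('h \<Rightarrow> 'g) \<Rightarrow> bool"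
  where "hopf_hom H G f \<longleftrightarrow> k_linear H G f \<and> f \<in> ring_hom H G
    \<and> (\<forall>x\<in>carrier H. tensor_eq G G (comult G (f x)) (tmap f f (comult H x)))
    \<and> (\<forall>x\<in>carrier H. counit G (f x) = counit H x)
    \<and> (\<forall>x\<in>carrier H. antipode G (f x) = f (antipode H x))"

definition hopf_iso ::
    "('k::field, 'h, 'm) hopf_scheme \<Rightarrow> ('k, 'g, 'n) hopf_scheme \<Rightarrow> ('h \<Rightarrow> 'g) \<Rightarrow> bool"
  where "hopf_iso H G f \<longleftrightarrow> hopf_hom H G f \<and> bij_betw f (carrier H) (carrier G)"

text \<open>A linear map \<open>H \<otimes> A \<rightarrow> A\<close> is given as the corresponding bilinear map \<open>\<psi>\<close>,
  with \<open>\<psi> h a\<close> the image of \<open>h \<otimes> a\<close>.\<close>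

locale hopf_action = hopf_algebra H + A: k_algebra A
  for H :: "('k::field, 'h, 'm) hopf_scheme"
    and A :: "('k::field, 'a, 'n) module_scheme"
    and \<psi> :: "'h \<Rightarrow> 'a \<Rightarrow> 'a" +
  assumes act_linear_r: "h \<in> carrier H \<Longrightarrow> k_linear A A (\<psi> h)"
    and act_linear_l: "a \<in> carrier A \<Longrightarrow> k_linear H A (\<lambda>h. \<psi> h a)"
    and act_one: "a \<in> carrier A \<Longrightarrow> \<psi> \<one>\<^bsub>H\<^esub> a = a"
    and act_mult: "\<lbrakk>g \<in> carrier H; h \<in> carrier H; a \<in> carrier A\<rbrakk> \<Longrightarrow>
      \<psi> (g \<otimes>\<^bsub>H\<^esub> h) a = \<psi> g (\<psi> h a)"
    and act_prod: "\<lbrakk>h \<in> carrier H; a \<in> carrier A; b \<in> carrier A\<rbrakk> \<Longrightarrow>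
      \<psi> h (a \<otimes>\<^bsub>A\<^esub> b) = mlift A (\<lambda>(h1, h2). \<psi> h1 a \<otimes>\<^bsub>A\<^esub> \<psi> h2 b) (comult H h)"

locale unital_hopf_action = hopf_action +
  assumes act_unital: "h \<in> carrier H \<Longrightarrow> \<psi> h \<one>\<^bsub>A\<^esub> = counit H h \<odot>\<^bsub>A\<^esub> \<one>\<^bsub>A\<^esub>"

locale unital_coaction = hopf_algebra H + A: k_algebra A
  for H :: "('k::field, 'h, 'm) hopf_scheme"
    and A :: "('k::field, 'a, 'n) module_scheme"
    and \<rho> :: "'a \<Rightarrow> ('a \<times> 'h \<Rightarrow>\<^sub>0 'k)" +
  assumes coact_linear: "tensor_linear A A H \<rho>"
    and coact_mult: "\<lbrakk>a \<in> carrier A; b \<in> carrier A\<rbrakk> \<Longrightarrow>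
      tensor_eq A H (\<rho> (a \<otimes>\<^bsub>A\<^esub> b)) (tmult A H (\<rho> a) (\<rho> b))"
    and coact_coassoc: "a \<in> carrier A \<Longrightarrow> tensor3_eq A H H
      (flift (\<lambda>(a, h). tens_r (\<rho> a) h) (\<rho> a))
      (flift (\<lambda>(a, h). tens_l a (comult H h)) (\<rho> a))"
    and coact_counit: "a \<in> carrier A \<Longrightarrow> mlift A (\<lambda>(a, h). counit H h \<odot>\<^bsub>A\<^esub> a) (\<rho> a) = a"
    and coact_unital: "tensor_eq A H (\<rho> \<one>\<^bsub>A\<^esub>) (tens \<one>\<^bsub>A\<^esub> \<one>\<^bsub>H\<^esub>)"

text \<open>The map \<open>\<rho>\<^sup>\<or>(\<lambda> \<otimes> a) = \<lambda>(a\<^sub>1) a\<^sub>0\<close>.\<close>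

definition coact_check ::
    "('k::field, 'a, 'n) module_scheme \<Rightarrow> ('a \<Rightarrow> ('a \<times> 'h \<Rightarrow>\<^sub>0 'k)) \<Rightarrow> ('h \<Rightarrow> 'k) \<Rightarrow> 'a \<Rightarrow> 'a"
  where "coact_check A \<rho> l a = mlift A (\<lambda>(a0, a1). l a1 \<odot>\<^bsub>A\<^esub> a0) (\<rho> a)"


section \<open>Cosupport, equivalence, universality\<close>

text \<open>Operators on \<open>A\<close> are functions on \<open>carrier A\<close>, made unique by extensionality.\<close>

definition End_k :: "('k::field, 'a, 'n) module_scheme \<Rightarrow> ('a \<Rightarrow> 'a) set"
  where "End_k A = {f \<in> extensional (carrier A). k_linear A A f}"

definition unital_subalgebra_End :: "('k::field, 'a, 'n) module_scheme \<Rightarrow> ('a \<Rightarrow> 'a) set \<Rightarrow> bool"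
  where "unital_subalgebra_End A V \<longleftrightarrow> V \<subseteq> End_k A \<and> (\<lambda>a\<in>carrier A. a) \<in> V
    \<and> (\<forall>f\<in>V. \<forall>g\<in>V. (\<lambda>a\<in>carrier A. f a \<oplus>\<^bsub>A\<^esub> g a) \<in> V \<and> compose (carrier A) f g \<in> V)
    \<and> (\<forall>c. \<forall>f\<in>V. (\<lambda>a\<in>carrier A. c \<odot>\<^bsub>A\<^esub> f a) \<in> V)"

text \<open>\<open>V\<close> is a subspace of dimension \<open>n\<close>: it is parametrised bijectively by the coefficients
  of linear combinations of a basis with \<open>n\<close> elements.\<close>

definition operator_dim :: "('k::field, 'a, 'n) module_scheme \<Rightarrow> ('a \<Rightarrow> 'a) set \<Rightarrow> nat \<Rightarrow> bool"
  where "operator_dim A V n \<longleftrightarrow> (\<exists>B \<subseteq> End_k A. finite B \<and> card B = n \<and>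
    bij_betw (\<lambda>c. \<lambda>a\<in>carrier A. \<Oplus>\<^bsub>A\<^esub>f\<in>B. c f \<odot>\<^bsub>A\<^esub> f a) (B \<rightarrow>\<^sub>E (UNIV :: 'k set)) V)"

definition cosupp ::
    "('k::field, 'h, 'm) hopf_scheme \<Rightarrow> ('k, 'a, 'n) module_scheme \<Rightarrow> ('h \<Rightarrow> 'a \<Rightarrow> 'a) \<Rightarrow> ('a \<Rightarrow> 'a) set"
  where "cosupp H A \<psi> = {restrict (\<psi> h) (carrier A) |h. h \<in> carrier H}"

definition equivalent_actions ::
    "('k::field, 'h, 'm) hopf_scheme \<Rightarrow> ('k, 'a, 'n) module_scheme \<Rightarrow> ('h \<Rightarrow> 'a \<Rightarrow> 'a)
      \<Rightarrow> ('k, 'g, 'o) hopf_scheme \<Rightarrow> ('k, 'b, 'p) module_scheme \<Rightarrow> ('g \<Rightarrow> 'b \<Rightarrow> 'b) \<Rightarrow> bool"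
  where "equivalent_actions H1 A1 \<psi>1 H2 A2 \<psi>2 \<longleftrightarrow>
    (\<exists>\<phi>. \<phi> \<in> ring_iso A1 A2 \<and> k_linear A1 A2 \<phi> \<and>
      {\<lambda>b\<in>carrier A2. \<phi> (f (inv_into (carrier A1) \<phi> b)) |f. f \<in> cosupp H1 A1 \<psi>1}
        = cosupp H2 A2 \<psi>2)"

text \<open>The test Hopf algebras range over all those whose elements come from a type \<open>'h\<close>, which is
  passed as an argument because a definition cannot quantify over types.\<close>

definition V_universal ::
    "'h itself \<Rightarrow> ('k::field, 'a, 'n) module_scheme \<Rightarrow> ('a \<Rightarrow> 'a) set
      \<Rightarrow> ('k, 'g, 'o) hopf_scheme \<Rightarrow> ('g \<Rightarrow> 'a \<Rightarrow> 'a) \<Rightarrow> bool"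
  where "V_universal T A V H0 \<psi>0 \<longleftrightarrow>
    unital_subalgebra_End A V \<and> hopf_action H0 A \<psi>0 \<and> cosupp H0 A \<psi>0 \<subseteq> V \<and>
    (\<forall>(H :: ('k, 'h) hopf) \<psi>. hopf_action H A \<psi> \<and> cosupp H A \<psi> \<subseteq> V \<longrightarrow>
      (\<exists>!\<phi>. \<phi> \<in> extensional (carrier H) \<and> hopf_hom H H0 \<phi> \<and>
        (\<forall>h\<in>carrier H. \<forall>a\<in>carrier A. \<psi> h a = \<psi>0 (\<phi> h) a)))"


section \<open>Constructions of algebras and Hopf algebras\<close>

definition quot_algebra :: "('k::field, 'a, 'm) module_scheme \<Rightarrow> 'a set \<Rightarrow> ('k, 'a set) module"
  where "quot_algebra A I = ring.extend (A Quot I)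
    (module.fields (\<lambda>c Z. \<Union>x\<in>Z. I +>\<^bsub>A\<^esub> (c \<odot>\<^bsub>A\<^esub> x)))"

definition monoid_algebra :: "('g, 'm) monoid_scheme \<Rightarrow> ('k::field, 'g \<Rightarrow>\<^sub>0 'k) module"
  where "monoid_algebra M = \<lparr>
    carrier = {f. Poly_Mapping.keys f \<subseteq> carrier M},
    monoid.mult = (\<lambda>f g. flift (\<lambda>u. flift (\<lambda>v. Poly_Mapping.single (u \<otimes>\<^bsub>M\<^esub> v) 1) g) f),
    one = Poly_Mapping.single \<one>\<^bsub>M\<^esub> 1,
    ring.zero = 0,
    add = (+),
    module.smult = fscale\<rparr>"

definition group_hopf :: "('g, 'm) monoid_scheme \<Rightarrow> ('k::field, 'g \<Rightarrow>\<^sub>0 'k) hopf"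
  where "group_hopf G = module.extend (monoid_algebra G) (hopf.fields
    (flift (\<lambda>g. tens (Poly_Mapping.single g 1) (Poly_Mapping.single g 1)))
    (slift (\<lambda>g. 1))
    (flift (\<lambda>g. Poly_Mapping.single (inv\<^bsub>G\<^esub> g) 1)))"

definition finite_codim_ideal :: "('k::field, 'a, 'm) module_scheme \<Rightarrow> 'a set \<Rightarrow> bool"
  where "finite_codim_ideal A I \<longleftrightarrow> ideal I A \<and> (\<exists>B. finite B \<and> B \<subseteq> carrier A \<and>
    (\<forall>a\<in>carrier A. \<exists>i\<in>I. \<exists>c. a = i \<oplus>\<^bsub>A\<^esub> (\<Oplus>\<^bsub>A\<^esub>b\<in>B. c b \<odot>\<^bsub>A\<^esub> b)))"

definition finite_dual_carrier :: "('k::field, 'a, 'm) module_scheme \<Rightarrow> ('a \<Rightarrow> 'k) set"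
  where "finite_dual_carrier A = {l \<in> extensional (carrier A). k_functional A l \<and>
    (\<exists>I. finite_codim_ideal A I \<and> (\<forall>x\<in>I. l x = 0))}"

text \<open>The Sweedler dual, with \<open>(\<lambda>\<mu>)(h) = \<lambda>(h\<^sub>1) \<mu>(h\<^sub>2)\<close> and
  \<open>\<lambda>(gh) = \<lambda>\<^sub>1(g) \<lambda>\<^sub>2(h)\<close>; the latter determines the tensor \<open>\<lambda>\<^sub>1 \<otimes> \<lambda>\<^sub>2\<close>, and any
  representative of it will do.  For a finite dimensional \<open>H\<close> this is the full dual of \<open>H\<close>.\<close>

definition finite_dual :: "('k::field, 'h, 'm) hopf_scheme \<Rightarrow> ('k, 'h \<Rightarrow> 'k) hopf"
  where "finite_dual H = \<lparr>
    carrier = finite_dual_carrier H,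
    monoid.mult = (\<lambda>l m. \<lambda>h\<in>carrier H. slift (\<lambda>(h1, h2). l h1 * m h2) (comult H h)),
    one = (\<lambda>h\<in>carrier H. counit H h),
    ring.zero = (\<lambda>h\<in>carrier H. 0),
    add = (\<lambda>l m. \<lambda>h\<in>carrier H. l h + m h),
    module.smult = (\<lambda>c l. \<lambda>h\<in>carrier H. c * l h),
    comult = (\<lambda>l. SOME t. Poly_Mapping.keys t \<subseteq> finite_dual_carrier H \<times> finite_dual_carrier H \<and>
      (\<forall>g\<in>carrier H. \<forall>h\<in>carrier H. l (g \<otimes>\<^bsub>H\<^esub> h) = slift (\<lambda>(l1, l2). l1 g * l2 h) t)),
    counit = (\<lambda>l. l \<one>\<^bsub>H\<^esub>),
    antipode = (\<lambda>l. \<lambda>h\<in>carrier H. l (antipode H h))\<rparr>"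

text \<open>The Hopf algebra structure on the set \<open>Z\<close> transported along a bijection \<open>f\<close> from \<open>Z\<close>
  onto \<open>carrier G\<close>.\<close>

definition transport_hopf :: "'h set \<Rightarrow> ('h \<Rightarrow> 'g) \<Rightarrow> ('k::field, 'g, 'm) hopf_scheme \<Rightarrow> ('k, 'h) hopf"
  where "transport_hopf Z f G = \<lparr>
    carrier = Z,
    monoid.mult = (\<lambda>x y. inv_into Z f (f x \<otimes>\<^bsub>G\<^esub> f y)),
    one = inv_into Z f \<one>\<^bsub>G\<^esub>,
    ring.zero = inv_into Z f \<zero>\<^bsub>G\<^esub>,
    add = (\<lambda>x y. inv_into Z f (f x \<oplus>\<^bsub>G\<^esub> f y)),
    module.smult = (\<lambda>c x. inv_into Z f (c \<odot>\<^bsub>G\<^esub> f x)),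
    comult = (\<lambda>x. tmap (inv_into Z f) (inv_into Z f) (comult G (f x))),
    counit = (\<lambda>x. counit G (f x)),
    antipode = (\<lambda>x. inv_into Z f (antipode G (f x)))\<rparr>"

definition field_hopf :: "('k::field, 'k) hopf"
  where "field_hopf = \<lparr>
    carrier = UNIV, monoid.mult = (*), one = 1, ring.zero = 0, add = (+), module.smult = (*),
    comult = (\<lambda>a. fscale a (tens 1 1)), counit = (\<lambda>a. a), antipode = (\<lambda>a. a)\<rparr>"


subsection \<open>Hopf algebras presented by generators and relations\<close>

text \<open>The free algebra on the type \<open>'g\<close> is the monoid algebra of the monoid of words.\<close>

definition free_algebra :: "('k::field, 'g list \<Rightarrow>\<^sub>0 'k) module"
  where "free_algebra = monoid_algebra \<lparr>carrier = UNIV, monoid.mult = (@), one = []\<rparr>"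

definition word :: "'g list \<Rightarrow> ('g list \<Rightarrow>\<^sub>0 'k::field)"
  where "word w = Poly_Mapping.single w 1"

primrec word_comult ::
    "('g \<Rightarrow> (('g list \<Rightarrow>\<^sub>0 'k) \<times> ('g list \<Rightarrow>\<^sub>0 'k) \<Rightarrow>\<^sub>0 'k))
      \<Rightarrow> 'g list \<Rightarrow> (('g list \<Rightarrow>\<^sub>0 'k) \<times> ('g list \<Rightarrow>\<^sub>0 'k) \<Rightarrow>\<^sub>0 'k::field)"
  where
    "word_comult D [] = tens (word []) (word [])"
  | "word_comult D (g # w) = tmult free_algebra free_algebra (D g) (word_comult D w)"

primrec word_antipode :: "('g \<Rightarrow> ('g list \<Rightarrow>\<^sub>0 'k)) \<Rightarrow> 'g list \<Rightarrow> ('g list \<Rightarrow>\<^sub>0 'k::field)"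
  where
    "word_antipode T [] = word []"
  | "word_antipode T (g # w) = word_antipode T w \<otimes>\<^bsub>free_algebra\<^esub> T g"

text \<open>The quotient of the free algebra by the two-sided ideal generated by \<open>R\<close>, with \<open>\<Delta>\<close>, \<open>\<epsilon>\<close>
  (as algebra homomorphisms) and \<open>S\<close> (as an anti-homomorphism) induced by the values \<open>D\<close>, \<open>E\<close>, \<open>T\<close>
  on the generators.  They are evaluated at an arbitrary representative of a coset, so this is
  meaningful only when \<open>D\<close>, \<open>E\<close>, \<open>T\<close> are compatible with \<open>R\<close>.\<close>

definition pres_class :: "('g list \<Rightarrow>\<^sub>0 'k) set \<Rightarrow> ('g list \<Rightarrow>\<^sub>0 'k) \<Rightarrow> ('g list \<Rightarrow>\<^sub>0 'k::field) set"
  where "pres_class R f = genideal free_algebra R +>\<^bsub>free_algebra\<^esub> f"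

definition presented_hopf ::
    "('g list \<Rightarrow>\<^sub>0 'k) set \<Rightarrow> ('g \<Rightarrow> (('g list \<Rightarrow>\<^sub>0 'k) \<times> ('g list \<Rightarrow>\<^sub>0 'k) \<Rightarrow>\<^sub>0 'k))
      \<Rightarrow> ('g \<Rightarrow> 'k) \<Rightarrow> ('g \<Rightarrow> ('g list \<Rightarrow>\<^sub>0 'k)) \<Rightarrow> ('k::field, ('g list \<Rightarrow>\<^sub>0 'k) set) hopf"
  where "presented_hopf R D E T =
    module.extend (quot_algebra free_algebra (genideal free_algebra R)) (hopf.fields
      (\<lambda>Z. tmap (pres_class R) (pres_class R) (flift (word_comult D) (SOME f. f \<in> Z)))
      (\<lambda>Z. slift (\<lambda>w. prod_list (map E w)) (SOME f. f \<in> Z))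
      (\<lambda>Z. pres_class R (flift (word_antipode T) (SOME f. f \<in> Z))))"

text \<open>The Hopf algebra \<open>k\<langle>c,d,h\<rangle>/I\<^sub>0\<close>.\<close>

datatype cdh = GenC | GenD | GenH

definition cdh_relators :: "(cdh list \<Rightarrow>\<^sub>0 'k::field) set"
  where "cdh_relators = {word [GenC, GenD] - word [], word [GenD, GenC] - word [],
    word [GenH, GenH], word [GenH, GenC] + word [GenC, GenH]}"

definition cdh_hopf :: "('k::field, (cdh list \<Rightarrow>\<^sub>0 'k) set) hopf"
  where "cdh_hopf = presented_hopf cdh_relators
    (case_cdh (tens (word [GenC]) (word [GenC]))
              (tens (word [GenD]) (word [GenD]))
              (tens (word [GenH]) (word [GenC]) + tens (word []) (word [GenH])))
    (case_cdh 1 1 0)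
    (case_cdh (word [GenD]) (word [GenC]) (- word [GenH, GenD]))"

definition cdh_c :: "(cdh list \<Rightarrow>\<^sub>0 'k::field) set"
  where "cdh_c = pres_class cdh_relators (word [GenC])"

definition cdh_h :: "(cdh list \<Rightarrow>\<^sub>0 'k::field) set"
  where "cdh_h = pres_class cdh_relators (word [GenH])"

text \<open>The Sweedler algebra \<open>H\<^sub>4\<close>.\<close>

datatype cv = SwC | SwV

definition sweedler_relators :: "(cv list \<Rightarrow>\<^sub>0 'k::field) set"
  where "sweedler_relators =
    {word [SwC, SwC] - word [], word [SwV, SwV], word [SwV, SwC] + word [SwC, SwV]}"

definition sweedler :: "('k::field, (cv list \<Rightarrow>\<^sub>0 'k) set) hopf"
  where "sweedler = presented_hopf sweedler_relators
    (case_cv (tens (word [SwC]) (word [SwC]))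
             (tens (word [SwC]) (word [SwV]) + tens (word [SwV]) (word [])))
    (case_cv 1 0)
    (case_cv (word [SwC]) (- word [SwC, SwV]))"

definition sw_c :: "(cv list \<Rightarrow>\<^sub>0 'k::field) set"
  where "sw_c = pres_class sweedler_relators (word [SwC])"

definition sw_v :: "(cv list \<Rightarrow>\<^sub>0 'k::field) set"
  where "sw_v = pres_class sweedler_relators (word [SwV])"

text \<open>Coordinates in the basis \<open>1, c, v, cv\<close>, that is, the values of the dual basis
  \<open>\<delta>\<^sub>1, \<delta>\<^sub>c, \<delta>\<^sub>v, \<delta>\<^bsub>cv\<^esub>\<close>.\<close>

definition sw_coords :: "(cv list \<Rightarrow>\<^sub>0 'k::field) set \<Rightarrow> 'k \<times> 'k \<times> 'k \<times> 'k"
  where "sw_coords Z = (THE (p, q, r, s).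
    Z = p \<odot>\<^bsub>sweedler\<^esub> \<one>\<^bsub>sweedler\<^esub> \<oplus>\<^bsub>sweedler\<^esub> q \<odot>\<^bsub>sweedler\<^esub> sw_c
        \<oplus>\<^bsub>sweedler\<^esub> r \<odot>\<^bsub>sweedler\<^esub> sw_v
        \<oplus>\<^bsub>sweedler\<^esub> s \<odot>\<^bsub>sweedler\<^esub> (sw_c \<otimes>\<^bsub>sweedler\<^esub> sw_v))"

text \<open>The map \<open>\<xi>\<close> from \<open>H\<^sub>4\<close> to its dual: the four summands are the multiples of
  \<open>\<xi>(1) = \<delta>\<^sub>1 + \<delta>\<^sub>c\<close>, \<open>\<xi>(c) = \<delta>\<^sub>1 - \<delta>\<^sub>c\<close>, \<open>\<xi>(v) = \<delta>\<^bsub>cv\<^esub> - \<delta>\<^sub>v\<close>, \<open>\<xi>(cv) = \<delta>\<^sub>v + \<delta>\<^bsub>cv\<^esub>\<close>.\<close>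

definition sw_xi :: "(cv list \<Rightarrow>\<^sub>0 'k::field) set \<Rightarrow> (cv list \<Rightarrow>\<^sub>0 'k) set \<Rightarrow> 'k"
  where "sw_xi Z = (case sw_coords Z of (p, q, r, s) \<Rightarrow>
    \<lambda>Y\<in>carrier sweedler. case sw_coords Y of (d1, dc, dv, dcv) \<Rightarrow>
      p * (d1 + dc) + q * (d1 - dc) + r * (dcv - dv) + s * (dv + dcv))"


section \<open>The algebra \<open>k[x]/(x\<^sup>2)\<close> and its actions\<close>

definition poly_algebra :: "('k::field, 'k poly) module"
  where "poly_algebra = ring.extend ring_of_type_algebra (module.fields Polynomial.smult)"

definition x_squared_ideal :: "'k::field poly set"
  where "x_squared_ideal = genideal poly_algebra {[:0, 1:]\<^sup>2}"

definition trunc :: "('k::field, 'k poly set) module"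
  where "trunc = quot_algebra poly_algebra x_squared_ideal"

definition bar1 :: "'k::field poly set"
  where "bar1 = x_squared_ideal +>\<^bsub>poly_algebra\<^esub> 1"

definition barx :: "'k::field poly set"
  where "barx = x_squared_ideal +>\<^bsub>poly_algebra\<^esub> [:0, 1:]"

definition coords :: "'k::field poly set \<Rightarrow> 'k \<times> 'k"
  where "coords a = (THE (p, q). a = p \<odot>\<^bsub>trunc\<^esub> bar1 \<oplus>\<^bsub>trunc\<^esub> q \<odot>\<^bsub>trunc\<^esub> barx)"

text \<open>The linear operator sending the basis vectors \<open>bar1\<close> and \<open>barx\<close> to \<open>u\<close> and \<open>v\<close>.\<close>

definition lin_op :: "'k::field poly set \<Rightarrow> 'k poly set \<Rightarrow> 'k poly set \<Rightarrow> 'k poly set"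
  where "lin_op u v a = (case coords a of (p, q) \<Rightarrow> p \<odot>\<^bsub>trunc\<^esub> u \<oplus>\<^bsub>trunc\<^esub> q \<odot>\<^bsub>trunc\<^esub> v)"

text \<open>\<open>has_matrix f m11 m12 m21 m22\<close>: the matrix of \<open>f\<close> in the basis \<open>bar1, barx\<close> has the rows
  \<open>(m11, m12)\<close> and \<open>(m21, m22)\<close>; its columns are the images of the basis vectors.\<close>

definition has_matrix ::
    "('k::field poly set \<Rightarrow> 'k poly set) \<Rightarrow> 'k \<Rightarrow> 'k \<Rightarrow> 'k \<Rightarrow> 'k \<Rightarrow> bool"
  where "has_matrix f m11 m12 m21 m22 \<longleftrightarrow>
      f bar1 = m11 \<odot>\<^bsub>trunc\<^esub> bar1 \<oplus>\<^bsub>trunc\<^esub> m21 \<odot>\<^bsub>trunc\<^esub> barx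
    \<and> f barx = m12 \<odot>\<^bsub>trunc\<^esub> bar1 \<oplus>\<^bsub>trunc\<^esub> m22 \<odot>\<^bsub>trunc\<^esub> barx"

definition psi1 :: "'k::field \<Rightarrow> 'k poly set \<Rightarrow> 'k poly set"
  where "psi1 c a = c \<odot>\<^bsub>trunc\<^esub> a"

definition trunc_hopf :: "('k::field, 'k poly set) hopf"
  where "trunc_hopf = module.extend trunc (hopf.fields
    (\<lambda>a. case coords a of (p, q) \<Rightarrow>
       fscale p (tens bar1 bar1) + fscale q (tens barx bar1 + tens bar1 barx))
    (\<lambda>a. fst (coords a))
    (lin_op bar1 barx))"

text \<open>\<open>bar1\<close> acts as the identity, and \<open>barx\<close> by \<open>bar1 \<mapsto> \<epsilon>(barx) bar1 = 0\<close> and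
  \<open>barx \<mapsto> bar1\<close>.\<close>

definition psi2 :: "'k::field poly set \<Rightarrow> 'k poly set \<Rightarrow> 'k poly set"
  where "psi2 h = (case coords h of (p, q) \<Rightarrow>
    lin_op (p \<odot>\<^bsub>trunc\<^esub> bar1) (q \<odot>\<^bsub>trunc\<^esub> bar1 \<oplus>\<^bsub>trunc\<^esub> p \<odot>\<^bsub>trunc\<^esub> barx))"

definition C2_hopf :: "('k::field, int \<Rightarrow>\<^sub>0 'k) hopf"
  where "C2_hopf = group_hopf (integer_mod_group 2)"

text \<open>The functional \<open>\<delta>\<^sub>g\<close> of the basis dual to the basis of group elements.  The group
  \<open>C\<^sub>2\<close> is written additively: its unit is \<open>0\<close> and its generator \<open>c\<close> is \<open>1\<close>.\<close>

definition C2_delta :: "int \<Rightarrow> (int \<Rightarrow>\<^sub>0 'k) \<Rightarrow> 'k::field"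
  where "C2_delta g = (\<lambda>f\<in>carrier C2_hopf. Poly_Mapping.lookup f g)"

text \<open>The transported multiplication on \<open>k \<times> k\<close> is the componentwise one.\<close>

definition kk_hopf :: "('k::field, 'k \<times> 'k) hopf"
  where "kk_hopf = transport_hopf UNIV
    (\<lambda>(p, q). p \<odot>\<^bsub>finite_dual C2_hopf\<^esub> C2_delta 0
       \<oplus>\<^bsub>finite_dual C2_hopf\<^esub> q \<odot>\<^bsub>finite_dual C2_hopf\<^esub> C2_delta 1)
    (finite_dual C2_hopf)"

definition psi3 :: "'k::field \<Rightarrow> 'k \<times> 'k \<Rightarrow> 'k poly set \<Rightarrow> 'k poly set"
  where "psi3 \<theta> = (\<lambda>(p, q). lin_op (p \<odot>\<^bsub>trunc\<^esub> bar1)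
    ((\<theta> * (p + q)) \<odot>\<^bsub>trunc\<^esub> bar1 \<oplus>\<^bsub>trunc\<^esub> q \<odot>\<^bsub>trunc\<^esub> barx))"

definition Cinf_hopf :: "('k::field, int \<Rightarrow>\<^sub>0 'k) hopf"
  where "Cinf_hopf = group_hopf integer_group"

definition psi4 :: "((int \<Rightarrow>\<^sub>0 'k) \<Rightarrow> 'k) \<Rightarrow> 'k::field poly set \<Rightarrow> 'k poly set"
  where "psi4 l = lin_op (counit (finite_dual Cinf_hopf) l \<odot>\<^bsub>trunc\<^esub> bar1)
    (l (Poly_Mapping.single 1 1) \<odot>\<^bsub>trunc\<^esub> barx)"

definition psi4a :: "(int \<Rightarrow>\<^sub>0 'k) \<Rightarrow> 'k::field poly set \<Rightarrow> 'k poly set"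
  where "psi4a f = lin_op (counit C2_hopf f \<odot>\<^bsub>trunc\<^esub> bar1)
    ((Poly_Mapping.lookup f 0 - Poly_Mapping.lookup f 1) \<odot>\<^bsub>trunc\<^esub> barx)"

definition rho5 :: "'k::field poly set \<Rightarrow> ('k poly set \<times> (cdh list \<Rightarrow>\<^sub>0 'k) set \<Rightarrow>\<^sub>0 'k)"
  where "rho5 a = (case coords a of (p, q) \<Rightarrow>
    fscale p (tens bar1 \<one>\<^bsub>cdh_hopf\<^esub>) + fscale q (tens bar1 cdh_h + tens barx cdh_c))"

definition psi5 :: "((cdh list \<Rightarrow>\<^sub>0 'k) set \<Rightarrow> 'k) \<Rightarrow> 'k::field poly set \<Rightarrow> 'k poly set"
  where "psi5 l = coact_check trunc rho5 l"

text \<open>On \<open>barx\<close>, the basis elements \<open>1\<close> and \<open>c\<close> act as \<open>1\<close> and \<open>-1\<close>, while \<open>v\<close> and \<open>cv\<close>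
  both send \<open>barx\<close> to \<open>bar1\<close>.\<close>

definition psi5a :: "(cv list \<Rightarrow>\<^sub>0 'k) set \<Rightarrow> 'k::field poly set \<Rightarrow> 'k poly set"
  where "psi5a Z = (case sw_coords Z of (p, q, r, s) \<Rightarrow>
    lin_op (counit sweedler Z \<odot>\<^bsub>trunc\<^esub> bar1)
      ((r + s) \<odot>\<^bsub>trunc\<^esub> bar1 \<oplus>\<^bsub>trunc\<^esub> (p - q) \<odot>\<^bsub>trunc\<^esub> barx))"

definition rho5a :: "'k::field poly set \<Rightarrow> ('k poly set \<times> (cv list \<Rightarrow>\<^sub>0 'k) set \<Rightarrow>\<^sub>0 'k)"
  where "rho5a a = (case coords a of (p, q) \<Rightarrow>
    fscale p (tens bar1 \<one>\<^bsub>sweedler\<^esub>)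
    + fscale q (tens barx sw_c + tens bar1 (sw_c \<otimes>\<^bsub>sweedler\<^esub> sw_v)))"

end

theory Submission
  imports Defs
begin

text \<open>
  An action of \<open>H\<close> on \<open>k[x]/(x\<^sup>2)\<close> has the form \<open>h 1 = \<epsilon>(h) 1\<close>, \<open>h x = \<alpha>(h) 1 + \<beta>(h) x\<close>.  It is an action
  iff \<open>\<beta>\<close> is a character of \<open>H\<close>, \<open>\<alpha>(gh) = \<epsilon>(g) \<alpha>(h) + \<alpha>(g) \<beta>(h)\<close>, and \<open>\<alpha>\<alpha> = 0\<close>, \<open>\<alpha>\<beta> + \<beta>\<alpha> = 0\<close> in the
  convolution algebra \<open>H\<^sup>*\<close>.  The cosupport is the image of \<open>H\<close> under \<open>(\<epsilon>, \<alpha>, \<beta>)\<close>, an algebra of upper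
  triangular matrices, so it is determined by the linear relations between \<open>\<epsilon>\<close>, \<open>\<alpha>\<close> and \<open>\<beta>\<close>; the two
  convolution identities force \<open>\<alpha> = 0\<close> or characteristic two as soon as there is such a relation, and
  up to a rescaling of \<open>x\<close> five cases remain.

  The relations satisfied by \<open>\<alpha>\<close> and \<open>\<beta>\<close> in \<open>H\<^sup>*\<close> are those of \<open>h\<close> and \<open>c\<close> in \<open>k\<langle>c,d,h\<rangle>/I\<^sub>0\<close>, and \<open>\<beta>\<close> is
  invertible with inverse \<open>\<beta> \<circ> S\<close>.  Hence an action is an algebra map from this Hopf algebra to \<open>H\<^sup>*\<close>,
  whose transpose is a Hopf algebra map from \<open>H\<close> to the finite dual; this is the universal property of
  \<open>\<psi>\<^sub>5\<close>, and the group algebra of \<open>C\<^sub>\<infinity>\<close> plays the same role for \<open>\<psi>\<^sub>4\<close>.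

  Two tensors are equal iff all multilinear forms agree on them, so identities between tensors are
  verified by evaluating such forms.
\<close>

subsection \<open>Formal linear combinations and multilinear forms\<close>

text \<open>If \<beta> = \<epsilon>, then \<alpha>\<beta> + \<beta>\<alpha> = 2\<alpha>, so a
  nonzero \<alpha> forces characteristic two. If \<alpha> = \<gamma>(\<epsilon> - \<beta>) with
  \<gamma> nonzero, the two identities read \<beta>\<beta> = 2\<beta> - \<epsilon> and 2(\<beta> -
  \<beta>\<beta>) = 0; were 2 invertible, then \<beta> = \<epsilon> and \<alpha> = 0. The obstacle
  is the finite dual: its comultiplication is some chosen formal combination, and forms on it are
  arbitrary functionals rather than evaluations. Both are controlled by
  \<open>interpolation\<close>: finitely many functions f satisfy f = sum f(p_i) e_i for suitable
  points p_i and functions e_i. This splits l(gh) into a sum of products, and shows that a tensor of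
  functionals vanishing at all pairs of points is zero. Membership is tested without ideals:
  finitely many functionals of b must control l(xby). For the transpose of an algebra map these are
  evaluations at the middle components of one representative of the twofold coproduct of h.\<close>

lemma lookup_fscale [simp]: "Poly_Mapping.lookup (fscale c t) x = c * Poly_Mapping.lookup t x"
  by (simp add: fscale_def map.rep_eq when_def)

interpretation fs: vector_space "fscale :: 'k::field \<Rightarrow> ('x \<Rightarrow>\<^sub>0 'k) \<Rightarrow> ('x \<Rightarrow>\<^sub>0 'k)"
  by unfold_locales (auto intro!: poly_mapping_eqI simp: lookup_add algebra_simps)

lemma fscale_single [simp]: "fscale c (Poly_Mapping.single x d) = Poly_Mapping.single x (c * d)"
  by (rule poly_mapping_eqI) (simp add: lookup_single when_def)

lemma keys_fscale: "Poly_Mapping.keys (fscale c t) \<subseteq> Poly_Mapping.keys t"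
  by (auto simp: in_keys_iff)

lemma slift_superset:
  assumes "finite S" "Poly_Mapping.keys t \<subseteq> S"
  shows "slift f t = (\<Sum>x\<in>S. Poly_Mapping.lookup t x * f x)"
  unfolding slift_def using assms by (intro sum.mono_neutral_left) (auto simp: in_keys_iff)

lemma slift_zero [simp]: "slift f 0 = 0"
  by (simp add: slift_def)

lemma slift_add [simp]: "slift f (s + t) = slift f s + slift f t"
proof -
  let ?S = "Poly_Mapping.keys s \<union> Poly_Mapping.keys t"
  have "Poly_Mapping.keys (s + t) \<subseteq> ?S" by (rule keys_add)
  then show ?thesis
    by (simp add: slift_superset[of ?S] lookup_add distrib_right sum.distrib)
qed

lemma slift_fscale [simp]: "slift f (fscale c t) = c * slift f t"
  unfolding slift_superset[OF finite_keys keys_fscale]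
  by (simp add: slift_def sum_distrib_left mult.assoc)

lemma slift_uminus [simp]: "slift f (- t) = - slift f t"
  by (simp add: slift_def sum_negf)

lemma slift_diff [simp]: "slift f (s - t) = slift f s - slift f t"
  using slift_add[of f s "- t"] by simp

lemma slift_single [simp]: "slift f (Poly_Mapping.single x c) = c * f x"
  by (simp add: slift_def)

lemma slift_tens [simp]: "slift f (tens a b) = f (a, b)"
  by (simp add: tens_def)

lemma slift_sum [simp]: "slift f (sum g I) = (\<Sum>i\<in>I. slift f (g i))"
  by (induction I rule: infinite_finite_induct) simp_all

text \<open>As a congruence rule this lets every simplification under \<open>slift\<close> assume
  that the index lies in the support, which is how closure conditions on carriers reach the
  summands.\<close>

lemma slift_cong [cong]:
  "s = t \<Longrightarrow> (\<And>x. x \<in> Poly_Mapping.keys t \<Longrightarrow> f x = g x) \<Longrightarrow> slift f s = slift g t"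
  by (auto simp: slift_def)

lemma slift_flift [simp]: "slift f (flift g t) = slift (\<lambda>x. slift f (g x)) t"
  by (simp add: flift_def slift_def[of "\<lambda>x. slift f (g x)"])

lemma slift_fun_add: "slift (\<lambda>x. f x + g x) t = slift f t + slift g t"
  by (simp add: slift_def distrib_left sum.distrib)

lemma slift_fun_diff: "slift (\<lambda>x. f x - g x) t = slift f t - slift g t"
  by (simp add: slift_def right_diff_distrib sum_subtractf)

lemma slift_fun_zero [simp]: "slift (\<lambda>x. 0) t = 0"
  by (simp add: slift_def)

lemma slift_cmult: "slift (\<lambda>x. c * f x) t = c * slift f t"
  by (simp add: slift_def sum_distrib_left mult.left_commute)

lemma slift_cmult_right: "slift (\<lambda>x. f x * c) t = slift f t * c"
  by (simp add: slift_def sum_distrib_right mult.assoc)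

lemma slift_swap: "slift (\<lambda>x. slift (f x) t) s = slift (\<lambda>y. slift (\<lambda>x. f x y) s) t"
  unfolding slift_def sum_distrib_left
  by (subst sum.swap) (simp add: mult.left_commute)

lemma lookup_eq_slift: "Poly_Mapping.lookup t x = slift (\<lambda>y. if y = x then 1 else 0) t"
  by (cases "x \<in> Poly_Mapping.keys t") (auto simp: slift_def sum.delta in_keys_iff if_distrib cong: if_cong)

text \<open>Each coordinate is itself a linear extension, of an indicator function. Identities of
  formal combinations thereby reduce to the simplification rules for \<open>slift\<close>.\<close>

lemma fmap_eqI: "(\<And>f. slift f s = slift f t) \<Longrightarrow> s = t"
  by (rule poly_mapping_eqI) (simp add: lookup_eq_slift)

lemma keys_flift: "Poly_Mapping.keys (flift f t) \<subseteq> (\<Union>x\<in>Poly_Mapping.keys t. Poly_Mapping.keys (f x))"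
  unfolding flift_def using keys_sum keys_fscale by fastforce

lemma keys_tens [simp]: "Poly_Mapping.keys (tens a b) = {(a, b)}"
  by (simp add: tens_def)

lemma flift_single [simp]: "flift f (Poly_Mapping.single x c) = fscale c (f x)"
  by (rule fmap_eqI) simp

lemma flift_add [simp]: "flift f (s + t) = flift f s + flift f t"
  by (rule fmap_eqI) simp

lemma flift_diff [simp]: "flift f (s - t) = flift f s - flift f t"
  by (rule fmap_eqI) simp

lemma flift_zero [simp]: "flift f 0 = 0"
  by (simp add: flift_def)

lemma flift_fscale [simp]: "flift f (fscale c t) = fscale c (flift f t)"
  by (rule fmap_eqI) simp

lemma flift_single_id [simp]: "flift (\<lambda>x. Poly_Mapping.single x 1) t = t"
  by (rule fmap_eqI) simp

lemma slift_tmap [simp]: "slift f (tmap p q t) = slift (\<lambda>(a, b). f (p a, q b)) t"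
  by (simp add: tmap_def case_prod_unfold)

lemma slift_tens_l [simp]: "slift f (tens_l a t) = slift (\<lambda>(b, c). f (a, b, c)) t"
  by (simp add: tens_l_def case_prod_unfold)

lemma slift_tens_r [simp]: "slift f (tens_r t c) = slift (\<lambda>(a, b). f (a, b, c)) t"
  by (simp add: tens_r_def case_prod_unfold)

lemma slift_tmult [simp]:
  "slift f (tmult A B s t) =
    slift (\<lambda>(a, b). slift (\<lambda>(a', b'). f (a \<otimes>\<^bsub>A\<^esub> a', b \<otimes>\<^bsub>B\<^esub> b')) t) s"
  by (simp add: tmult_def case_prod_unfold)

text \<open>A basis of the span of \<open>R\<close> stays independent when \<open>t\<close> is
  added, so a linear functional may be prescribed on both. On a free vector space every linear
  functional is the linear extension of its values on the basis elements.\<close>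

lemma separating_slift:
  fixes t :: "'x \<Rightarrow>\<^sub>0 'k::field"
  assumes "t \<notin> fs.span R"
  obtains f where "\<And>r. r \<in> R \<Longrightarrow> slift f r = 0" "slift f t = 1"
proof -
  interpret vp: vector_space_pair "fscale :: 'k \<Rightarrow> ('x \<Rightarrow>\<^sub>0 'k) \<Rightarrow> ('x \<Rightarrow>\<^sub>0 'k)" "(*) :: 'k \<Rightarrow> 'k \<Rightarrow> 'k"
    by unfold_locales (auto simp: algebra_simps)
  obtain B where B: "B \<subseteq> R" "fs.independent B" "R \<subseteq> fs.span B"
    using fs.maximal_independent_subset .
  have "t \<notin> fs.span B"
    using assms B(1) fs.span_mono by blast
  with B(2) have "fs.independent (insert t B)"
    by (rule fs.independent_insertI[rotated])
  then obtain F where F: "Vector_Spaces.linear fscale (*) F"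
      "\<forall>x\<in>insert t B. F x = (if x = t then 1 else 0)"
    using vp.linear_independent_extend[where f = "\<lambda>x. if x = t then 1 else 0"] by blast
  interpret F: Vector_Spaces.linear fscale "(*)" F by fact
  have F_eq: "F u = slift (\<lambda>x. F (Poly_Mapping.single x 1)) u" for u
  proof -
    have "F u = F (flift (\<lambda>x. Poly_Mapping.single x 1) u)" by simp
    also have "\<dots> = slift (\<lambda>x. F (Poly_Mapping.single x 1)) u"
      unfolding flift_def slift_def by (simp add: F.sum F.scale del: fscale_single)
    finally show ?thesis .
  qed
  have "F r = 0" if "r \<in> R" for r
  proof (rule vp.linear_eq_0_on_span[OF F(1)])
    show "r \<in> fs.span B" using that B(3) by blast
    show "F b = 0" if "b \<in> B" for b
      using F(2) that \<open>t \<notin> fs.span B\<close> fs.span_base by auto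
  qed
  moreover have "F t = 1" using F(2) by simp
  ultimately show ?thesis using that[of "\<lambda>x. F (Poly_Mapping.single x 1)"] F_eq by metis
qed

text \<open>A span is its own double annihilator. This turns congruence of tensors, a membership in
  a span, into a statement about forms.\<close>

lemma span_fscale_iff:
  fixes t :: "'x \<Rightarrow>\<^sub>0 'k::field"
  shows "t \<in> module.span fscale R \<longleftrightarrow> (\<forall>f. (\<forall>r\<in>R. slift f r = 0) \<longrightarrow> slift f t = 0)"
proof
  assume "t \<in> module.span fscale R"
  then show "\<forall>f. (\<forall>r\<in>R. slift f r = 0) \<longrightarrow> slift f t = 0"
    by (induction rule: fs.span_induct) (auto simp: fs.subspace_def)
next
  assume "\<forall>f. (\<forall>r\<in>R. slift f r = 0) \<longrightarrow> slift f t = 0"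
  then show "t \<in> module.span fscale R"
    using separating_slift[of t R] zero_neq_one by metis
qed

section \<open>Bilinear and trilinear forms as tests for equality of tensors\<close>

definition bil :: "('k::field, 'a, 'm) module_scheme \<Rightarrow> ('k, 'b, 'n) module_scheme
    \<Rightarrow> ('a \<Rightarrow> 'b \<Rightarrow> 'k) \<Rightarrow> bool"
  where "bil A B \<beta> \<longleftrightarrow> (\<forall>a\<in>carrier A. k_functional B (\<beta> a))
    \<and> (\<forall>b\<in>carrier B. k_functional A (\<lambda>a. \<beta> a b))"

definition tril :: "('k::field, 'a, 'm) module_scheme \<Rightarrow> ('k, 'b, 'n) module_scheme
    \<Rightarrow> ('k, 'c, 'o) module_scheme \<Rightarrow> ('a \<Rightarrow> 'b \<Rightarrow> 'c \<Rightarrow> 'k) \<Rightarrow> bool"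
  where "tril A B C \<tau> \<longleftrightarrow> (\<forall>a\<in>carrier A. bil B C (\<tau> a))
    \<and> (\<forall>b\<in>carrier B. \<forall>c\<in>carrier C. k_functional A (\<lambda>a. \<tau> a b c))"

lemma k_functionalD:
  assumes "k_functional A l"
  shows "\<And>x y. \<lbrakk>x \<in> carrier A; y \<in> carrier A\<rbrakk> \<Longrightarrow> l (x \<oplus>\<^bsub>A\<^esub> y) = l x + l y"
    and "\<And>c x. x \<in> carrier A \<Longrightarrow> l (c \<odot>\<^bsub>A\<^esub> x) = c * l x"
  using assms by (auto simp: k_functional_def)

lemma bilD:
  assumes "bil A B \<beta>"
  shows "\<And>a a' b. \<lbrakk>a \<in> carrier A; a' \<in> carrier A; b \<in> carrier B\<rbrakk> \<Longrightarrow> \<beta> (a \<oplus>\<^bsub>A\<^esub> a') b = \<beta> a b + \<beta> a' b"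
    and "\<And>a b b'. \<lbrakk>a \<in> carrier A; b \<in> carrier B; b' \<in> carrier B\<rbrakk> \<Longrightarrow> \<beta> a (b \<oplus>\<^bsub>B\<^esub> b') = \<beta> a b + \<beta> a b'"
    and "\<And>c a b. \<lbrakk>a \<in> carrier A; b \<in> carrier B\<rbrakk> \<Longrightarrow> \<beta> (c \<odot>\<^bsub>A\<^esub> a) b = c * \<beta> a b"
    and "\<And>c a b. \<lbrakk>a \<in> carrier A; b \<in> carrier B\<rbrakk> \<Longrightarrow> \<beta> a (c \<odot>\<^bsub>B\<^esub> b) = c * \<beta> a b"
  using assms by (auto simp: bil_def k_functional_def)

lemma trilD:
  assumes "tril A B C \<tau>"
  shows "\<And>a a' b c. \<lbrakk>a \<in> carrier A; a' \<in> carrier A; b \<in> carrier B; c \<in> carrier C\<rbrakk>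
      \<Longrightarrow> \<tau> (a \<oplus>\<^bsub>A\<^esub> a') b c = \<tau> a b c + \<tau> a' b c"
    and "\<And>a b b' c. \<lbrakk>a \<in> carrier A; b \<in> carrier B; b' \<in> carrier B; c \<in> carrier C\<rbrakk>
      \<Longrightarrow> \<tau> a (b \<oplus>\<^bsub>B\<^esub> b') c = \<tau> a b c + \<tau> a b' c"
    and "\<And>a b c c'. \<lbrakk>a \<in> carrier A; b \<in> carrier B; c \<in> carrier C; c' \<in> carrier C\<rbrakk>
      \<Longrightarrow> \<tau> a b (c \<oplus>\<^bsub>C\<^esub> c') = \<tau> a b c + \<tau> a b c'"
    and "\<And>r a b c. \<lbrakk>a \<in> carrier A; b \<in> carrier B; c \<in> carrier C\<rbrakk>
      \<Longrightarrow> \<tau> (r \<odot>\<^bsub>A\<^esub> a) b c = r * \<tau> a b c"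
    and "\<And>r a b c. \<lbrakk>a \<in> carrier A; b \<in> carrier B; c \<in> carrier C\<rbrakk>
      \<Longrightarrow> \<tau> a (r \<odot>\<^bsub>B\<^esub> b) c = r * \<tau> a b c"
    and "\<And>r a b c. \<lbrakk>a \<in> carrier A; b \<in> carrier B; c \<in> carrier C\<rbrakk>
      \<Longrightarrow> \<tau> a b (r \<odot>\<^bsub>C\<^esub> c) = r * \<tau> a b c"
  using assms by (auto simp: tril_def bil_def k_functional_def)

lemma slift_tensor_relators:
  "(\<forall>r\<in>tensor_relators A B. slift f r = 0) \<longleftrightarrow> bil A B (\<lambda>a b. f (a, b))"
proof
  assume R: "\<forall>r\<in>tensor_relators A B. slift f r = 0"
  have "slift f (tens (a \<oplus>\<^bsub>A\<^esub> a') b - tens a b - tens a' b) = 0"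
    if "a \<in> carrier A" "a' \<in> carrier A" "b \<in> carrier B" for a a' b
    by (rule R[rule_format]) (use that in \<open>unfold tensor_relators_def, blast\<close>)
  moreover have "slift f (tens a (b \<oplus>\<^bsub>B\<^esub> b') - tens a b - tens a b') = 0"
    if "a \<in> carrier A" "b \<in> carrier B" "b' \<in> carrier B" for a b b'
    by (rule R[rule_format]) (use that in \<open>unfold tensor_relators_def, blast\<close>)
  moreover have "slift f (tens (c \<odot>\<^bsub>A\<^esub> a) b - fscale c (tens a b)) = 0"
    if "a \<in> carrier A" "b \<in> carrier B" for c a b
    by (rule R[rule_format]) (use that in \<open>unfold tensor_relators_def, blast\<close>)
  moreover have "slift f (tens a (c \<odot>\<^bsub>B\<^esub> b) - fscale c (tens a b)) = 0"
    if "a \<in> carrier A" "b \<in> carrier B" for c a b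
    by (rule R[rule_format]) (use that in \<open>unfold tensor_relators_def, blast\<close>)
  ultimately show "bil A B (\<lambda>a b. f (a, b))"
    by (simp add: bil_def k_functional_def algebra_simps)
next
  assume "bil A B (\<lambda>a b. f (a, b))"
  from bilD[OF this] show "\<forall>r\<in>tensor_relators A B. slift f r = 0"
    by (auto simp: tensor_relators_def)
qed

text \<open>A functional on formal combinations annihilates the bilinearity relators exactly when it
  is a bilinear form on the carriers; the annihilator description of the span then becomes the
  universal property of the tensor product.\<close>

theorem tensor_eq_iff:
  fixes A :: "('k::field, 'a, 'm) module_scheme" and B :: "('k, 'b, 'n) module_scheme"
  shows "tensor_eq A B s t \<longleftrightarrow>
    (\<forall>\<beta>. bil A B \<beta> \<longrightarrow> slift (\<lambda>(a, b). \<beta> a b) s = slift (\<lambda>(a, b). \<beta> a b) t)"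
proof -
  have *: "(\<forall>f. P f) \<longleftrightarrow> (\<forall>\<beta>. P (\<lambda>(a, b). \<beta> a b))" for P :: "('a \<times> 'b \<Rightarrow> 'k) \<Rightarrow> bool"
  proof (intro iffI allI)
    fix f assume "\<forall>\<beta>. P (\<lambda>(a, b). \<beta> a b)"
    from this[THEN spec, of "\<lambda>a b. f (a, b)"] show "P f" by simp
  qed simp
  show ?thesis
    unfolding tensor_eq_def span_fscale_iff slift_tensor_relators by (subst *) simp
qed

text \<open>The two families of relators give bilinearity in the first two and in the last two
  arguments; together they give linearity in each of the three.\<close>

lemma slift_tensor3_relators:
  "(\<forall>r\<in>{tens_r r c |r c. r \<in> tensor_relators A B \<and> c \<in> carrier C}
       \<union> {tens_l a r |a r. a \<in> carrier A \<and> r \<in> tensor_relators B C}. slift f r = 0)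
    \<longleftrightarrow> tril A B C (\<lambda>a b c. f (a, b, c))" (is "?L \<longleftrightarrow> ?R")
proof -
  have "?L \<longleftrightarrow> (\<forall>c\<in>carrier C. \<forall>r\<in>tensor_relators A B. slift (\<lambda>(a, b). f (a, b, c)) r = 0)
      \<and> (\<forall>a\<in>carrier A. \<forall>r\<in>tensor_relators B C. slift (\<lambda>(b, c). f (a, b, c)) r = 0)"
  proof (intro iffI conjI ballI, goal_cases)
    case (1 c r)
    then have "slift f (tens_r r c) = 0" by blast
    then show ?case by simp
  next
    case (2 a r)
    then have "slift f (tens_l a r) = 0" by blast
    then show ?case by simp
  qed auto
  also have "\<dots> \<longleftrightarrow> ?R"
    unfolding slift_tensor_relators by (auto simp: tril_def bil_def)
  finally show ?thesis .
qed

theorem tensor3_eq_iff: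
  fixes A :: "('k::field, 'a, 'm) module_scheme" and B :: "('k, 'b, 'n) module_scheme"
    and C :: "('k, 'c, 'o) module_scheme"
  shows "tensor3_eq A B C s t \<longleftrightarrow>
    (\<forall>\<tau>. tril A B C \<tau> \<longrightarrow> slift (\<lambda>(a, b, c). \<tau> a b c) s = slift (\<lambda>(a, b, c). \<tau> a b c) t)"
proof -
  have *: "(\<forall>f. P f) \<longleftrightarrow> (\<forall>\<beta>. P (\<lambda>(a, b, c). \<beta> a b c))" for P :: "('a \<times> 'b \<times> 'c \<Rightarrow> 'k) \<Rightarrow> bool"
  proof (intro iffI allI)
    fix f assume "\<forall>\<beta>. P (\<lambda>(a, b, c). \<beta> a b c)"
    from this[THEN spec, of "\<lambda>a b c. f (a, b, c)"] show "P f" by simp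
  qed simp
  show ?thesis
    unfolding tensor3_eq_def span_fscale_iff slift_tensor3_relators by (subst *) simp
qed

section \<open>Modules and algebras over the base field\<close>

lemma ring_of_type_algebra_simps [simp]:
  "carrier (ring_of_type_algebra :: 'k::ring_1 ring) = UNIV"
  "(x :: 'k) \<otimes>\<^bsub>ring_of_type_algebra\<^esub> y = x * y"
  "\<one>\<^bsub>ring_of_type_algebra\<^esub> = (1 :: 'k)"
  "\<zero>\<^bsub>ring_of_type_algebra\<^esub> = (0 :: 'k)"
  "x \<oplus>\<^bsub>ring_of_type_algebra\<^esub> y = x + y"
  by (simp_all add: ring_of_type_algebra_def)

text \<open>Scalars enter the general module locale as a ring record. Here its laws are restated
  with the operations of the field type.\<close>

locale k_module = module ring_of_type_algebra A
  for A :: "('k::field, 'a, 'm) module_scheme" (structure)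

sublocale k_algebra \<subseteq> k_module ..

context k_module
begin

lemma scale_closed [simp, intro]: "x \<in> carrier A \<Longrightarrow> c \<odot> x \<in> carrier A"
  using smult_closed[of c x] by simp

lemma scale_add_l: "x \<in> carrier A \<Longrightarrow> (c + d) \<odot> x = c \<odot> x \<oplus> d \<odot> x"
  using smult_l_distr[of c d x] by simp

lemma scale_add_r: "\<lbrakk>x \<in> carrier A; y \<in> carrier A\<rbrakk> \<Longrightarrow> c \<odot> (x \<oplus> y) = c \<odot> x \<oplus> c \<odot> y"
  using smult_r_distr[of c x y] by simp

lemma scale_assoc: "x \<in> carrier A \<Longrightarrow> (c * d) \<odot> x = c \<odot> (d \<odot> x)"
  using smult_assoc1[of c d x] by simp

lemma scale_one [simp]: "x \<in> carrier A \<Longrightarrow> 1 \<odot> x = x"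
  using smult_one[of x] by simp

lemma scale_zero_l [simp]: "x \<in> carrier A \<Longrightarrow> 0 \<odot> x = \<zero>"
  using smult_l_null[of x] by simp

lemma scale_zero_r [simp]: "c \<odot> \<zero> = \<zero>"
  using smult_r_null[of c] by simp

lemma scale_minus_one: "x \<in> carrier A \<Longrightarrow> (- 1) \<odot> x = \<ominus> x"
proof -
  assume x: "x \<in> carrier A"
  then have "(- 1) \<odot> x \<oplus> x = (- 1 + 1) \<odot> x" by (simp only: scale_add_l scale_one)
  then show ?thesis using x by (intro M.minus_equality[symmetric]) simp_all
qed

lemma functional_zero: "k_functional A l \<Longrightarrow> l \<zero> = 0"
  using k_functionalD(2)[of A l \<zero> 0] by simp

lemma functional_minus: "k_functional A l \<Longrightarrow> x \<in> carrier A \<Longrightarrow> l (\<ominus> x) = - l x"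
  using k_functionalD(2)[of A l x "- 1"] by (simp add: scale_minus_one)

lemma functional_finsum:
  assumes "k_functional A l" "finite I" "f \<in> I \<rightarrow> carrier A"
  shows "l (\<Oplus>i\<in>I. f i) = (\<Sum>i\<in>I. l (f i))"
  using assms(2,3)
proof (induction I)
  case (insert i I)
  then show ?case
    by (simp add: M.finsum_insert k_functionalD(1)[OF assms(1)] Pi_iff)
qed (simp add: functional_zero assms(1))

lemma mlift_superset:
  assumes "finite S" "Poly_Mapping.keys t \<subseteq> S" "f \<in> S \<rightarrow> carrier A"
  shows "mlift A f t = (\<Oplus>x\<in>S. Poly_Mapping.lookup t x \<odot> f x)"
  unfolding mlift_def using assms
  by (intro M.add.finprod_mono_neutral_cong_left) (auto simp: in_keys_iff Pi_iff)

lemma mlift_closed: "f \<in> Poly_Mapping.keys t \<rightarrow> carrier A \<Longrightarrow> mlift A f t \<in> carrier A"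
  unfolding mlift_def by (rule M.finsum_closed) auto

lemma functional_mlift:
  assumes "k_functional A l" "f \<in> Poly_Mapping.keys t \<rightarrow> carrier A"
  shows "l (mlift A f t) = slift (\<lambda>x. l (f x)) t"
proof -
  have "l (mlift A f t) = (\<Sum>x\<in>Poly_Mapping.keys t. l (Poly_Mapping.lookup t x \<odot> f x))"
    unfolding mlift_def using assms by (intro functional_finsum) auto
  also have "\<dots> = slift (\<lambda>x. l (f x)) t"
    unfolding slift_def using assms(2) by (intro sum.cong) (auto simp: Pi_iff k_functionalD(2)[OF assms(1)])
  finally show ?thesis .
qed

text \<open>The formal difference of \<open>x\<close> and \<open>y\<close> is annihilated by every
  functional, hence lies in the span of the linearity relators \<open>R\<close>; evaluating formal
  combinations in \<open>A\<close>, which is the map \<open>M\<close>, sends this span to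
  zero.\<close>

theorem functional_ext:
  assumes "x \<in> carrier A" "y \<in> carrier A" "\<And>l. k_functional A l \<Longrightarrow> l x = l y"
  shows "x = y"
proof -
  define R where "R = {Poly_Mapping.single (a \<oplus> b) 1 - Poly_Mapping.single a 1 - Poly_Mapping.single b (1::'k) |a b.
      a \<in> carrier A \<and> b \<in> carrier A}
    \<union> {Poly_Mapping.single (c \<odot> a) 1 - Poly_Mapping.single a c |a c. a \<in> carrier A}"
  define M where "M = mlift A (\<lambda>a. a)"
  have M_add: "M (s + t) = M s \<oplus> M t"
    if "Poly_Mapping.keys s \<subseteq> carrier A" "Poly_Mapping.keys t \<subseteq> carrier A" for s t
  proof -
    let ?S = "Poly_Mapping.keys s \<union> Poly_Mapping.keys t"
    have "M u = (\<Oplus>x\<in>?S. Poly_Mapping.lookup u x \<odot> x)" if "u \<in> {s, t, s + t}" for u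
      unfolding M_def
      by (rule mlift_superset)
        (use that keys_add[of s t] \<open>Poly_Mapping.keys s \<subseteq> carrier A\<close> \<open>Poly_Mapping.keys t \<subseteq> carrier A\<close> in auto)
    moreover have "(\<Oplus>x\<in>?S. Poly_Mapping.lookup (s + t) x \<odot> x)
        = (\<Oplus>x\<in>?S. Poly_Mapping.lookup s x \<odot> x \<oplus> Poly_Mapping.lookup t x \<odot> x)"
      using that by (intro M.finsum_cong) (auto simp: lookup_add scale_add_l simp_implies_def)
    moreover have "\<dots> = (\<Oplus>x\<in>?S. Poly_Mapping.lookup s x \<odot> x) \<oplus> (\<Oplus>x\<in>?S. Poly_Mapping.lookup t x \<odot> x)"
      using that by (intro M.finsum_addf) auto
    ultimately show ?thesis by simp
  qed
  have M_scale: "M (fscale c t) = c \<odot> M t" if t: "Poly_Mapping.keys t \<subseteq> carrier A" for c t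
  proof -
    have "M (fscale c t) = (\<Oplus>x\<in>Poly_Mapping.keys t. c \<odot> (Poly_Mapping.lookup t x \<odot> x))"
      unfolding M_def using t
      by (subst mlift_superset[OF finite_keys keys_fscale])
        (auto intro!: M.finsum_cong scale_assoc simp: simp_implies_def)
    also have "\<dots> = c \<odot> M t"
      unfolding M_def mlift_def using t by (subst finsum_smult_ldistr) auto
    finally show ?thesis .
  qed
  have M_single: "M (Poly_Mapping.single a c) = c \<odot> a" if "a \<in> carrier A" for a c
    using that by (cases "c = 0") (simp_all add: M_def mlift_def)
  have minus: "s - t = s + fscale (- 1) t" for s t :: "'a \<Rightarrow>\<^sub>0 'k"
    by (rule fmap_eqI) simp
  have "Poly_Mapping.single x 1 - Poly_Mapping.single y 1 \<in> module.span fscale R"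
    unfolding span_fscale_iff
  proof (intro allI impI)
    fix f assume f: "\<forall>r\<in>R. slift f r = 0"
    have "k_functional A f"
      unfolding k_functional_def
    proof (intro conjI ballI allI)
      fix a b assume "a \<in> carrier A" "b \<in> carrier A"
      then have "slift f (Poly_Mapping.single (a \<oplus> b) 1 - Poly_Mapping.single a 1 - Poly_Mapping.single b 1) = 0"
        by (intro f[rule_format]) (unfold R_def, blast)
      then show "f (a \<oplus> b) = f a + f b" by (simp add: algebra_simps)
    next
      fix c a assume "a \<in> carrier A"
      then have "slift f (Poly_Mapping.single (c \<odot> a) 1 - Poly_Mapping.single a c) = 0"
        by (intro f[rule_format]) (unfold R_def, blast)
      then show "f (c \<odot> a) = c * f a" by simp
    qed
    then show "slift f (Poly_Mapping.single x 1 - Poly_Mapping.single y 1) = 0"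
      using assms(3)[of f] by simp
  qed
  then have "Poly_Mapping.keys (Poly_Mapping.single x 1 - Poly_Mapping.single y (1 :: 'k)) \<subseteq> carrier A
      \<and> M (Poly_Mapping.single x 1 - Poly_Mapping.single y 1) = \<zero>"
  proof (induction rule: fs.span_induct)
    case base
    have "M 0 = \<zero>" by (simp add: M_def mlift_def)
    then show ?case
      unfolding fs.subspace_def
      by (simp add: M_add M_scale order_trans[OF keys_add] order_trans[OF keys_fscale])
  next
    case (step r)
    then consider (add) a b where "a \<in> carrier A" "b \<in> carrier A"
        "r = Poly_Mapping.single (a \<oplus> b) 1 - Poly_Mapping.single a 1 - Poly_Mapping.single b 1"
      | (scale) a c where "a \<in> carrier A" "r = Poly_Mapping.single (c \<odot> a) 1 - Poly_Mapping.single a c"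
      unfolding R_def by blast
    then show ?case
    proof cases
      case add
      have "Poly_Mapping.keys (Poly_Mapping.single (a \<oplus> b) 1 + Poly_Mapping.single a (- 1 :: 'k)) \<subseteq> carrier A"
        using add(1,2) by (intro order_trans[OF keys_add]) auto
      moreover have "a \<oplus> b \<oplus> \<ominus> a \<oplus> \<ominus> b = \<zero>"
        using add(1,2) M.r_neg[of "a \<oplus> b"] M.a_assoc[of "a \<oplus> b" "\<ominus> a" "\<ominus> b"] by (simp add: M.minus_add)
      ultimately show ?thesis
        using add by (simp add: minus M_add M_single scale_minus_one order_trans[OF keys_add])
    next
      case scale
      have "(- c) \<odot> a = \<ominus> (c \<odot> a)" using scale(1) scale_assoc[of a "- 1" c] by (simp add: scale_minus_one)
      then show ?thesis
        using scale by (simp add: minus M_add M_single M.r_neg order_trans[OF keys_add])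
    qed
  qed
  then have "M (Poly_Mapping.single x 1 + fscale (- 1) (Poly_Mapping.single y 1)) = \<zero>"
    by (simp only: minus)
  then have "x \<oplus> \<ominus> y = \<zero>"
    using assms(1,2) by (subst (asm) M_add) (auto simp: M_single scale_minus_one)
  then show ?thesis
    using assms(1,2) M.minus_equality[of x "\<ominus> y"] by (simp)
qed

end

text \<open>Additive inverses are supplied by the scalar -1, since (-1) x + x = 0 x; nothing about
  subtraction has to be checked.\<close>

lemma k_algebraI:
  fixes A :: "('k::field, 'a, 'm) module_scheme" (structure)
  assumes "\<zero> \<in> carrier A" "\<one> \<in> carrier A"
    and "\<And>x y. \<lbrakk>x \<in> carrier A; y \<in> carrier A\<rbrakk> \<Longrightarrow> x \<oplus> y \<in> carrier A"
    and "\<And>x y. \<lbrakk>x \<in> carrier A; y \<in> carrier A\<rbrakk> \<Longrightarrow> x \<otimes> y \<in> carrier A"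
    and "\<And>c x. x \<in> carrier A \<Longrightarrow> c \<odot> x \<in> carrier A"
    and "\<And>x y z. \<lbrakk>x \<in> carrier A; y \<in> carrier A; z \<in> carrier A\<rbrakk> \<Longrightarrow> x \<oplus> y \<oplus> z = x \<oplus> (y \<oplus> z)"
    and "\<And>x y. \<lbrakk>x \<in> carrier A; y \<in> carrier A\<rbrakk> \<Longrightarrow> x \<oplus> y = y \<oplus> x"
    and "\<And>x. x \<in> carrier A \<Longrightarrow> \<zero> \<oplus> x = x"
    and "\<And>x y z. \<lbrakk>x \<in> carrier A; y \<in> carrier A; z \<in> carrier A\<rbrakk> \<Longrightarrow> x \<otimes> y \<otimes> z = x \<otimes> (y \<otimes> z)"
    and "\<And>x. x \<in> carrier A \<Longrightarrow> \<one> \<otimes> x = x" "\<And>x. x \<in> carrier A \<Longrightarrow> x \<otimes> \<one> = x"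
    and "\<And>x y z. \<lbrakk>x \<in> carrier A; y \<in> carrier A; z \<in> carrier A\<rbrakk> \<Longrightarrow> (x \<oplus> y) \<otimes> z = x \<otimes> z \<oplus> y \<otimes> z"
    and "\<And>x y z. \<lbrakk>x \<in> carrier A; y \<in> carrier A; z \<in> carrier A\<rbrakk> \<Longrightarrow> z \<otimes> (x \<oplus> y) = z \<otimes> x \<oplus> z \<otimes> y"
    and "\<And>c d x. x \<in> carrier A \<Longrightarrow> (c + d) \<odot> x = c \<odot> x \<oplus> d \<odot> x"
    and "\<And>c x y. \<lbrakk>x \<in> carrier A; y \<in> carrier A\<rbrakk> \<Longrightarrow> c \<odot> (x \<oplus> y) = c \<odot> x \<oplus> c \<odot> y"
    and "\<And>c d x. x \<in> carrier A \<Longrightarrow> (c * d) \<odot> x = c \<odot> (d \<odot> x)"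
    and "\<And>x. x \<in> carrier A \<Longrightarrow> 1 \<odot> x = x" "\<And>x. x \<in> carrier A \<Longrightarrow> 0 \<odot> x = \<zero>"
    and "\<And>c x y. \<lbrakk>x \<in> carrier A; y \<in> carrier A\<rbrakk> \<Longrightarrow> (c \<odot> x) \<otimes> y = c \<odot> (x \<otimes> y)"
    and "\<And>c x y. \<lbrakk>x \<in> carrier A; y \<in> carrier A\<rbrakk> \<Longrightarrow> x \<otimes> (c \<odot> y) = c \<odot> (x \<otimes> y)"
  shows "k_algebra A"
proof -
  have inv: "\<exists>y\<in>carrier A. y \<oplus> x = \<zero>" if "x \<in> carrier A" for x
    using assms(5)[of x "- 1"] assms(14)[of x "- 1" 1] assms(17,18)[of x] that
    by (intro bexI[of _ "(- 1) \<odot> x"]) simp_all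
  have ab: "abelian_group A"
    by (rule abelian_groupI) (rule assms inv; assumption)+
  interpret abelian_group A by (rule ab)
  have mon: "Group.monoid A"
    by (rule monoidI) (rule assms; assumption)+
  interpret ring A
    by (rule ringI) (rule assms ab mon; assumption)+
  interpret module ring_of_type_algebra A
    by (intro moduleI ab cring_from_type_algebra; simp) (rule assms; assumption)+
  show ?thesis
    by unfold_locales (rule assms; assumption)+
qed

subsection \<open>Sweedler notation\<close>

text \<open>The sum of \<beta>(h1, h2) in Sweedler notation, that is, the form \<beta> evaluated on
  the coproduct of \<open>h\<close>. For bilinear \<beta> it depends only on the tensor and not on
  its representative.\<close>

definition sweed :: "('k::field, 'h, 'm) hopf_scheme \<Rightarrow> 'h \<Rightarrow> ('h \<Rightarrow> 'h \<Rightarrow> 'k) \<Rightarrow> 'k"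
  where "sweed H h \<beta> = slift (\<lambda>(a, b). \<beta> a b) (comult H h)"

lemma sweed_fun_add: "sweed H h (\<lambda>a b. \<beta> a b + \<gamma> a b) = sweed H h \<beta> + sweed H h \<gamma>"
  by (simp add: sweed_def case_prod_unfold slift_fun_add)

lemma sweed_fun_diff: "sweed H h (\<lambda>a b. \<beta> a b - \<gamma> a b) = sweed H h \<beta> - sweed H h \<gamma>"
  by (simp add: sweed_def case_prod_unfold slift_fun_diff)

lemma sweed_fun_zero [simp]: "sweed H h (\<lambda>a b. 0) = 0"
  by (simp add: sweed_def case_prod_unfold)

lemma sweed_cmult: "sweed H h (\<lambda>a b. c * \<beta> a b) = c * sweed H h \<beta>"
  by (simp add: sweed_def case_prod_unfold slift_cmult)

lemma sweed_cmult_right: "sweed H h (\<lambda>a b. \<beta> a b * c) = sweed H h \<beta> * c"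
  by (simp add: sweed_def case_prod_unfold slift_cmult_right)

lemma sweed_swap:
  "sweed H x (\<lambda>a b. sweed G y (\<lambda>c d. f a b c d)) = sweed G y (\<lambda>c d. sweed H x (\<lambda>a b. f a b c d))"
  by (simp add: sweed_def case_prod_unfold slift_swap[of _ "comult G y"])

lemma sweed_slift_swap:
  "sweed H x (\<lambda>a b. slift (f a b) t) = slift (\<lambda>u. sweed H x (\<lambda>a b. f a b u)) t"
  by (simp add: sweed_def case_prod_unfold slift_swap[of _ t])

lemmas sweed_linear = sweed_fun_add sweed_cmult sweed_fun_diff

text \<open>The comultiplication laws in evaluated form, with coassociativity and the counit left
  out. This much is available while the remaining axioms of a candidate are being checked, so the
  calculus of \<open>sweed\<close> can be used in that check.\<close>

locale pre_bialgebra = k_algebra H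
  for H :: "('k::field, 'h, 'm) hopf_scheme" (structure) +
  assumes comult_closed: "x \<in> carrier H \<Longrightarrow> Poly_Mapping.keys (comult H x) \<subseteq> carrier H \<times> carrier H"
    and sweed_add: "\<lbrakk>bil H H \<beta>; x \<in> carrier H; y \<in> carrier H\<rbrakk>
      \<Longrightarrow> sweed H (x \<oplus> y) \<beta> = sweed H x \<beta> + sweed H y \<beta>"
    and sweed_scale: "\<lbrakk>bil H H \<beta>; x \<in> carrier H\<rbrakk> \<Longrightarrow> sweed H (c \<odot> x) \<beta> = c * sweed H x \<beta>"
    and sweed_one: "bil H H \<beta> \<Longrightarrow> sweed H \<one> \<beta> = \<beta> \<one> \<one>"
    and sweed_mult: "\<lbrakk>bil H H \<beta>; x \<in> carrier H; y \<in> carrier H\<rbrakk>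
      \<Longrightarrow> sweed H (x \<otimes> y) \<beta> = sweed H x (\<lambda>a b. sweed H y (\<lambda>a' b'. \<beta> (a \<otimes> a') (b \<otimes> b')))"
begin

text \<open>Representatives of coproducts are supported on the carrier, so both Sweedler components
  may be assumed to lie in it; many calculations below simplify under this rule.\<close>

lemma sweed_cong:
  assumes "h = h'" "h' \<in> carrier H" "\<And>a b. \<lbrakk>a \<in> carrier H; b \<in> carrier H\<rbrakk> \<Longrightarrow> \<beta> a b = \<gamma> a b"
  shows "sweed H h \<beta> = sweed H h' \<gamma>"
  unfolding sweed_def using comult_closed[OF assms(2)] assms by (intro slift_cong) auto

lemma mlift_comult_closed:
  assumes "k_module A" "x \<in> carrier H" "\<And>a b. \<lbrakk>a \<in> carrier H; b \<in> carrier H\<rbrakk> \<Longrightarrow> g a b \<in> carrier A"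
  shows "mlift A (\<lambda>(a, b). g a b) (comult H x) \<in> carrier A"
  using comult_closed[OF assms(2)] assms(3)
  by (intro k_module.mlift_closed[OF assms(1)]) (auto simp: Pi_iff)

lemma functional_mlift_comult:
  assumes "k_module A" "k_functional A l" "x \<in> carrier H"
    "\<And>a b. \<lbrakk>a \<in> carrier H; b \<in> carrier H\<rbrakk> \<Longrightarrow> g a b \<in> carrier A"
  shows "l (mlift A (\<lambda>(a, b). g a b) (comult H x)) = sweed H x (\<lambda>a b. l (g a b))"
  using comult_closed[OF assms(3)] assms(4)
  by (subst k_module.functional_mlift[OF assms(1,2)])
    (auto simp: Pi_iff sweed_def case_prod_unfold)

text \<open>Functionals separate the points of \<open>A\<close>, so an identity between vectors
  built from a coproduct becomes a family of scalar identities in Sweedler notation.\<close>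

lemma mlift_comult_eqI:
  assumes "k_module A" "x \<in> carrier H" "y \<in> carrier A"
    "\<And>a b. \<lbrakk>a \<in> carrier H; b \<in> carrier H\<rbrakk> \<Longrightarrow> g a b \<in> carrier A"
    "\<And>l. k_functional A l \<Longrightarrow> sweed H x (\<lambda>a b. l (g a b)) = l y"
  shows "mlift A (\<lambda>(a, b). g a b) (comult H x) = y"
proof (rule k_module.functional_ext[OF assms(1) mlift_comult_closed[OF assms(1,2,4)] assms(3)])
  fix l assume l: "k_functional A l"
  have "l (mlift A (\<lambda>(a, b). g a b) (comult H x)) = sweed H x (\<lambda>a b. l (g a b))"
    by (rule functional_mlift_comult[OF assms(1) l assms(2,4)])
  then show "l (mlift A (\<lambda>(a, b). g a b) (comult H x)) = l y"
    using assms(5)[OF l] by simp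
qed

lemma k_module_H: "k_module H" ..

lemmas functional_simps = bil_def tril_def k_functional_def sweed_linear l_distr r_distr
  smult_mult_l smult_mult_r distrib_left distrib_right mult.left_commute mult.assoc

end

context hopf_algebra
begin

sublocale pre_bialgebra
proof
  show "Poly_Mapping.keys (comult H x) \<subseteq> carrier H \<times> carrier H" if "x \<in> carrier H" for x
    using comult_linear that by (auto simp: tensor_linear_def tensor_carrier_def)
  show "sweed H (x \<oplus> y) \<beta> = sweed H x \<beta> + sweed H y \<beta>"
    if "bil H H \<beta>" "x \<in> carrier H" "y \<in> carrier H" for x y \<beta>
    using comult_linear that by (simp add: tensor_linear_def tensor_eq_iff sweed_def)
  show "sweed H (c \<odot> x) \<beta> = c * sweed H x \<beta>" if "bil H H \<beta>" "x \<in> carrier H" for c x \<beta>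
    using comult_linear that by (simp add: tensor_linear_def tensor_eq_iff sweed_def)
  show "sweed H \<one> \<beta> = \<beta> \<one> \<one>" if "bil H H \<beta>" for \<beta>
    using comult_one that by (simp add: tensor_eq_iff sweed_def)
  show "sweed H (x \<otimes> y) \<beta> = sweed H x (\<lambda>a b. sweed H y (\<lambda>a' b'. \<beta> (a \<otimes> a') (b \<otimes> b')))"
    if "bil H H \<beta>" "x \<in> carrier H" "y \<in> carrier H" for x y \<beta>
    using comult_mult that by (simp add: tensor_eq_iff sweed_def)
qed

lemma sweed_coassoc:
  assumes "tril H H H \<tau>" "x \<in> carrier H"
  shows "sweed H x (\<lambda>a b. sweed H a (\<lambda>a1 a2. \<tau> a1 a2 b)) = sweed H x (\<lambda>a b. sweed H b (\<lambda>b1 b2. \<tau> a b1 b2))"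
  using coassoc[OF assms(2)] assms(1) by (simp add: tensor3_eq_iff sweed_def case_prod_unfold)

lemma counit_add: "\<lbrakk>x \<in> carrier H; y \<in> carrier H\<rbrakk> \<Longrightarrow> counit H (x \<oplus> y) = counit H x + counit H y"
  and counit_scale: "x \<in> carrier H \<Longrightarrow> counit H (c \<odot> x) = c * counit H x"
  using counit_linear by (auto simp: k_functional_def)

lemma sweed_counit_l:
  assumes "k_functional H l" "x \<in> carrier H"
  shows "sweed H x (\<lambda>a b. counit H a * l b) = l x"
  using functional_mlift_comult[OF k_module_H assms, of "\<lambda>a b. counit H a \<odot> b"] counit_l[OF assms(2)] assms
  by (simp add: k_functionalD(2) cong: sweed_cong)

lemma sweed_counit_r:
  assumes "k_functional H l" "x \<in> carrier H"
  shows "sweed H x (\<lambda>a b. counit H b * l a) = l x"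
  using functional_mlift_comult[OF k_module_H assms, of "\<lambda>a b. counit H b \<odot> a"] counit_r[OF assms(2)] assms
  by (simp add: k_functionalD(2) cong: sweed_cong)

lemma antipode_closed [simp, intro]: "x \<in> carrier H \<Longrightarrow> antipode H x \<in> carrier H"
  and antipode_add: "\<lbrakk>x \<in> carrier H; y \<in> carrier H\<rbrakk> \<Longrightarrow> antipode H (x \<oplus> y) = antipode H x \<oplus> antipode H y"
  and antipode_scale: "x \<in> carrier H \<Longrightarrow> antipode H (c \<odot> x) = c \<odot> antipode H x"
  using antipode_linear by (auto simp: k_linear_def)

lemma sweed_antipode_l:
  assumes "k_functional H l" "x \<in> carrier H"
  shows "sweed H x (\<lambda>a b. l (antipode H a \<otimes> b)) = counit H x * l \<one>"
  using functional_mlift_comult[OF k_module_H assms, of "\<lambda>a b. antipode H a \<otimes> b"] antipode_l[OF assms(2)] assms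
  by (simp add: k_functionalD(2))

lemma sweed_antipode_r:
  assumes "k_functional H l" "x \<in> carrier H"
  shows "sweed H x (\<lambda>a b. l (a \<otimes> antipode H b)) = counit H x * l \<one>"
  using functional_mlift_comult[OF k_module_H assms, of "\<lambda>a b. a \<otimes> antipode H b"] antipode_r[OF assms(2)] assms
  by (simp add: k_functionalD(2))

lemma bil_antipode_mult:
  assumes "k_functional H l"
  shows "bil H H (\<lambda>a b. l (antipode H a \<otimes> b))" "bil H H (\<lambda>a b. l (a \<otimes> antipode H b))"
  using assms by (simp_all add: functional_simps antipode_add antipode_scale)

text \<open>Both sides are convolution inverses of the multiplication map from H \<otimes> H to H.
  The threefold convolution of S(xy), xy and S(y)S(x) is computed by bracketing it in both
  ways.\<close>

lemma antipode_mult: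
  assumes xy: "x \<in> carrier H" "y \<in> carrier H"
  shows "antipode H (x \<otimes> y) = antipode H y \<otimes> antipode H x"
proof (rule functional_ext)
  fix l assume l: "k_functional H l"
  note lD = k_functionalD[OF l]
  let ?S = "antipode H" and ?e = "counit H"
  \<comment> \<open>The summand S(x1 y1) x2 y2 S(y3) S(x3) of this threefold convolution, seen
    through \<open>l\<close>.\<close>
  define \<Theta> where "\<Theta> x1 y1 x2 y2 x3 y3 = l (?S (x1 \<otimes> y1) \<otimes> (x2 \<otimes> y2 \<otimes> (?S y3 \<otimes> ?S x3)))"
    for x1 y1 x2 y2 x3 y3
  have tril1: "tril H H H (\<lambda>x1 x2 x3. sweed H y (\<lambda>y1 y'. sweed H y' (\<lambda>y2 y3. \<Theta> x1 y1 x2 y2 x3 y3)))"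
    unfolding \<Theta>_def using xy
    by (simp add: functional_simps lD antipode_add antipode_scale cong: sweed_cong)
  have tril2: "tril H H H (\<lambda>y1 y2 y3. \<Theta> x1 y1 x2 y2 x3 y3)"
    if "x1 \<in> carrier H" "x2 \<in> carrier H" "x3 \<in> carrier H" for x1 x2 x3
    unfolding \<Theta>_def using that by (simp add: functional_simps lD antipode_add antipode_scale)
  \<comment> \<open>The first two convolution factors cancel, by the antipode law for the product of
    \<open>a\<close> and \<open>b\<close>.\<close>
  have E1: "sweed H a (\<lambda>x1 x2. sweed H b (\<lambda>y1 y2. \<Theta> x1 y1 x2 y2 c d)) = ?e a * ?e b * l (?S d \<otimes> ?S c)"
    if [simp]: "a \<in> carrier H" "b \<in> carrier H" "c \<in> carrier H" "d \<in> carrier H" for a b c d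
  proof -
    let ?L = "\<lambda>u. l (u \<otimes> (?S d \<otimes> ?S c))"
    have L: "k_functional H ?L" by (simp add: k_functional_def lD l_distr smult_mult_l)
    have "sweed H (a \<otimes> b) (\<lambda>p q. ?L (?S p \<otimes> q)) = ?e (a \<otimes> b) * ?L \<one>"
      by (rule sweed_antipode_l[OF L]) simp
    then show ?thesis
      by (subst (asm) sweed_mult[OF bil_antipode_mult(1)[OF L]])
        (simp_all add: \<Theta>_def m_assoc counit_mult cong: sweed_cong)
  qed
  \<comment> \<open>The last two factors cancel from the inside: y2 S(y3) first, then x2
    S(x3).\<close>
  have E2: "sweed H a (\<lambda>x2 x3. sweed H b (\<lambda>y2 y3. \<Theta> c d x2 y2 x3 y3)) = ?e a * (?e b * l (?S (c \<otimes> d)))"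
    if [simp]: "a \<in> carrier H" "b \<in> carrier H" "c \<in> carrier H" "d \<in> carrier H" for a b c d
  proof -
    have "sweed H b (\<lambda>y2 y3. \<Theta> c d x2 y2 x3 y3) = ?e b * l (?S (c \<otimes> d) \<otimes> (x2 \<otimes> ?S x3))"
      if [simp]: "x2 \<in> carrier H" "x3 \<in> carrier H" for x2 x3
    proof -
      have "k_functional H (\<lambda>u. l (?S (c \<otimes> d) \<otimes> (x2 \<otimes> (u \<otimes> ?S x3))))"
        by (simp add: k_functional_def lD l_distr r_distr smult_mult_l smult_mult_r)
      from sweed_antipode_r[OF this \<open>b \<in> carrier H\<close>] show ?thesis
        by (simp add: \<Theta>_def m_assoc cong: sweed_cong)
    qed
    moreover have "k_functional H (\<lambda>u. l (?S (c \<otimes> d) \<otimes> u))"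
      by (simp add: k_functional_def lD r_distr smult_mult_r)
    note sweed_antipode_r[OF this \<open>a \<in> carrier H\<close>]
    ultimately show ?thesis by (simp add: sweed_cmult mult.left_commute cong: sweed_cong)
  qed
  have lS: "k_functional H (\<lambda>u. l (?S (u \<otimes> v)))" "k_functional H (\<lambda>u. l (?S (v \<otimes> u)))"
      "k_functional H (\<lambda>u. l (?S u \<otimes> v))" "k_functional H (\<lambda>u. l (v \<otimes> ?S u))"
    if "v \<in> carrier H" for v
    using that by (simp_all add: functional_simps lD antipode_add antipode_scale)
  have "l (?S (x \<otimes> y)) = sweed H x (\<lambda>x1 x'. sweed H y (\<lambda>y1 y'. ?e x' * (?e y' * l (?S (x1 \<otimes> y1)))))"
    using xy by (simp add: sweed_cmult sweed_counit_r lS cong: sweed_cong)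
  also have "\<dots> = sweed H x (\<lambda>x1 x'. sweed H y (\<lambda>y1 y'. sweed H x' (\<lambda>x2 x3. sweed H y' (\<lambda>y2 y3. \<Theta> x1 y1 x2 y2 x3 y3))))"
    using xy by (simp add: E2 cong: sweed_cong)
  \<comment> \<open>Coassociativity applies to \<open>x\<close> only when its two coproducts are
    adjacent, so the sums over \<open>x\<close> and over \<open>y\<close> are interchanged before
    and after.\<close>
  also have "\<dots> = sweed H x (\<lambda>x1 x'. sweed H x' (\<lambda>x2 x3. sweed H y (\<lambda>y1 y'. sweed H y' (\<lambda>y2 y3. \<Theta> x1 y1 x2 y2 x3 y3))))"
    by (subst (2) sweed_swap) simp
  also have "\<dots> = sweed H x (\<lambda>x' x3. sweed H x' (\<lambda>x1 x2. sweed H y (\<lambda>y1 y'. sweed H y' (\<lambda>y2 y3. \<Theta> x1 y1 x2 y2 x3 y3))))"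
    by (rule sweed_coassoc[OF tril1 xy(1), symmetric])
  also have "\<dots> = sweed H x (\<lambda>x' x3. sweed H x' (\<lambda>x1 x2. sweed H y (\<lambda>y' y3. sweed H y' (\<lambda>y1 y2. \<Theta> x1 y1 x2 y2 x3 y3))))"
    using xy by (simp add: sweed_coassoc[OF tril2 xy(2)] cong: sweed_cong)
  also have "\<dots> = sweed H x (\<lambda>x' x3. sweed H y (\<lambda>y' y3. sweed H x' (\<lambda>x1 x2. sweed H y' (\<lambda>y1 y2. \<Theta> x1 y1 x2 y2 x3 y3))))"
    by (subst (2) sweed_swap) simp
  also have "\<dots> = sweed H x (\<lambda>x' x3. ?e x' * sweed H y (\<lambda>y' y3. ?e y' * l (?S y3 \<otimes> ?S x3)))"
    using xy by (simp add: E1 sweed_cmult mult.assoc cong: sweed_cong)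
  also have "\<dots> = l (?S y \<otimes> ?S x)"
    using xy by (simp add: sweed_counit_l lS cong: sweed_cong)
  finally show "l (?S (x \<otimes> y)) = l (?S y \<otimes> ?S x)" .
qed (use xy in simp_all)

end

text \<open>Every tensor axiom is replaced by its evaluation on forms, and the counit and antipode
  laws by their images under functionals. All Hopf algebras below are verified in this form.\<close>

lemma hopf_algebraI:
  fixes H :: "('k::field, 'h, 'm) hopf_scheme" (structure)
  assumes "pre_bialgebra H" and counit_linear: "k_functional H (counit H)"
    and counit_one: "counit H \<one> = 1"
    and counit_mult: "\<And>x y. \<lbrakk>x \<in> carrier H; y \<in> carrier H\<rbrakk> \<Longrightarrow> counit H (x \<otimes> y) = counit H x * counit H y"
    and coassoc: "\<And>\<tau> x. \<lbrakk>tril H H H \<tau>; x \<in> carrier H\<rbrakk> \<Longrightarrow>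
      sweed H x (\<lambda>a b. sweed H a (\<lambda>a1 a2. \<tau> a1 a2 b)) = sweed H x (\<lambda>a b. sweed H b (\<lambda>b1 b2. \<tau> a b1 b2))"
    and counit_l: "\<And>l x. \<lbrakk>k_functional H l; x \<in> carrier H\<rbrakk> \<Longrightarrow> sweed H x (\<lambda>a b. counit H a * l b) = l x"
    and counit_r: "\<And>l x. \<lbrakk>k_functional H l; x \<in> carrier H\<rbrakk> \<Longrightarrow> sweed H x (\<lambda>a b. counit H b * l a) = l x"
    and antipode_linear: "k_linear H H (antipode H)"
    and antipode_l: "\<And>l x. \<lbrakk>k_functional H l; x \<in> carrier H\<rbrakk> \<Longrightarrow>
      sweed H x (\<lambda>a b. l (antipode H a \<otimes> b)) = counit H x * l \<one>"
    and antipode_r: "\<And>l x. \<lbrakk>k_functional H l; x \<in> carrier H\<rbrakk> \<Longrightarrow>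
      sweed H x (\<lambda>a b. l (a \<otimes> antipode H b)) = counit H x * l \<one>"
  shows "hopf_algebra H"
proof -
  interpret pre_bialgebra H by fact
  have S: "x \<in> carrier H \<Longrightarrow> antipode H x \<in> carrier H" for x
    using antipode_linear by (auto simp: k_linear_def)
  show ?thesis
  proof
    show "tensor_linear H H H (comult H)"
      unfolding tensor_linear_def tensor_eq_iff
      using comult_closed sweed_add sweed_scale by (auto simp: tensor_carrier_def sweed_def)
    show "tensor_eq H H (comult H \<one>) (tens \<one> \<one>)"
      unfolding tensor_eq_iff using sweed_one by (auto simp: sweed_def)
    show "tensor_eq H H (comult H (x \<otimes> y)) (tmult H H (comult H x) (comult H y))"
      if "x \<in> carrier H" "y \<in> carrier H" for x y
      unfolding tensor_eq_iff using sweed_mult that by (auto simp: sweed_def)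
    show "tensor3_eq H H H (flift (\<lambda>(a, b). tens_r (comult H a) b) (comult H x))
        (flift (\<lambda>(a, b). tens_l a (comult H b)) (comult H x))" if "x \<in> carrier H" for x
      unfolding tensor3_eq_iff using coassoc that by (simp add: sweed_def case_prod_unfold)
    show "mlift H (\<lambda>(a, b). counit H a \<odot> b) (comult H x) = x" if "x \<in> carrier H" for x
      using that counit_l by (intro mlift_comult_eqI) (auto simp: k_module_H k_functionalD(2) cong: sweed_cong)
    show "mlift H (\<lambda>(a, b). counit H b \<odot> a) (comult H x) = x" if "x \<in> carrier H" for x
      using that counit_r by (intro mlift_comult_eqI) (auto simp: k_module_H k_functionalD(2) cong: sweed_cong)
    show "mlift H (\<lambda>(a, b). antipode H a \<otimes> b) (comult H x) = counit H x \<odot> \<one>" if "x \<in> carrier H" for x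
      using that antipode_l S by (intro mlift_comult_eqI) (auto simp: k_module_H k_functionalD(2))
    show "mlift H (\<lambda>(a, b). a \<otimes> antipode H b) (comult H x) = counit H x \<odot> \<one>" if "x \<in> carrier H" for x
      using that antipode_r S by (intro mlift_comult_eqI) (auto simp: k_module_H k_functionalD(2))
  qed (use assms in simp_all)
qed

lemma hopf_hom_sweed:
  assumes "hopf_hom H G f" "x \<in> carrier H" "bil G G \<beta>"
  shows "sweed G (f x) \<beta> = sweed H x (\<lambda>a b. \<beta> (f a) (f b))"
  using assms by (simp add: hopf_hom_def tensor_eq_iff sweed_def)

text \<open>A bialgebra homomorphism preserves the antipode: both \<open>f \<circ> S\<close> and \<open>S \<circ> f\<close> are convolution
  inverses of \<open>f\<close>.\<close>

theorem hopf_homI: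
  fixes H :: "('k::field, 'h, 'm) hopf_scheme" and G :: "('k, 'g, 'n) hopf_scheme"
  assumes "hopf_algebra H" "hopf_algebra G" and f: "k_linear H G f"
    and f_one: "f \<one>\<^bsub>H\<^esub> = \<one>\<^bsub>G\<^esub>"
    and f_mult: "\<And>x y. \<lbrakk>x \<in> carrier H; y \<in> carrier H\<rbrakk> \<Longrightarrow> f (x \<otimes>\<^bsub>H\<^esub> y) = f x \<otimes>\<^bsub>G\<^esub> f y"
    and f_comult: "\<And>x \<beta>. \<lbrakk>x \<in> carrier H; bil G G \<beta>\<rbrakk> \<Longrightarrow> sweed G (f x) \<beta> = sweed H x (\<lambda>a b. \<beta> (f a) (f b))"
    and f_counit: "\<And>x. x \<in> carrier H \<Longrightarrow> counit G (f x) = counit H x"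
  shows "hopf_hom H G f"
proof -
  interpret H: hopf_algebra H by fact
  interpret G: hopf_algebra G by fact
  have f_closed [simp]: "x \<in> carrier H \<Longrightarrow> f x \<in> carrier G"
    and f_add: "\<lbrakk>x \<in> carrier H; y \<in> carrier H\<rbrakk> \<Longrightarrow> f (x \<oplus>\<^bsub>H\<^esub> y) = f x \<oplus>\<^bsub>G\<^esub> f y"
    and f_scale: "x \<in> carrier H \<Longrightarrow> f (c \<odot>\<^bsub>H\<^esub> x) = c \<odot>\<^bsub>G\<^esub> f x" for x y c
    using f by (auto simp: k_linear_def)
  have "antipode G (f x) = f (antipode H x)" if x: "x \<in> carrier H" for x
  proof (rule G.functional_ext)
    fix l assume l: "k_functional G l"
    note lD = k_functionalD[OF l]
    \<comment> \<open>The threefold convolution of the two candidate inverses with \<open>f\<close>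
      between them, seen through \<open>l\<close>.\<close>
    define \<Theta> where "\<Theta> a b c = l (f (antipode H a) \<otimes>\<^bsub>G\<^esub> (f b \<otimes>\<^bsub>G\<^esub> antipode G (f c)))" for a b c
    have tril: "tril H H H \<Theta>"
      unfolding \<Theta>_def by (simp add: G.functional_simps lD f_add f_scale H.antipode_add H.antipode_scale
          G.antipode_add G.antipode_scale)
    have "sweed H h (\<lambda>b c. \<Theta> a b c) = counit H h * l (f (antipode H a))"
      if [simp]: "a \<in> carrier H" "h \<in> carrier H" for a h
    proof -
      have L: "k_functional G (\<lambda>u. l (f (antipode H a) \<otimes>\<^bsub>G\<^esub> u))"
        by (simp add: k_functional_def lD G.r_distr G.smult_mult_r)
      show ?thesis
        using G.sweed_antipode_r[OF L, of "f h"] f_comult[OF _ G.bil_antipode_mult(2)[OF L], of h]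
        by (simp add: \<Theta>_def f_counit)
    qed
    moreover have "k_functional H (\<lambda>a. l (f (antipode H a)))"
      by (simp add: k_functional_def lD f_add f_scale H.antipode_add H.antipode_scale)
    ultimately have "l (f (antipode H x)) = sweed H x (\<lambda>a h. sweed H h (\<lambda>b c. \<Theta> a b c))"
      using x by (simp add: H.sweed_counit_r cong: H.sweed_cong)
    also have "\<dots> = sweed H x (\<lambda>h c. sweed H h (\<lambda>a b. \<Theta> a b c))"
      by (rule H.sweed_coassoc[OF tril x, symmetric])
    also have "\<dots> = sweed H x (\<lambda>h c. counit H h * l (antipode G (f c)))"
    proof -
      have "sweed H h (\<lambda>a b. \<Theta> a b c) = counit H h * l (antipode G (f c))"
        if [simp]: "c \<in> carrier H" "h \<in> carrier H" for c h
      proof -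
        have L: "k_functional H (\<lambda>u. l (f u \<otimes>\<^bsub>G\<^esub> antipode G (f c)))"
          by (simp add: k_functional_def lD f_add f_scale G.l_distr G.smult_mult_l)
        show ?thesis
          using H.sweed_antipode_l[OF L, of h]
          by (simp add: \<Theta>_def f_mult f_one G.m_assoc cong: H.sweed_cong)
      qed
      then show ?thesis using x by (simp cong: H.sweed_cong)
    qed
    also have "\<dots> = l (antipode G (f x))"
    proof -
      have "k_functional H (\<lambda>c. l (antipode G (f c)))"
        by (simp add: k_functional_def lD f_add f_scale G.antipode_add G.antipode_scale)
      then show ?thesis using x by (rule H.sweed_counit_l)
    qed
    finally show "l (antipode G (f x)) = l (f (antipode H x))" ..
  qed (use x in simp_all)
  then show ?thesis
    unfolding hopf_hom_def tensor_eq_iff ring_hom_def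
    using f f_one f_mult f_add f_counit f_comult by (simp add: sweed_def)
qed

text \<open>Every action of a Hopf algebra is unital, since
  \<open>\<epsilon>(h) 1 = h\<^sub>1 (1 \<cdot> S(h\<^sub>2) 1) = (h\<^sub>1 1) (h\<^sub>2 S(h\<^sub>3) 1) = h 1\<close>.\<close>

context hopf_action
begin

lemma act_closed [simp]: "\<lbrakk>h \<in> carrier H; a \<in> carrier A\<rbrakk> \<Longrightarrow> \<psi> h a \<in> carrier A"
  and act_add_r: "\<lbrakk>h \<in> carrier H; a \<in> carrier A; b \<in> carrier A\<rbrakk> \<Longrightarrow> \<psi> h (a \<oplus>\<^bsub>A\<^esub> b) = \<psi> h a \<oplus>\<^bsub>A\<^esub> \<psi> h b"
  and act_scale_r: "\<lbrakk>h \<in> carrier H; a \<in> carrier A\<rbrakk> \<Longrightarrow> \<psi> h (c \<odot>\<^bsub>A\<^esub> a) = c \<odot>\<^bsub>A\<^esub> \<psi> h a"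
  using act_linear_r[of h] by (auto simp: k_linear_def)

lemma act_add_l: "\<lbrakk>h \<in> carrier H; g \<in> carrier H; a \<in> carrier A\<rbrakk> \<Longrightarrow> \<psi> (h \<oplus>\<^bsub>H\<^esub> g) a = \<psi> h a \<oplus>\<^bsub>A\<^esub> \<psi> g a"
  and act_scale_l: "\<lbrakk>h \<in> carrier H; a \<in> carrier A\<rbrakk> \<Longrightarrow> \<psi> (c \<odot>\<^bsub>H\<^esub> h) a = c \<odot>\<^bsub>A\<^esub> \<psi> h a"
  using act_linear_l by (auto simp: k_linear_def)

lemma functional_act_prod:
  assumes "k_functional A l" "h \<in> carrier H" "a \<in> carrier A" "b \<in> carrier A"
  shows "l (\<psi> h (a \<otimes>\<^bsub>A\<^esub> b)) = sweed H h (\<lambda>h1 h2. l (\<psi> h1 a \<otimes>\<^bsub>A\<^esub> \<psi> h2 b))"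
  using assms by (simp add: act_prod functional_mlift_comult A.k_module_axioms)

lemma action_unital:
  assumes x: "x \<in> carrier H"
  shows "\<psi> x \<one>\<^bsub>A\<^esub> = counit H x \<odot>\<^bsub>A\<^esub> \<one>\<^bsub>A\<^esub>"
proof (rule A.functional_ext)
  fix l assume l: "k_functional A l"
  note lD = k_functionalD[OF l]
  define \<Theta> where "\<Theta> a b c = l (\<psi> a \<one>\<^bsub>A\<^esub> \<otimes>\<^bsub>A\<^esub> \<psi> (b \<otimes>\<^bsub>H\<^esub> antipode H c) \<one>\<^bsub>A\<^esub>)" for a b c
  have tril: "tril H H H \<Theta>"
    unfolding \<Theta>_def by (simp add: functional_simps A.l_distr A.r_distr A.smult_mult_l A.smult_mult_r
        lD act_add_l act_scale_l antipode_add antipode_scale)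
  have "k_functional H (\<lambda>u. l (\<psi> a \<one>\<^bsub>A\<^esub> \<otimes>\<^bsub>A\<^esub> \<psi> u \<one>\<^bsub>A\<^esub>))" if "a \<in> carrier H" for a
    using that by (simp add: k_functional_def A.r_distr A.smult_mult_r lD act_add_l act_scale_l)
  from sweed_antipode_r[OF this] have "sweed H h (\<lambda>b c. \<Theta> a b c) = counit H h * l (\<psi> a \<one>\<^bsub>A\<^esub>)"
    if "a \<in> carrier H" "h \<in> carrier H" for a h
    using that by (simp add: \<Theta>_def act_one)
  moreover have "k_functional H (\<lambda>a. l (\<psi> a \<one>\<^bsub>A\<^esub>))"
    by (simp add: k_functional_def lD act_add_l act_scale_l)
  ultimately have "l (\<psi> x \<one>\<^bsub>A\<^esub>) = sweed H x (\<lambda>a h. sweed H h (\<lambda>b c. \<Theta> a b c))"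
    using x by (simp add: sweed_counit_r cong: sweed_cong)
  also have "\<dots> = sweed H x (\<lambda>h c. sweed H h (\<lambda>a b. \<Theta> a b c))"
    by (rule sweed_coassoc[OF tril x, symmetric])
  also have "\<dots> = sweed H x (\<lambda>h c. l (\<psi> (h \<otimes>\<^bsub>H\<^esub> antipode H c) \<one>\<^bsub>A\<^esub>))"
    using x functional_act_prod[OF l, of _ "\<one>\<^bsub>A\<^esub>", symmetric]
    by (simp add: \<Theta>_def act_mult cong: sweed_cong)
  also have "\<dots> = counit H x * l \<one>\<^bsub>A\<^esub>"
    using x by (subst sweed_antipode_r) (simp_all add: k_functional_def lD act_add_l act_scale_l act_one)
  finally show "l (\<psi> x \<one>\<^bsub>A\<^esub>) = l (counit H x \<odot>\<^bsub>A\<^esub> \<one>\<^bsub>A\<^esub>)"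
    by (simp add: lD)
qed (use x in simp_all)

end

subsection \<open>The finite dual\<close>

text \<open>Finitely many functions span a space on which suitable point evaluations are
  coordinates, with dual functions e_i. The pairs are found by induction: the residue of a new
  function is normalised at a point where it does not vanish, and the old e_i are corrected to
  vanish there. In the applications the members of \<open>W\<close> are functions on a carrier, so
  closure of \<open>W\<close> is asked only up to agreement on \<open>D\<close>.\<close>

lemma interpolation:
  fixes F :: "('a \<Rightarrow> 'k::field) set"
  assumes "finite F" "F \<subseteq> W"
    and W: "\<And>c f g. \<lbrakk>f \<in> W; g \<in> W\<rbrakk> \<Longrightarrow> \<exists>h\<in>W. \<forall>x\<in>D. h x = c * f x + g x"
  obtains t where "Poly_Mapping.keys t \<subseteq> D \<times> W"
    "\<And>f x. \<lbrakk>f \<in> F; x \<in> D\<rbrakk> \<Longrightarrow> f x = slift (\<lambda>(p, e). f p * e x) t"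
proof -
  have "\<exists>t. Poly_Mapping.keys t \<subseteq> D \<times> W \<and> (\<forall>f\<in>F. \<forall>x\<in>D. f x = slift (\<lambda>(p, e). f p * e x) t)"
  using assms(1,2)
proof (induction F)
  case empty
  show ?case by (rule exI[of _ 0]) simp
next
  case (insert l F)
  then obtain t where t: "Poly_Mapping.keys t \<subseteq> D \<times> W"
      "\<And>f x. f \<in> F \<Longrightarrow> x \<in> D \<Longrightarrow> f x = slift (\<lambda>(p, e). f p * e x) t" and l: "l \<in> W"
    by auto
  \<comment> \<open>The part of \<open>l\<close> that the pairs found so far fail to reproduce; if
    it vanishes on \<open>D\<close>, they already suffice.\<close>
  define m where "m x = l x - slift (\<lambda>(p, e). l p * e x) t" for x
  show ?case
  proof (cases "\<forall>x\<in>D. m x = 0")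
    case True
    then show ?thesis using t by (intro exI[of _ t]) (auto simp: m_def)
  next
    case False
    then obtain p0 where p0: "p0 \<in> D" "m p0 \<noteq> 0" by blast
    have W_sum: "\<exists>h\<in>W. \<forall>x\<in>D. h x = w x + (\<Sum>i\<in>I. c i * f i x)"
      if "finite I" "f ` I \<subseteq> W" "w \<in> W" for I :: "('a \<times> ('a \<Rightarrow> 'k)) set" and c f w
      using that(1,2)
    proof (induction I)
      case empty
      then show ?case using that(3) by auto
    next
      case (insert i I)
      then obtain h where "h \<in> W" "\<forall>x\<in>D. h x = w x + (\<Sum>i\<in>I. c i * f i x)" by auto
      moreover from this obtain h' where "h' \<in> W" "\<forall>x\<in>D. h' x = c i * f i x + h x"
        using W[of "f i" h "c i"] insert by auto
      ultimately show ?case using insert by (intro bexI[of _ h']) (auto simp: algebra_simps)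
    qed
    have "\<exists>h\<in>W. \<forall>x\<in>D. h x = l x + (\<Sum>q\<in>Poly_Mapping.keys t. - (Poly_Mapping.lookup t q * l (fst q)) * snd q x)"
      by (rule W_sum) (use t(1) l in auto)
    then obtain m' where m': "m' \<in> W" "\<And>x. x \<in> D \<Longrightarrow> m' x = m x"
      by (auto simp: m_def slift_def case_prod_unfold sum_negf mult.assoc)
    obtain e0 where e0: "e0 \<in> W" "\<And>x. x \<in> D \<Longrightarrow> e0 x = m x / m p0"
    proof -
      \<comment> \<open>The zero function. Closure of \<open>W\<close> provides combinations c f + g
        only, so a multiple of \<open>m'\<close> is obtained by adding zero to it.\<close>
      obtain z where z: "z \<in> W" "\<forall>x\<in>D. z x = (- 1) * m' x + m' x" using W m'(1) by metis
      obtain e where "e \<in> W" "\<forall>x\<in>D. e x = inverse (m p0) * m' x + z x" using W m'(1) z(1) by metis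
      then show ?thesis using z(2) m'(2) by (intro that[of e]) (auto simp: field_simps)
    qed
    \<comment> \<open>Since e0(p0) = 1, subtracting e(p0) e0 makes each old e vanish at
      \<open>p0\<close>. For the functions already treated the two terms with \<open>e0\<close>
      cancel, because the old pairs reproduce their value at \<open>p0\<close>.\<close>
    have "\<forall>e\<in>W. \<exists>h\<in>W. \<forall>x\<in>D. h x = - e p0 * e0 x + e x" using W e0(1) by blast
    then obtain r where r: "\<And>e. e \<in> W \<Longrightarrow> r e \<in> W"
        "\<And>e x. e \<in> W \<Longrightarrow> x \<in> D \<Longrightarrow> r e x = - e p0 * e0 x + e x" by metis
    define t' where "t' = flift (\<lambda>(p, e). tens p (r e)) t + tens p0 e0"
    have "Poly_Mapping.keys t' \<subseteq> D \<times> W"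
      unfolding t'_def using t(1) r(1) p0(1) e0(1)
      by (intro order_trans[OF keys_add] Un_least order_trans[OF keys_flift]) auto
    moreover have "slift (\<lambda>(p, e). f p * e x) t' =
        slift (\<lambda>(p, e). f p * e x) t - slift (\<lambda>(p, e). f p * e p0) t * e0 x + f p0 * e0 x"
      if x: "x \<in> D" for f x
    proof -
      have "slift (\<lambda>(p, e). f p * r e x) t = slift (\<lambda>(p, e). f p * e x - (f p * e p0) * e0 x) t"
        using t(1) x by (intro slift_cong) (auto simp: r(2) algebra_simps)
      then show ?thesis
        by (simp add: t'_def case_prod_unfold slift_fun_diff slift_cmult_right)
    qed
    moreover have "slift (\<lambda>(p, e). l p * e x) t = l x - m x" for x by (simp add: m_def)
    ultimately show ?thesis
      using t(2) p0 e0(2) by (intro exI[of _ t'] conjI ballI) (auto simp: right_diff_distrib left_diff_distrib diff_divide_distrib)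
  qed
qed
  then show ?thesis using that by blast
qed

lemma finite_dual_carrierD:
  assumes "l \<in> finite_dual_carrier A"
  shows "l \<in> extensional (carrier A)" "k_functional A l"
  using assms by (auto simp: finite_dual_carrier_def)

context k_algebra
begin

lemma restrict_functional:
  assumes "k_functional A l"
  shows "k_functional A (restrict l (carrier A))"
  using assms by (simp add: k_functional_def)

lemma finite_codim_functional_zero:
  assumes "k_functional A l" "\<And>x. x \<in> J \<Longrightarrow> l x = 0" "J \<subseteq> carrier A"
    "finite B" "B \<subseteq> carrier A" "\<And>b. b \<in> B \<Longrightarrow> l b = 0"
    "\<exists>i\<in>J. \<exists>c. a = i \<oplus> (\<Oplus>b\<in>B. c b \<odot> b)"
  shows "l a = 0"
proof -
  obtain i c where a: "i \<in> J" "a = i \<oplus> (\<Oplus>b\<in>B. c b \<odot> b)" using assms(7) by blast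
  have "l (\<Oplus>b\<in>B. c b \<odot> b) = (\<Sum>b\<in>B. l (c b \<odot> b))"
    using assms by (intro functional_finsum) auto
  also have "\<dots> = 0"
    using assms(5,6) by (intro sum.neutral) (auto simp: k_functionalD(2)[OF assms(1)] subset_iff)
  finally show ?thesis
    using a assms(2,3,5) M.finsum_closed[of "\<lambda>b. c b \<odot> b" B]
    by (simp add: k_functionalD(1)[OF assms(1)] subset_iff Pi_iff)
qed

text \<open>This provides the comultiplication of the finite dual. Modulo an ideal killed by
  \<open>l\<close> the algebra is spanned by a finite set \<open>B\<close>, so only the finitely
  many translates h \<mapsto> l(bh) with b in \<open>B\<close> have to be interpolated.\<close>

theorem finite_dual_split:
  assumes "l \<in> finite_dual_carrier A"
  shows "\<exists>t. Poly_Mapping.keys t \<subseteq> finite_dual_carrier A \<times> finite_dual_carrier A \<and>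
    (\<forall>g\<in>carrier A. \<forall>h\<in>carrier A. l (g \<otimes> h) = slift (\<lambda>(l1, l2). l1 g * l2 h) t)"
proof -
  obtain J where J: "finite_codim_ideal A J" "\<And>x. x \<in> J \<Longrightarrow> l x = 0"
    and l: "k_functional A l"
    using assms by (auto simp: finite_dual_carrier_def)
  note lD = k_functionalD[OF l]
  interpret J: ideal J A using J(1) by (simp add: finite_codim_ideal_def)
  obtain B where B: "finite B" "B \<subseteq> carrier A"
      "\<And>a. a \<in> carrier A \<Longrightarrow> \<exists>i\<in>J. \<exists>c. a = i \<oplus> (\<Oplus>b\<in>B. c b \<odot> b)"
    using J(1) by (auto simp: finite_codim_ideal_def)
  \<comment> \<open>Functionals killed by the same ideal \<open>J\<close> belong to the finite dual,
    so interpolation inside \<open>W\<close> delivers second tensor factors of the required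
    kind.\<close>
  define W where "W = {f \<in> extensional (carrier A). k_functional A f \<and> (\<forall>x\<in>J. f x = 0)}"
  have W: "W \<subseteq> finite_dual_carrier A"
    using J(1) by (auto simp: W_def finite_dual_carrier_def)
  define F where "F = (\<lambda>b. \<lambda>h\<in>carrier A. l (b \<otimes> h)) ` B"
  have FW: "F \<subseteq> W"
    unfolding F_def W_def using B(2) J(2) J.I_l_closed
    by (auto intro!: restrict_functional simp: k_functional_def r_distr smult_mult_r lD subset_iff)
  have W_comb: "\<exists>h\<in>W. \<forall>x\<in>carrier A. h x = c * f x + g x" if "f \<in> W" "g \<in> W" for c f g
    using that by (intro bexI[of _ "\<lambda>x\<in>carrier A. c * f x + g x"])
      (auto simp: W_def k_functional_def algebra_simps)
  have "finite F" using B(1) by (simp add: F_def)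
  from interpolation[of F W "carrier A", OF this FW W_comb]
  obtain t where t: "Poly_Mapping.keys t \<subseteq> carrier A \<times> W"
      "\<And>f x. f \<in> F \<Longrightarrow> x \<in> carrier A \<Longrightarrow> f x = slift (\<lambda>(p, e). f p * e x) t"
    by metis
  have eq: "l (g \<otimes> h) = slift (\<lambda>(p, e). l (g \<otimes> p) * e h) t"
    if gh: "g \<in> carrier A" "h \<in> carrier A" for g h
  proof -
    \<comment> \<open>The defect of the splitting as a function of the left argument alone: it
      vanishes on \<open>J\<close>, which is stable under right multiplication, and on
      \<open>B\<close> by construction.\<close>
    define \<Phi> where "\<Phi> g = l (g \<otimes> h) - slift (\<lambda>(p, e). l (g \<otimes> p) * e h) t" for g
    have pos: "fst q \<in> carrier A" if "q \<in> Poly_Mapping.keys t" for q using t(1) that by auto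
    have \<Phi>: "k_functional A \<Phi>"
      using gh pos unfolding \<Phi>_def k_functional_def
      by (simp add: case_prod_unfold l_distr smult_mult_l lD distrib_right slift_fun_add
          mult.assoc slift_cmult right_diff_distrib cong: slift_cong)
    have \<Phi>_J: "\<Phi> x = 0" if "x \<in> J" for x
      using J(2) J.I_r_closed that gh pos by (simp add: \<Phi>_def case_prod_unfold cong: slift_cong)
    have \<Phi>_B: "\<Phi> b = 0" if "b \<in> B" for b
    proof -
      have "(\<lambda>h\<in>carrier A. l (b \<otimes> h)) \<in> F" using that by (simp add: F_def)
      from t(2)[OF this gh(2)] have "l (b \<otimes> h) = slift (\<lambda>(p, e). l (b \<otimes> p) * e h) t"
        using gh pos by (simp add: case_prod_unfold cong: slift_cong)
      then show ?thesis by (simp add: \<Phi>_def)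
    qed
    have "\<Phi> g = 0"
      by (rule finite_codim_functional_zero[OF \<Phi> \<Phi>_J J.a_subset B(1,2) \<Phi>_B B(3)[OF gh(1)]])
    then show ?thesis by (simp add: \<Phi>_def)
  qed
  \<comment> \<open>The first tensor factors are the translates g \<mapsto> l(gp) by the
    interpolation points; they vanish on \<open>J\<close> as well.\<close>
  have "(\<lambda>g\<in>carrier A. l (g \<otimes> p)) \<in> finite_dual_carrier A" if "p \<in> carrier A" for p
    using W that J(2) J.I_r_closed J.a_subset
    by (intro subsetD[OF W]) (auto simp: W_def intro!: restrict_functional
        simp: k_functional_def l_distr smult_mult_l lD)
  then have "Poly_Mapping.keys (flift (\<lambda>(p, e). tens (\<lambda>g\<in>carrier A. l (g \<otimes> p)) e) t)
      \<subseteq> finite_dual_carrier A \<times> finite_dual_carrier A"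
    using t(1) W by (intro order_trans[OF keys_flift] UN_least) auto
  moreover have "l (g \<otimes> h) = slift (\<lambda>(l1, l2). l1 g * l2 h)
      (flift (\<lambda>(p, e). tens (\<lambda>g\<in>carrier A. l (g \<otimes> p)) e) t)"
    if "g \<in> carrier A" "h \<in> carrier A" for g h
    using eq[OF that] that by (simp add: case_prod_unfold)
  ultimately show ?thesis by blast
qed

text \<open>Isolates the dependence of l(xby) on the middle argument: \<open>b\<close> enters only
  through finitely many functionals. This is the shape in which membership in the finite dual is
  tested.\<close>

lemma finite_dual_triple:
  assumes "l \<in> finite_dual_carrier A"
  obtains t where "Poly_Mapping.keys t \<subseteq> finite_dual_carrier A \<times> finite_dual_carrier A \<times> finite_dual_carrier A"
    "\<And>x b y. \<lbrakk>x \<in> carrier A; b \<in> carrier A; y \<in> carrier A\<rbrakk> \<Longrightarrow>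
      l (x \<otimes> b \<otimes> y) = slift (\<lambda>(f, g, k). f x * (g b * k y)) t"
proof -
  let ?D = "finite_dual_carrier A"
  obtain t0 where t0: "Poly_Mapping.keys t0 \<subseteq> ?D \<times> ?D"
      "\<And>g h. \<lbrakk>g \<in> carrier A; h \<in> carrier A\<rbrakk> \<Longrightarrow> l (g \<otimes> h) = slift (\<lambda>(l1, l2). l1 g * l2 h) t0"
    using finite_dual_split[OF assms] by blast
  obtain T where T: "\<And>m. m \<in> ?D \<Longrightarrow> Poly_Mapping.keys (T m) \<subseteq> ?D \<times> ?D"
      "\<And>m g h. \<lbrakk>m \<in> ?D; g \<in> carrier A; h \<in> carrier A\<rbrakk> \<Longrightarrow> m (g \<otimes> h) = slift (\<lambda>(l1, l2). l1 g * l2 h) (T m)"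
    using finite_dual_split by metis
  let ?t = "flift (\<lambda>(f, m). tens_l f (T m)) t0"
  have "Poly_Mapping.keys (tens_l f u) \<subseteq> {f} \<times> Poly_Mapping.keys u" for f and u :: "(('a \<Rightarrow> 'k) \<times> ('a \<Rightarrow> 'k)) \<Rightarrow>\<^sub>0 'k"
    unfolding tens_l_def by (rule order_trans[OF keys_flift]) auto
  then have "Poly_Mapping.keys ?t \<subseteq> ?D \<times> ?D \<times> ?D"
    using t0(1) T(1) by (intro order_trans[OF keys_flift]) fastforce
  moreover have "l (x \<otimes> b \<otimes> y) = slift (\<lambda>(f, g, k). f x * (g b * k y)) ?t"
    if xby: "x \<in> carrier A" "b \<in> carrier A" "y \<in> carrier A" for x b y
  proof -
    have "l (x \<otimes> (b \<otimes> y)) = slift (\<lambda>(f, m). f x * m (b \<otimes> y)) t0" using t0(2) xby by simp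
    also have "\<dots> = slift (\<lambda>(f, m). slift (\<lambda>(g, k). f x * (g b * k y)) (T m)) t0"
      using t0(1) T(2) xby by (intro slift_cong) (auto simp: case_prod_unfold slift_cmult)
    finally show ?thesis using xby by (simp add: m_assoc case_prod_unfold)
  qed
  ultimately show ?thesis by (rule that)
qed

text \<open>A test for the finite dual that mentions no ideal. The b with l(xby) = 0 for all x and y
  form the largest two-sided ideal inside the kernel of \<open>l\<close>; it contains the common
  kernel of the finite set \<open>G\<close>, hence has finite codimension.\<close>

lemma finite_dualI:
  assumes "l \<in> extensional (carrier A)" "k_functional A l" "finite G" "\<And>g. g \<in> G \<Longrightarrow> k_functional A g"
    and "\<And>b x y. \<lbrakk>b \<in> carrier A; \<And>g. g \<in> G \<Longrightarrow> g b = 0; x \<in> carrier A; y \<in> carrier A\<rbrakk> \<Longrightarrow> l (x \<otimes> b \<otimes> y) = 0"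
  shows "l \<in> finite_dual_carrier A"
proof -
  note lD = k_functionalD[OF assms(2)]
  define J where "J = {b \<in> carrier A. \<forall>x\<in>carrier A. \<forall>y\<in>carrier A. l (x \<otimes> b \<otimes> y) = 0}"
  have "ideal J A"
  proof (rule idealI)
    show "ring A" ..
    show "subgroup J (add_monoid A)"
    proof
      show "inv\<^bsub>add_monoid A\<^esub> x \<in> J" if "x \<in> J" for x
      proof -
        have "l (u \<otimes> \<ominus> x \<otimes> v) = 0" if "u \<in> carrier A" "v \<in> carrier A" for u v
          using that \<open>x \<in> J\<close> functional_minus[OF assms(2), of "u \<otimes> x \<otimes> v"]
          by (simp add: J_def r_minus l_minus)
        then show ?thesis using that by (simp add: J_def flip: a_inv_def)
      qed
      show "x \<otimes>\<^bsub>add_monoid A\<^esub> y \<in> J" if "x \<in> J" "y \<in> J" for x y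
        using that by (simp add: J_def r_distr l_distr lD)
      show "\<one>\<^bsub>add_monoid A\<^esub> \<in> J"
        by (simp add: J_def functional_zero[OF assms(2)])
    qed (auto simp: J_def)
    show "x \<otimes> a \<in> J" "a \<otimes> x \<in> J" if ax: "a \<in> J" "x \<in> carrier A" for a x
    proof -
      have a: "a \<in> carrier A" "\<And>u v. \<lbrakk>u \<in> carrier A; v \<in> carrier A\<rbrakk> \<Longrightarrow> l (u \<otimes> a \<otimes> v) = 0"
        using ax(1) by (auto simp: J_def)
      have "l (u \<otimes> (x \<otimes> a) \<otimes> v) = 0" "l (u \<otimes> (a \<otimes> x) \<otimes> v) = 0"
        if uv: "u \<in> carrier A" "v \<in> carrier A" for u v
        using a(2)[of "u \<otimes> x" v] a(2)[of u "x \<otimes> v"] uv a(1) ax(2) by (simp_all add: m_assoc)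
      then show "x \<otimes> a \<in> J" "a \<otimes> x \<in> J" using a(1) ax(2) by (simp_all add: J_def)
    qed
  qed
  moreover have "l x = 0" if "x \<in> J" for x
    using that by (force simp: J_def dest: bspec[of _ _ \<one>])
  moreover have "\<exists>B. finite B \<and> B \<subseteq> carrier A \<and> (\<forall>a\<in>carrier A. \<exists>i\<in>J. \<exists>c. a = i \<oplus> (\<Oplus>b\<in>B. c b \<odot> b))"
  proof -
    have comb: "\<exists>h\<in>Collect (k_functional A). \<forall>x\<in>carrier A. h x = c * f x + g x"
      if "f \<in> Collect (k_functional A)" "g \<in> Collect (k_functional A)" for c f g
      using that by (intro bexI[of _ "\<lambda>x. c * f x + g x"]) (auto simp: k_functional_def algebra_simps)
    have "G \<subseteq> Collect (k_functional A)" using assms(4) by auto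
    from interpolation[of G "Collect (k_functional A)" "carrier A", OF assms(3) this comb]
    obtain t where t: "Poly_Mapping.keys t \<subseteq> carrier A \<times> Collect (k_functional A)"
        "\<And>f x. f \<in> G \<Longrightarrow> x \<in> carrier A \<Longrightarrow> f x = slift (\<lambda>(p, e). f p * e x) t"
      by metis
    let ?K = "Poly_Mapping.keys t"
    \<comment> \<open>Interpolating \<open>G\<close> at points p makes a - sum e(a) p invisible to
      every member of \<open>G\<close>. A point may occur in several pairs, so its coefficient
      collects all of them.\<close>
    define c where "c a b = (\<Sum>q\<in>{q\<in>?K. fst q = b}. Poly_Mapping.lookup t q * snd q a)" for a b
    have "\<exists>i\<in>J. a = i \<oplus> (\<Oplus>b\<in>fst ` ?K. c a b \<odot> b)" if a: "a \<in> carrier A" for a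
    proof -
      let ?s = "\<Oplus>b\<in>fst ` ?K. c a b \<odot> b"
      have s: "?s \<in> carrier A" using t(1) by (intro M.finsum_closed) auto
      have "g (a \<ominus> ?s) = 0" if g: "g \<in> G" for g
      proof -
        note gD = k_functionalD[OF assms(4)[OF g]]
        have "g ?s = (\<Sum>b\<in>fst ` ?K. g (c a b \<odot> b))"
          using t(1) by (intro functional_finsum assms(4) g) auto
        also have "\<dots> = (\<Sum>b\<in>fst ` ?K. c a b * g b)"
          using t(1) by (intro sum.cong) (auto simp: gD)
        also have "\<dots> = (\<Sum>b\<in>fst ` ?K. \<Sum>q\<in>{q\<in>?K. fst q = b}. Poly_Mapping.lookup t q * (g (fst q) * snd q a))"
          unfolding c_def sum_distrib_right by (intro sum.cong) auto
        also have "\<dots> = slift (\<lambda>(p, e). g p * e a) t"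
          unfolding slift_def case_prod_unfold by (rule sum.image_gen[symmetric]) simp
        also have "\<dots> = g a" using t(2) g a by simp
        finally show ?thesis
          using a s by (simp add: a_minus_def gD functional_minus[OF assms(4)[OF g]])
      qed
      then have "a \<ominus> ?s \<in> J" using assms(5) a s by (auto simp: J_def)
      moreover have "a = (a \<ominus> ?s) \<oplus> ?s" using a s by (simp add: a_minus_def M.a_assoc M.l_neg)
      ultimately show ?thesis by blast
    qed
    then have "\<forall>a\<in>carrier A. \<exists>i\<in>J. \<exists>c. a = i \<oplus> (\<Oplus>b\<in>fst ` ?K. c b \<odot> b)"
      by blast
    moreover have "fst ` ?K \<subseteq> carrier A" using t(1) by auto
    ultimately show ?thesis by (intro exI[of _ "fst ` ?K"] conjI) simp_all
  qed
  ultimately show ?thesis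
    using assms(1,2) by (auto simp: finite_dual_carrier_def finite_codim_ideal_def)
qed

end

text \<open>The full dual under convolution. It has the operations of \<open>finite_dual\<close> on
  a larger carrier, so the algebra laws proved here are inherited there.\<close>

definition dual_algebra :: "('k::field, 'h, 'm) hopf_scheme \<Rightarrow> ('k, 'h \<Rightarrow> 'k) module"
  where "dual_algebra H = \<lparr>
    carrier = {l \<in> extensional (carrier H). k_functional H l},
    monoid.mult = (\<lambda>l m. \<lambda>h\<in>carrier H. slift (\<lambda>(h1, h2). l h1 * m h2) (comult H h)),
    one = (\<lambda>h\<in>carrier H. counit H h),
    ring.zero = (\<lambda>h\<in>carrier H. 0),
    add = (\<lambda>l m. \<lambda>h\<in>carrier H. l h + m h),
    module.smult = (\<lambda>c l. \<lambda>h\<in>carrier H. c * l h)\<rparr>"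

lemma finite_dual_sel:
  "carrier (finite_dual H) = finite_dual_carrier H"
  "monoid.mult (finite_dual H) = monoid.mult (dual_algebra H)"
  "one (finite_dual H) = one (dual_algebra H)"
  "ring.zero (finite_dual H) = ring.zero (dual_algebra H)"
  "add (finite_dual H) = add (dual_algebra H)"
  "module.smult (finite_dual H) = module.smult (dual_algebra H)"
  "counit (finite_dual H) = (\<lambda>l. l \<one>\<^bsub>H\<^esub>)"
  "antipode (finite_dual H) = (\<lambda>l. \<lambda>h\<in>carrier H. l (antipode H h))"
  by (simp_all add: finite_dual_def dual_algebra_def)

lemma slift_mult: "slift f s * slift g t = slift (\<lambda>p. slift (\<lambda>q. f p * g q) t) s"
  by (simp add: slift_cmult slift_cmult_right)

context hopf_algebra
begin

lemma dual_carrier: "l \<in> carrier (dual_algebra H) \<longleftrightarrow> l \<in> extensional (carrier H) \<and> k_functional H l"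
  by (simp add: dual_algebra_def)

lemma dual_apply [simp]:
  assumes "h \<in> carrier H"
  shows "(l \<otimes>\<^bsub>dual_algebra H\<^esub> m) h = sweed H h (\<lambda>a b. l a * m b)"
    "\<one>\<^bsub>dual_algebra H\<^esub> h = counit H h"
    "\<zero>\<^bsub>dual_algebra H\<^esub> h = 0"
    "(l \<oplus>\<^bsub>dual_algebra H\<^esub> m) h = l h + m h"
    "(c \<odot>\<^bsub>dual_algebra H\<^esub> l) h = c * l h"
  using assms by (simp_all add: dual_algebra_def sweed_def)

lemma dual_extensional [simp]:
  "l \<otimes>\<^bsub>dual_algebra H\<^esub> m \<in> extensional (carrier H)"
  "\<one>\<^bsub>dual_algebra H\<^esub> \<in> extensional (carrier H)"
  "\<zero>\<^bsub>dual_algebra H\<^esub> \<in> extensional (carrier H)"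
  "l \<oplus>\<^bsub>dual_algebra H\<^esub> m \<in> extensional (carrier H)"
  "c \<odot>\<^bsub>dual_algebra H\<^esub> l \<in> extensional (carrier H)"
  by (simp_all add: dual_algebra_def)

lemma k_functional_cong:
  assumes "\<And>x. x \<in> carrier H \<Longrightarrow> l x = m x"
  shows "k_functional H l = k_functional H m"
  using assms by (simp add: k_functional_def)

lemma bil_mult:
  assumes "k_functional H l" "k_functional H m"
  shows "bil H H (\<lambda>a b. l a * m b)"
  using assms by (simp add: bil_def k_functional_def algebra_simps)

lemma dual_functional:
  assumes "k_functional H l" "k_functional H m"
  shows "k_functional H (l \<otimes>\<^bsub>dual_algebra H\<^esub> m)"
    "k_functional H (l \<oplus>\<^bsub>dual_algebra H\<^esub> m)"
    "k_functional H (c \<odot>\<^bsub>dual_algebra H\<^esub> l)"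
  using assms sweed_add[OF bil_mult[OF assms]] sweed_scale[OF bil_mult[OF assms]]
  by (simp_all add: k_functional_def algebra_simps)

lemma dual_functional_const:
  "k_functional H \<one>\<^bsub>dual_algebra H\<^esub>" "k_functional H \<zero>\<^bsub>dual_algebra H\<^esub>"
  by (simp_all add: k_functional_def counit_add counit_scale)

lemma dual_algebra_algebra: "k_algebra (dual_algebra H)"
proof (rule k_algebraI, goal_cases)
  case (9 x y z)
  then have f: "k_functional H x" "k_functional H y" "k_functional H z"
    by (auto simp: dual_carrier)
  show ?case
  proof (rule extensionalityI)
    fix h assume h: "h \<in> carrier H"
    have "tril H H H (\<lambda>a b c. x a * y b * z c)"
      using f by (simp add: tril_def bil_def k_functional_def algebra_simps)
    from sweed_coassoc[OF this h] h
    show "(x \<otimes>\<^bsub>dual_algebra H\<^esub> y \<otimes>\<^bsub>dual_algebra H\<^esub> z) h = (x \<otimes>\<^bsub>dual_algebra H\<^esub> (y \<otimes>\<^bsub>dual_algebra H\<^esub> z)) h"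
      by (simp add: sweed_cmult sweed_cmult_right mult.assoc flip: sweed_cmult sweed_cmult_right cong: sweed_cong)
  qed simp_all
next
  case (10 x) then show ?case
    by (intro extensionalityI[of _ "carrier H"]) (simp_all add: dual_carrier sweed_counit_l cong: sweed_cong)
next
  case (11 x) then show ?case
    by (intro extensionalityI[of _ "carrier H"])
      (simp_all add: dual_carrier sweed_counit_r mult.commute[of "x _"] cong: sweed_cong)
qed (auto simp: dual_carrier dual_functional dual_functional_const algebra_simps sweed_linear sweed_fun_add cong: sweed_cong
    intro!: extensionalityI[of _ "carrier H"])

lemma finite_dual_dual: "l \<in> finite_dual_carrier H \<Longrightarrow> l \<in> carrier (dual_algebra H)"
  by (simp add: dual_carrier finite_dual_carrierD)

text \<open>The converse of \<open>finite_dualI\<close>: the middle factors of a threefold splitting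
  form the required finite family.\<close>

lemma finite_dualE:
  assumes "l \<in> finite_dual_carrier H"
  obtains G where "finite G" "\<And>g. g \<in> G \<Longrightarrow> k_functional H g"
    "\<And>b x y. \<lbrakk>b \<in> carrier H; \<And>g. g \<in> G \<Longrightarrow> g b = 0; x \<in> carrier H; y \<in> carrier H\<rbrakk> \<Longrightarrow> l (x \<otimes> b \<otimes> y) = 0"
proof -
  obtain t where t: "Poly_Mapping.keys t \<subseteq> finite_dual_carrier H \<times> finite_dual_carrier H \<times> finite_dual_carrier H"
    "\<And>x b y. \<lbrakk>x \<in> carrier H; b \<in> carrier H; y \<in> carrier H\<rbrakk> \<Longrightarrow>
      l (x \<otimes> b \<otimes> y) = slift (\<lambda>(f, g, k). f x * (g b * k y)) t"
    using finite_dual_triple[OF assms] by metis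
  show ?thesis
  proof (rule that[of "(fst \<circ> snd) ` Poly_Mapping.keys t"])
    fix b x y
    assume b: "b \<in> carrier H" "\<And>g. g \<in> (fst \<circ> snd) ` Poly_Mapping.keys t \<Longrightarrow> g b = 0"
      and xy: "x \<in> carrier H" "y \<in> carrier H"
    have "fst (snd q) b = 0" if "q \<in> Poly_Mapping.keys t" for q
      by (rule b(2)) (use that in force)
    then show "l (x \<otimes> b \<otimes> y) = 0"
      by (simp add: t(2) b(1) xy case_prod_unfold cong: slift_cong)
  qed (use t(1) finite_dual_carrierD in fastforce)+
qed

text \<open>With the test by finite families no ideal has to be constructed: each operation turns
  the families of \<open>l\<close> and \<open>m\<close> into one for the result.\<close>

lemma finite_dual_closed:
  assumes l: "l \<in> finite_dual_carrier H" and m: "m \<in> finite_dual_carrier H"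
  shows "l \<oplus>\<^bsub>dual_algebra H\<^esub> m \<in> finite_dual_carrier H" (is ?add)
    "c \<odot>\<^bsub>dual_algebra H\<^esub> l \<in> finite_dual_carrier H" (is ?smult)
    "l \<otimes>\<^bsub>dual_algebra H\<^esub> m \<in> finite_dual_carrier H" (is ?mult)
    "(\<lambda>h\<in>carrier H. l (antipode H h)) \<in> finite_dual_carrier H" (is ?antipode)
proof -
  note lf = finite_dual_carrierD(2)[OF l] and mf = finite_dual_carrierD(2)[OF m]
  obtain G where G: "finite G" "\<And>g. g \<in> G \<Longrightarrow> k_functional H g"
    "\<And>b x y. \<lbrakk>b \<in> carrier H; \<And>g. g \<in> G \<Longrightarrow> g b = 0; x \<in> carrier H; y \<in> carrier H\<rbrakk> \<Longrightarrow> l (x \<otimes> b \<otimes> y) = 0"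
    using finite_dualE[OF l] by metis
  obtain G' where G': "finite G'" "\<And>g. g \<in> G' \<Longrightarrow> k_functional H g"
    "\<And>b x y. \<lbrakk>b \<in> carrier H; \<And>g. g \<in> G' \<Longrightarrow> g b = 0; x \<in> carrier H; y \<in> carrier H\<rbrakk> \<Longrightarrow> m (x \<otimes> b \<otimes> y) = 0"
    using finite_dualE[OF m] by metis
  show ?add
    by (rule finite_dualI[of _ "G \<union> G'"]) (use G G' lf mf dual_functional in auto)
  show ?smult
    by (rule finite_dualI[of _ G]) (use G lf dual_functional in auto)
  \<comment> \<open>S(xby) = S(y) S(b) S(x), so the family of \<open>l\<close> composed with S
    works; the reversal is harmless because the test is two-sided.\<close>
  show ?antipode
  proof (rule finite_dualI[of _ "(\<lambda>g h. g (antipode H h)) ` G"])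
    show "k_functional H (\<lambda>h\<in>carrier H. l (antipode H h))"
      using lf by (simp add: k_functional_def antipode_add antipode_scale)
    show "k_functional H g" if "g \<in> (\<lambda>g h. g (antipode H h)) ` G" for g
      using that G(2) by (auto simp: k_functional_def antipode_add antipode_scale)
    fix b x y
    assume b: "b \<in> carrier H" "\<And>g. g \<in> (\<lambda>g h. g (antipode H h)) ` G \<Longrightarrow> g b = 0"
      and xy: "x \<in> carrier H" "y \<in> carrier H"
    moreover have "g (antipode H b) = 0" if "g \<in> G" for g
      using b(2)[of "\<lambda>h. g (antipode H h)"] that by auto
    ultimately show "(\<lambda>h\<in>carrier H. l (antipode H h)) (x \<otimes> b \<otimes> y) = 0"
      using G(3)[of "antipode H b" "antipode H y" "antipode H x"] by (simp add: antipode_mult m_assoc)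
  qed (use G(1) in auto)
  show ?mult
  proof -
    obtain t where t: "Poly_Mapping.keys t \<subseteq> finite_dual_carrier H \<times> finite_dual_carrier H \<times> finite_dual_carrier H"
      "\<And>x b y. \<lbrakk>x \<in> carrier H; b \<in> carrier H; y \<in> carrier H\<rbrakk> \<Longrightarrow>
        l (x \<otimes> b \<otimes> y) = slift (\<lambda>(f, g, k). f x * (g b * k y)) t"
      using finite_dual_triple[OF l] by metis
    obtain u where u: "Poly_Mapping.keys u \<subseteq> finite_dual_carrier H \<times> finite_dual_carrier H \<times> finite_dual_carrier H"
      "\<And>x b y. \<lbrakk>x \<in> carrier H; b \<in> carrier H; y \<in> carrier H\<rbrakk> \<Longrightarrow>
        m (x \<otimes> b \<otimes> y) = slift (\<lambda>(f, g, k). f x * (g b * k y)) u"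
      using finite_dual_triple[OF m] by metis
    \<comment> \<open>The coproduct of xby is the product of the three coproducts, so after
      splitting \<open>l\<close> and \<open>m\<close> the middle argument enters only through
      convolution products of middle factors.\<close>
    define G where "G = (\<lambda>(p, q). fst (snd p) \<otimes>\<^bsub>dual_algebra H\<^esub> fst (snd q)) ` (Poly_Mapping.keys t \<times> Poly_Mapping.keys u)"
    show ?thesis
    proof (rule finite_dualI[of _ G])
      show "k_functional H (l \<otimes>\<^bsub>dual_algebra H\<^esub> m)" by (rule dual_functional[OF lf mf])
      show "k_functional H g" if "g \<in> G" for g
      proof -
        have "k_functional H (fst (snd p))" if "p \<in> Poly_Mapping.keys t \<or> p \<in> Poly_Mapping.keys u" for p
          using that t(1) u(1) finite_dual_carrierD by fastforce
        with \<open>g \<in> G\<close> show ?thesis unfolding G_def by (auto intro!: dual_functional)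
      qed
      fix b x y
      assume b: "b \<in> carrier H" "\<And>g. g \<in> G \<Longrightarrow> g b = 0" and xy: "x \<in> carrier H" "y \<in> carrier H"
      have bilm: "bil H H (\<lambda>p q. l p * m q)" by (rule bil_mult[OF lf mf])
      have bil2: "bil H H (\<lambda>p q. sweed H y (\<lambda>c c'. l (p \<otimes> c) * m (q \<otimes> c')))"
        using xy lf mf by (simp add: functional_simps k_functionalD cong: sweed_cong)
      have "(l \<otimes>\<^bsub>dual_algebra H\<^esub> m) (x \<otimes> b \<otimes> y) = sweed H x (\<lambda>x1 x2. sweed H b (\<lambda>b1 b2. sweed H y (\<lambda>y1 y2.
          l (x1 \<otimes> b1 \<otimes> y1) * m (x2 \<otimes> b2 \<otimes> y2))))"
        using b xy by (simp add: sweed_mult[OF bilm] sweed_mult[OF bil2])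
      also have "\<dots> = sweed H x (\<lambda>x1 x2. sweed H b (\<lambda>b1 b2. sweed H y (\<lambda>y1 y2.
          slift (\<lambda>p. slift (\<lambda>q. (fst p x1 * fst q x2) * ((fst (snd p) b1 * fst (snd q) b2) *
            (snd (snd p) y1 * snd (snd q) y2))) u) t)))"
        using b(1) xy by (simp add: t(2) u(2) case_prod_unfold slift_mult cong: sweed_cong)
          (simp add: mult_ac)
      also have "\<dots> = slift (\<lambda>p. slift (\<lambda>q. sweed H x (\<lambda>x1 x2. fst p x1 * fst q x2) *
          (sweed H b (\<lambda>b1 b2. fst (snd p) b1 * fst (snd q) b2) *
          sweed H y (\<lambda>y1 y2. snd (snd p) y1 * snd (snd q) y2))) u) t"
        by (simp only: sweed_slift_swap sweed_cmult sweed_cmult_right)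
      also have "\<dots> = 0"
      proof -
        have "sweed H b (\<lambda>b1 b2. fst (snd p) b1 * fst (snd q) b2) = 0"
          if "p \<in> Poly_Mapping.keys t" "q \<in> Poly_Mapping.keys u" for p q
          using b(2)[of "fst (snd p) \<otimes>\<^bsub>dual_algebra H\<^esub> fst (snd q)"] that b(1) by (force simp: G_def)
        then show ?thesis by (simp cong: slift_cong)
      qed
      finally show "(l \<otimes>\<^bsub>dual_algebra H\<^esub> m) (x \<otimes> b \<otimes> y) = 0" .
    qed (auto simp: G_def)
  qed
qed

lemma finite_dual_one: "\<one>\<^bsub>dual_algebra H\<^esub> \<in> finite_dual_carrier H"
  by (rule finite_dualI[of _ "{counit H}"])
    (auto simp: counit_linear counit_mult k_functional_cong[of "\<one>\<^bsub>dual_algebra H\<^esub>" "counit H"])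

lemma finite_dual_algebra: "k_algebra (finite_dual H)"
proof -
  interpret D: k_algebra "dual_algebra H" by (rule dual_algebra_algebra)
  have "\<zero>\<^bsub>dual_algebra H\<^esub> \<in> finite_dual_carrier H"
    using finite_dual_closed(2)[OF finite_dual_one finite_dual_one, of 0] by simp
  then show ?thesis
    by (intro k_algebraI; unfold finite_dual_sel)
      (simp_all add: finite_dual_closed finite_dual_one finite_dual_dual D.a_assoc D.m_assoc D.l_distr D.r_distr D.a_ac D.scale_add_l D.scale_add_r D.scale_assoc
          D.smult_mult_l D.smult_mult_r)
qed

lemma finite_dual_module: "k_module (finite_dual H)"
  by (rule k_algebra.axioms(1)[OF finite_dual_algebra, THEN k_module.intro])

section \<open>Tensors over the finite dual and their values at points\<close>

lemma functional_eval:
  assumes "h \<in> carrier H"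
  shows "k_functional (finite_dual H) (\<lambda>l. l h)"
  using assms by (simp add: k_functional_def finite_dual_sel)

text \<open>Elements of the finite dual are functions, so a pointwise identity is an identity of
  vectors, and any functional \<open>L\<close> may be applied to it term by term.\<close>

lemma functional_eval_eq:
  assumes L: "k_functional (finite_dual H) L" and v: "\<And>x. x \<in> Poly_Mapping.keys t \<Longrightarrow> v x \<in> finite_dual_carrier H"
    and m: "m \<in> finite_dual_carrier H" "\<And>h. h \<in> carrier H \<Longrightarrow> slift (\<lambda>x. v x h) t = m h"
  shows "slift (\<lambda>x. L (v x)) t = L m"
proof -
  interpret F: k_module "finite_dual H" by (rule finite_dual_module)
  have v': "v \<in> Poly_Mapping.keys t \<rightarrow> carrier (finite_dual H)" using v by (auto simp: finite_dual_sel)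
  have "mlift (finite_dual H) v t = m"
  proof (rule extensionalityI[of _ "carrier H"])
    show "mlift (finite_dual H) v t \<in> extensional (carrier H)" "m \<in> extensional (carrier H)"
      using F.mlift_closed[OF v'] m(1) by (auto simp: finite_dual_sel finite_dual_carrierD)
    show "mlift (finite_dual H) v t h = m h" if "h \<in> carrier H" for h
      using F.functional_mlift[OF functional_eval[OF that] v'] m(2)[OF that] by simp
  qed
  then show ?thesis using F.functional_mlift[OF L v'] by simp
qed

text \<open>A functional on the finite dual need not be an evaluation, but on a finite set
  \<open>F\<close> interpolation writes it as a combination of evaluations, with coefficients
  L(e).\<close>

lemma finite_dual_coordinates:
  assumes "finite F" "F \<subseteq> finite_dual_carrier H"
  obtains t where "Poly_Mapping.keys t \<subseteq> carrier H \<times> finite_dual_carrier H"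
    "\<And>f L. \<lbrakk>f \<in> F; k_functional (finite_dual H) L\<rbrakk> \<Longrightarrow> L f = slift (\<lambda>(p, e). f p * L e) t"
proof -
  have "\<exists>h\<in>finite_dual_carrier H. \<forall>x\<in>carrier H. h x = c * f x + g x"
    if "f \<in> finite_dual_carrier H" "g \<in> finite_dual_carrier H" for c f g
    using that by (intro bexI[of _ "c \<odot>\<^bsub>dual_algebra H\<^esub> f \<oplus>\<^bsub>dual_algebra H\<^esub> g"]) (auto intro!: finite_dual_closed)
  from interpolation[of F "finite_dual_carrier H" "carrier H", OF assms this]
  obtain t where t: "Poly_Mapping.keys t \<subseteq> carrier H \<times> finite_dual_carrier H"
      "\<And>f x. f \<in> F \<Longrightarrow> x \<in> carrier H \<Longrightarrow> f x = slift (\<lambda>(p, e). f p * e x) t"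
    by metis
  have "L f = slift (\<lambda>(p, e). f p * L e) t" if f: "f \<in> F" and L: "k_functional (finite_dual H) L" for f L
  proof -
    have "slift (\<lambda>q. L (f (fst q) \<odot>\<^bsub>dual_algebra H\<^esub> snd q)) t = L f"
      using t f assms(2) by (intro functional_eval_eq[OF L]) (auto intro!: finite_dual_closed simp: case_prod_unfold)
    moreover have "L (f p \<odot>\<^bsub>dual_algebra H\<^esub> e) = f p * L e" if "e \<in> finite_dual_carrier H" for p e
      using k_functionalD(2)[OF L, of e "f p"] that by (simp add: finite_dual_sel)
    moreover have "snd q \<in> finite_dual_carrier H" if "q \<in> Poly_Mapping.keys t" for q
      using t(1) that by auto
    ultimately show ?thesis by (simp add: case_prod_unfold cong: slift_cong)
  qed
  with t(1) show ?thesis using that by blast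
qed

text \<open>The map from tensors of functionals to functions of two arguments is injective, so the
  arbitrary choice in the comultiplication of \<open>finite_dual\<close> is immaterial. The first
  tensor factors are expanded into evaluations, which leaves pointwise identities for the second
  ones.\<close>

lemma finite_dual_tensor_zero:
  assumes t: "Poly_Mapping.keys t \<subseteq> finite_dual_carrier H \<times> finite_dual_carrier H"
    and zero: "\<And>g h. \<lbrakk>g \<in> carrier H; h \<in> carrier H\<rbrakk> \<Longrightarrow> slift (\<lambda>(a, b). a g * b h) t = 0"
    and \<beta>: "bil (finite_dual H) (finite_dual H) \<beta>"
  shows "slift (\<lambda>(a, b). \<beta> a b) t = 0"
proof -
  interpret F: k_module "finite_dual H" by (rule finite_dual_module)
  have "fst ` Poly_Mapping.keys t \<subseteq> finite_dual_carrier H" using t by auto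
  from finite_dual_coordinates[OF _ this]
  obtain s where s: "Poly_Mapping.keys s \<subseteq> carrier H \<times> finite_dual_carrier H"
      "\<And>f L. \<lbrakk>f \<in> fst ` Poly_Mapping.keys t; k_functional (finite_dual H) L\<rbrakk> \<Longrightarrow> L f = slift (\<lambda>(p, e). f p * L e) s"
    by (metis finite_keys finite_imageI)
  have "slift (\<lambda>(a, b). \<beta> a b) t = slift (\<lambda>q. slift (\<lambda>(p, e). fst q p * \<beta> e (snd q)) s) t"
  proof (intro slift_cong refl, clarify)
    fix a b assume ab: "(a, b) \<in> Poly_Mapping.keys t"
    then have "k_functional (finite_dual H) (\<lambda>a. \<beta> a b)"
      using \<beta> t by (auto simp: bil_def finite_dual_sel)
    from s(2)[OF _ this, of a] imageI[OF ab, of fst] show "\<beta> a b = slift (\<lambda>(p, e). fst (a, b) p * \<beta> e (snd (a, b))) s" by simp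
  qed
  also have "\<dots> = slift (\<lambda>r. slift (\<lambda>q. fst q (fst r) * \<beta> (snd r) (snd q)) t) s"
    by (simp add: slift_swap[of _ s] case_prod_unfold)
  also have "\<dots> = slift (\<lambda>r. 0) s"
  proof (intro slift_cong refl)
    fix r assume "r \<in> Poly_Mapping.keys s"
    then have r: "fst r \<in> carrier H" "snd r \<in> finite_dual_carrier H" using s(1) by auto
    then have L: "k_functional (finite_dual H) (\<beta> (snd r))" using \<beta> by (auto simp: bil_def finite_dual_sel)
    have "slift (\<lambda>q. \<beta> (snd r) (fst q (fst r) \<odot>\<^bsub>finite_dual H\<^esub> snd q)) t = \<beta> (snd r) \<zero>\<^bsub>finite_dual H\<^esub>"
      using t r zero F.M.zero_closed
      by (intro functional_eval_eq[OF L]) (auto intro!: finite_dual_closed simp: finite_dual_sel case_prod_unfold)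
    moreover have "\<beta> (snd r) (fst q (fst r) \<odot>\<^bsub>finite_dual H\<^esub> snd q) = fst q (fst r) * \<beta> (snd r) (snd q)"
      if "q \<in> Poly_Mapping.keys t" for q
      using that t by (intro k_functionalD(2)[OF L]) (auto simp: finite_dual_sel)
    ultimately show "slift (\<lambda>q. fst q (fst r) * \<beta> (snd r) (snd q)) t = 0"
      by (simp add: F.functional_zero[OF L] cong: slift_cong)
  qed
  finally show ?thesis by simp
qed

text \<open>Expanding the first factor into evaluations leaves the slices \<open>?u\<close>, which
  are twofold tensors vanishing at all pairs of points.\<close>

lemma finite_dual_tensor3_zero:
  assumes t: "Poly_Mapping.keys t \<subseteq> finite_dual_carrier H \<times> finite_dual_carrier H \<times> finite_dual_carrier H"
    and zero: "\<And>x y z. \<lbrakk>x \<in> carrier H; y \<in> carrier H; z \<in> carrier H\<rbrakk> \<Longrightarrow> slift (\<lambda>(a, b, c). a x * (b y * c z)) t = 0"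
    and \<tau>: "tril (finite_dual H) (finite_dual H) (finite_dual H) \<tau>"
  shows "slift (\<lambda>(a, b, c). \<tau> a b c) t = 0"
proof -
  have "fst ` Poly_Mapping.keys t \<subseteq> finite_dual_carrier H" using t by auto
  from finite_dual_coordinates[OF _ this]
  obtain s where s: "Poly_Mapping.keys s \<subseteq> carrier H \<times> finite_dual_carrier H"
      "\<And>f L. \<lbrakk>f \<in> fst ` Poly_Mapping.keys t; k_functional (finite_dual H) L\<rbrakk> \<Longrightarrow> L f = slift (\<lambda>(p, e). f p * L e) s"
    by (metis finite_keys finite_imageI)
  have "slift (\<lambda>(a, b, c). \<tau> a b c) t = slift (\<lambda>q. slift (\<lambda>(p, e). fst q p * \<tau> e (fst (snd q)) (snd (snd q))) s) t"
  proof (intro slift_cong refl, clarify)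
    fix a b c assume abc: "(a, b, c) \<in> Poly_Mapping.keys t"
    then have "k_functional (finite_dual H) (\<lambda>a. \<tau> a b c)"
      using \<tau> t by (auto simp: tril_def finite_dual_sel)
    from s(2)[OF _ this, of a] imageI[OF abc, of fst]
    show "\<tau> a b c = slift (\<lambda>(p, e). fst (a, b, c) p * \<tau> e (fst (snd (a, b, c))) (snd (snd (a, b, c)))) s" by simp
  qed
  also have "\<dots> = slift (\<lambda>r. slift (\<lambda>q. fst q (fst r) * \<tau> (snd r) (fst (snd q)) (snd (snd q))) t) s"
    by (simp add: slift_swap[of _ s] case_prod_unfold)
  also have "\<dots> = slift (\<lambda>r. 0) s"
  proof (intro slift_cong refl)
    fix r assume "r \<in> Poly_Mapping.keys s"
    then have r: "fst r \<in> carrier H" "snd r \<in> finite_dual_carrier H" using s(1) by auto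
    let ?u = "flift (\<lambda>q. fscale (fst q (fst r)) (tens (fst (snd q)) (snd (snd q)))) t"
    have "slift (\<lambda>(a, b). \<tau> (snd r) a b) ?u = 0"
    proof (rule finite_dual_tensor_zero)
      show "Poly_Mapping.keys ?u \<subseteq> finite_dual_carrier H \<times> finite_dual_carrier H"
        using t by (intro order_trans[OF keys_flift] UN_least order_trans[OF keys_fscale]) auto
      show "slift (\<lambda>(a, b). a g * b h) ?u = 0" if "g \<in> carrier H" "h \<in> carrier H" for g h
        using zero[OF r(1) that] by (simp add: case_prod_unfold)
      show "bil (finite_dual H) (finite_dual H) (\<tau> (snd r))"
        using \<tau> r(2) by (simp add: tril_def finite_dual_sel)
    qed
    then show "slift (\<lambda>q. fst q (fst r) * \<tau> (snd r) (fst (snd q)) (snd (snd q))) t = 0"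
      by (simp add: case_prod_unfold)
  qed
  finally show ?thesis by simp
qed

lemma comult_finite_dual:
  assumes "l \<in> finite_dual_carrier H"
  shows "Poly_Mapping.keys (comult (finite_dual H) l) \<subseteq> finite_dual_carrier H \<times> finite_dual_carrier H" (is ?keys)
    "\<And>g h. \<lbrakk>g \<in> carrier H; h \<in> carrier H\<rbrakk> \<Longrightarrow> sweed (finite_dual H) l (\<lambda>a b. a g * b h) = l (g \<otimes> h)"
proof -
  let ?P = "\<lambda>t. Poly_Mapping.keys t \<subseteq> finite_dual_carrier H \<times> finite_dual_carrier H \<and>
      (\<forall>g\<in>carrier H. \<forall>h\<in>carrier H. l (g \<otimes> h) = slift (\<lambda>(l1, l2). l1 g * l2 h) t)"
  have eq: "comult (finite_dual H) l = (SOME t. ?P t)" by (simp add: finite_dual_def)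
  have *: "?P (comult (finite_dual H) l)"
    unfolding eq by (rule someI_ex) (rule finite_dual_split[OF assms])
  then show ?keys by blast
  show "sweed (finite_dual H) l (\<lambda>a b. a g * b h) = l (g \<otimes> h)"
    if "g \<in> carrier H" "h \<in> carrier H" for g h
    unfolding sweed_def using * that by simp
qed

text \<open>Replaces the chosen representative of a coproduct by any convenient one with the same
  values l(gh).\<close>

lemma sweed_finite_dualI:
  assumes "l \<in> finite_dual_carrier H" "bil (finite_dual H) (finite_dual H) \<beta>"
    "Poly_Mapping.keys t \<subseteq> finite_dual_carrier H \<times> finite_dual_carrier H"
    "\<And>g h. \<lbrakk>g \<in> carrier H; h \<in> carrier H\<rbrakk> \<Longrightarrow> slift (\<lambda>(a, b). a g * b h) t = l (g \<otimes> h)"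
  shows "sweed (finite_dual H) l \<beta> = slift (\<lambda>(a, b). \<beta> a b) t"
proof -
  have "slift (\<lambda>(a, b). \<beta> a b) (comult (finite_dual H) l - t) = 0"
  proof (rule finite_dual_tensor_zero[OF _ _ assms(2)])
    show "Poly_Mapping.keys (comult (finite_dual H) l - t) \<subseteq> finite_dual_carrier H \<times> finite_dual_carrier H"
      using comult_finite_dual(1)[OF assms(1)] assms(3) by (intro order_trans[OF keys_diff]) auto
  qed (use comult_finite_dual(2)[OF assms(1)] assms(4) in \<open>simp add: sweed_def\<close>)
  then show ?thesis by (simp add: sweed_def)
qed

lemma sweed_finite_dual_functional:
  assumes "k_functional (finite_dual H) L" "l \<in> finite_dual_carrier H" "m \<in> finite_dual_carrier H"
    "\<And>a b. \<lbrakk>a \<in> finite_dual_carrier H; b \<in> finite_dual_carrier H\<rbrakk> \<Longrightarrow> v a b \<in> finite_dual_carrier H"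
    "\<And>h. h \<in> carrier H \<Longrightarrow> sweed (finite_dual H) l (\<lambda>a b. v a b h) = m h"
  shows "sweed (finite_dual H) l (\<lambda>a b. L (v a b)) = L m"
  unfolding sweed_def case_prod_unfold
  using comult_finite_dual(1)[OF assms(2)] assms(3-)
  by (intro functional_eval_eq[OF assms(1)]) (auto simp: sweed_def case_prod_unfold)

lemma finite_dual_pre_bialgebra: "pre_bialgebra (finite_dual H)"
proof -
  let ?D = "finite_dual_carrier H"
  note comult = comult_finite_dual[unfolded sweed_def]
  interpret F: k_algebra "finite_dual H" by (rule finite_dual_algebra)
  show ?thesis
  proof (unfold_locales, unfold finite_dual_sel(1))
    show "Poly_Mapping.keys (comult (finite_dual H) x) \<subseteq> ?D \<times> ?D" if "x \<in> ?D" for x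
      by (rule comult(1)[OF that])
    fix \<beta> assume \<beta>: "bil (finite_dual H) (finite_dual H) \<beta>"
    show "sweed (finite_dual H) (x \<oplus>\<^bsub>finite_dual H\<^esub> y) \<beta> = sweed (finite_dual H) x \<beta> + sweed (finite_dual H) y \<beta>"
      if xy: "x \<in> ?D" "y \<in> ?D" for x y
      using xy comult[OF xy(1)] comult[OF xy(2)]
      by (subst sweed_finite_dualI[OF _ \<beta>, of _ "comult (finite_dual H) x + comult (finite_dual H) y"])
        (auto simp: sweed_def finite_dual_sel intro: finite_dual_closed intro!: order_trans[OF keys_add])
    show "sweed (finite_dual H) (c \<odot>\<^bsub>finite_dual H\<^esub> x) \<beta> = c * sweed (finite_dual H) x \<beta>" if x: "x \<in> ?D" for x c
      using x comult[OF x]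
      by (subst sweed_finite_dualI[OF _ \<beta>, of _ "fscale c (comult (finite_dual H) x)"])
        (auto simp: sweed_def finite_dual_sel intro: finite_dual_closed intro!: order_trans[OF keys_fscale])
    show "sweed (finite_dual H) \<one>\<^bsub>finite_dual H\<^esub> \<beta> = \<beta> \<one>\<^bsub>finite_dual H\<^esub> \<one>\<^bsub>finite_dual H\<^esub>"
      by (subst sweed_finite_dualI[OF _ \<beta>, of _ "tens \<one>\<^bsub>finite_dual H\<^esub> \<one>\<^bsub>finite_dual H\<^esub>"])
        (auto simp: finite_dual_sel finite_dual_one counit_mult)
    show "sweed (finite_dual H) (x \<otimes>\<^bsub>finite_dual H\<^esub> y) \<beta> = sweed (finite_dual H) x (\<lambda>a b.
        sweed (finite_dual H) y (\<lambda>a' b'. \<beta> (a \<otimes>\<^bsub>finite_dual H\<^esub> a') (b \<otimes>\<^bsub>finite_dual H\<^esub> b')))"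
      if xy: "x \<in> ?D" "y \<in> ?D" for x y
    \<comment> \<open>The product of representatives represents the coproduct of the product because
      the comultiplication of \<open>H\<close> is multiplicative.\<close>
    proof (subst sweed_finite_dualI[OF _ \<beta>, of _ "tmult (finite_dual H) (finite_dual H) (comult (finite_dual H) x) (comult (finite_dual H) y)"])
      show "x \<otimes>\<^bsub>finite_dual H\<^esub> y \<in> ?D" using xy by (simp add: finite_dual_sel finite_dual_closed)
      show "Poly_Mapping.keys (tmult (finite_dual H) (finite_dual H) (comult (finite_dual H) x) (comult (finite_dual H) y)) \<subseteq> ?D \<times> ?D"
        unfolding tmult_def case_prod_unfold using comult(1)[OF xy(1)] comult(1)[OF xy(2)]
        by (intro order_trans[OF keys_flift] UN_least) (auto simp: finite_dual_sel intro!: finite_dual_closed)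
      fix g h assume gh: "g \<in> carrier H" "h \<in> carrier H"
      note lf = finite_dual_carrierD(2)[OF xy(1)] and mf = finite_dual_carrierD(2)[OF xy(2)]
      have "(x \<otimes>\<^bsub>finite_dual H\<^esub> y) (g \<otimes> h) = sweed H g (\<lambda>g1 g2. sweed H h (\<lambda>h1 h2. x (g1 \<otimes> h1) * y (g2 \<otimes> h2)))"
        using gh by (simp add: finite_dual_sel sweed_mult[OF bil_mult[OF lf mf]])
      also have "\<dots> = sweed H g (\<lambda>g1 g2. sweed H h (\<lambda>h1 h2. slift (\<lambda>p. slift (\<lambda>q.
          (fst p g1 * fst q g2) * (snd p h1 * snd q h2)) (comult (finite_dual H) y)) (comult (finite_dual H) x)))"
        using gh by (simp add: comult(2)[OF xy(1), symmetric] comult(2)[OF xy(2), symmetric] case_prod_unfold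
            slift_mult cong: sweed_cong) (simp add: mult_ac)
      also have "\<dots> = slift (\<lambda>p. slift (\<lambda>q. sweed H g (\<lambda>g1 g2. fst p g1 * fst q g2) *
          sweed H h (\<lambda>h1 h2. snd p h1 * snd q h2)) (comult (finite_dual H) y)) (comult (finite_dual H) x)"
        by (simp only: sweed_slift_swap sweed_cmult sweed_cmult_right)
      finally show "slift (\<lambda>(a, b). a g * b h)
          (tmult (finite_dual H) (finite_dual H) (comult (finite_dual H) x) (comult (finite_dual H) y)) =
          (x \<otimes>\<^bsub>finite_dual H\<^esub> y) (g \<otimes> h)"
        using gh by (simp add: finite_dual_sel case_prod_unfold)
    qed (simp add: sweed_def)
  qed
qed

text \<open>Evaluated at elements of \<open>H\<close>, each axiom becomes its transpose:
  coassociativity is associativity of \<open>H\<close>, the counit laws are the unit laws, and the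
  antipode laws are those of \<open>H\<close>.\<close>

theorem hopf_algebra_finite_dual: "hopf_algebra (finite_dual H)"
proof -
  let ?D = "finite_dual_carrier H" and ?F = "finite_dual H"
  note keys = comult_finite_dual(1) and eval = comult_finite_dual(2)
  interpret F: pre_bialgebra ?F by (rule finite_dual_pre_bialgebra)
  note cong = F.sweed_cong[unfolded finite_dual_sel(1)]
  show ?thesis
  proof (rule hopf_algebraI[OF finite_dual_pre_bialgebra], unfold finite_dual_sel(1))
    show "k_functional ?F (counit ?F)"
      using functional_eval[of \<one>] by (simp add: finite_dual_sel)
    show "counit ?F \<one>\<^bsub>?F\<^esub> = 1" by (simp add: finite_dual_sel counit_one)
    show "counit ?F (x \<otimes>\<^bsub>?F\<^esub> y) = counit ?F x * counit ?F y" if "x \<in> ?D" "y \<in> ?D" for x y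
      using that by (simp add: finite_dual_sel sweed_one[OF bil_mult] finite_dual_carrierD)
    show "k_linear ?F ?F (antipode ?F)"
      by (auto simp: k_linear_def finite_dual_sel finite_dual_closed intro!: extensionalityI[of _ "carrier H"])
    fix x assume x: "x \<in> ?D"
    note xf = finite_dual_carrierD(2)[OF x]
    {
      fix l assume L: "k_functional ?F l"
      show "sweed ?F x (\<lambda>a b. counit ?F a * l b) = l x"
      proof -
        have "sweed ?F x (\<lambda>a b. l (counit ?F a \<odot>\<^bsub>?F\<^esub> b)) = l x"
          using x by (intro sweed_finite_dual_functional[OF L])
            (auto simp: finite_dual_sel eval finite_dual_closed)
        then show ?thesis using x by (simp add: k_functionalD(2)[OF L] finite_dual_sel(1) cong: cong)
      qed
      show "sweed ?F x (\<lambda>a b. counit ?F b * l a) = l x"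
      proof -
        have "sweed ?F x (\<lambda>a b. l (counit ?F b \<odot>\<^bsub>?F\<^esub> a)) = l x"
          using x eval[OF x, of _ \<one>] by (intro sweed_finite_dual_functional[OF L])
            (auto simp: finite_dual_sel finite_dual_closed mult.commute)
        then show ?thesis using x by (simp add: k_functionalD(2)[OF L] finite_dual_sel(1) cong: cong)
      qed
      have swap: "sweed ?F x (\<lambda>a b. sweed H h (\<lambda>h1 h2. a (p h1) * b (q h2))) = sweed H h (\<lambda>h1 h2. x (p h1 \<otimes> q h2))"
        if "h \<in> carrier H" "\<And>a. a \<in> carrier H \<Longrightarrow> p a \<in> carrier H" "\<And>a. a \<in> carrier H \<Longrightarrow> q a \<in> carrier H" for h p q
        using that by (subst sweed_swap) (simp add: eval[OF x] cong: sweed_cong)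
      show "sweed ?F x (\<lambda>a b. l (antipode ?F a \<otimes>\<^bsub>?F\<^esub> b)) = counit ?F x * l \<one>\<^bsub>?F\<^esub>"
      proof -
        have "sweed ?F x (\<lambda>a b. l (antipode ?F a \<otimes>\<^bsub>?F\<^esub> b)) = l (counit ?F x \<odot>\<^bsub>?F\<^esub> \<one>\<^bsub>?F\<^esub>)"
          using x swap[of _ "antipode H" "\<lambda>a. a"] sweed_antipode_l[OF xf]
          by (intro sweed_finite_dual_functional[OF L])
            (auto simp: finite_dual_sel finite_dual_closed finite_dual_one mult.commute cong: sweed_cong)
        then show ?thesis by (simp add: k_functionalD(2)[OF L])
      qed
      show "sweed ?F x (\<lambda>a b. l (a \<otimes>\<^bsub>?F\<^esub> antipode ?F b)) = counit ?F x * l \<one>\<^bsub>?F\<^esub>"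
      proof -
        have "sweed ?F x (\<lambda>a b. l (a \<otimes>\<^bsub>?F\<^esub> antipode ?F b)) = l (counit ?F x \<odot>\<^bsub>?F\<^esub> \<one>\<^bsub>?F\<^esub>)"
          using x swap[of _ "\<lambda>a. a" "antipode H"] sweed_antipode_r[OF xf]
          by (intro sweed_finite_dual_functional[OF L])
            (auto simp: finite_dual_sel finite_dual_closed finite_dual_one mult.commute cong: sweed_cong)
        then show ?thesis by (simp add: k_functionalD(2)[OF L])
      qed
    }
    fix \<tau> assume \<tau>: "tril ?F ?F ?F \<tau>"
    \<comment> \<open>The two sides of coassociativity as threefold tensors; evaluated at
      \<open>u\<close>, \<open>v\<close>, \<open>w\<close> both give x(uvw).\<close>
    define s where "s = flift (\<lambda>(a, b). tens_r (comult ?F a) b) (comult ?F x)"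
    define t where "t = flift (\<lambda>(a, b). tens_l a (comult ?F b)) (comult ?F x)"
    have "slift (\<lambda>(a, b, c). \<tau> a b c) (s - t) = 0"
    proof (rule finite_dual_tensor3_zero[OF _ _ \<tau>])
      have "Poly_Mapping.keys s \<subseteq> ?D \<times> ?D \<times> ?D"
        using keys[OF x] keys unfolding s_def tens_r_def
        by (intro order_trans[OF keys_flift] UN_least) (fastforce intro!: order_trans[OF keys_flift])
      moreover have "Poly_Mapping.keys t \<subseteq> ?D \<times> ?D \<times> ?D"
        using keys[OF x] keys unfolding t_def tens_l_def
        by (intro order_trans[OF keys_flift] UN_least) (fastforce intro!: order_trans[OF keys_flift])
      ultimately show "Poly_Mapping.keys (s - t) \<subseteq> ?D \<times> ?D \<times> ?D"
        by (intro order_trans[OF keys_diff]) auto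
      fix u v w assume uvw: "u \<in> carrier H" "v \<in> carrier H" "w \<in> carrier H"
      have "slift (\<lambda>(a, b, c). a u * (b v * c w)) s = sweed ?F x (\<lambda>a b. sweed ?F a (\<lambda>a1 a2. a1 u * a2 v) * b w)"
        by (simp add: s_def sweed_def case_prod_unfold mult.assoc flip: slift_cmult_right)
      also have "\<dots> = x (u \<otimes> v \<otimes> w)"
        using x uvw eval[OF x, of "u \<otimes> v" w] by (simp add: eval cong: cong)
      also have "\<dots> = sweed ?F x (\<lambda>a b. a u * sweed ?F b (\<lambda>b1 b2. b1 v * b2 w))"
        using x uvw eval[OF x, of u "v \<otimes> w"] by (simp add: eval m_assoc cong: cong)
      also have "\<dots> = slift (\<lambda>(a, b, c). a u * (b v * c w)) t"
        by (simp add: t_def sweed_def case_prod_unfold flip: slift_cmult)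
      finally show "slift (\<lambda>(a, b, c). a u * (b v * c w)) (s - t) = 0" by simp
    qed
    then show "sweed ?F x (\<lambda>a b. sweed ?F a (\<lambda>a1 a2. \<tau> a1 a2 b)) = sweed ?F x (\<lambda>a b. sweed ?F b (\<lambda>b1 b2. \<tau> a b1 b2))"
      by (simp add: s_def t_def sweed_def case_prod_unfold)
  qed
qed

end

lemma k_algebra_extend:
  assumes "k_algebra A"
  shows "k_algebra (module.extend A r)"
proof -
  interpret A: k_algebra A by fact
  show ?thesis
    by (rule k_algebraI; simp add: module.defs A.a_ac A.m_assoc A.l_distr A.r_distr
        A.scale_add_l A.scale_add_r A.scale_assoc A.smult_mult_l A.smult_mult_r)
qed

lemma extend_sel [simp]:
  "carrier (module.extend A r) = carrier A"
  "monoid.mult (module.extend A r) = monoid.mult A"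
  "one (module.extend A r) = one A"
  "ring.zero (module.extend A r) = ring.zero A"
  "add (module.extend A r) = add A"
  "module.smult (module.extend A r) = module.smult A"
  by (simp_all add: module.defs)

lemma extend_hopf_sel [simp]:
  "comult (module.extend A (hopf.fields d e s)) = d"
  "counit (module.extend A (hopf.fields d e s)) = e"
  "antipode (module.extend A (hopf.fields d e s)) = s"
  by (simp_all add: module.defs hopf.defs)

lemma k_functional_extend [simp]: "k_functional (module.extend A r) = k_functional A"
  by (rule ext) (simp add: k_functional_def)

subsection \<open>Monoid algebras and group algebras\<close>

lemma monoid_algebra_sel [simp]:
  "carrier (monoid_algebra M) = {f. Poly_Mapping.keys f \<subseteq> carrier M}"
  "one (monoid_algebra M) = Poly_Mapping.single \<one>\<^bsub>M\<^esub> 1"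
  "ring.zero (monoid_algebra M) = 0"
  "add (monoid_algebra M) = (+)"
  "module.smult (monoid_algebra M) = fscale"
  by (simp_all add: monoid_algebra_def)

lemma slift_monoid_mult [simp]:
  "slift F (f \<otimes>\<^bsub>monoid_algebra M\<^esub> g) = slift (\<lambda>u. slift (\<lambda>v. F (u \<otimes>\<^bsub>M\<^esub> v)) g) f"
  by (simp add: monoid_algebra_def)

lemma monoid_mult_single [simp]:
  "Poly_Mapping.single u 1 \<otimes>\<^bsub>monoid_algebra M\<^esub> Poly_Mapping.single v 1 = Poly_Mapping.single (u \<otimes>\<^bsub>M\<^esub> v) 1"
  by (rule fmap_eqI) simp

lemma k_functional_slift: "k_functional (monoid_algebra M) (slift F)"
  by (simp add: k_functional_def)

lemma monoid_algebra_algebra: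
  assumes "Group.monoid M"
  shows "k_algebra (monoid_algebra M :: ('k::field, 'g \<Rightarrow>\<^sub>0 'k) module)"
proof -
  interpret M: Group.monoid M by fact
  show ?thesis
  proof (rule k_algebraI, goal_cases)
    case (3 f g) then show ?case using keys_add[of f g] by auto
  next
    case (4 f g)
    then show ?case
      unfolding monoid_algebra_def
      by (auto intro!: order_trans[OF keys_flift] UN_least M.m_closed)
  next
    case (5 c f) then show ?case using keys_fscale[of c f] by auto
  next
    case (9 f g h)
    then show ?case by (intro fmap_eqI) (simp add: M.m_assoc subset_iff cong: slift_cong)
  next
    case (10 f) then show ?case by (intro fmap_eqI) (simp add: subset_iff cong: slift_cong)
  next
    case (11 f) then show ?case by (intro fmap_eqI) (simp add: subset_iff cong: slift_cong)
  next
    case (12 f g h) show ?case by (rule fmap_eqI) simp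
  next
    case (13 f g h) show ?case by (rule fmap_eqI) (simp add: slift_fun_add)
  next
    case (19 c f g) show ?case by (rule fmap_eqI) simp
  next
    case (20 c f g) show ?case by (rule fmap_eqI) (simp add: slift_cmult)
  qed (simp_all add: fs.scale_left_distrib fs.scale_right_distrib)
qed

lemma functional_monoid_algebra:
  fixes f :: "'g \<Rightarrow>\<^sub>0 'k::field"
  assumes "Group.monoid M" "k_functional (monoid_algebra M) l" "Poly_Mapping.keys f \<subseteq> carrier M"
  shows "l f = slift (\<lambda>g. l (Poly_Mapping.single g 1)) f"
proof -
  interpret A: k_algebra "monoid_algebra M :: ('k, 'g \<Rightarrow>\<^sub>0 'k) module"
    by (rule monoid_algebra_algebra[OF assms(1)])
  have v: "(\<lambda>g. Poly_Mapping.single g (1 :: 'k)) \<in> Poly_Mapping.keys f \<rightarrow> carrier (monoid_algebra M)"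
    using assms(3) by auto
  have "mlift (monoid_algebra M) (\<lambda>g. Poly_Mapping.single g 1) f = f"
    by (rule fmap_eqI) (simp add: A.functional_mlift[OF k_functional_slift v])
  then show ?thesis
    using A.functional_mlift[OF assms(2) v] by simp
qed

lemma group_hopf_carrier: "carrier (group_hopf G) = {f. Poly_Mapping.keys f \<subseteq> carrier G}"
  by (simp add: group_hopf_def)

lemma sweed_group_hopf:
  "sweed (group_hopf G) f \<beta> = slift (\<lambda>g. \<beta> (Poly_Mapping.single g 1) (Poly_Mapping.single g 1)) f"
  by (simp add: sweed_def group_hopf_def)

lemma group_hopf_sel:
  "monoid.mult (group_hopf G) = monoid.mult (monoid_algebra G)"
  "\<one>\<^bsub>group_hopf G\<^esub> = Poly_Mapping.single \<one>\<^bsub>G\<^esub> 1"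
  "counit (group_hopf G) = slift (\<lambda>g. 1)"
  "antipode (group_hopf G) = flift (\<lambda>g. Poly_Mapping.single (inv\<^bsub>G\<^esub> g) 1)"
  "k_functional (group_hopf G) = k_functional (monoid_algebra G)"
  by (simp_all add: group_hopf_def)

theorem hopf_algebra_group_hopf:
  assumes "Group.group G"
  shows "hopf_algebra (group_hopf G :: ('k::field, 'g \<Rightarrow>\<^sub>0 'k) hopf)"
proof -
  interpret G: Group.group G by fact
  let ?H = "group_hopf G :: ('k, 'g \<Rightarrow>\<^sub>0 'k) hopf"
  interpret H: k_algebra ?H
    unfolding group_hopf_def by (rule k_algebra_extend[OF monoid_algebra_algebra]) (rule G.is_monoid)
  have rep: "l f = slift (\<lambda>g. l (Poly_Mapping.single g 1)) f"
    if "k_functional ?H l" "Poly_Mapping.keys f \<subseteq> carrier G" for l :: "('g \<Rightarrow>\<^sub>0 'k) \<Rightarrow> 'k" and f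
    using that(1) by (intro functional_monoid_algebra[OF G.is_monoid _ that(2)]) (simp add: group_hopf_sel)
  have pre: "pre_bialgebra ?H"
  proof
    show "Poly_Mapping.keys (comult ?H f) \<subseteq> carrier ?H \<times> carrier ?H" if "f \<in> carrier ?H" for f
      using that by (auto simp: group_hopf_def intro!: order_trans[OF keys_flift])
  qed (simp_all add: sweed_group_hopf, simp_all add: group_hopf_def)
  show ?thesis
  proof (rule hopf_algebraI[OF pre], goal_cases)
    case (3 f g) show ?case by (simp add: group_hopf_def slift_mult)
  next
    case (4 \<tau> f) show ?case by (simp add: sweed_group_hopf)
  next
    case (5 l f)
    then show ?case by (subst rep[of l f]) (simp_all add: sweed_group_hopf group_hopf_sel group_hopf_carrier)
  next
    case (6 l f)
    then show ?case by (subst rep[of l f]) (simp_all add: sweed_group_hopf group_hopf_sel group_hopf_carrier)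
  next
    case 7
    show ?case
      unfolding k_linear_def group_hopf_def
      by (auto intro!: order_trans[OF keys_flift])
  next
    case (8 l f)
    then have f: "Poly_Mapping.keys f \<subseteq> carrier G" by (simp add: group_hopf_def)
    have "sweed ?H f (\<lambda>a b. l (antipode ?H a \<otimes>\<^bsub>?H\<^esub> b)) = slift (\<lambda>g. 1 * l \<one>\<^bsub>?H\<^esub>) f"
      unfolding sweed_group_hopf using f by (intro slift_cong) (auto simp: group_hopf_sel)
    then show ?case by (simp only: slift_cmult_right group_hopf_sel(3))
  next
    case (9 l f)
    then have f: "Poly_Mapping.keys f \<subseteq> carrier G" by (simp add: group_hopf_def)
    have "sweed ?H f (\<lambda>a b. l (a \<otimes>\<^bsub>?H\<^esub> antipode ?H b)) = slift (\<lambda>g. 1 * l \<one>\<^bsub>?H\<^esub>) f"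
      unfolding sweed_group_hopf using f by (intro slift_cong) (auto simp: group_hopf_sel)
    then show ?case by (simp only: slift_cmult_right group_hopf_sel(3))
  qed (simp_all add: group_hopf_def k_functional_slift)
qed

subsection \<open>Quotient algebras\<close>

locale quotient_algebra = k_algebra A + ideal J A
  for A :: "('k::field, 'a, 'm) module_scheme" (structure) and J
begin

definition proj :: "'a \<Rightarrow> 'a set" where "proj a = J +> a"

lemma proj_eq_iff: "\<lbrakk>x \<in> carrier A; y \<in> carrier A\<rbrakk> \<Longrightarrow> proj x = proj y \<longleftrightarrow> x \<ominus> y \<in> J"
  unfolding proj_def by (rule quotient_eq_iff_same_a_r_cos[OF is_ideal, symmetric])

lemma quot_carrier: "carrier (quot_algebra A J) = proj ` carrier A"
  by (auto simp: quot_algebra_def ring.defs FactRing_def A_RCOSETS_def' proj_def a_r_coset_def')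

lemma quot_mult: "\<lbrakk>x \<in> carrier A; y \<in> carrier A\<rbrakk> \<Longrightarrow> proj x \<otimes>\<^bsub>quot_algebra A J\<^esub> proj y = proj (x \<otimes> y)"
  by (simp add: quot_algebra_def ring.defs FactRing_def proj_def rcoset_mult_add)

lemma quot_add: "\<lbrakk>x \<in> carrier A; y \<in> carrier A\<rbrakk> \<Longrightarrow> proj x \<oplus>\<^bsub>quot_algebra A J\<^esub> proj y = proj (x \<oplus> y)"
  by (simp add: quot_algebra_def ring.defs FactRing_def proj_def a_rcos_sum)

lemma quot_one: "\<one>\<^bsub>quot_algebra A J\<^esub> = proj \<one>"
  by (simp add: quot_algebra_def ring.defs FactRing_def proj_def)

lemma quot_zero: "\<zero>\<^bsub>quot_algebra A J\<^esub> = proj \<zero>"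
  using a_rcos_const[of \<zero>] by (simp add: quot_algebra_def ring.defs FactRing_def proj_def)

lemma in_proj: "x \<in> carrier A \<Longrightarrow> y \<in> proj x \<Longrightarrow> y \<in> carrier A \<and> proj y = proj x"
  unfolding proj_def using a_elemrcos_carrier[of x y] a_repr_independence[of y J x] a_subgroup by auto

lemma self_proj: "x \<in> carrier A \<Longrightarrow> x \<in> proj x"
  unfolding proj_def by (rule a_rcos_self)

text \<open>A scalar acts as multiplication by c 1, so an ideal of the ring is automatically a
  subspace.\<close>

lemma ideal_scale: "x \<in> J \<Longrightarrow> c \<odot> x \<in> J"
  using I_l_closed[of x "c \<odot> \<one>"] a_subset by (auto simp: smult_mult_l)

text \<open>Scalar multiplication of a coset is defined as a union over its representatives; the
  union collapses because all of them yield the same coset.\<close>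

lemma quot_smult: "x \<in> carrier A \<Longrightarrow> c \<odot>\<^bsub>quot_algebra A J\<^esub> proj x = proj (c \<odot> x)"
proof -
  assume x: "x \<in> carrier A"
  have "proj (c \<odot> y) = proj (c \<odot> x)" if "y \<in> proj x" for y
  proof -
    have y: "y \<in> carrier A" "y \<ominus> x \<in> J" using in_proj[OF x that] proj_eq_iff x by auto
    have "c \<odot> (y \<ominus> x) = c \<odot> y \<ominus> c \<odot> x"
      using x y(1) by (simp add: a_minus_def scale_add_r scale_minus_one[symmetric] scale_assoc[symmetric])
    then show ?thesis using ideal_scale[OF y(2), of c] x y(1) by (simp add: proj_eq_iff)
  qed
  then have "(\<Union>y\<in>proj x. proj (c \<odot> y)) = (\<Union>y\<in>proj x. proj (c \<odot> x))"
    by (intro SUP_cong refl)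
  also have "\<dots> = proj (c \<odot> x)" using self_proj[OF x] by blast
  finally show ?thesis by (simp add: quot_algebra_def ring.defs module.defs proj_def)
qed

lemmas quot_simps = quot_carrier quot_mult quot_add quot_one quot_zero quot_smult

lemma k_algebra_quot: "k_algebra (quot_algebra A J)"
proof (rule k_algebraI, unfold quot_carrier, goal_cases)
  case (6 x y z) then show ?case by (elim imageE) (simp add: quot_simps a_assoc)
next
  case (7 x y) then show ?case by (elim imageE) (simp add: quot_simps a_comm)
next
  case (9 x y z) then show ?case by (elim imageE) (simp add: quot_simps m_assoc)
next
  case (12 x y z) then show ?case by (elim imageE) (simp add: quot_simps l_distr)
next
  case (13 x y z) then show ?case by (elim imageE) (simp add: quot_simps r_distr)
next
  case (14 c d x) then show ?case by (elim imageE) (simp add: quot_simps scale_add_l)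
next
  case (15 c x y) then show ?case by (elim imageE) (simp add: quot_simps scale_add_r)
next
  case (16 c d x) then show ?case by (elim imageE) (simp add: quot_simps scale_assoc)
next
  case (19 c x y) then show ?case by (elim imageE) (simp add: quot_simps smult_mult_l)
next
  case (20 c x y) then show ?case by (elim imageE) (simp add: quot_simps smult_mult_r)
qed ((elim imageE)?, simp add: quot_simps)+

lemma functional_proj:
  "k_functional (quot_algebra A J) l \<longleftrightarrow> k_functional A (\<lambda>x. l (proj x))"
  unfolding k_functional_def by (simp add: quot_simps)

end

subsection \<open>Presented algebras\<close>

lemma free_algebra_sel [simp]:
  "carrier free_algebra = UNIV"
  "one free_algebra = word []"
  "ring.zero free_algebra = 0"
  "add free_algebra = (+)"
  "module.smult free_algebra = fscale"
  by (simp_all add: free_algebra_def word_def)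

interpretation free: k_algebra "free_algebra :: ('k::field, 'g list \<Rightarrow>\<^sub>0 'k) module"
  unfolding free_algebra_def by (rule monoid_algebra_algebra) (simp add: monoid_def)

lemma free_minus [simp]: "x \<ominus>\<^bsub>free_algebra\<^esub> y = x - (y :: 'g list \<Rightarrow>\<^sub>0 'k::field)"
proof -
  have "\<ominus>\<^bsub>free_algebra\<^esub> y = - y" by (rule free.minus_equality) simp_all
  then show ?thesis by (simp add: a_minus_def)
qed

lemma slift_free_mult [simp]:
  "slift F (f \<otimes>\<^bsub>free_algebra\<^esub> g) = slift (\<lambda>u. slift (\<lambda>v. F (u @ v)) g) f"
  by (simp add: free_algebra_def)

lemma slift_word [simp]: "slift F (word w) = F w"
  by (simp add: word_def)

lemma flift_word [simp]: "flift F (word w) = F w"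
  by (simp add: word_def)

lemma free_mult_word [simp]: "word u \<otimes>\<^bsub>free_algebra\<^esub> word v = word (u @ v)"
  by (rule fmap_eqI) simp

lemma slift_fun_uminus: "slift (\<lambda>x. - f x) t = - slift f t"
  by (simp add: slift_def sum_negf)

lemma free_mult_minus [simp]:
  "(- f) \<otimes>\<^bsub>free_algebra\<^esub> g = - (f \<otimes>\<^bsub>free_algebra\<^esub> g)"
  "f \<otimes>\<^bsub>free_algebra\<^esub> (- g) = - (f \<otimes>\<^bsub>free_algebra\<^esub> g)"
  by (rule fmap_eqI, simp add: slift_fun_uminus)+

lemma ideal_freeI:
  assumes "0 \<in> N" "\<And>x y. \<lbrakk>x \<in> N; y \<in> N\<rbrakk> \<Longrightarrow> x + y \<in> N" "\<And>c x. x \<in> N \<Longrightarrow> fscale c x \<in> N"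
    "\<And>x y. x \<in> N \<Longrightarrow> x \<otimes>\<^bsub>free_algebra\<^esub> y \<in> N" "\<And>x y. x \<in> N \<Longrightarrow> y \<otimes>\<^bsub>free_algebra\<^esub> x \<in> N"
  shows "ideal N (free_algebra :: ('k::field, 'g list \<Rightarrow>\<^sub>0 'k) module)"
proof (rule idealI)
  show "ring (free_algebra :: ('k, 'g list \<Rightarrow>\<^sub>0 'k) module)" ..
  show "subgroup N (add_monoid (free_algebra :: ('k, 'g list \<Rightarrow>\<^sub>0 'k) module))"
  proof
    show "inv\<^bsub>add_monoid free_algebra\<^esub> x \<in> N" if "x \<in> N" for x
    proof -
      have "fscale (- 1) x + x = 0" by (rule fmap_eqI) simp
      then have "\<ominus>\<^bsub>free_algebra\<^esub> x = fscale (- 1) x"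
        by (intro free.minus_equality) simp_all
      then show ?thesis using assms(3)[OF that, of "- 1"] unfolding a_inv_def by simp
    qed
  qed (use assms in auto)
qed (use assms in auto)

locale presented =
  fixes R :: "('g list \<Rightarrow>\<^sub>0 'k::field) set"
begin

abbreviation rel_ideal where "rel_ideal \<equiv> genideal free_algebra R"
abbreviation Q where "Q \<equiv> quot_algebra free_algebra rel_ideal"
abbreviation cls where "cls \<equiv> pres_class R"

sublocale quotient_algebra free_algebra rel_ideal
  rewrites "quotient_algebra.proj free_algebra rel_ideal = pres_class R"
proof -
  show *: "quotient_algebra free_algebra rel_ideal"
    by (intro quotient_algebra.intro free.k_algebra_axioms free.genideal_ideal) simp
  show "quotient_algebra.proj free_algebra rel_ideal = pres_class R"
    by (rule ext) (simp add: quotient_algebra.proj_def[OF *] pres_class_def)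
qed

lemma carrier_Q: "carrier Q = range cls"
  by (simp add: quot_carrier)

lemma Q_simps [simp]:
  "\<one>\<^bsub>Q\<^esub> = cls (word [])" "\<zero>\<^bsub>Q\<^esub> = cls 0"
  "cls x \<otimes>\<^bsub>Q\<^esub> cls y = cls (x \<otimes>\<^bsub>free_algebra\<^esub> y)"
  "cls x \<oplus>\<^bsub>Q\<^esub> cls y = cls (x + y)"
  "c \<odot>\<^bsub>Q\<^esub> cls x = cls (fscale c x)"
  "cls x \<in> carrier Q"
  by (simp_all add: quot_simps)

lemma cls_eq_iff: "cls x = cls y \<longleftrightarrow> x - y \<in> rel_ideal"
  by (simp add: proj_eq_iff)

lemma rel_ideal_subset:
  assumes "ideal N free_algebra" "R \<subseteq> N"
  shows "rel_ideal \<subseteq> N"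
  by (rule free.genideal_minimal[OF assms])

lemma some_rep: "cls (SOME f. f \<in> cls x) = cls x"
proof (rule in_proj[THEN conjunct2])
  show "(SOME f. f \<in> cls x) \<in> cls x" by (rule someI[of _ x]) (rule self_proj, simp)
qed simp

lemma cls_relator: "r \<in> R \<Longrightarrow> cls r = cls 0"
  using free.genideal_self[of R] by (auto simp: cls_eq_iff)

text \<open>Words span the quotient and are built by adding letters on the left, so generators only
  ever need to be multiplied from that side.\<close>

lemma Q_induct [consumes 1, case_names one gen add scale]:
  assumes "z \<in> carrier Q"
    and one: "P (cls (word []))"
    and gen: "\<And>g w. P (cls (word w)) \<Longrightarrow> P (cls (word (g # w)))"
    and add: "\<And>x y. \<lbrakk>x \<in> carrier Q; y \<in> carrier Q; P x; P y\<rbrakk> \<Longrightarrow> P (x \<oplus>\<^bsub>Q\<^esub> y)"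
    and scale: "\<And>c x. \<lbrakk>x \<in> carrier Q; P x\<rbrakk> \<Longrightarrow> P (c \<odot>\<^bsub>Q\<^esub> x)"
  shows "P z"
proof -
  obtain f where z: "z = cls f" using assms(1) by (auto simp: carrier_Q)
  have word: "P (cls (word w))" for w by (induction w) (simp_all add: one gen)
  have "P (cls (\<Sum>w\<in>S. fscale (h w) (word w)))" if "finite S" for S h
    using that
  proof (induction S)
    case empty
    show ?case using scale[OF _ one, of 0] by simp
  next
    case (insert w S)
    then show ?case using add[OF _ _ scale[OF _ word[of w], of "h w"] insert.IH] by simp
  qed
  moreover have "f = (\<Sum>w\<in>Poly_Mapping.keys f. fscale (Poly_Mapping.lookup f w) (word w))"
    using flift_single_id[of f] unfolding flift_def word_def by simp
  ultimately show ?thesis using finite_keys z by metis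
qed

end

text \<open>The Hopf algebra axioms that remain to be checked for a bialgebra structure given by algebra
  homomorphisms only need to be verified on generators.\<close>

locale pre_hopf = pre_bialgebra H
  for H :: "('k::field, 'h, 'm) hopf_scheme" (structure) +
  assumes counit_linear: "k_functional H (counit H)"
    and counit_one: "counit H \<one> = 1"
    and counit_mult: "\<lbrakk>x \<in> carrier H; y \<in> carrier H\<rbrakk> \<Longrightarrow> counit H (x \<otimes> y) = counit H x * counit H y"
    and antipode_linear: "k_linear H H (antipode H)"
    and antipode_one: "antipode H \<one> = \<one>"
    and antipode_anti: "\<lbrakk>x \<in> carrier H; y \<in> carrier H\<rbrakk> \<Longrightarrow> antipode H (x \<otimes> y) = antipode H y \<otimes> antipode H x"
begin

definition hopf_at :: "'h \<Rightarrow> bool"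
  where "hopf_at x \<longleftrightarrow>
      (\<forall>\<tau>. tril H H H \<tau> \<longrightarrow>
        sweed H x (\<lambda>a b. sweed H a (\<lambda>a1 a2. \<tau> a1 a2 b)) = sweed H x (\<lambda>a b. sweed H b (\<lambda>b1 b2. \<tau> a b1 b2)))
    \<and> (\<forall>l. k_functional H l \<longrightarrow>
        sweed H x (\<lambda>a b. counit H a * l b) = l x \<and>
        sweed H x (\<lambda>a b. counit H b * l a) = l x \<and>
        sweed H x (\<lambda>a b. l (antipode H a \<otimes> b)) = counit H x * l \<one> \<and>
        sweed H x (\<lambda>a b. l (a \<otimes> antipode H b)) = counit H x * l \<one>)"

lemma S_closed [simp]: "x \<in> carrier H \<Longrightarrow> antipode H x \<in> carrier H"
  and S_add: "\<lbrakk>x \<in> carrier H; y \<in> carrier H\<rbrakk> \<Longrightarrow> antipode H (x \<oplus> y) = antipode H x \<oplus> antipode H y"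
  and S_scale: "x \<in> carrier H \<Longrightarrow> antipode H (c \<odot> x) = c \<odot> antipode H x"
  using antipode_linear by (auto simp: k_linear_def)

lemma counit_add: "\<lbrakk>x \<in> carrier H; y \<in> carrier H\<rbrakk> \<Longrightarrow> counit H (x \<oplus> y) = counit H x + counit H y"
  and counit_scale: "x \<in> carrier H \<Longrightarrow> counit H (c \<odot> x) = c * counit H x"
  using counit_linear by (auto simp: k_functional_def)

lemma bil_basic:
  assumes "k_functional H l"
  shows "bil H H (\<lambda>a b. counit H a * l b)" "bil H H (\<lambda>a b. counit H b * l a)"
    "bil H H (\<lambda>a b. l (antipode H a \<otimes> b))" "bil H H (\<lambda>a b. l (a \<otimes> antipode H b))"
  using k_functionalD[OF assms]
  by (simp_all add: functional_simps S_add S_scale counit_add counit_scale)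

lemma bil_coassoc:
  assumes "tril H H H \<tau>"
  shows "bil H H (\<lambda>a b. sweed H a (\<lambda>a1 a2. \<tau> a1 a2 b))" "bil H H (\<lambda>a b. sweed H b (\<lambda>b1 b2. \<tau> a b1 b2))"
proof -
  note \<tau>D = trilD[OF assms]
  have "bil H H (\<lambda>a1 a2. \<tau> a1 a2 b)" "bil H H (\<lambda>b1 b2. \<tau> b b1 b2)" if "b \<in> carrier H" for b
    using that by (simp_all add: bil_def k_functional_def \<tau>D)
  note * = sweed_add[OF this(1)] sweed_scale[OF this(1)] sweed_add[OF this(2)] sweed_scale[OF this(2)]
  show "bil H H (\<lambda>a b. sweed H a (\<lambda>a1 a2. \<tau> a1 a2 b))" "bil H H (\<lambda>a b. sweed H b (\<lambda>b1 b2. \<tau> a b1 b2))"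
    by (simp_all add: bil_def k_functional_def * \<tau>D sweed_linear cong: sweed_cong)
qed

lemma hopf_at_one: "hopf_at \<one>"
proof -
  have "bil H H (\<lambda>a1 a2. \<tau> a1 a2 \<one>)" "bil H H (\<lambda>b1 b2. \<tau> \<one> b1 b2)" if "tril H H H \<tau>" for \<tau>
    using trilD[OF that] by (simp_all add: bil_def k_functional_def)
  note * = sweed_one[OF this(1)] sweed_one[OF this(2)]
  show ?thesis
    unfolding hopf_at_def
    by (auto simp: sweed_one[OF bil_basic(1)] sweed_one[OF bil_basic(2)] sweed_one[OF bil_basic(3)]
        sweed_one[OF bil_basic(4)] sweed_one[OF bil_coassoc(1)] sweed_one[OF bil_coassoc(2)] * counit_one antipode_one)
qed

lemma hopf_at_add: "\<lbrakk>x \<in> carrier H; y \<in> carrier H; hopf_at x; hopf_at y\<rbrakk> \<Longrightarrow> hopf_at (x \<oplus> y)"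
  unfolding hopf_at_def
  by (simp add: sweed_add[OF bil_basic(1)] sweed_add[OF bil_basic(2)] sweed_add[OF bil_basic(3)]
      sweed_add[OF bil_basic(4)] sweed_add[OF bil_coassoc(1)] sweed_add[OF bil_coassoc(2)]
      counit_add distrib_right k_functionalD)

lemma hopf_at_scale: "\<lbrakk>x \<in> carrier H; hopf_at x\<rbrakk> \<Longrightarrow> hopf_at (c \<odot> x)"
  unfolding hopf_at_def
  by (simp add: sweed_scale[OF bil_basic(1)] sweed_scale[OF bil_basic(2)] sweed_scale[OF bil_basic(3)]
      sweed_scale[OF bil_basic(4)] sweed_scale[OF bil_coassoc(1)] sweed_scale[OF bil_coassoc(2)]
      counit_scale mult.assoc k_functionalD)

text \<open>The elements satisfying the Hopf axioms form a subalgebra: the coproduct of a product is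
  expanded, and the axiom is applied to one factor while the Sweedler components of the other stay
  fixed.\<close>

lemma hopf_at_mult:
  assumes x: "x \<in> carrier H" "hopf_at x" and y: "y \<in> carrier H" "hopf_at y"
  shows "hopf_at (x \<otimes> y)"
  unfolding hopf_at_def
proof (intro conjI allI impI)
  fix \<tau> assume \<tau>: "tril H H H \<tau>"
  note \<tau>D = trilD[OF \<tau>]
  have bil: "bil H H (\<lambda>a1 a2. \<tau> a1 a2 b)" "bil H H (\<lambda>b1 b2. \<tau> b b1 b2)" if "b \<in> carrier H" for b
    using that by (simp_all add: bil_def k_functional_def \<tau>D)
  have tril1: "tril H H H (\<lambda>u v w. \<tau> (a \<otimes> u) (b \<otimes> v) (c \<otimes> w))"
    if "a \<in> carrier H" "b \<in> carrier H" "c \<in> carrier H" for a b c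
    using that by (simp add: functional_simps \<tau>D)
  have tril2: "tril H H H (\<lambda>a b c. sweed H y (\<lambda>u v. sweed H v (\<lambda>v1 v2. \<tau> (a \<otimes> u) (b \<otimes> v1) (c \<otimes> v2))))"
    using y(1) by (simp add: functional_simps \<tau>D cong: sweed_cong)
  have "sweed H (x \<otimes> y) (\<lambda>a b. sweed H a (\<lambda>a1 a2. \<tau> a1 a2 b)) =
      sweed H x (\<lambda>a b. sweed H y (\<lambda>a' b'. sweed H a (\<lambda>a1 a2. sweed H a' (\<lambda>a1' a2'. \<tau> (a1 \<otimes> a1') (a2 \<otimes> a2') (b \<otimes> b')))))"
    using x(1) y(1) by (simp add: sweed_mult[OF bil_coassoc(1)[OF \<tau>]] sweed_mult[OF bil(1)] cong: sweed_cong)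
  also have "\<dots> = sweed H x (\<lambda>a b. sweed H a (\<lambda>a1 a2. sweed H y (\<lambda>a' b'. sweed H a' (\<lambda>a1' a2'. \<tau> (a1 \<otimes> a1') (a2 \<otimes> a2') (b \<otimes> b')))))"
    by (subst (2) sweed_swap) simp
  also have "\<dots> = sweed H x (\<lambda>a b. sweed H a (\<lambda>a1 a2. sweed H y (\<lambda>u v. sweed H v (\<lambda>v1 v2. \<tau> (a1 \<otimes> u) (a2 \<otimes> v1) (b \<otimes> v2)))))"
    using x(1) y(2)[unfolded hopf_at_def, THEN conjunct1, rule_format, OF tril1] by (simp cong: sweed_cong)
  also have "\<dots> = sweed H x (\<lambda>a b. sweed H b (\<lambda>b1 b2. sweed H y (\<lambda>u v. sweed H v (\<lambda>v1 v2. \<tau> (a \<otimes> u) (b1 \<otimes> v1) (b2 \<otimes> v2)))))"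
    by (rule x(2)[unfolded hopf_at_def, THEN conjunct1, rule_format, OF tril2])
  also have "\<dots> = sweed H x (\<lambda>a b. sweed H y (\<lambda>u v. sweed H b (\<lambda>b1 b2. sweed H v (\<lambda>v1 v2. \<tau> (a \<otimes> u) (b1 \<otimes> v1) (b2 \<otimes> v2)))))"
    by (subst (2) sweed_swap) simp
  also have "\<dots> = sweed H (x \<otimes> y) (\<lambda>a b. sweed H b (\<lambda>b1 b2. \<tau> a b1 b2))"
    using x(1) y(1) by (simp add: sweed_mult[OF bil_coassoc(2)[OF \<tau>]] sweed_mult[OF bil(2)] cong: sweed_cong)
  finally show "sweed H (x \<otimes> y) (\<lambda>a b. sweed H a (\<lambda>a1 a2. \<tau> a1 a2 b)) =
      sweed H (x \<otimes> y) (\<lambda>a b. sweed H b (\<lambda>b1 b2. \<tau> a b1 b2))" .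
next
  fix l assume l: "k_functional H l"
  note lD = k_functionalD[OF l]
  have at: "sweed H z (\<lambda>a b. counit H a * m b) = m z" "sweed H z (\<lambda>a b. counit H b * m a) = m z"
      "sweed H z (\<lambda>a b. m (antipode H a \<otimes> b)) = counit H z * m \<one>"
      "sweed H z (\<lambda>a b. m (a \<otimes> antipode H b)) = counit H z * m \<one>"
    if "k_functional H m" "z \<in> {x, y}" for m z
    using that x(2) y(2) by (auto simp: hopf_at_def)
  have f1: "k_functional H (\<lambda>u. l (u \<otimes> v))" "k_functional H (\<lambda>u. l (v \<otimes> u))"
    "k_functional H (\<lambda>u. l (w \<otimes> (u \<otimes> v)))" if "v \<in> carrier H" "w \<in> carrier H" for v w
    using that by (simp_all add: k_functional_def lD l_distr r_distr smult_mult_l smult_mult_r)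
  have "sweed H y (\<lambda>a' b'. counit H a * counit H a' * l (b \<otimes> b')) = counit H a * l (b \<otimes> y)"
    if "b \<in> carrier H" for a b
    using at(1)[OF f1(2)[of b b], of y] that by (simp add: mult.assoc sweed_cmult)
  then show "sweed H (x \<otimes> y) (\<lambda>a b. counit H a * l b) = l (x \<otimes> y)"
    using x(1) y(1) at(1)[OF f1(1)[of y y], of x]
    by (simp add: sweed_mult[OF bil_basic(1)[OF l]] counit_mult cong: sweed_cong)
  have "sweed H y (\<lambda>a' b'. counit H b * counit H b' * l (a \<otimes> a')) = counit H b * l (a \<otimes> y)"
    if "a \<in> carrier H" for a b
    using at(2)[OF f1(2)[of a a], of y] that by (simp add: mult.assoc sweed_cmult)
  then show "sweed H (x \<otimes> y) (\<lambda>a b. counit H b * l a) = l (x \<otimes> y)"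
    using x(1) y(1) at(2)[OF f1(1)[of y y], of x]
    by (simp add: sweed_mult[OF bil_basic(2)[OF l]] counit_mult cong: sweed_cong)
  \<comment> \<open>In S(y1) S(x1) x2 y2 the components of \<open>x\<close> are innermost and cancel
    first, so the sum over \<open>x\<close> is moved inside.\<close>
  have "sweed H (x \<otimes> y) (\<lambda>a b. l (antipode H a \<otimes> b)) =
      sweed H y (\<lambda>a' b'. sweed H x (\<lambda>a b. l (antipode H a' \<otimes> (antipode H a \<otimes> b \<otimes> b'))))"
    using x(1) y(1) by (subst sweed_swap)
      (simp add: sweed_mult[OF bil_basic(3)[OF l]] antipode_anti m_assoc cong: sweed_cong)
  also have "\<dots> = counit H (x \<otimes> y) * l \<one>"
    using x(1) y(1) at(3)[OF f1(3), of _ _ x] at(3)[OF l, of y]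
    by (simp add: sweed_cmult counit_mult cong: sweed_cong)
  finally show "sweed H (x \<otimes> y) (\<lambda>a b. l (antipode H a \<otimes> b)) = counit H (x \<otimes> y) * l \<one>" .
  \<comment> \<open>In x1 y1 S(y2) S(x2) the components of \<open>y\<close> are innermost, and the
    sums already stand in the right order.\<close>
  have "sweed H (x \<otimes> y) (\<lambda>a b. l (a \<otimes> antipode H b)) =
      sweed H x (\<lambda>a b. sweed H y (\<lambda>a' b'. l (a \<otimes> (a' \<otimes> antipode H b' \<otimes> antipode H b))))"
    using x(1) y(1)
    by (simp add: sweed_mult[OF bil_basic(4)[OF l]] antipode_anti m_assoc cong: sweed_cong)
  also have "\<dots> = counit H (x \<otimes> y) * l \<one>"
    using x(1) y(1) at(4)[OF f1(3), of _ _ y] at(4)[OF l, of x]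
    by (simp add: sweed_cmult counit_mult cong: sweed_cong)
  finally show "sweed H (x \<otimes> y) (\<lambda>a b. l (a \<otimes> antipode H b)) = counit H (x \<otimes> y) * l \<one>" .
qed

lemma hopf_algebra_if_hopf_at:
  assumes "\<And>x. x \<in> carrier H \<Longrightarrow> hopf_at x"
  shows "hopf_algebra H"
  by (rule hopf_algebraI[OF pre_bialgebra_axioms counit_linear counit_one counit_mult _ _ _ antipode_linear])
    (use assms in \<open>auto simp: hopf_at_def\<close>)

end

section \<open>Bialgebra structures on presented algebras\<close>

lemma free_one_mult [simp]:
  "word [] \<otimes>\<^bsub>free_algebra\<^esub> f = f" "f \<otimes>\<^bsub>free_algebra\<^esub> word [] = f"
  by (rule fmap_eqI, simp)+

lemma slift_word_comult_append:
  "slift F (word_comult D (u @ v)) = slift (\<lambda>(a, b). slift (\<lambda>(a', b').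
    F (a \<otimes>\<^bsub>free_algebra\<^esub> a', b \<otimes>\<^bsub>free_algebra\<^esub> b')) (word_comult D v)) (word_comult D u)"
proof (induction u arbitrary: F)
  case (Cons g u)
  show ?case by (simp add: Cons.IH case_prod_unfold free.m_assoc[simplified])
qed simp

lemma slift_comult_mult:
  "slift F (flift (word_comult D) (f \<otimes>\<^bsub>free_algebra\<^esub> g)) = slift (\<lambda>(a, b). slift (\<lambda>(a', b').
    F (a \<otimes>\<^bsub>free_algebra\<^esub> a', b \<otimes>\<^bsub>free_algebra\<^esub> b')) (flift (word_comult D) g)) (flift (word_comult D) f)"
  by (simp add: slift_word_comult_append case_prod_unfold slift_swap[of _ g])

lemma word_antipode_append:
  "word_antipode T (u @ v) = word_antipode T v \<otimes>\<^bsub>free_algebra\<^esub> word_antipode T u"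
  by (induction u) (simp_all add: free.m_assoc[simplified])

lemma antipode_free_mult:
  "flift (word_antipode T) (f \<otimes>\<^bsub>free_algebra\<^esub> g) =
    flift (word_antipode T) g \<otimes>\<^bsub>free_algebra\<^esub> flift (word_antipode T) f"
  by (rule fmap_eqI) (simp add: word_antipode_append slift_swap[where s = f])

text \<open>The conditions under which comultiplication, counit and antipode descend to the
  quotient. For the comultiplication the condition is posed through bilinear forms on the quotient,
  which is equality of tensors over it.\<close>

locale presented_bialgebra = presented R
  for R :: "('g list \<Rightarrow>\<^sub>0 'k::field) set" +
  fixes D :: "'g \<Rightarrow> (('g list \<Rightarrow>\<^sub>0 'k) \<times> ('g list \<Rightarrow>\<^sub>0 'k) \<Rightarrow>\<^sub>0 'k)"
    and E :: "'g \<Rightarrow> 'k" and T :: "'g \<Rightarrow> ('g list \<Rightarrow>\<^sub>0 'k)"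
  assumes counit_relator: "r \<in> R \<Longrightarrow> slift (\<lambda>w. prod_list (map E w)) r = 0"
    and comult_relator: "\<lbrakk>r \<in> R; bil Q Q \<beta>\<rbrakk> \<Longrightarrow>
      slift (\<lambda>(a, b). \<beta> (cls a) (cls b)) (flift (word_comult D) r) = 0"
    and antipode_relator: "r \<in> R \<Longrightarrow> cls (flift (word_antipode T) r) = cls 0"
begin

abbreviation P where "P \<equiv> presented_hopf R D E T"

lemma P_sel:
  "carrier P = range cls" "\<one>\<^bsub>P\<^esub> = cls (word [])" "\<zero>\<^bsub>P\<^esub> = cls 0"
  "cls x \<otimes>\<^bsub>P\<^esub> cls y = cls (x \<otimes>\<^bsub>free_algebra\<^esub> y)"
  "cls x \<oplus>\<^bsub>P\<^esub> cls y = cls (x + y)"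
  "c \<odot>\<^bsub>P\<^esub> cls x = cls (fscale c x)"
  by (simp_all add: presented_hopf_def carrier_Q)

lemma k_functional_P: "k_functional P l \<longleftrightarrow> k_functional Q l"
  by (simp add: presented_hopf_def)

lemma bil_P: "bil P P \<beta> \<longleftrightarrow> bil Q Q \<beta>"
  by (simp add: bil_def k_functional_P) (simp add: presented_hopf_def)

lemma counit_ideal: "f \<in> rel_ideal \<Longrightarrow> slift (\<lambda>w. prod_list (map E w)) f = 0"
proof -
  have "rel_ideal \<subseteq> {f. slift (\<lambda>w. prod_list (map E w)) f = 0}"
    by (intro rel_ideal_subset ideal_freeI) (auto simp: counit_relator slift_mult[symmetric])
  then show "f \<in> rel_ideal \<Longrightarrow> slift (\<lambda>w. prod_list (map E w)) f = 0" by auto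
qed

text \<open>All forms \<beta> have to be treated at once: multiplying \<open>f\<close> by another
  element translates the arguments of \<beta>, so the elements annihilated by every form make up an
  ideal because a translated form is again bilinear.\<close>

lemma comult_ideal:
  assumes "f \<in> rel_ideal" "bil Q Q \<beta>"
  shows "slift (\<lambda>(a, b). \<beta> (cls a) (cls b)) (flift (word_comult D) f) = 0"
proof -
  let ?N = "{f. \<forall>\<beta>. bil Q Q \<beta> \<longrightarrow> slift (\<lambda>(a, b). \<beta> (cls a) (cls b)) (flift (word_comult D) f) = 0}"
  have "ideal ?N free_algebra"
  proof (rule ideal_freeI)
    fix f g assume f: "f \<in> ?N"
    have "slift (\<lambda>(a, b). \<beta> (cls a) (cls b)) (flift (word_comult D) (f \<otimes>\<^bsub>free_algebra\<^esub> g)) = 0"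
      "slift (\<lambda>(a, b). \<beta> (cls a) (cls b)) (flift (word_comult D) (g \<otimes>\<^bsub>free_algebra\<^esub> f)) = 0"
      if \<beta>: "bil Q Q \<beta>" for \<beta>
    proof -
      interpret Q: k_algebra Q by (rule k_algebra_quot)
      have "bil Q Q (\<lambda>x y. \<beta> (x \<otimes>\<^bsub>Q\<^esub> cls a) (y \<otimes>\<^bsub>Q\<^esub> cls b))"
        "bil Q Q (\<lambda>x y. \<beta> (cls a \<otimes>\<^bsub>Q\<^esub> x) (cls b \<otimes>\<^bsub>Q\<^esub> y))" for a b
        using bilD[OF \<beta>] by (simp_all add: bil_def k_functional_def Q.l_distr Q.r_distr Q.smult_mult_l Q.smult_mult_r
          del: Q_simps add: Q_simps(6))
      then have *: "slift (\<lambda>(x, y). \<beta> (cls x \<otimes>\<^bsub>Q\<^esub> cls a) (cls y \<otimes>\<^bsub>Q\<^esub> cls b)) (flift (word_comult D) f) = 0"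
        "slift (\<lambda>(x, y). \<beta> (cls a \<otimes>\<^bsub>Q\<^esub> cls x) (cls b \<otimes>\<^bsub>Q\<^esub> cls y)) (flift (word_comult D) f) = 0" for a b
        using f by blast+
      show "slift (\<lambda>(a, b). \<beta> (cls a) (cls b)) (flift (word_comult D) (g \<otimes>\<^bsub>free_algebra\<^esub> f)) = 0"
        using *(2) unfolding slift_comult_mult by (simp add: case_prod_unfold del: slift_flift)
      have "slift (\<lambda>(a, b). \<beta> (cls a) (cls b)) (flift (word_comult D) (f \<otimes>\<^bsub>free_algebra\<^esub> g)) =
          slift (\<lambda>(a, b). slift (\<lambda>(x, y). \<beta> (cls x \<otimes>\<^bsub>Q\<^esub> cls a) (cls y \<otimes>\<^bsub>Q\<^esub> cls b)) (flift (word_comult D) f))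
            (flift (word_comult D) g)"
        unfolding slift_comult_mult by (simp add: case_prod_unfold slift_swap[of _ "flift (word_comult D) g"] del: slift_flift)
      then show "slift (\<lambda>(a, b). \<beta> (cls a) (cls b)) (flift (word_comult D) (f \<otimes>\<^bsub>free_algebra\<^esub> g)) = 0"
        unfolding *(1) by (simp add: case_prod_unfold)
    qed
    then show "f \<otimes>\<^bsub>free_algebra\<^esub> g \<in> ?N" "g \<otimes>\<^bsub>free_algebra\<^esub> f \<in> ?N" by blast+
  qed (auto simp del: slift_flift)
  then have "rel_ideal \<subseteq> ?N"
    by (rule rel_ideal_subset) (use comult_relator in blast)
  then show ?thesis using assms by blast
qed

lemma antipode_ideal:
  assumes "f \<in> rel_ideal"
  shows "cls (flift (word_antipode T) f) = cls 0"
proof -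
  interpret Q: k_algebra Q by (rule k_algebra_quot)
  let ?N = "{f. cls (flift (word_antipode T) f) = cls 0}"
  have zero: "cls (x + y) = cls 0" "cls (fscale c x) = cls 0" "cls (x \<otimes>\<^bsub>free_algebra\<^esub> z) = cls 0"
    "cls (z \<otimes>\<^bsub>free_algebra\<^esub> x) = cls 0"
    if "cls x = cls 0" "cls y = cls 0" for x y z c
  proof -
    have "cls x = \<zero>\<^bsub>Q\<^esub>" "cls y = \<zero>\<^bsub>Q\<^esub>" using that by simp_all
    then show "cls (x + y) = cls 0" "cls (fscale c x) = cls 0" "cls (x \<otimes>\<^bsub>free_algebra\<^esub> z) = cls 0"
      "cls (z \<otimes>\<^bsub>free_algebra\<^esub> x) = cls 0"
      by (simp_all only: Q_simps(2,3,4,5)[symmetric] Q_simps(6) Q.M.l_zero Q.M.zero_closed Q.scale_zero_r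
          Q.l_null Q.r_null)
  qed
  have "rel_ideal \<subseteq> ?N"
  proof (rule rel_ideal_subset)
    show "ideal ?N free_algebra"
      by (rule ideal_freeI) (simp_all add: antipode_free_mult zero)
    show "R \<subseteq> ?N" using antipode_relator by auto
  qed
  then show ?thesis using assms by auto
qed

text \<open>The counit is defined at some representative of the coset; this differs from
  \<open>f\<close> by an element of the ideal, where the counit vanishes. The antipode and the
  comultiplication are treated in the same way.\<close>

lemma counit_P: "counit P (cls f) = slift (\<lambda>w. prod_list (map E w)) f"
  using counit_ideal[of "(SOME x. x \<in> cls f) - f"] some_rep[of f]
  by (simp add: presented_hopf_def cls_eq_iff)

lemma antipode_P: "antipode P (cls f) = cls (flift (word_antipode T) f)"
proof -
  interpret Q: k_algebra Q by (rule k_algebra_quot)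
  let ?g = "SOME x. x \<in> cls f"
  have "cls (flift (word_antipode T) (?g - f)) = cls 0"
    by (rule antipode_ideal) (use some_rep[of f] in \<open>simp add: cls_eq_iff\<close>)
  then have "cls (flift (word_antipode T) ?g) = cls (flift (word_antipode T) f)"
    by (simp add: cls_eq_iff)
  then show ?thesis by (simp add: presented_hopf_def)
qed

lemma sweed_P:
  assumes "bil Q Q \<beta>"
  shows "sweed P (cls f) \<beta> = slift (\<lambda>(a, b). \<beta> (cls a) (cls b)) (flift (word_comult D) f)"
  using comult_ideal[OF _ assms, of "(SOME x. x \<in> cls f) - f"] some_rep[of f]
  by (simp add: presented_hopf_def sweed_def cls_eq_iff del: slift_flift)

lemma pre_hopf_P: "pre_hopf P"
proof -
  interpret P: k_algebra P
    unfolding presented_hopf_def by (rule k_algebra_extend[OF k_algebra_quot])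
  show ?thesis
  proof (unfold_locales, goal_cases)
    case (1 x)
    show ?case
      unfolding presented_hopf_def tmap_def by (auto intro!: order_trans[OF keys_flift] simp: carrier_Q)
  next
    case (5 \<beta> x y)
    interpret Q: k_algebra Q by (rule k_algebra_quot)
    have \<beta>: "bil Q Q \<beta>" using 5(1) by (simp add: bil_P)
    note \<beta>D = bilD[OF \<beta>]
    obtain f g where fg: "x = cls f" "y = cls g" using 5 by (auto simp: P_sel)
    have b1: "bil Q Q (\<lambda>a' b'. \<beta> (a \<otimes>\<^bsub>Q\<^esub> a') (b \<otimes>\<^bsub>Q\<^esub> b'))" if "a \<in> carrier Q" "b \<in> carrier Q" for a b
      using that by (simp add: bil_def k_functional_def \<beta>D Q.r_distr Q.smult_mult_r)
    have mult: "monoid.mult P = monoid.mult Q" by (simp add: presented_hopf_def)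
    have b2: "bil Q Q (\<lambda>a b. slift (\<lambda>(a', b'). \<beta> (a \<otimes>\<^bsub>Q\<^esub> cls a') (b \<otimes>\<^bsub>Q\<^esub> cls b')) (flift (word_comult D) g))"
      by (simp add: bil_def k_functional_def \<beta>D Q.l_distr Q.smult_mult_l case_prod_unfold slift_fun_add slift_cmult
          del: slift_flift cong: slift_cong)
    have "sweed P x (\<lambda>a b. sweed P y (\<lambda>a' b'. \<beta> (a \<otimes>\<^bsub>P\<^esub> a') (b \<otimes>\<^bsub>P\<^esub> b'))) =
        sweed P x (\<lambda>a b. slift (\<lambda>(a', b'). \<beta> (a \<otimes>\<^bsub>Q\<^esub> cls a') (b \<otimes>\<^bsub>Q\<^esub> cls b')) (flift (word_comult D) g))"
    proof -
      have "Poly_Mapping.keys (comult P x) \<subseteq> carrier Q \<times> carrier Q"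
        unfolding presented_hopf_def tmap_def by (auto intro!: order_trans[OF keys_flift] simp: carrier_Q)
      then show ?thesis
        unfolding sweed_def[of P x] mult fg(2)
        by (intro slift_cong refl) (auto simp: sweed_P[OF b1] simp del: slift_flift)
    qed
    then show ?case
      unfolding fg sweed_P[OF b2] P_sel(4) sweed_P[OF \<beta>] slift_comult_mult
      by (simp add: case_prod_unfold del: slift_flift)
  qed (auto simp: bil_P P_sel sweed_P counit_P antipode_P k_functional_def k_linear_def
      word_antipode_append antipode_free_mult slift_mult bilD)
qed

theorem hopf_algebra_P:
  assumes "\<And>g. pre_hopf.hopf_at P (cls (word [g]))"
  shows "hopf_algebra P"
proof -
  interpret P: pre_hopf P by (rule pre_hopf_P)
  show ?thesis
  proof (rule P.hopf_algebra_if_hopf_at)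
    fix x assume "x \<in> carrier P"
    then have "x \<in> carrier Q" by (simp add: P_sel carrier_Q)
    then show "P.hopf_at x"
    proof (induction rule: Q_induct)
      case one
      show ?case using P.hopf_at_one by (simp add: P_sel)
    next
      case (gen g w)
      then show ?case
        using P.hopf_at_mult[OF _ assms[of g] _ gen] by (simp add: P_sel)
    next
      case (add x y)
      then show ?case using P.hopf_at_add[of x y] by (simp add: presented_hopf_def)
    next
      case (scale c x)
      then show ?case using P.hopf_at_scale[of x c] by (simp add: presented_hopf_def)
    qed
  qed
qed

end

section \<open>The universal property of a presented algebra\<close>

context presented
begin

theorem presented_hom:
  fixes A :: "('k, 'a, 'n) module_scheme" (structure)
  assumes "k_algebra A" and u: "\<And>g. u g \<in> carrier A"
    and rel: "\<And>r. r \<in> R \<Longrightarrow> mlift A (\<lambda>w. foldr (\<lambda>g x. u g \<otimes> x) w \<one>) r = \<zero>"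
  obtains F where "k_linear Q A F" "F \<in> ring_hom Q A" "\<And>g. F (cls (word [g])) = u g"
proof -
  interpret A: k_algebra A by fact
  interpret Q: k_algebra Q by (rule k_algebra_quot)
  define v where "v w = foldr (\<lambda>g x. u g \<otimes> x) w \<one>" for w
  have v_closed [simp]: "v w \<in> carrier A" for w
    unfolding v_def by (induction w) (simp_all add: u)
  have v_append: "v (w @ w') = v w \<otimes> v w'" for w w'
    by (induction w) (simp_all add: v_def u A.m_assoc v_closed[unfolded v_def])
  define M where "M = mlift A v"
  have M_closed [simp]: "M f \<in> carrier A" for f
    unfolding M_def by (rule A.mlift_closed) auto
  have lM: "l (M f) = slift (\<lambda>w. l (v w)) f" if "k_functional A l" for l f
    unfolding M_def by (rule A.functional_mlift[OF that]) auto
  have M_add: "M (f + g) = M f \<oplus> M g" for f g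
    by (rule A.functional_ext) (simp_all add: k_functionalD lM)
  have M_scale: "M (fscale c f) = c \<odot> M f" for c f
    by (rule A.functional_ext) (simp_all add: k_functionalD lM)
  have M_mult: "M (f \<otimes>\<^bsub>free_algebra\<^esub> g) = M f \<otimes> M g" for f g
  proof (rule A.functional_ext)
    fix l assume l: "k_functional A l"
    have "k_functional A (\<lambda>x. l (x \<otimes> M g))" "\<And>y. y \<in> carrier A \<Longrightarrow> k_functional A (\<lambda>x. l (y \<otimes> x))"
      by (simp_all add: k_functional_def k_functionalD[OF l] A.l_distr A.r_distr A.smult_mult_l A.smult_mult_r)
    note * = lM[OF this(1)] lM[OF this(2)]
    show "l (M (f \<otimes>\<^bsub>free_algebra\<^esub> g)) = l (M f \<otimes> M g)"
      by (simp add: lM[OF l] * v_append)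
  qed simp_all
  have M_word: "M (word w) = v w" for w
    by (rule A.functional_ext) (simp_all add: lM)
  have M_zero: "M 0 = \<zero>" by (simp add: M_def mlift_def)
  have "rel_ideal \<subseteq> {f. M f = \<zero>}"
  proof (rule rel_ideal_subset)
    show "ideal {f. M f = \<zero>} free_algebra"
      by (rule ideal_freeI) (simp_all add: M_zero M_add M_scale M_mult)
    show "R \<subseteq> {f. M f = \<zero>}" using rel by (auto simp: M_def v_def[abs_def])
  qed
  then have M_cong: "M f = M g" if "cls f = cls g" for f g
    using that M_add[of "f - g" g] by (auto simp: cls_eq_iff)
  define F where "F Z = M (SOME f. f \<in> Z)" for Z
  have F: "F (cls f) = M f" for f
    unfolding F_def by (rule M_cong) (rule some_rep)
  show ?thesis
  proof (rule that[of F])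
    show "k_linear Q A F"
      by (auto simp: k_linear_def carrier_Q F M_add M_scale)
    show "F \<in> ring_hom Q A"
      by (rule ring_hom_memI) (auto simp: carrier_Q F M_add M_mult M_word v_def)
    show "F (cls (word [g])) = u g" for g
      by (simp add: F M_word v_def u)
  qed
qed

end

section \<open>Hopf pairings and homomorphisms into the finite dual\<close>

lemma sweed_product:
  "sweed H x \<beta> * sweed G y \<gamma> = sweed H x (\<lambda>a b. sweed G y (\<lambda>c d. \<beta> a b * \<gamma> c d))"
  by (simp add: sweed_cmult sweed_cmult_right)

text \<open>An algebra map \<open>F\<close> from \<open>B\<close> to the convolution algebra \<open>H\<^sup>*\<close> that is compatible with the
  multiplication of \<open>H\<close> on generators of \<open>B\<close> is the same as a Hopf algebra map from \<open>H\<close> to the finite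
  dual of \<open>B\<close>.\<close>

locale dual_map = H: hopf_algebra H + B: hopf_algebra B
  for H :: "('k::field, 'h, 'm) hopf_scheme" and B :: "('k, 'b, 'n) hopf_scheme" and F :: "'b \<Rightarrow> 'h \<Rightarrow> 'k" +
  assumes F_linear: "k_linear B (dual_algebra H) F"
    and F_hom: "F \<in> ring_hom B (dual_algebra H)"
begin

text \<open>An algebra map \<open>F\<close> into the dual is a pairing of \<open>B\<close> with
  \<open>H\<close> that satisfies half of the axioms of a Hopf pairing. This is the other half, at a
  single element \<open>b\<close>.\<close>

definition multiplicative_at :: "'b \<Rightarrow> bool"
  where "multiplicative_at b \<longleftrightarrow> F b \<one>\<^bsub>H\<^esub> = counit B b \<and>
    (\<forall>h\<in>carrier H. \<forall>h'\<in>carrier H. F b (h \<otimes>\<^bsub>H\<^esub> h') = sweed B b (\<lambda>b1 b2. F b1 h * F b2 h'))"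

lemma F_functional: "b \<in> carrier B \<Longrightarrow> k_functional H (F b)"
  using F_linear by (auto simp: k_linear_def H.dual_carrier)

lemma F_simps:
  assumes "h \<in> carrier H" "b \<in> carrier B" "b' \<in> carrier B"
  shows "F (b \<otimes>\<^bsub>B\<^esub> b') h = sweed H h (\<lambda>h1 h2. F b h1 * F b' h2)"
    "F (b \<oplus>\<^bsub>B\<^esub> b') h = F b h + F b' h"
    "F (c \<odot>\<^bsub>B\<^esub> b) h = c * F b h"
  using assms F_linear ring_hom_mult[OF F_hom] by (auto simp: k_linear_def)

lemma F_one: "h \<in> carrier H \<Longrightarrow> F \<one>\<^bsub>B\<^esub> h = counit H h"
  using ring_hom_one[OF F_hom] by simp

lemma bil_F: "h \<in> carrier H \<Longrightarrow> h' \<in> carrier H \<Longrightarrow> bil B B (\<lambda>b1 b2. F b1 h * F b2 h')"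
  by (simp add: bil_def k_functional_def F_simps algebra_simps)

lemma bil_F': "b \<in> carrier B \<Longrightarrow> b' \<in> carrier B \<Longrightarrow> bil H H (\<lambda>h1 h2. F b h1 * F b' h2)"
  by (intro H.bil_mult F_functional)

lemma multiplicative_at_one: "multiplicative_at \<one>\<^bsub>B\<^esub>"
  unfolding multiplicative_at_def
  by (simp add: F_one B.sweed_one[OF bil_F] B.counit_one H.counit_one H.counit_mult)

lemma multiplicative_at_add:
  "\<lbrakk>x \<in> carrier B; y \<in> carrier B; multiplicative_at x; multiplicative_at y\<rbrakk> \<Longrightarrow> multiplicative_at (x \<oplus>\<^bsub>B\<^esub> y)"
  unfolding multiplicative_at_def by (simp add: F_simps B.counit_add B.sweed_add[OF bil_F])

lemma multiplicative_at_scale: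
  "\<lbrakk>x \<in> carrier B; multiplicative_at x\<rbrakk> \<Longrightarrow> multiplicative_at (c \<odot>\<^bsub>B\<^esub> x)"
  unfolding multiplicative_at_def by (simp add: F_simps(3)[where b' = x] B.counit_scale B.sweed_scale[OF bil_F])

text \<open>Expanding with both comultiplications gives the same four sums in a different order,
  because F(xy) is a convolution product. Checking generators of \<open>B\<close> is therefore
  enough.\<close>

lemma multiplicative_at_mult:
  assumes x: "x \<in> carrier B" "multiplicative_at x" and y: "y \<in> carrier B" "multiplicative_at y"
  shows "multiplicative_at (x \<otimes>\<^bsub>B\<^esub> y)"
  unfolding multiplicative_at_def
proof (intro conjI ballI)
  show "F (x \<otimes>\<^bsub>B\<^esub> y) \<one>\<^bsub>H\<^esub> = counit B (x \<otimes>\<^bsub>B\<^esub> y)"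
    using x y by (simp add: F_simps H.sweed_one[OF bil_F'] B.counit_mult multiplicative_at_def)
  fix h h' assume h: "h \<in> carrier H" "h' \<in> carrier H"
  have "F (x \<otimes>\<^bsub>B\<^esub> y) (h \<otimes>\<^bsub>H\<^esub> h') = sweed H h (\<lambda>h1 h2. sweed H h' (\<lambda>h1' h2'.
      F x (h1 \<otimes>\<^bsub>H\<^esub> h1') * F y (h2 \<otimes>\<^bsub>H\<^esub> h2')))"
    using x(1) y(1) h by (simp add: F_simps H.sweed_mult[OF bil_F'])
  also have "\<dots> = sweed H h (\<lambda>h1 h2. sweed H h' (\<lambda>h1' h2'.
      sweed B x (\<lambda>x1 x2. sweed B y (\<lambda>y1 y2. (F x1 h1 * F y1 h2) * (F x2 h1' * F y2 h2')))))"
    using x y h unfolding multiplicative_at_def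
    by (simp add: sweed_product cong: H.sweed_cong) (simp add: mult_ac)
  also have "\<dots> = sweed H h (\<lambda>h1 h2. sweed B x (\<lambda>x1 x2. sweed B y (\<lambda>y1 y2. sweed H h' (\<lambda>h1' h2'.
      (F x1 h1 * F y1 h2) * (F x2 h1' * F y2 h2')))))"
    by (simp only: sweed_swap[of H h'])
  also have "\<dots> = sweed B x (\<lambda>x1 x2. sweed B y (\<lambda>y1 y2. sweed H h (\<lambda>h1 h2. F x1 h1 * F y1 h2) *
      sweed H h' (\<lambda>h1' h2'. F x2 h1' * F y2 h2')))"
    by (simp only: sweed_swap[of H h] sweed_cmult sweed_cmult_right)
  also have "\<dots> = sweed B (x \<otimes>\<^bsub>B\<^esub> y) (\<lambda>b1 b2. F b1 h * F b2 h')"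
    using x(1) y(1) h by (simp add: B.sweed_mult[OF bil_F] F_simps cong: B.sweed_cong)
  finally show "F (x \<otimes>\<^bsub>B\<^esub> y) (h \<otimes>\<^bsub>H\<^esub> h') = sweed B (x \<otimes>\<^bsub>B\<^esub> y) (\<lambda>b1 b2. F b1 h * F b2 h')" .
qed

definition transpose :: "'h \<Rightarrow> 'b \<Rightarrow> 'k"
  where "transpose = (\<lambda>h\<in>carrier H. \<lambda>b\<in>carrier B. F b h)"

lemma transpose_apply: "\<lbrakk>h \<in> carrier H; b \<in> carrier B\<rbrakk> \<Longrightarrow> transpose h b = F b h"
  by (simp add: transpose_def)

text \<open>F(xby)(h) is the sum of F(x)(h1) F(b)(h2) F(y)(h3). In one representative only finitely
  many h2 occur, and the values of F(b) at these form the family required by the membership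
  test.\<close>

lemma transpose_finite_dual:
  assumes h: "h \<in> carrier H"
  shows "transpose h \<in> finite_dual_carrier B"
proof -
  \<comment> \<open>The middle components h2: second components in the coproducts of the first
    components of the coproduct of \<open>h\<close>.\<close>
  define L where "L = (\<Union>p\<in>Poly_Mapping.keys (comult H h). snd ` Poly_Mapping.keys (comult H (fst p)))"
  have keys: "p \<in> carrier H \<times> carrier H" if "p \<in> Poly_Mapping.keys (comult H g)" "g \<in> carrier H" for p g
    using that H.comult_closed by blast
  show ?thesis
  proof (rule B.finite_dualI[of _ "(\<lambda>q b. F b q) ` L"])
    show "transpose h \<in> extensional (carrier B)" using h by (simp add: transpose_def)
    show "k_functional B (transpose h)"
      using h by (simp add: k_functional_def transpose_apply F_simps)
    show "finite ((\<lambda>q b. F b q) ` L)" by (simp add: L_def)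
    show "k_functional B g" if "g \<in> (\<lambda>q b. F b q) ` L" for g
    proof -
      obtain q where q: "q \<in> L" "g = (\<lambda>b. F b q)" using \<open>g \<in> _\<close> by blast
      obtain p r where p: "p \<in> Poly_Mapping.keys (comult H h)" "r \<in> Poly_Mapping.keys (comult H (fst p))" "q = snd r"
        using q(1) by (auto simp: L_def)
      have "fst p \<in> carrier H" using keys[OF p(1) h] by auto
      then have "q \<in> carrier H" using keys[OF p(2)] p(3) by auto
      then show ?thesis by (simp add: q(2) k_functional_def F_simps)
    qed
    fix b x y
    assume b: "b \<in> carrier B" "\<And>g. g \<in> (\<lambda>q b. F b q) ` L \<Longrightarrow> g b = 0" and xy: "x \<in> carrier B" "y \<in> carrier B"
    have zero: "F b q = 0" if "q \<in> L" for q using b(2)[of "\<lambda>b. F b q"] that by blast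
    have "transpose h (x \<otimes>\<^bsub>B\<^esub> b \<otimes>\<^bsub>B\<^esub> y) = slift (\<lambda>p. slift (\<lambda>q. F x (fst q) * F b (snd q)) (comult H (fst p)) * F y (snd p)) (comult H h)"
      using b(1) xy h keys[OF _ h]
      by (simp add: transpose_apply F_simps) (simp add: sweed_def case_prod_unfold F_simps mem_Times_iff cong: slift_cong)
    also have "\<dots> = slift (\<lambda>p. 0) (comult H h)"
    proof (intro slift_cong refl)
      fix p assume p: "p \<in> Poly_Mapping.keys (comult H h)"
      have "F b (snd q) = 0" if "q \<in> Poly_Mapping.keys (comult H (fst p))" for q
        by (rule zero) (use that p in \<open>auto simp: L_def\<close>)
      then show "slift (\<lambda>q. F x (fst q) * F b (snd q)) (comult H (fst p)) * F y (snd p) = 0"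
        by (simp cong: slift_cong)
    qed
    finally show "transpose h (x \<otimes>\<^bsub>B\<^esub> b \<otimes>\<^bsub>B\<^esub> y) = 0" by simp
  qed
qed

text \<open>The two halves of the pairing axioms change places: multiplicativity of \<open>F\<close>
  makes the transpose comultiplicative, and \<open>multiplicative_at\<close> makes it
  multiplicative.\<close>

theorem hopf_hom_transpose:
  assumes "\<And>b. b \<in> carrier B \<Longrightarrow> multiplicative_at b"
  shows "hopf_hom H (finite_dual B) transpose"
proof (rule hopf_homI[OF H.hopf_algebra_axioms B.hopf_algebra_finite_dual])
  note ext = extensionalityI[of _ "carrier B"]
  have [simp]: "transpose h \<in> extensional (carrier B)" if "h \<in> carrier H" for h
    using that by (simp add: transpose_def)
  show "k_linear H (finite_dual B) transpose"
    unfolding k_linear_def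
    by (auto simp: finite_dual_sel transpose_finite_dual transpose_apply k_functionalD[OF F_functional] intro!: ext)
  show "transpose \<one>\<^bsub>H\<^esub> = \<one>\<^bsub>finite_dual B\<^esub>"
    using assms by (auto simp: finite_dual_sel transpose_apply multiplicative_at_def intro!: ext)
  show "transpose (x \<otimes>\<^bsub>H\<^esub> y) = transpose x \<otimes>\<^bsub>finite_dual B\<^esub> transpose y"
    if "x \<in> carrier H" "y \<in> carrier H" for x y
    using assms that
    by (auto simp: finite_dual_sel transpose_apply multiplicative_at_def intro!: ext cong: B.sweed_cong)
  show "counit (finite_dual B) (transpose x) = counit H x" if "x \<in> carrier H" for x
    using that by (simp add: finite_dual_sel transpose_apply F_one)
  show "sweed (finite_dual B) (transpose x) \<beta> = sweed H x (\<lambda>a b. \<beta> (transpose a) (transpose b))"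
    if x: "x \<in> carrier H" and \<beta>: "bil (finite_dual B) (finite_dual B) \<beta>" for x \<beta>
  proof -
    have "sweed (finite_dual B) (transpose x) \<beta> = slift (\<lambda>(a, b). \<beta> a b) (tmap transpose transpose (comult H x))"
    proof (rule B.sweed_finite_dualI[OF transpose_finite_dual[OF x] \<beta>])
      show "Poly_Mapping.keys (tmap transpose transpose (comult H x)) \<subseteq> finite_dual_carrier B \<times> finite_dual_carrier B"
        using H.comult_closed[OF x] transpose_finite_dual unfolding tmap_def
        by (intro order_trans[OF keys_flift]) auto
      fix g h assume "g \<in> carrier B" "h \<in> carrier B"
      moreover from this have "sweed H x (\<lambda>a b. transpose a g * transpose b h) = sweed H x (\<lambda>a b. F g a * F h b)"
        using x by (intro H.sweed_cong) (simp_all add: transpose_apply)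
      ultimately show "slift (\<lambda>(a, b). a g * b h) (tmap transpose transpose (comult H x)) = transpose x (g \<otimes>\<^bsub>B\<^esub> h)"
        using x by (simp add: transpose_apply F_simps) (simp add: sweed_def)
    qed
    then show ?thesis by (simp add: sweed_def)
  qed
qed

end

text \<open>For uniqueness: the elements of \<open>B\<close> at which two homomorphisms into its
  finite dual agree form a subalgebra stable under the antipode. Products are covered because both
  maps preserve the comultiplication, and the antipode supplies inverses of grouplike
  generators.\<close>

locale two_dual_homs = H: hopf_algebra H + B: hopf_algebra B
  for H :: "('k::field, 'h, 'm) hopf_scheme" and B :: "('k, 'b, 'n) hopf_scheme" +
  fixes f f' :: "'h \<Rightarrow> 'b \<Rightarrow> 'k"
  assumes f: "hopf_hom H (finite_dual B) f" and f': "hopf_hom H (finite_dual B) f'"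
begin

definition agree_at :: "'b \<Rightarrow> bool" where "agree_at b \<longleftrightarrow> (\<forall>h\<in>carrier H. f h b = f' h b)"

lemma in_finite_dual: "h \<in> carrier H \<Longrightarrow> f h \<in> finite_dual_carrier B" "h \<in> carrier H \<Longrightarrow> f' h \<in> finite_dual_carrier B"
  using f f' by (auto simp: hopf_hom_def k_linear_def finite_dual_sel)

lemma agree_at_one: "agree_at \<one>\<^bsub>B\<^esub>"
  using f f' by (simp add: agree_at_def hopf_hom_def finite_dual_sel)

lemma agree_at_add: "\<lbrakk>x \<in> carrier B; y \<in> carrier B; agree_at x; agree_at y\<rbrakk> \<Longrightarrow> agree_at (x \<oplus>\<^bsub>B\<^esub> y)"
  using in_finite_dual[THEN finite_dual_carrierD(2)] by (simp add: agree_at_def k_functionalD)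

lemma agree_at_scale: "\<lbrakk>x \<in> carrier B; agree_at x\<rbrakk> \<Longrightarrow> agree_at (c \<odot>\<^bsub>B\<^esub> x)"
  using in_finite_dual[THEN finite_dual_carrierD(2)] by (simp add: agree_at_def k_functionalD)

lemma agree_at_antipode: "\<lbrakk>x \<in> carrier B; agree_at x\<rbrakk> \<Longrightarrow> agree_at (antipode B x)"
proof -
  have "g h (antipode B x) = g (antipode H h) x" if "hopf_hom H (finite_dual B) g" "h \<in> carrier H" "x \<in> carrier B" for g h x
  proof -
    have "antipode (finite_dual B) (g h) x = g (antipode H h) x"
      using that by (simp add: hopf_hom_def)
    then show ?thesis using that by (simp add: finite_dual_sel)
  qed
  from this[OF f] this[OF f'] show "\<lbrakk>x \<in> carrier B; agree_at x\<rbrakk> \<Longrightarrow> agree_at (antipode B x)"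
    by (simp add: agree_at_def)
qed

lemma agree_at_mult:
  assumes "x \<in> carrier B" "y \<in> carrier B" "agree_at x" "agree_at y"
  shows "agree_at (x \<otimes>\<^bsub>B\<^esub> y)"
  unfolding agree_at_def
proof
  fix h assume h: "h \<in> carrier H"
  have bil: "bil (finite_dual B) (finite_dual B) (\<lambda>l m. l x * m y)"
    using assms(1,2) by (simp add: bil_def k_functional_def finite_dual_sel algebra_simps)
  have "f h (x \<otimes>\<^bsub>B\<^esub> y) = sweed H h (\<lambda>a b. f a x * f b y)"
    using B.comult_finite_dual(2)[OF in_finite_dual(1)[OF h] assms(1,2)] hopf_hom_sweed[OF f h bil] by simp
  moreover have "f' h (x \<otimes>\<^bsub>B\<^esub> y) = sweed H h (\<lambda>a b. f' a x * f' b y)"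
    using B.comult_finite_dual(2)[OF in_finite_dual(2)[OF h] assms(1,2)] hopf_hom_sweed[OF f' h bil] by simp
  ultimately show "f h (x \<otimes>\<^bsub>B\<^esub> y) = f' h (x \<otimes>\<^bsub>B\<^esub> y)"
    using assms(3,4) h by (simp add: agree_at_def cong: H.sweed_cong)
qed

lemma agree_all:
  assumes "\<And>b. b \<in> carrier B \<Longrightarrow> agree_at b" "h \<in> carrier H"
  shows "f h = f' h"
  using assms in_finite_dual[THEN finite_dual_carrierD(1)]
  by (intro extensionalityI[of _ "carrier B"]) (auto simp: agree_at_def)

end

subsection \<open>Transport of structure\<close>

lemma transport_sel [simp]:
  "carrier (transport_hopf Z f G) = Z"
  "x \<otimes>\<^bsub>transport_hopf Z f G\<^esub> y = inv_into Z f (f x \<otimes>\<^bsub>G\<^esub> f y)"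
  "\<one>\<^bsub>transport_hopf Z f G\<^esub> = inv_into Z f \<one>\<^bsub>G\<^esub>"
  "\<zero>\<^bsub>transport_hopf Z f G\<^esub> = inv_into Z f \<zero>\<^bsub>G\<^esub>"
  "x \<oplus>\<^bsub>transport_hopf Z f G\<^esub> y = inv_into Z f (f x \<oplus>\<^bsub>G\<^esub> f y)"
  "c \<odot>\<^bsub>transport_hopf Z f G\<^esub> x = inv_into Z f (c \<odot>\<^bsub>G\<^esub> f x)"
  "counit (transport_hopf Z f G) x = counit G (f x)"
  "antipode (transport_hopf Z f G) x = inv_into Z f (antipode G (f x))"
  by (simp_all add: transport_hopf_def)

lemma sweed_transport:
  "sweed (transport_hopf Z f G) x \<beta> = sweed G (f x) (\<lambda>a b. \<beta> (inv_into Z f a) (inv_into Z f b))"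
  by (simp add: sweed_def transport_hopf_def)

theorem hopf_algebra_transport:
  fixes G :: "('k::field, 'g, 'm) hopf_scheme"
  assumes "hopf_algebra G" and f: "bij_betw f Z (carrier G)"
  shows "hopf_algebra (transport_hopf Z f G)"
proof -
  interpret G: hopf_algebra G by fact
  let ?T = "transport_hopf Z f G" and ?g = "inv_into Z f"
  have f_closed [simp]: "x \<in> Z \<Longrightarrow> f x \<in> carrier G" for x using f by (auto simp: bij_betw_def)
  have gf [simp]: "x \<in> Z \<Longrightarrow> ?g (f x) = x" for x using f by (simp add: bij_betw_inv_into_left)
  have fg [simp]: "y \<in> carrier G \<Longrightarrow> f (?g y) = y" for y using f by (simp add: bij_betw_inv_into_right)
  have g_closed [simp]: "y \<in> carrier G \<Longrightarrow> ?g y \<in> Z" for y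
    using f by (metis bij_betw_imp_surj_on inv_into_into)
  interpret T: k_algebra ?T
  proof (rule k_algebraI, goal_cases)
    case (7 x y) then show ?case by (simp add: G.a_comm)
  qed (simp_all add: G.a_assoc G.m_assoc G.l_distr G.r_distr G.scale_add_l G.scale_add_r
      G.scale_assoc G.smult_mult_l G.smult_mult_r)
  have functional: "k_functional G (\<lambda>x. l (?g x))" if "k_functional ?T l" for l
    unfolding k_functional_def
  proof (intro conjI ballI allI)
    fix x y assume "x \<in> carrier G" "y \<in> carrier G"
    then show "l (?g (x \<oplus>\<^bsub>G\<^esub> y)) = l (?g x) + l (?g y)"
      using k_functionalD(1)[OF that, of "?g x" "?g y"] by simp
  next
    fix c x assume "x \<in> carrier G"
    then show "l (?g (c \<odot>\<^bsub>G\<^esub> x)) = c * l (?g x)"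
      using k_functionalD(2)[OF that, of "?g x" c] by simp
  qed
  have bil: "bil G G (\<lambda>a b. \<beta> (?g a) (?g b))" if "bil ?T ?T \<beta>" for \<beta>
    unfolding bil_def
  proof (intro conjI ballI)
    fix a assume "a \<in> carrier G"
    then show "k_functional G (\<lambda>b. \<beta> (?g a) (?g b))" "k_functional G (\<lambda>b. \<beta> (?g b) (?g a))"
      using that by (auto simp: bil_def intro: functional[of "\<beta> (?g a)"] functional[of "\<lambda>b. \<beta> b (?g a)"])
  qed
  have tril: "tril G G G (\<lambda>a b c. \<tau> (?g a) (?g b) (?g c))" if "tril ?T ?T ?T \<tau>" for \<tau>
    unfolding tril_def
  proof (intro conjI ballI)
    show "bil G G (\<lambda>b c. \<tau> (?g a) (?g b) (?g c))" if "a \<in> carrier G" for a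
      using \<open>tril ?T ?T ?T \<tau>\<close> that by (intro bil) (simp add: tril_def)
    show "k_functional G (\<lambda>a. \<tau> (?g a) (?g b) (?g c))" if "b \<in> carrier G" "c \<in> carrier G" for b c
      using \<open>tril ?T ?T ?T \<tau>\<close> that by (intro functional[of "\<lambda>a. \<tau> a (?g b) (?g c)"]) (simp add: tril_def)
  qed
  have "pre_bialgebra ?T"
  proof (unfold_locales, goal_cases)
    case (1 x)
    then show ?case
      using G.comult_closed[of "f x"] unfolding transport_hopf_def tmap_def
      by (auto intro!: order_trans[OF keys_flift])
  next
    case (5 \<beta> x y)
    then show ?case
      by (simp add: sweed_transport G.sweed_mult[OF bil] cong: G.sweed_cong)
  qed (simp_all add: sweed_transport G.sweed_add[OF bil] G.sweed_scale[OF bil] G.sweed_one[OF bil])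
  then show ?thesis
  proof (rule hopf_algebraI, goal_cases)
    case 1 show ?case by (simp add: k_functional_def G.counit_add G.counit_scale)
  next
    case (4 \<tau> x)
    then show ?case
      using G.sweed_coassoc[OF tril[OF 4(1)], of "f x"] by (simp add: sweed_transport cong: G.sweed_cong)
  next
    case (5 l x)
    then show ?case
      using G.sweed_counit_l[OF functional[OF 5(1)], of "f x"] by (simp add: sweed_transport cong: G.sweed_cong)
  next
    case (6 l x)
    then show ?case
      using G.sweed_counit_r[OF functional[OF 6(1)], of "f x"] by (simp add: sweed_transport cong: G.sweed_cong)
  next
    case 7 show ?case by (auto simp: k_linear_def G.antipode_add G.antipode_scale)
  next
    case (8 l x)
    then show ?case
      using G.sweed_antipode_l[OF functional[OF 8(1)], of "f x"] by (simp add: sweed_transport cong: G.sweed_cong)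
  next
    case (9 l x)
    then show ?case
      using G.sweed_antipode_r[OF functional[OF 9(1)], of "f x"] by (simp add: sweed_transport cong: G.sweed_cong)
  qed (simp_all add: G.counit_one G.counit_mult)
qed

subsection \<open>The algebra of dual numbers\<close>

lemma poly_algebra_sel [simp]:
  "carrier poly_algebra = UNIV" "p \<otimes>\<^bsub>poly_algebra\<^esub> q = p * q" "\<one>\<^bsub>poly_algebra\<^esub> = 1"
  "\<zero>\<^bsub>poly_algebra\<^esub> = 0" "p \<oplus>\<^bsub>poly_algebra\<^esub> q = p + q" "c \<odot>\<^bsub>poly_algebra\<^esub> p = Polynomial.smult c p"
  by (simp_all add: poly_algebra_def ring_of_type_algebra_def ring.defs module.defs)

interpretation poly: k_algebra "poly_algebra :: ('k::field, 'k poly) module"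
  by (rule k_algebraI) (simp_all add: algebra_simps smult_add_left smult_add_right)

lemma poly_minus [simp]: "p \<ominus>\<^bsub>poly_algebra\<^esub> q = p - (q :: 'k::field poly)"
proof -
  have "\<ominus>\<^bsub>poly_algebra\<^esub> q = - q" by (rule poly.minus_equality) simp_all
  then show ?thesis by (simp add: a_minus_def)
qed

lemma x_squared_mult: "[:0, 1:]\<^sup>2 * (p :: 'k::field poly) = pCons 0 (pCons 0 p)"
  by (simp add: power2_eq_square)

lemma quotient_x_squared: "quotient_algebra (poly_algebra :: ('k::field, 'k poly) module) x_squared_ideal"
  unfolding x_squared_ideal_def
  by (intro quotient_algebra.intro poly.k_algebra_axioms poly.genideal_ideal) simp

abbreviation tproj :: "'k::field poly \<Rightarrow> 'k poly set"
  where "tproj \<equiv> quotient_algebra.proj poly_algebra x_squared_ideal"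

lemmas tproj_def = quotient_algebra.proj_def[OF quotient_x_squared]
  and tproj_eq_iff = quotient_algebra.proj_eq_iff[OF quotient_x_squared, simplified]
  and trunc_quot_simps = quotient_algebra.quot_simps[OF quotient_x_squared, folded trunc_def, simplified]

lemma x_squared_ideal_iff: "f \<in> x_squared_ideal \<longleftrightarrow> (\<exists>h. f = pCons 0 (pCons 0 (h :: 'k::field poly)))"
proof
  have "ideal {f. \<exists>h. f = [:0, 1:]\<^sup>2 * h} (poly_algebra :: ('k, 'k poly) module)"
  proof (rule idealI)
    show "ring (poly_algebra :: ('k, 'k poly) module)" ..
    show "subgroup {f. \<exists>h. f = [:0, 1:]\<^sup>2 * h} (add_monoid (poly_algebra :: ('k, 'k poly) module))"
    proof
      fix f :: "'k poly" assume "f \<in> {f. \<exists>h. f = [:0, 1:]\<^sup>2 * h}"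
      then obtain h where h: "f = [:0, 1:]\<^sup>2 * h" by blast
      have "\<ominus>\<^bsub>poly_algebra\<^esub> f = - f" by (rule poly.minus_equality) simp_all
      also have "\<dots> = [:0, 1:]\<^sup>2 * (- h)" using h by simp
      finally show "inv\<^bsub>add_monoid poly_algebra\<^esub> f \<in> {f. \<exists>h. f = [:0, 1:]\<^sup>2 * h}"
        unfolding a_inv_def by blast
    qed (auto simp: distrib_left[symmetric] intro: exI[of _ 0])
  qed (auto simp: mult.assoc mult.left_commute)
  from poly.genideal_minimal[OF this, of "{[:0, 1:]\<^sup>2}"]
  have "x_squared_ideal \<subseteq> {f. \<exists>h. f = [:0, 1:]\<^sup>2 * (h :: 'k poly)}"
    unfolding x_squared_ideal_def by (auto intro: exI[of _ 1])
  then show "f \<in> x_squared_ideal \<Longrightarrow> \<exists>h. f = pCons 0 (pCons 0 h)"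
    by (auto simp: x_squared_mult)
next
  assume "\<exists>h. f = pCons 0 (pCons 0 h)"
  then obtain h where "f = [:0, 1:]\<^sup>2 * h" by (auto simp: x_squared_mult)
  moreover have "[:0, 1:]\<^sup>2 \<in> (x_squared_ideal :: 'k poly set)"
    unfolding x_squared_ideal_def using poly.genideal_self'[of "[:0, 1:]\<^sup>2"] by simp
  ultimately show "f \<in> x_squared_ideal"
    using ideal.I_r_closed[OF quotient_algebra.axioms(2)[OF quotient_x_squared], of "[:0, 1:]\<^sup>2" h] by simp
qed

definition el :: "'k::field \<Rightarrow> 'k \<Rightarrow> 'k poly set"
  where "el p q = p \<odot>\<^bsub>trunc\<^esub> bar1 \<oplus>\<^bsub>trunc\<^esub> q \<odot>\<^bsub>trunc\<^esub> barx"

lemma k_algebra_trunc: "k_algebra trunc"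
  unfolding trunc_def by (rule quotient_algebra.k_algebra_quot[OF quotient_x_squared])

interpretation tr: k_algebra "trunc :: ('k::field, 'k poly set) module"
  by (rule k_algebra_trunc)

lemma el_proj:
  fixes p q :: "'k::field"
  shows "el p q = tproj [:p, q:]"
proof -
  have b: "bar1 = (tproj 1 :: 'k poly set)" "barx = (tproj [:0, 1:] :: 'k poly set)"
    by (simp_all add: bar1_def barx_def tproj_def)
  show ?thesis unfolding el_def b trunc_quot_simps by (simp add: one_pCons)
qed

lemma proj_el: "tproj f = el (coeff f 0) (coeff f 1)" for f :: "'k::field poly"
proof -
  obtain a b h where f: "f = pCons a (pCons b h)" by (metis pCons_cases)
  have "f - [:a, b:] = pCons 0 (pCons 0 h)" by (simp add: f)
  then show ?thesis by (simp add: el_proj tproj_eq_iff x_squared_ideal_iff f)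
qed

lemma el_eq_iff [simp]: "el p q = el p' q' \<longleftrightarrow> p = p' \<and> q = q'"
  by (auto simp: el_proj tproj_eq_iff x_squared_ideal_iff pCons_eq_0_iff)

lemma el_simps [simp]:
  fixes p q :: "'k::field"
  shows "el p q \<oplus>\<^bsub>trunc\<^esub> el p' q' = el (p + p') (q + q')"
    "c \<odot>\<^bsub>trunc\<^esub> el p q = el (c * p) (c * q)"
    "el p q \<otimes>\<^bsub>trunc\<^esub> el p' q' = el (p * p') (p * q' + q * p')"
    "\<one>\<^bsub>trunc\<^esub> = el (1 :: 'k) 0" "\<zero>\<^bsub>trunc\<^esub> = el (0 :: 'k) 0" "el p q \<in> carrier trunc"
proof -
  have "el p q \<otimes>\<^bsub>trunc\<^esub> el p' q' = tproj ([:p, q:] * [:p', q':])"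
    unfolding el_proj trunc_quot_simps ..
  then show "el p q \<otimes>\<^bsub>trunc\<^esub> el p' q' = el (p * p') (p * q' + q * p')"
    unfolding proj_el by (simp add: coeff_mult)
  show "\<one>\<^bsub>trunc\<^esub> = el (1 :: 'k) 0" "\<zero>\<^bsub>trunc\<^esub> = el (0 :: 'k) 0"
    unfolding trunc_quot_simps proj_el by simp_all
  show "el p q \<in> carrier trunc"
    unfolding trunc_quot_simps el_proj by (rule rangeI)
qed (simp_all add: el_proj trunc_quot_simps)

lemma carrier_trunc: "carrier trunc = {el p q |p q. True}"
proof -
  have "tproj f \<in> {el p q |p q. True}" for f :: "'a poly"
    unfolding proj_el by blast
  moreover have "el p q \<in> range tproj" for p q :: 'a
    unfolding el_proj by simp
  ultimately have "range tproj = {el p q |p q :: 'a. True}" by fast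
  then show ?thesis unfolding trunc_quot_simps by simp
qed

lemma trunc_cases: "a \<in> carrier trunc \<Longrightarrow> (\<And>p q. a = el p q \<Longrightarrow> P) \<Longrightarrow> P"
  by (auto simp: carrier_trunc)

lemma bar1_el: "bar1 = el 1 0" and barx_el: "barx = el 0 1"
  using el_simps(4)
  by (simp_all add: el_proj bar1_def barx_def tproj_def one_pCons)

lemma coords_el [simp]: "coords (el p q) = (p, q)"
proof -
  have "coords (el p q) = (THE x. case x of (p', q') \<Rightarrow> el p q = el p' q')"
    by (simp add: coords_def el_def)
  also have "\<dots> = (p, q)" by (rule the_equality) auto
  finally show ?thesis .
qed

lemma lin_op_el [simp]: "lin_op (el a b) (el c d) (el p q) = el (p * a + q * c) (p * b + q * d)"
  by (simp add: lin_op_def)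

lemma functional_trunc: "k_functional trunc l \<Longrightarrow> l (el p q) = p * l (el 1 0) + q * l (el 0 1)"
  using k_functionalD[of trunc l] by (metis el_def bar1_el barx_el el_simps(6) el_simps(2))

lemma functional_fst_snd: "k_functional trunc (\<lambda>a. fst (coords a))" "k_functional trunc (\<lambda>a. snd (coords a))"
  by (auto simp: k_functional_def carrier_trunc)

subsection \<open>Actions on the dual numbers\<close>

text \<open>An action on the dual numbers is given by \<open>h 1 = \<epsilon>(h) 1\<close> and \<open>h x = \<alpha>(h) 1 + \<beta>(h) x\<close>.\<close>

definition action_data :: "('k::field, 'h, 'm) hopf_scheme \<Rightarrow> ('h \<Rightarrow> 'k) \<Rightarrow> ('h \<Rightarrow> 'k) \<Rightarrow> bool"
  where "action_data H \<alpha> \<beta> \<longleftrightarrow> k_functional H \<alpha> \<and> k_functional H \<beta> \<and> \<alpha> \<one>\<^bsub>H\<^esub> = 0 \<and> \<beta> \<one>\<^bsub>H\<^esub> = 1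
    \<and> (\<forall>g\<in>carrier H. \<forall>h\<in>carrier H. \<alpha> (g \<otimes>\<^bsub>H\<^esub> h) = counit H g * \<alpha> h + \<alpha> g * \<beta> h)
    \<and> (\<forall>g\<in>carrier H. \<forall>h\<in>carrier H. \<beta> (g \<otimes>\<^bsub>H\<^esub> h) = \<beta> g * \<beta> h)
    \<and> (\<forall>h\<in>carrier H. sweed H h (\<lambda>a b. \<alpha> a * \<alpha> b) = 0)
    \<and> (\<forall>h\<in>carrier H. sweed H h (\<lambda>a b. \<alpha> a * \<beta> b) + sweed H h (\<lambda>a b. \<beta> a * \<alpha> b) = 0)"

definition acts_by :: "('k::field, 'h, 'm) hopf_scheme \<Rightarrow> ('h \<Rightarrow> 'k poly set \<Rightarrow> 'k poly set)
    \<Rightarrow> ('h \<Rightarrow> 'k) \<Rightarrow> ('h \<Rightarrow> 'k) \<Rightarrow> bool"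
  where "acts_by H \<psi> \<alpha> \<beta> \<longleftrightarrow>
    (\<forall>h\<in>carrier H. \<forall>p q. \<psi> h (el p q) = el (counit H h * p + \<alpha> h * q) (\<beta> h * q))"

text \<open>The module laws say that the triangular matrices formed from \<epsilon>, \<alpha> and
  \<beta> represent \<open>H\<close>. Compatibility with products reduces by bilinearity to pairs of
  basis vectors: pairs containing 1 are the counit laws, and the pair (x, x) with x x = 0 gives the
  two convolution identities.\<close>

theorem trunc_actionI:
  fixes H :: "('k::field, 'h, 'm) hopf_scheme"
  assumes "hopf_algebra H" and data: "action_data H \<alpha> \<beta>" and \<psi>: "acts_by H \<psi> \<alpha> \<beta>"
  shows "unital_hopf_action H trunc \<psi>"
proof -
  interpret H: hopf_algebra H by fact
  note \<psi> = \<psi>[unfolded acts_by_def, rule_format]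
  have f: "k_functional H \<alpha>" "k_functional H \<beta>" and one: "\<alpha> \<one>\<^bsub>H\<^esub> = 0" "\<beta> \<one>\<^bsub>H\<^esub> = 1"
    and mult: "\<And>g h. \<lbrakk>g \<in> carrier H; h \<in> carrier H\<rbrakk> \<Longrightarrow> \<alpha> (g \<otimes>\<^bsub>H\<^esub> h) = counit H g * \<alpha> h + \<alpha> g * \<beta> h"
      "\<And>g h. \<lbrakk>g \<in> carrier H; h \<in> carrier H\<rbrakk> \<Longrightarrow> \<beta> (g \<otimes>\<^bsub>H\<^esub> h) = \<beta> g * \<beta> h"
    and conv: "\<And>h. h \<in> carrier H \<Longrightarrow> sweed H h (\<lambda>a b. \<alpha> a * \<alpha> b) = 0"
      "\<And>h. h \<in> carrier H \<Longrightarrow> sweed H h (\<lambda>a b. \<alpha> a * \<beta> b) + sweed H h (\<lambda>a b. \<beta> a * \<alpha> b) = 0"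
    using data by (auto simp: action_data_def)
  show ?thesis
  proof
    fix h assume h: "h \<in> carrier H"
    show "k_linear trunc trunc (\<psi> h)"
      using h by (auto simp: k_linear_def carrier_trunc \<psi> algebra_simps)
    show "\<psi> h \<one>\<^bsub>trunc\<^esub> = counit H h \<odot>\<^bsub>trunc\<^esub> \<one>\<^bsub>trunc\<^esub>"
      using h by (simp add: \<psi>)
    fix a b assume "a \<in> carrier (trunc :: ('k, 'k poly set) module)" "b \<in> carrier (trunc :: ('k, 'k poly set) module)"
    then obtain p q r s where ab: "a = el p q" "b = el r s" by (auto simp: carrier_trunc)
    have "mlift trunc (\<lambda>(h1, h2). \<psi> h1 a \<otimes>\<^bsub>trunc\<^esub> \<psi> h2 b) (comult H h) = \<psi> h (a \<otimes>\<^bsub>trunc\<^esub> b)"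
    proof (rule H.mlift_comult_eqI[OF tr.k_module_axioms h])
      fix l assume l: "k_functional (trunc :: ('k, 'k poly set) module) l"
      have ae: "sweed H h (\<lambda>a b. counit H a * counit H b) = counit H h"
        "sweed H h (\<lambda>a b. counit H a * \<alpha> b) = \<alpha> h" "sweed H h (\<lambda>a b. \<alpha> a * counit H b) = \<alpha> h"
        "sweed H h (\<lambda>a b. counit H a * \<beta> b) = \<beta> h" "sweed H h (\<lambda>a b. \<beta> a * counit H b) = \<beta> h"
        using H.sweed_counit_l[OF H.counit_linear h] H.sweed_counit_l[OF f(1) h] H.sweed_counit_l[OF f(2) h]
          H.sweed_counit_r[OF f(1) h] H.sweed_counit_r[OF f(2) h] by (simp_all add: mult.commute)
      have "sweed H h (\<lambda>h1 h2. l (\<psi> h1 a \<otimes>\<^bsub>trunc\<^esub> \<psi> h2 b)) = sweed H h (\<lambda>h1 h2.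
          l (el 1 0) * ((p * r) * (counit H h1 * counit H h2) + (p * s) * (counit H h1 * \<alpha> h2)
            + (q * r) * (\<alpha> h1 * counit H h2) + (q * s) * (\<alpha> h1 * \<alpha> h2))
          + l (el 0 1) * ((p * s) * (counit H h1 * \<beta> h2) + (q * s) * (\<alpha> h1 * \<beta> h2)
            + (q * r) * (\<beta> h1 * counit H h2) + (q * s) * (\<beta> h1 * \<alpha> h2)))"
      proof (intro H.sweed_cong refl h, goal_cases)
        case (1 h1 h2)
        let ?X = "(counit H h1 * p + \<alpha> h1 * q) * (counit H h2 * r + \<alpha> h2 * s)"
          and ?Y = "(counit H h1 * p + \<alpha> h1 * q) * (\<beta> h2 * s) + \<beta> h1 * q * (counit H h2 * r + \<alpha> h2 * s)"
        have "\<psi> h1 a \<otimes>\<^bsub>trunc\<^esub> \<psi> h2 b = el ?X ?Y" using 1 by (simp add: ab \<psi>)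
        then show ?case
          by (simp only: functional_trunc[OF l, of ?X ?Y]) (simp add: algebra_simps)
      qed
      also have "\<dots> = l (el 1 0) * ((p * r) * counit H h + (p * s) * \<alpha> h + (q * r) * \<alpha> h)
          + l (el 0 1) * ((p * s) * \<beta> h + (q * r) * \<beta> h + (q * s) * (sweed H h (\<lambda>a b. \<alpha> a * \<beta> b)
            + sweed H h (\<lambda>a b. \<beta> a * \<alpha> b)))"
        by (simp only: sweed_fun_add sweed_cmult ae conv(1)[OF h]) (simp add: algebra_simps)
      also have "\<dots> = l (\<psi> h (a \<otimes>\<^bsub>trunc\<^esub> b))"
      proof -
        let ?X = "counit H h * (p * r) + \<alpha> h * (p * s + q * r)" and ?Y = "\<beta> h * (p * s + q * r)"
        have "\<psi> h (a \<otimes>\<^bsub>trunc\<^esub> b) = el ?X ?Y" using h by (simp add: ab \<psi>)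
        then show ?thesis
          unfolding conv(2)[OF h] by (simp only: functional_trunc[OF l, of ?X ?Y]) (simp add: algebra_simps)
      qed
      finally show "sweed H h (\<lambda>h1 h2. l (\<psi> h1 a \<otimes>\<^bsub>trunc\<^esub> \<psi> h2 b)) = l (\<psi> h (a \<otimes>\<^bsub>trunc\<^esub> b))" .
    qed (use h in \<open>simp_all add: ab \<psi>\<close>)
    then show "\<psi> h (a \<otimes>\<^bsub>trunc\<^esub> b) = mlift trunc (\<lambda>(h1, h2). \<psi> h1 a \<otimes>\<^bsub>trunc\<^esub> \<psi> h2 b) (comult H h)" by simp
  next
    fix a assume "a \<in> carrier (trunc :: ('k, 'k poly set) module)"
    then obtain p q where a: "a = el p q" by (auto simp: carrier_trunc)
    show "k_linear H trunc (\<lambda>h. \<psi> h a)"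
      by (auto simp: k_linear_def a \<psi> k_functionalD[OF f(1)] k_functionalD[OF f(2)] H.counit_add H.counit_scale algebra_simps)
    show "\<psi> \<one>\<^bsub>H\<^esub> a = a" by (simp add: a \<psi> H.counit_one one)
    show "\<psi> (g \<otimes>\<^bsub>H\<^esub> h) a = \<psi> g (\<psi> h a)" if "g \<in> carrier H" "h \<in> carrier H" for g h
      using that by (simp add: a \<psi> H.counit_mult mult algebra_simps)
  qed
qed

text \<open>The first column of the matrix of \<open>h\<close> comes from
  \<open>action_unital\<close>; the second one defines \<alpha> and \<beta>. Applying
  \<open>h\<close> to x x = 0 and reading off both coordinates yields the convolution
  identities.\<close>

theorem trunc_actionE:
  fixes H :: "('k::field, 'h, 'm) hopf_scheme"
  assumes "hopf_action H trunc \<psi>"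
  obtains \<alpha> \<beta> where "action_data H \<alpha> \<beta>" "acts_by H \<psi> \<alpha> \<beta>"
proof -
  interpret hopf_action H trunc \<psi> by fact
  define \<alpha> \<beta> where "\<alpha> h = fst (coords (\<psi> h barx))" and "\<beta> h = snd (coords (\<psi> h barx))" for h
  have \<psi>x: "\<psi> h (el 0 1) = el (\<alpha> h) (\<beta> h)" if "h \<in> carrier H" for h
  proof -
    have "\<psi> h (el 0 1) \<in> carrier trunc" using that by simp
    then obtain p q where "\<psi> h (el 0 1) = el p q" unfolding carrier_trunc by blast
    then show ?thesis by (simp add: \<alpha>_def \<beta>_def barx_el)
  qed
  have \<psi>: "\<psi> h (el p q) = el (counit H h * p + \<alpha> h * q) (\<beta> h * q)" if h: "h \<in> carrier H" for h p q
  proof -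
    have "\<psi> h (p \<odot>\<^bsub>trunc\<^esub> el 1 0 \<oplus>\<^bsub>trunc\<^esub> q \<odot>\<^bsub>trunc\<^esub> el 0 1) = el (counit H h * p + \<alpha> h * q) (\<beta> h * q)"
      using action_unital[OF h] h
      by (simp only: act_add_r act_scale_r el_simps(6) tr.scale_closed \<psi>x) (simp add: mult.commute)
    then show ?thesis by simp
  qed
  have prod: "sweed H h (\<lambda>a b. \<alpha> a * \<alpha> b) = 0"
      "sweed H h (\<lambda>a b. \<alpha> a * \<beta> b) + sweed H h (\<lambda>a b. \<beta> a * \<alpha> b) = 0" if h: "h \<in> carrier H" for h
  proof -
    have "\<psi> h (el 0 1 \<otimes>\<^bsub>trunc\<^esub> el 0 1) = el 0 0" using h by (simp add: \<psi>)
    moreover have "\<psi> a (el 0 1) \<otimes>\<^bsub>trunc\<^esub> \<psi> b (el 0 1) = el (\<alpha> a * \<alpha> b) (\<alpha> a * \<beta> b + \<beta> a * \<alpha> b)"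
      if "a \<in> carrier H" "b \<in> carrier H" for a b
      using that by (simp add: \<psi>)
    ultimately show "sweed H h (\<lambda>a b. \<alpha> a * \<alpha> b) = 0"
        "sweed H h (\<lambda>a b. \<alpha> a * \<beta> b) + sweed H h (\<lambda>a b. \<beta> a * \<alpha> b) = 0"
      using functional_act_prod[OF functional_fst_snd(1) h, of "el 0 1" "el 0 1"]
        functional_act_prod[OF functional_fst_snd(2) h, of "el 0 1" "el 0 1"] h
      by (simp_all add: sweed_fun_add del: el_simps(3) cong: sweed_cong)
  qed
  have "el (\<alpha> (g \<otimes>\<^bsub>H\<^esub> h)) (\<beta> (g \<otimes>\<^bsub>H\<^esub> h)) = el (counit H g * \<alpha> h + \<alpha> g * \<beta> h) (\<beta> g * \<beta> h)"
    if "g \<in> carrier H" "h \<in> carrier H" for g h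
    using act_mult[OF that, of "el 0 1"] that by (simp add: \<psi>x) (simp add: \<psi>)
  moreover have "el (\<alpha> (g \<oplus>\<^bsub>H\<^esub> h)) (\<beta> (g \<oplus>\<^bsub>H\<^esub> h)) = el (\<alpha> g + \<alpha> h) (\<beta> g + \<beta> h)"
    if "g \<in> carrier H" "h \<in> carrier H" for g h
    using act_add_l[OF that, of "el 0 1"] that by (simp add: \<psi>x)
  moreover have "el (\<alpha> (c \<odot>\<^bsub>H\<^esub> g)) (\<beta> (c \<odot>\<^bsub>H\<^esub> g)) = el (c * \<alpha> g) (c * \<beta> g)"
    if "g \<in> carrier H" for g c
    using act_scale_l[OF that, of "el 0 1" c] that by (simp add: \<psi>x)
  moreover have "el (\<alpha> \<one>\<^bsub>H\<^esub>) (\<beta> \<one>\<^bsub>H\<^esub>) = el 0 1"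
    using act_one[of "el 0 1"] by (simp add: \<psi>x)
  ultimately have "action_data H \<alpha> \<beta>"
    unfolding action_data_def k_functional_def using prod by simp
  moreover have "acts_by H \<psi> \<alpha> \<beta>" by (simp add: acts_by_def \<psi>)
  ultimately show ?thesis by (rule that)
qed

subsection \<open>Cosupports\<close>

text \<open>The operator with matrix rows \<open>(p, q)\<close> and \<open>(0, r)\<close>,
  restricted to the carrier so that equality of operators is equality of entries.\<close>

definition mop :: "'k::field \<Rightarrow> 'k \<Rightarrow> 'k \<Rightarrow> 'k poly set \<Rightarrow> 'k poly set"
  where "mop p q r = (\<lambda>a\<in>carrier trunc. lin_op (el p 0) (el q r) a)"

lemma mop_el [simp]: "mop p q r (el a b) = el (p * a + q * b) (r * b)"
  by (simp add: mop_def mult.commute)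

lemma mop_eq_iff [simp]: "mop p q r = mop p' q' r' \<longleftrightarrow> p = p' \<and> q = q' \<and> r = r'"
proof
  assume "mop p q r = mop p' q' r'"
  then have "mop p q r (el 1 0) = mop p' q' r' (el 1 0)" "mop p q r (el 0 1) = mop p' q' r' (el 0 1)" by simp_all
  then show "p = p' \<and> q = q' \<and> r = r'" by simp
qed simp

lemma trunc_ext:
  assumes "f \<in> extensional (carrier trunc)" "g \<in> extensional (carrier trunc)" "\<And>p q. f (el p q) = g (el p q)"
  shows "f = g"
  using assms by (intro extensionalityI[of _ "carrier trunc"]) (auto simp: carrier_trunc)

lemma mop_extensional [simp]: "mop p q r \<in> extensional (carrier trunc)"
  by (simp add: mop_def)

lemma mop_End: "mop p q r \<in> End_k trunc"
proof -
  have "k_linear trunc trunc (mop p q r)"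
    by (auto simp: k_linear_def carrier_trunc algebra_simps)
  then show ?thesis by (simp add: End_k_def)
qed

lemma has_matrix_mop: "has_matrix (mop p q r) p q 0 r"
  by (simp add: has_matrix_def bar1_el barx_el)

lemma End_has_matrix_iff: "f \<in> End_k trunc \<and> has_matrix f p q 0 r \<longleftrightarrow> f = mop p q r"
proof
  assume f: "f \<in> End_k trunc \<and> has_matrix f p q 0 r"
  have "f (el a b) = mop p q r (el a b)" for a b
  proof -
    have "f (a \<odot>\<^bsub>trunc\<^esub> el 1 0 \<oplus>\<^bsub>trunc\<^esub> b \<odot>\<^bsub>trunc\<^esub> el 0 1) =
        a \<odot>\<^bsub>trunc\<^esub> f (el 1 0) \<oplus>\<^bsub>trunc\<^esub> b \<odot>\<^bsub>trunc\<^esub> f (el 0 1)"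
      using f by (simp only: End_k_def k_linear_def mem_Collect_eq tr.scale_closed el_simps(6))
    then show ?thesis using f by (simp add: has_matrix_def bar1_el barx_el algebra_simps)
  qed
  then show "f = mop p q r" using f by (intro trunc_ext) (auto simp: End_k_def)
qed (auto simp: mop_End has_matrix_mop)

lemma cosupp_acts_by:
  assumes "acts_by H \<psi> \<alpha> \<beta>"
  shows "cosupp H trunc \<psi> = {mop (counit H h) (\<alpha> h) (\<beta> h) |h. h \<in> carrier H}"
proof -
  have "restrict (\<psi> h) (carrier trunc) = mop (counit H h) (\<alpha> h) (\<beta> h)" if "h \<in> carrier H" for h
    using assms that by (intro trunc_ext) (auto simp: acts_by_def)
  then show ?thesis unfolding cosupp_def by (intro Collect_cong) metis
qed

lemma (in hopf_action) unital_subalgebra_cosupp: "unital_subalgebra_End A (cosupp H A \<psi>)"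
  unfolding unital_subalgebra_End_def
proof (intro conjI ballI allI)
  show "cosupp H A \<psi> \<subseteq> End_k A"
    using act_linear_r by (auto simp: cosupp_def End_k_def k_linear_def Pi_iff)
  have cosuppI: "f \<in> cosupp H A \<psi>" if "h \<in> carrier H" "f = restrict (\<psi> h) (carrier A)" for f h
    using that by (auto simp: cosupp_def)
  show "(\<lambda>a\<in>carrier A. a) \<in> cosupp H A \<psi>"
    by (rule cosuppI[of "\<one>\<^bsub>H\<^esub>"]) (auto intro!: restrict_ext simp: act_one)
  fix f assume "f \<in> cosupp H A \<psi>"
  then obtain h where h: "h \<in> carrier H" "f = restrict (\<psi> h) (carrier A)" by (auto simp: cosupp_def)
  show "(\<lambda>a\<in>carrier A. c \<odot>\<^bsub>A\<^esub> f a) \<in> cosupp H A \<psi>" for c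
    by (rule cosuppI[of "c \<odot>\<^bsub>H\<^esub> h"]) (auto intro!: restrict_ext simp: act_scale_l h)
  fix g assume "g \<in> cosupp H A \<psi>"
  then obtain k where k: "k \<in> carrier H" "g = restrict (\<psi> k) (carrier A)" by (auto simp: cosupp_def)
  show "(\<lambda>a\<in>carrier A. f a \<oplus>\<^bsub>A\<^esub> g a) \<in> cosupp H A \<psi>"
    by (rule cosuppI[of "h \<oplus>\<^bsub>H\<^esub> k"]) (auto intro!: restrict_ext simp: act_add_l h k)
  show "compose (carrier A) f g \<in> cosupp H A \<psi>"
    by (rule cosuppI[of "h \<otimes>\<^bsub>H\<^esub> k"]) (auto intro!: restrict_ext simp: act_mult h k compose_def)
qed

lemma equivalent_if_cosupp_eq:
  fixes H1 :: "('k::field, 'h, 'm) hopf_scheme" and H2 :: "('k, 'g, 'n) hopf_scheme"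
  assumes "cosupp H1 trunc \<psi>1 = cosupp H2 trunc \<psi>2" "cosupp H1 trunc \<psi>1 \<subseteq> End_k trunc"
  shows "equivalent_actions H1 trunc \<psi>1 H2 trunc \<psi>2"
proof -
  let ?i = "\<lambda>a. a :: 'k poly set" and ?C = "cosupp H1 trunc \<psi>1"
  let ?T = "\<lambda>f. \<lambda>b\<in>carrier trunc. ?i (f (inv_into (carrier trunc) ?i b))"
  have "?T f = f" if "f \<in> ?C" for f
  proof (rule trunc_ext)
    show "f \<in> extensional (carrier trunc)" using that assms(2) by (auto simp: End_k_def)
    show "?T f (el p q) = f (el p q)" for p q
      using inv_into_f_f[of ?i "carrier trunc" "el p q"] by simp
  qed simp
  then have "?T ` ?C = ?C" by (simp cong: image_cong)
  then have "{?T f |f. f \<in> ?C} = cosupp H2 trunc \<psi>2"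
    using assms(1) by (simp only: Setcompr_eq_image)
  moreover have "?i \<in> ring_iso trunc trunc" by (auto simp: ring_iso_def ring_hom_def bij_betw_def)
  moreover have "k_linear trunc trunc ?i" by (simp add: k_linear_def)
  ultimately show ?thesis unfolding equivalent_actions_def by (intro exI[of _ ?i] conjI)
qed

text \<open>Rescaling \<open>x\<close> by \<open>s\<close> divides the upper right matrix entry by \<open>s\<close>.\<close>

lemma equivalent_rescale:
  fixes s :: "'k::field"
    and H1 :: "('k, 'h, 'm) hopf_scheme" and H2 :: "('k, 'g, 'n) hopf_scheme"
  assumes "s \<noteq> 0" "cosupp H1 trunc \<psi>1 = {mop p (s * u p r) r |p r. True}"
    "cosupp H2 trunc \<psi>2 = {mop p (u p r) r |p r. True}"
  shows "equivalent_actions H1 trunc \<psi>1 H2 trunc \<psi>2"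
proof -
  let ?\<phi> = "mop 1 0 s"
  let ?T = "\<lambda>f. \<lambda>b\<in>carrier trunc. ?\<phi> (f (inv_into (carrier trunc) ?\<phi> b))"
  have inj: "inj_on ?\<phi> (carrier trunc)"
    using assms(1) by (auto simp: inj_on_def carrier_trunc)
  have surj: "?\<phi> ` carrier trunc = carrier trunc"
  proof
    show "?\<phi> ` carrier trunc \<subseteq> carrier trunc" by (auto simp: carrier_trunc)
    have "el p q \<in> ?\<phi> ` carrier trunc" for p q
      using assms(1) by (intro image_eqI[of _ _ "el p (q / s)"]) simp_all
    then show "carrier trunc \<subseteq> ?\<phi> ` carrier trunc" unfolding carrier_trunc by blast
  qed
  have inv: "inv_into (carrier trunc) ?\<phi> (el p q) = el p (q / s)" for p q
    using inv_into_f_f[OF inj, of "el p (q / s)"] assms(1) by simp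
  have T: "?T (mop p (s * q) r) = mop p q r" for p q r
    using assms(1) by (intro trunc_ext) (auto simp: inv field_simps)
  have range: "{g p r |p r. True} = range (\<lambda>(p, r). g p r)" for g :: "'k \<Rightarrow> 'k \<Rightarrow> 'k poly set \<Rightarrow> 'k poly set"
    by auto
  have "{?T f |f. f \<in> cosupp H1 trunc \<psi>1} = cosupp H2 trunc \<psi>2"
    unfolding assms(2,3) range Setcompr_eq_image image_image case_prod_unfold T ..
  moreover have "?\<phi> \<in> ring_iso trunc trunc"
    using inj surj by (auto simp: ring_iso_def ring_hom_def bij_betw_def carrier_trunc algebra_simps)
  moreover have "k_linear trunc trunc ?\<phi>" using mop_End by (auto simp: End_k_def)
  ultimately show ?thesis unfolding equivalent_actions_def by (intro exI[of _ ?\<phi>] conjI)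
qed

section \<open>Classification of the cosupports\<close>

lemma char_two_iff: "CHAR('k::field) = 2 \<longleftrightarrow> (2 :: 'k) = 0"
proof -
  have "(2 :: 'k) = 0 \<longleftrightarrow> CHAR('k) dvd 2" using of_nat_eq_0_iff_char_dvd[of 2, where 'a = 'k] by simp
  also have "\<dots> \<longleftrightarrow> CHAR('k) = 2"
    using CHAR_not_1'[where 'a = 'k] dvd_imp_le[of "CHAR('k)" 2]
    by (auto simp: le_Suc_eq numeral_2_eq_2)
  finally show ?thesis ..
qed

text \<open>The unit of \<open>H\<close> contributes the triple (1, 0, 1), so every linear relation
  among \<epsilon>, \<alpha>, \<beta> has the form t\<alpha> = s(\<epsilon> - \<beta>). The case
  distinction asks in turn whether \<alpha> = 0, whether \<beta> = \<epsilon>, and whether \<alpha>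
  is a multiple of \<epsilon> - \<beta>.\<close>

theorem cosupp_classification:
  fixes H :: "('k::field, 'h, 'm) hopf_scheme"
  assumes "hopf_algebra H" "action_data H \<alpha> \<beta>" "acts_by H \<psi> \<alpha> \<beta>"
  shows "cosupp H trunc \<psi> = {mop p 0 p |p. True}
    \<or> CHAR('k) = 2 \<and> cosupp H trunc \<psi> = {mop p q p |p q. True}
    \<or> CHAR('k) = 2 \<and> (\<exists>\<gamma>. \<gamma> \<noteq> 0 \<and> cosupp H trunc \<psi> = {mop p (\<gamma> * (p + q)) q |p q. True})
    \<or> cosupp H trunc \<psi> = {mop p 0 q |p q. True}
    \<or> cosupp H trunc \<psi> = {mop p q r |p q r. True}"
proof -
  interpret H: hopf_algebra H by fact
  let ?\<epsilon> = "counit H"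
  have f: "k_functional H \<alpha>" "k_functional H \<beta>" and one: "\<alpha> \<one>\<^bsub>H\<^esub> = 0" "\<beta> \<one>\<^bsub>H\<^esub> = 1"
    and conv: "\<And>h. h \<in> carrier H \<Longrightarrow> sweed H h (\<lambda>a b. \<alpha> a * \<alpha> b) = 0"
      "\<And>h. h \<in> carrier H \<Longrightarrow> sweed H h (\<lambda>a b. \<alpha> a * \<beta> b) + sweed H h (\<lambda>a b. \<beta> a * \<alpha> b) = 0"
    using assms(2) by (auto simp: action_data_def)
  note fD = k_functionalD[OF f(1)] k_functionalD[OF f(2)] H.counit_add H.counit_scale
  define W where "W h = mop (?\<epsilon> h) (\<alpha> h) (\<beta> h)" for h
  \<comment> \<open>Combinations of two elements with the unit, which contributes the identity
    matrix, are all that is used to fill the cosupport.\<close>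
  have comb: "mop (x * ?\<epsilon> g + y * ?\<epsilon> h + z) (x * \<alpha> g + y * \<alpha> h) (x * \<beta> g + y * \<beta> h + z) \<in> W ` carrier H"
    if gh: "g \<in> carrier H" "h \<in> carrier H" for g h x y z
  proof -
    let ?w = "x \<odot>\<^bsub>H\<^esub> g \<oplus>\<^bsub>H\<^esub> y \<odot>\<^bsub>H\<^esub> h \<oplus>\<^bsub>H\<^esub> z \<odot>\<^bsub>H\<^esub> \<one>\<^bsub>H\<^esub>"
    have "W ?w = mop (x * ?\<epsilon> g + y * ?\<epsilon> h + z) (x * \<alpha> g + y * \<alpha> h) (x * \<beta> g + y * \<beta> h + z)"
      using gh by (simp add: W_def fD H.counit_one one)
    moreover have "?w \<in> carrier H" using gh by simp
    ultimately show ?thesis by (metis imageI)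
  qed
  have "cosupp H trunc \<psi> = W ` carrier H"
    unfolding cosupp_acts_by[OF assms(3)] W_def by (rule Setcompr_eq_image)
  then have V: "cosupp H trunc \<psi> = S" if "\<And>h. h \<in> carrier H \<Longrightarrow> W h \<in> S" "S \<subseteq> W ` carrier H" for S
    using that by (simp add: subset_antisym image_subsetI)
  show ?thesis
  proof (cases "\<forall>h\<in>carrier H. \<alpha> h = 0")
    case \<alpha>0: True
    show ?thesis
    proof (cases "\<forall>h\<in>carrier H. \<beta> h = ?\<epsilon> h")
      case True
      have "mop z 0 z \<in> W ` carrier H" for z using comb[of "\<one>\<^bsub>H\<^esub>" "\<one>\<^bsub>H\<^esub>" 0 0 z] by simp
      then have "cosupp H trunc \<psi> = {mop p 0 p |p. True}"
        using \<alpha>0 True by (intro V) (auto simp: W_def)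
      then show ?thesis by simp
    next
      case False
      then obtain h where h: "h \<in> carrier H" "\<beta> h \<noteq> ?\<epsilon> h" by blast
      have "mop p 0 q \<in> W ` carrier H" for p q
      proof -
        \<comment> \<open>The coefficient of \<open>h\<close> fixes the difference of the diagonal
          entries; a multiple of the unit then adjusts both.\<close>
        define x where "x = (q - p) / (\<beta> h - ?\<epsilon> h)"
        have "x * (\<beta> h - ?\<epsilon> h) = q - p" using h(2) by (simp add: x_def)
        then show ?thesis using comb[OF h(1) h(1), of x 0 "p - x * ?\<epsilon> h"] \<alpha>0 h(1) by (simp add: algebra_simps)
      qed
      then have "cosupp H trunc \<psi> = {mop p 0 q |p q. True}"
        using \<alpha>0 by (intro V) (auto simp: W_def)
      then show ?thesis by simp
    qed
  next
    case False
    then obtain h where h: "h \<in> carrier H" "\<alpha> h \<noteq> 0" by blast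
    show ?thesis
    proof (cases "\<forall>h\<in>carrier H. \<beta> h = ?\<epsilon> h")
      case True
      \<comment> \<open>With \<beta> = \<epsilon> the counit laws evaluate both convolutions to
        \<alpha>, whence 2\<alpha> = 0.\<close>
      have "sweed H h (\<lambda>a b. \<alpha> a * \<beta> b) = \<alpha> h" "sweed H h (\<lambda>a b. \<beta> a * \<alpha> b) = \<alpha> h"
        using H.sweed_counit_l[OF f(1) h(1)] H.sweed_counit_r[OF f(1) h(1)] True h(1)
        by (simp_all add: mult.commute cong: H.sweed_cong)
      then have "\<alpha> h + \<alpha> h = 0" using conv(2)[OF h(1)] by simp
      then have "2 * \<alpha> h = 0" by (simp only: mult_2)
      then have char: "CHAR('k) = 2" using h(2) by (simp add: char_two_iff)
      have "mop p q p \<in> W ` carrier H" for p q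
        using comb[OF h(1) h(1), of "q / \<alpha> h" 0 "p - q / \<alpha> h * ?\<epsilon> h"] h True by simp
      then have "cosupp H trunc \<psi> = {mop p q p |p q. True}"
        using True by (intro V) (auto simp: W_def)
      then show ?thesis using char by simp
    next
      case False
      then obtain g where g: "g \<in> carrier H" "?\<epsilon> g - \<beta> g \<noteq> 0" by auto
      \<comment> \<open>The only candidate for a relation \<alpha> = \<gamma>(\<epsilon> - \<beta>),
        read off at \<open>g\<close>. Whether it holds everywhere separates dimension two from
        dimension three.\<close>
      define \<gamma> where "\<gamma> = \<alpha> g / (?\<epsilon> g - \<beta> g)"
      have \<gamma>g: "\<alpha> g = \<gamma> * (?\<epsilon> g - \<beta> g)" using g(2) by (simp add: \<gamma>_def)
      show ?thesis
      proof (cases "\<forall>h\<in>carrier H. \<alpha> h = \<gamma> * (?\<epsilon> h - \<beta> h)")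
        case True
        have \<gamma>: "\<gamma> \<noteq> 0" using True h by auto
        \<comment> \<open>The two convolution identities after substituting \<alpha> =
          \<gamma>(\<epsilon> - \<beta>) and cancelling the powers of \<gamma>.\<close>
        have \<beta>\<beta>: "sweed H a (\<lambda>b c. \<beta> b * \<beta> c) = 2 * \<beta> a - ?\<epsilon> a" "2 * (\<beta> a - sweed H a (\<lambda>b c. \<beta> b * \<beta> c)) = 0"
          if a: "a \<in> carrier H" for a
        proof -
          have ae: "sweed H a (\<lambda>a b. ?\<epsilon> a * ?\<epsilon> b) = ?\<epsilon> a"
            "sweed H a (\<lambda>a b. ?\<epsilon> a * \<beta> b) = \<beta> a" "sweed H a (\<lambda>a b. \<beta> a * ?\<epsilon> b) = \<beta> a"
            using H.sweed_counit_l[OF H.counit_linear a] H.sweed_counit_l[OF f(2) a]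
              H.sweed_counit_r[OF f(2) a] by (simp_all add: mult.commute)
          have "0 = sweed H a (\<lambda>b c. \<alpha> b * \<alpha> c)" using conv(1)[OF a] by simp
          also have "\<dots> = sweed H a (\<lambda>b c. (\<gamma> * \<gamma>) * (?\<epsilon> b * ?\<epsilon> c - ?\<epsilon> b * \<beta> c - \<beta> b * ?\<epsilon> c + \<beta> b * \<beta> c))"
            by (intro H.sweed_cong refl a) (simp only: True[rule_format], simp add: algebra_simps)
          also have "\<dots> = (\<gamma> * \<gamma>) * (?\<epsilon> a - 2 * \<beta> a + sweed H a (\<lambda>b c. \<beta> b * \<beta> c))"
            by (simp only: sweed_linear ae) (simp add: algebra_simps)
          finally have "?\<epsilon> a - 2 * \<beta> a + sweed H a (\<lambda>b c. \<beta> b * \<beta> c) = 0" using \<gamma> by simp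
          then show "sweed H a (\<lambda>b c. \<beta> b * \<beta> c) = 2 * \<beta> a - ?\<epsilon> a" by (simp add: algebra_simps)
          have "sweed H a (\<lambda>b c. \<alpha> b * \<beta> c) = sweed H a (\<lambda>b c. \<gamma> * (?\<epsilon> b * \<beta> c - \<beta> b * \<beta> c))"
            "sweed H a (\<lambda>b c. \<beta> b * \<alpha> c) = sweed H a (\<lambda>b c. \<gamma> * (\<beta> b * ?\<epsilon> c - \<beta> b * \<beta> c))"
            by (intro H.sweed_cong refl a, simp only: True[rule_format], simp add: algebra_simps)+
          then have "\<gamma> * (\<beta> a - sweed H a (\<lambda>b c. \<beta> b * \<beta> c)) + \<gamma> * (\<beta> a - sweed H a (\<lambda>b c. \<beta> b * \<beta> c)) = 0"
            using conv(2)[OF a] by (simp only: sweed_linear ae)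
          then have "\<gamma> * (2 * (\<beta> a - sweed H a (\<lambda>b c. \<beta> b * \<beta> c))) = 0"
            by (simp only: mult_2 distrib_left)
          then show "2 * (\<beta> a - sweed H a (\<lambda>b c. \<beta> b * \<beta> c)) = 0" using \<gamma> by simp
        qed
        \<comment> \<open>If 2 were invertible, \<beta>\<beta> would equal both \<beta> and 2\<beta>
          - \<epsilon> at \<open>g\<close>, so \<beta> and \<epsilon> would agree there, against the
          choice of \<open>g\<close>.\<close>
        have "(2 :: 'k) = 0"
        proof (rule ccontr)
          assume "(2 :: 'k) \<noteq> 0"
          then have "\<beta> g = sweed H g (\<lambda>b c. \<beta> b * \<beta> c)" using \<beta>\<beta>(2)[OF g(1)] by simp
          then show False using \<beta>\<beta>(1)[OF g(1)] g(2) by (simp add: algebra_simps)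
        qed
        then have char: "CHAR('k) = 2" by (simp add: char_two_iff)
        \<comment> \<open>Signs disappear in characteristic two, which brings the relation into the
          form \<gamma>(p + q).\<close>
        have minus: "a - b = a + b" for a b :: 'k
        proof -
          have "b + b = 0" using \<open>(2 :: 'k) = 0\<close> by (simp flip: mult_2)
          then show ?thesis by (simp add: eq_neg_iff_add_eq_0 flip: diff_minus_eq_add)
        qed
        have "mop p (\<gamma> * (p + q)) q \<in> W ` carrier H" for p q
        proof -
          define x where "x = (p - q) / (?\<epsilon> g - \<beta> g)"
          have x: "x * (?\<epsilon> g - \<beta> g) = p - q" using g(2) by (simp add: x_def)
          then have "x * \<alpha> g = \<gamma> * (p - q)" by (simp add: \<gamma>g mult.left_commute)
          moreover have "x * \<beta> g + (p - x * ?\<epsilon> g) = q" using x by (simp add: algebra_simps)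
          ultimately show ?thesis using comb[OF g(1) g(1), of x 0 "p - x * ?\<epsilon> g"] by (simp add: minus[of p q])
        qed
        moreover have "\<alpha> a = \<gamma> * (?\<epsilon> a + \<beta> a)" if "a \<in> carrier H" for a
          using True that by (simp add: minus[of "?\<epsilon> a"])
        ultimately have "cosupp H trunc \<psi> = {mop p (\<gamma> * (p + q)) q |p q. True}"
          by (intro V) (auto simp: W_def)
        then show ?thesis using char \<gamma> by blast
      next
        case False
        then obtain k where k: "k \<in> carrier H" "\<alpha> k \<noteq> \<gamma> * (?\<epsilon> k - \<beta> k)" by blast
        have "mop p q r \<in> W ` carrier H" for p q r
        proof -
          \<comment> \<open>A triangular system: \<alpha> - \<gamma>(\<epsilon> - \<beta>) vanishes
            at \<open>g\<close> and not at \<open>k\<close>, so it determines \<open>y\<close>; the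
            difference of the diagonal entries then determines \<open>x\<close>, and a multiple of
            the unit supplies the rest.\<close>
          define y where "y = (q - \<gamma> * (p - r)) / (\<alpha> k - \<gamma> * (?\<epsilon> k - \<beta> k))"
          define x where "x = (p - r - y * (?\<epsilon> k - \<beta> k)) / (?\<epsilon> g - \<beta> g)"
          have y: "y * (\<alpha> k - \<gamma> * (?\<epsilon> k - \<beta> k)) = q - \<gamma> * (p - r)" using k(2) by (simp add: y_def)
          have x: "x * (?\<epsilon> g - \<beta> g) = p - r - y * (?\<epsilon> k - \<beta> k)" using g(2) by (simp add: x_def)
          have e: "x * \<alpha> g = \<gamma> * (p - r - y * (?\<epsilon> k - \<beta> k))"
            by (simp only: \<gamma>g mult.left_commute[of x] x)
          have "x * \<alpha> g + y * \<alpha> k = \<gamma> * (p - r) + y * (\<alpha> k - \<gamma> * (?\<epsilon> k - \<beta> k))"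
            by (simp only: e) (simp add: algebra_simps)
          then have "x * \<alpha> g + y * \<alpha> k = q" by (simp add: y)
          moreover have "x * \<beta> g + y * \<beta> k + (p - x * ?\<epsilon> g - y * ?\<epsilon> k) = r" using x by (simp add: algebra_simps)
          ultimately show ?thesis using comb[OF g(1) k(1), of x y "p - x * ?\<epsilon> g - y * ?\<epsilon> k"] by simp
        qed
        then have "cosupp H trunc \<psi> = {mop p q r |p q r. True}"
          by (intro V) (auto simp: W_def)
        then show ?thesis by simp
      qed
    qed
  qed
qed

lemma hopf_hom_cong:
  assumes "hopf_algebra H" "\<And>x. x \<in> carrier H \<Longrightarrow> f x = g x" "hopf_hom H G f"
  shows "hopf_hom H G g"
proof -
  interpret H: hopf_algebra H by fact
  have "tmap g g (comult H x) = tmap f f (comult H x)" if "x \<in> carrier H" for x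
    using H.comult_closed[OF that] assms(2) by (intro fmap_eqI) (auto intro!: slift_cong)
  then show ?thesis
    using assms(2,3) by (auto simp: hopf_hom_def k_linear_def ring_hom_def Pi_iff)
qed

text \<open>A homomorphism preserves the counit, so it intertwines two actions exactly when its
  composites with \<open>\<alpha>0\<close> and \<open>\<beta>0\<close> are \<alpha> and \<beta>.
  Universality thus becomes existence and uniqueness of a homomorphism with these two composites
  prescribed.\<close>

lemma V_universalI:
  fixes H0 :: "('k::field, 'g) hopf"
  assumes act: "unital_hopf_action H0 trunc \<psi>0" and acts: "acts_by H0 \<psi>0 \<alpha>0 \<beta>0"
    and ex: "\<And>(H :: ('k, 'h) hopf) \<alpha> \<beta>. \<lbrakk>hopf_algebra H; action_data H \<alpha> \<beta>;
      \<And>h. h \<in> carrier H \<Longrightarrow> mop (counit H h) (\<alpha> h) (\<beta> h) \<in> cosupp H0 trunc \<psi>0\<rbrakk> \<Longrightarrow>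
      \<exists>\<phi>. hopf_hom H H0 \<phi> \<and> (\<forall>h\<in>carrier H. \<alpha>0 (\<phi> h) = \<alpha> h \<and> \<beta>0 (\<phi> h) = \<beta> h)"
    and uniq: "\<And>(H :: ('k, 'h) hopf) \<phi> \<phi>' h. \<lbrakk>hopf_algebra H; hopf_hom H H0 \<phi>; hopf_hom H H0 \<phi>';
      \<And>h. h \<in> carrier H \<Longrightarrow> \<alpha>0 (\<phi> h) = \<alpha>0 (\<phi>' h) \<and> \<beta>0 (\<phi> h) = \<beta>0 (\<phi>' h); h \<in> carrier H\<rbrakk> \<Longrightarrow> \<phi> h = \<phi>' h"
  shows "V_universal TYPE('h) trunc (cosupp H0 trunc \<psi>0) H0 \<psi>0"
  unfolding V_universal_def
proof (intro conjI allI impI)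
  interpret H0: unital_hopf_action H0 trunc \<psi>0 by fact
  show "unital_subalgebra_End trunc (cosupp H0 trunc \<psi>0)" by (rule H0.unital_subalgebra_cosupp)
  show "hopf_action H0 trunc \<psi>0" ..
  show "cosupp H0 trunc \<psi>0 \<subseteq> cosupp H0 trunc \<psi>0" ..
  fix H :: "('k, 'h) hopf" and \<psi>
  assume H: "hopf_action H trunc \<psi> \<and> cosupp H trunc \<psi> \<subseteq> cosupp H0 trunc \<psi>0"
  then have hopf: "hopf_algebra H" by (auto simp: hopf_action_def)
  obtain \<alpha> \<beta> where data: "action_data H \<alpha> \<beta>" and \<psi>: "acts_by H \<psi> \<alpha> \<beta>"
    using trunc_actionE H by metis
  have "mop (counit H h) (\<alpha> h) (\<beta> h) \<in> cosupp H0 trunc \<psi>0" if "h \<in> carrier H" for h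
    using H that unfolding cosupp_acts_by[OF \<psi>] by blast
  from ex[OF hopf data this] obtain \<phi> where \<phi>: "hopf_hom H H0 \<phi>"
      "\<And>h. h \<in> carrier H \<Longrightarrow> \<alpha>0 (\<phi> h) = \<alpha> h \<and> \<beta>0 (\<phi> h) = \<beta> h" by blast
  have cmp: "(\<forall>a\<in>carrier trunc. \<psi> h a = \<psi>0 (f h) a) \<longleftrightarrow> \<alpha>0 (f h) = \<alpha> h \<and> \<beta>0 (f h) = \<beta> h"
    if "hopf_hom H H0 f" "h \<in> carrier H" for f h
  proof -
    have fh: "f h \<in> carrier H0" "counit H0 (f h) = counit H h"
      using that by (auto simp: hopf_hom_def k_linear_def)
    have 1: "\<psi> h (el p q) = el (counit H h * p + \<alpha> h * q) (\<beta> h * q)" for p q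
      using \<psi> that(2) by (simp add: acts_by_def)
    have 2: "\<psi>0 (f h) (el p q) = el (counit H h * p + \<alpha>0 (f h) * q) (\<beta>0 (f h) * q)" for p q
      using acts fh by (simp add: acts_by_def)
    show ?thesis
    proof
      assume "\<forall>a\<in>carrier trunc. \<psi> h a = \<psi>0 (f h) a"
      then have "\<psi> h (el 0 1) = \<psi>0 (f h) (el 0 1)" by simp
      then show "\<alpha>0 (f h) = \<alpha> h \<and> \<beta>0 (f h) = \<beta> h" by (simp add: 1 2)
    qed (auto simp: carrier_trunc 1 2)
  qed
  let ?P = "\<lambda>f. f \<in> extensional (carrier H) \<and> hopf_hom H H0 f \<and>
    (\<forall>h\<in>carrier H. \<forall>a\<in>carrier trunc. \<psi> h a = \<psi>0 (f h) a)"
  show "\<exists>!f. ?P f"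
  proof (rule ex1I)
    have r: "hopf_hom H H0 (restrict \<phi> (carrier H))" by (rule hopf_hom_cong[OF hopf _ \<phi>(1)]) simp
    then show "?P (restrict \<phi> (carrier H))" using \<phi>(2) cmp[OF r] by auto
    fix f assume f: "?P f"
    have "f h = \<phi> h" if h: "h \<in> carrier H" for h
    proof (rule uniq[OF hopf _ \<phi>(1) _ h])
      show "hopf_hom H H0 f" using f by blast
      show "\<alpha>0 (f h) = \<alpha>0 (\<phi> h) \<and> \<beta>0 (f h) = \<beta>0 (\<phi> h)" if "h \<in> carrier H" for h
        using f \<phi>(2) that cmp by metis
    qed
    then show "f = restrict \<phi> (carrier H)"
      using f by (intro extensionalityI[of _ "carrier H"]) auto
  qed
qed

lemma operator_dim_mop:
  shows "operator_dim trunc {mop p 0 p |p :: 'k::field. True} 1"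
    and "operator_dim trunc {mop p 0 q |p q :: 'k. True} 2"
    and "operator_dim trunc {mop p q r |p q r :: 'k. True} 3"
proof -
  let ?C = "\<lambda>(B :: ('k poly set \<Rightarrow> 'k poly set) set) c. \<lambda>a\<in>carrier trunc. \<Oplus>\<^bsub>trunc\<^esub>f\<in>B. c f \<odot>\<^bsub>trunc\<^esub> f a"
  have closed: "c \<odot>\<^bsub>trunc\<^esub> mop p q r a \<in> carrier trunc" if "a \<in> carrier trunc" for c p q r and a :: "'k poly set"
    using that by (auto simp: carrier_trunc)
  have dim: "operator_dim trunc V n" if B: "B \<subseteq> End_k trunc" "finite B" "card B = n"
      and V: "\<And>c. ?C B c \<in> V" and inj: "\<And>c d f. ?C B c = ?C B d \<Longrightarrow> f \<in> B \<Longrightarrow> c f = d f"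
      and surj: "\<And>v. v \<in> V \<Longrightarrow> \<exists>c. v = ?C B c"
    for B :: "('k poly set \<Rightarrow> 'k poly set) set" and V n
  proof -
    \<comment> \<open>In \<open>operator_dim\<close> the coefficients are extensional functions on
      \<open>B\<close>, while unrestricted functions are handier as witnesses; the sum does not see
      the difference.\<close>
    have restr: "?C B (restrict c B) = ?C B c" for c
    proof (rule restrict_ext)
      fix a :: "'k poly set" assume a: "a \<in> carrier trunc"
      have "f a \<in> carrier trunc" if "f \<in> B" for f
        using B(1) that a by (auto simp: End_k_def k_linear_def)
      then show "(\<Oplus>\<^bsub>trunc\<^esub>f\<in>B. restrict c B f \<odot>\<^bsub>trunc\<^esub> f a) = (\<Oplus>\<^bsub>trunc\<^esub>f\<in>B. c f \<odot>\<^bsub>trunc\<^esub> f a)"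
        by (intro tr.M.finsum_cong') simp_all
    qed
    have "?C B ` (B \<rightarrow>\<^sub>E UNIV) = V"
    proof
      show "?C B ` (B \<rightarrow>\<^sub>E UNIV) \<subseteq> V" using V by (rule image_subsetI)
      show "V \<subseteq> ?C B ` (B \<rightarrow>\<^sub>E UNIV)"
      proof
        fix v assume "v \<in> V"
        from surj[OF this] obtain c where "v = ?C B c" ..
        then have "v = ?C B (restrict c B)" by (simp only: restr)
        then show "v \<in> ?C B ` (B \<rightarrow>\<^sub>E UNIV)" by (rule image_eqI[where x = "restrict c B"]) simp
      qed
    qed
    moreover have "inj_on (?C B) (B \<rightarrow>\<^sub>E UNIV)"
    proof (rule inj_onI)
      fix c d assume cd: "c \<in> B \<rightarrow>\<^sub>E UNIV" "d \<in> B \<rightarrow>\<^sub>E UNIV" "?C B c = ?C B d"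
      show "c = d" by (rule PiE_ext[OF cd(1,2)]) (rule inj[OF cd(3)])
    qed
    ultimately have "bij_betw (?C B) (B \<rightarrow>\<^sub>E UNIV) V" by (simp only: bij_betw_def)
    then show ?thesis unfolding operator_dim_def using B by blast
  qed
  have C1: "?C {mop 1 0 1} c = mop (c (mop 1 0 1)) 0 (c (mop 1 0 1))" for c
    by (rule trunc_ext) (simp_all add: tr.M.finsum_insert closed)
  show "operator_dim trunc {mop p 0 p |p :: 'k::field. True} 1"
  proof (rule dim[of "{mop 1 0 1}"]; (unfold C1)?)
    show "\<exists>c. v = mop (c (mop 1 0 1)) 0 (c (mop 1 0 1))" if "v \<in> {mop p 0 p |p :: 'k. True}" for v
    proof -
      obtain p where "v = mop p 0 p" using \<open>v \<in> _\<close> by blast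
      then show ?thesis by (intro exI[of _ "\<lambda>_. p"]) simp
    qed
  qed (auto simp: mop_End)
  have C2: "?C {mop 1 0 0, mop 0 0 1} c = mop (c (mop 1 0 0)) 0 (c (mop 0 0 1))" for c
    by (rule trunc_ext) (simp_all add: tr.M.finsum_insert closed)
  show "operator_dim trunc {mop p 0 q |p q :: 'k. True} 2"
  proof (rule dim[of "{mop 1 0 0, mop 0 0 1}"]; (unfold C2)?)
    show "\<exists>c. v = mop (c (mop 1 0 0)) 0 (c (mop 0 0 1))" if "v \<in> {mop p 0 q |p q :: 'k. True}" for v
    proof -
      obtain p q where "v = mop p 0 q" using \<open>v \<in> _\<close> by blast
      then show ?thesis by (intro exI[of _ "\<lambda>f. if f = mop 1 0 0 then p else q"]) simp
    qed
  qed (auto simp: mop_End)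
  have C3: "?C {mop 1 0 0, mop 0 1 0, mop 0 0 1} c = mop (c (mop 1 0 0)) (c (mop 0 1 0)) (c (mop 0 0 1))" for c
    by (rule trunc_ext) (simp_all add: tr.M.finsum_insert closed)
  show "operator_dim trunc {mop p q r |p q r :: 'k. True} 3"
  proof (rule dim[of "{mop 1 0 0, mop 0 1 0, mop 0 0 1}"]; (unfold C3)?)
    show "\<exists>c. v = mop (c (mop 1 0 0)) (c (mop 0 1 0)) (c (mop 0 0 1))" if "v \<in> {mop p q r |p q r :: 'k. True}" for v
    proof -
      obtain p q r where "v = mop p q r" using \<open>v \<in> _\<close> by blast
      then show ?thesis
        by (intro exI[of _ "\<lambda>f. if f = mop 1 0 0 then p else if f = mop 0 1 0 then q else r"]) simp
    qed
  qed (auto simp: mop_End)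
qed

subsection \<open>The trivial action\<close>

lemma field_hopf_sel [simp]:
  "carrier field_hopf = UNIV" "x \<otimes>\<^bsub>field_hopf\<^esub> y = x * y" "\<one>\<^bsub>field_hopf\<^esub> = 1" "\<zero>\<^bsub>field_hopf\<^esub> = 0"
  "x \<oplus>\<^bsub>field_hopf\<^esub> y = x + y" "c \<odot>\<^bsub>field_hopf\<^esub> x = c * x" "counit field_hopf x = x" "antipode field_hopf x = x"
  "sweed field_hopf x \<beta> = x * \<beta> 1 1"
  by (simp_all add: field_hopf_def sweed_def)

lemma functional_field: "k_functional field_hopf l \<Longrightarrow> l x = x * l 1"
  using k_functionalD(2)[of field_hopf l 1 x] by simp

lemma hopf_algebra_field: "hopf_algebra (field_hopf :: ('k::field, 'k) hopf)"
proof -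
  have alg: "k_algebra (field_hopf :: ('k, 'k) hopf)"
    by (rule k_algebraI) (simp_all add: algebra_simps)
  have "pre_bialgebra (field_hopf :: ('k, 'k) hopf)"
  proof (intro pre_bialgebra.intro alg pre_bialgebra_axioms.intro)
    fix \<beta> :: "'k \<Rightarrow> 'k \<Rightarrow> 'k" and x y :: 'k assume "bil field_hopf field_hopf \<beta>"
    show "sweed field_hopf (x \<otimes>\<^bsub>field_hopf\<^esub> y) \<beta> = sweed field_hopf x (\<lambda>a b. sweed field_hopf y
        (\<lambda>a' b'. \<beta> (a \<otimes>\<^bsub>field_hopf\<^esub> a') (b \<otimes>\<^bsub>field_hopf\<^esub> b')))" by simp
  qed (simp_all add: algebra_simps)
  then show ?thesis
  proof (rule hopf_algebraI, goal_cases)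
    case (5 l x) then show ?case using functional_field[of l x] by simp
  next
    case (6 l x) then show ?case using functional_field[of l x] by simp
  qed (simp_all add: k_functional_def k_linear_def algebra_simps)
qed

lemma acts_by_psi1: "acts_by field_hopf psi1 (\<lambda>h. 0) (\<lambda>h. h)"
  by (simp add: acts_by_def psi1_def)

lemma action_psi1: "unital_hopf_action (field_hopf :: ('k::field, 'k) hopf) trunc psi1"
  by (rule trunc_actionI[OF hopf_algebra_field _ acts_by_psi1])
    (simp add: action_data_def k_functional_def algebra_simps)

lemma cosupp_psi1: "cosupp field_hopf trunc psi1 = {mop p 0 p |p. True}"
  unfolding cosupp_acts_by[OF acts_by_psi1] by simp

text \<open>The homomorphism behind the universality of the trivial action. Every bilinear form on
  the field is a multiple of the product, so compatibility with comultiplication is the counit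
  law.\<close>

lemma hopf_hom_counit:
  fixes H :: "('k::field, 'h, 'm) hopf_scheme"
  assumes "hopf_algebra H"
  shows "hopf_hom H field_hopf (counit H)"
proof -
  interpret H: hopf_algebra H by fact
  show ?thesis
  proof (rule hopf_homI[OF assms hopf_algebra_field])
    fix x and \<beta> :: "'k \<Rightarrow> 'k \<Rightarrow> 'k" assume x: "x \<in> carrier H" and \<beta>: "bil field_hopf field_hopf \<beta>"
    have \<beta>_eq: "\<beta> a b = a * b * \<beta> 1 1" for a b
    proof -
      have "\<beta> a b = a * \<beta> 1 b" using \<beta> by (intro functional_field) (simp add: bil_def)
      moreover have "\<beta> 1 b = b * \<beta> 1 1" using \<beta> by (intro functional_field) (simp add: bil_def)
      ultimately show ?thesis by simp
    qed
    have "sweed H x (\<lambda>a b. \<beta> (counit H a) (counit H b)) = sweed H x (\<lambda>a b. counit H a * counit H b * \<beta> 1 1)"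
      by (intro H.sweed_cong refl x) (rule \<beta>_eq)
    also have "\<dots> = sweed H x (\<lambda>a b. counit H a * counit H b) * \<beta> 1 1"
      by (rule sweed_cmult_right)
    finally show "sweed field_hopf (counit H x) \<beta> = sweed H x (\<lambda>a b. \<beta> (counit H a) (counit H b))"
      using H.sweed_counit_l[OF H.counit_linear x] by simp
  qed (simp_all add: k_linear_def H.counit_add H.counit_scale H.counit_one H.counit_mult)
qed

lemma universal_psi1:
  "V_universal TYPE('h) trunc (cosupp (field_hopf :: ('k::field, 'k) hopf) trunc psi1) field_hopf psi1"
proof (rule V_universalI[OF action_psi1 acts_by_psi1])
  fix H :: "('k, 'h) hopf" and \<alpha> \<beta>
  assume "hopf_algebra H" and V: "\<And>h. h \<in> carrier H \<Longrightarrow> mop (counit H h) (\<alpha> h) (\<beta> h) \<in> cosupp field_hopf trunc psi1"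
  then have "0 = \<alpha> h \<and> counit H h = \<beta> h" if "h \<in> carrier H" for h
    using V[OF that] by (auto simp: cosupp_psi1)
  then show "\<exists>\<phi>. hopf_hom H field_hopf \<phi> \<and> (\<forall>h\<in>carrier H. 0 = \<alpha> h \<and> \<phi> h = \<beta> h)"
    using hopf_hom_counit[OF \<open>hopf_algebra H\<close>] by blast
qed simp

subsection \<open>Characteristic two: the additive group\<close>

lemma trunc_hopf_sel [simp]:
  "carrier trunc_hopf = carrier trunc" "\<one>\<^bsub>trunc_hopf\<^esub> = el 1 0" "\<zero>\<^bsub>trunc_hopf\<^esub> = el 0 0"
  "x \<otimes>\<^bsub>trunc_hopf\<^esub> y = x \<otimes>\<^bsub>trunc\<^esub> y" "x \<oplus>\<^bsub>trunc_hopf\<^esub> y = x \<oplus>\<^bsub>trunc\<^esub> y"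
  "c \<odot>\<^bsub>trunc_hopf\<^esub> x = c \<odot>\<^bsub>trunc\<^esub> x"
  "counit trunc_hopf (el p q) = p" "antipode trunc_hopf (el p q) = el p q"
  "sweed trunc_hopf (el p q) \<beta> = p * \<beta> (el 1 0) (el 1 0) + q * (\<beta> (el 0 1) (el 1 0) + \<beta> (el 1 0) (el 0 1))"
  "k_functional trunc_hopf = k_functional trunc"
  by (simp_all add: trunc_hopf_def sweed_def bar1_el barx_el)

lemma bil_trunc:
  assumes "bil trunc trunc \<beta>"
  shows "\<beta> (el p q) (el r s) = p * (r * \<beta> (el 1 0) (el 1 0) + s * \<beta> (el 1 0) (el 0 1))
    + q * (r * \<beta> (el 0 1) (el 1 0) + s * \<beta> (el 0 1) (el 0 1))"
proof -
  have "\<beta> (el p q) (el r s) = p * \<beta> (el 1 0) (el r s) + q * \<beta> (el 0 1) (el r s)"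
    using assms by (intro functional_trunc) (auto simp: bil_def)
  also have "\<beta> (el 1 0) (el r s) = r * \<beta> (el 1 0) (el 1 0) + s * \<beta> (el 1 0) (el 0 1)"
    using assms by (intro functional_trunc) (auto simp: bil_def)
  also have "\<beta> (el 0 1) (el r s) = r * \<beta> (el 0 1) (el 1 0) + s * \<beta> (el 0 1) (el 0 1)"
    using assms by (intro functional_trunc) (auto simp: bil_def)
  finally show ?thesis .
qed

lemma bil_trunc_hopf: "bil trunc_hopf trunc_hopf = bil trunc trunc"
  by (intro ext) (simp add: bil_def)

lemma double_zero: "(2 :: 'k::field) = 0 \<Longrightarrow> x + x = (0 :: 'k)"
  by (simp flip: mult_2)

text \<open>Characteristic two enters twice: the square of x \<otimes> 1 + 1 \<otimes> x is 2 (x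
  \<otimes> x), which must vanish together with x x, and the antipode x \<mapsto> x has to be x
  \<mapsto> -x.\<close>

lemma hopf_algebra_trunc:
  assumes two: "(2 :: 'k::field) = 0"
  shows "hopf_algebra (trunc_hopf :: ('k, 'k poly set) hopf)"
proof -
  note dz = double_zero[OF two]
  have alg: "k_algebra (trunc_hopf :: ('k, 'k poly set) hopf)"
    unfolding trunc_hopf_def by (rule k_algebra_extend[OF k_algebra_trunc])
  have "pre_bialgebra (trunc_hopf :: ('k, 'k poly set) hopf)"
  proof (intro pre_bialgebra.intro alg pre_bialgebra_axioms.intro)
    fix x y :: "'k poly set" and \<beta> c assume x: "x \<in> carrier trunc_hopf"
    then obtain p q where xe: "x = el p q" by (auto simp: carrier_trunc)
    show "Poly_Mapping.keys (comult trunc_hopf x) \<subseteq> carrier trunc_hopf \<times> carrier trunc_hopf"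
      unfolding xe by (simp add: trunc_hopf_def bar1_el barx_el)
        (intro order_trans[OF keys_add] Un_least order_trans[OF keys_fscale]; simp)
    show "sweed trunc_hopf (c \<odot>\<^bsub>trunc_hopf\<^esub> x) \<beta> = c * sweed trunc_hopf x \<beta>"
      by (simp add: xe algebra_simps)
    assume "y \<in> carrier trunc_hopf" and "bil trunc_hopf trunc_hopf \<beta>"
    then obtain r s where ye: "y = el r s" and \<beta>: "bil trunc trunc \<beta>" by (auto simp: carrier_trunc bil_trunc_hopf)
    show "sweed trunc_hopf (x \<oplus>\<^bsub>trunc_hopf\<^esub> y) \<beta> = sweed trunc_hopf x \<beta> + sweed trunc_hopf y \<beta>"
      by (simp add: xe ye algebra_simps)
    have "\<beta> (el 0 0) b = 0" "\<beta> b (el 0 0) = 0" if "b \<in> carrier trunc" for b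
      using bilD(3)[OF \<beta>, of "el 0 0" b 0] bilD(4)[OF \<beta>, of b "el 0 0" 0] that by simp_all
    then show "sweed trunc_hopf (x \<otimes>\<^bsub>trunc_hopf\<^esub> y) \<beta> = sweed trunc_hopf x (\<lambda>a b. sweed trunc_hopf y
        (\<lambda>a' b'. \<beta> (a \<otimes>\<^bsub>trunc_hopf\<^esub> a') (b \<otimes>\<^bsub>trunc_hopf\<^esub> b')))"
      using dz[of "q * (s * \<beta> (el 0 1) (el 0 1))"] by (simp add: xe ye algebra_simps)
  qed simp
  then show ?thesis
  proof (rule hopf_algebraI, goal_cases)
    case 1 show ?case by (auto simp: k_functional_def carrier_trunc)
  next
    case (3 x y) then show ?case by (auto simp: carrier_trunc)
  next
    case (4 \<tau> x) then show ?case by (auto simp: carrier_trunc algebra_simps)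
  next
    case (5 l x)
    then obtain p q where "x = el p q" by (auto simp: carrier_trunc)
    then show ?case using functional_trunc[of l p q] 5 by simp
  next
    case (6 l x)
    then obtain p q where "x = el p q" by (auto simp: carrier_trunc)
    then show ?case using functional_trunc[of l p q] 6 by simp
  next
    case 7 show ?case by (auto simp: k_linear_def carrier_trunc)
  next
    case (8 l x) then show ?case using dz by (auto simp: carrier_trunc)
  next
    case (9 l x) then show ?case using dz by (auto simp: carrier_trunc)
  qed simp
qed

lemma acts_by_psi2: "acts_by trunc_hopf psi2 (\<lambda>h. snd (coords h)) (\<lambda>h. fst (coords h))"
  by (auto simp: acts_by_def psi2_def carrier_trunc bar1_el barx_el algebra_simps)

lemma action_psi2:
  assumes "(2 :: 'k::field) = 0"
  shows "unital_hopf_action (trunc_hopf :: ('k, 'k poly set) hopf) trunc psi2"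
proof (rule trunc_actionI[OF hopf_algebra_trunc[OF assms] _ acts_by_psi2])
  show "action_data (trunc_hopf :: ('k, 'k poly set) hopf) (\<lambda>h. snd (coords h)) (\<lambda>h. fst (coords h))"
    unfolding action_data_def using double_zero[OF assms] functional_fst_snd
    by (auto simp: carrier_trunc)
qed

lemma cosupp_psi2: "cosupp trunc_hopf trunc psi2 = {mop p q p |p q. True}"
  unfolding cosupp_acts_by[OF acts_by_psi2]
proof (rule Set.set_eqI, rule iffI)
  fix f :: "'a poly set \<Rightarrow> 'a poly set" assume "f \<in> {mop p q p |p q. True}"
  then obtain p q where "f = mop p q p" by blast
  then show "f \<in> {mop (counit trunc_hopf h) (snd (coords h)) (fst (coords h)) |h. h \<in> carrier trunc_hopf}"
    by (intro CollectI exI[of _ "el p q"]) simp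
next
  fix f :: "'a poly set \<Rightarrow> 'a poly set"
  assume "f \<in> {mop (counit trunc_hopf h) (snd (coords h)) (fst (coords h)) |h. h \<in> carrier trunc_hopf}"
  then show "f \<in> {mop p q p |p q. True}" by (auto simp: carrier_trunc)
qed

text \<open>The cosupport forces \<beta> = \<epsilon>, and the homomorphism is h \<mapsto>
  \<epsilon>(h) 1 + \<alpha>(h) x. It is multiplicative because \<alpha> is an \<epsilon>-derivation
  and x x = 0, and comultiplicative because \<alpha>\<alpha> = 0 removes the term with x \<otimes>
  x.\<close>

lemma universal_psi2:
  assumes two: "(2 :: 'k::field) = 0"
  shows "V_universal TYPE('h) trunc (cosupp (trunc_hopf :: ('k, 'k poly set) hopf) trunc psi2) trunc_hopf psi2"
proof (rule V_universalI[OF action_psi2[OF two] acts_by_psi2])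
  fix H :: "('k, 'h) hopf" and \<alpha> \<beta>
  assume hopf: "hopf_algebra H" and data: "action_data H \<alpha> \<beta>"
    and V: "\<And>h. h \<in> carrier H \<Longrightarrow> mop (counit H h) (\<alpha> h) (\<beta> h) \<in> cosupp trunc_hopf trunc psi2"
  interpret H: hopf_algebra H by fact
  have \<beta>: "\<beta> h = counit H h" if "h \<in> carrier H" for h using V[OF that] by (auto simp: cosupp_psi2)
  have \<alpha>: "k_functional H \<alpha>" "\<alpha> \<one>\<^bsub>H\<^esub> = 0"
    "\<And>g h. \<lbrakk>g \<in> carrier H; h \<in> carrier H\<rbrakk> \<Longrightarrow> \<alpha> (g \<otimes>\<^bsub>H\<^esub> h) = counit H g * \<alpha> h + \<alpha> g * counit H h"
    "\<And>h. h \<in> carrier H \<Longrightarrow> sweed H h (\<lambda>a b. \<alpha> a * \<alpha> b) = 0"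
    using data \<beta> by (auto simp: action_data_def)
  have "hopf_hom H trunc_hopf (\<lambda>h. el (counit H h) (\<alpha> h))"
  proof (rule hopf_homI[OF hopf hopf_algebra_trunc[OF two]])
    fix x and \<gamma> :: "'k poly set \<Rightarrow> 'k poly set \<Rightarrow> 'k" assume x: "x \<in> carrier H" and "bil trunc_hopf trunc_hopf \<gamma>"
    then have \<gamma>: "bil trunc trunc \<gamma>" by (simp add: bil_trunc_hopf)
    have "sweed H x (\<lambda>a b. \<gamma> (el (counit H a) (\<alpha> a)) (el (counit H b) (\<alpha> b))) =
        sweed H x (\<lambda>a b. \<gamma> (el 1 0) (el 1 0) * (counit H a * counit H b) + \<gamma> (el 1 0) (el 0 1) * (counit H a * \<alpha> b)
          + \<gamma> (el 0 1) (el 1 0) * (counit H b * \<alpha> a) + \<gamma> (el 0 1) (el 0 1) * (\<alpha> a * \<alpha> b))"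
      unfolding bil_trunc[OF \<gamma>, of "counit H _"] by (simp add: algebra_simps)
    also have "\<dots> = sweed trunc_hopf (el (counit H x) (\<alpha> x)) \<gamma>"
      by (simp only: sweed_linear H.sweed_counit_l[OF H.counit_linear x] H.sweed_counit_l[OF \<alpha>(1) x]
          H.sweed_counit_r[OF \<alpha>(1) x] \<alpha>(4)[OF x]) (simp add: algebra_simps)
    finally show "sweed trunc_hopf (el (counit H x) (\<alpha> x)) \<gamma> =
        sweed H x (\<lambda>a b. \<gamma> (el (counit H a) (\<alpha> a)) (el (counit H b) (\<alpha> b)))" ..
  qed (use \<alpha> in \<open>auto simp: k_linear_def H.counit_add H.counit_scale k_functionalD H.counit_one H.counit_mult\<close>)
  then show "\<exists>\<phi>. hopf_hom H trunc_hopf \<phi> \<and>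
      (\<forall>h\<in>carrier H. snd (coords (\<phi> h)) = \<alpha> h \<and> fst (coords (\<phi> h)) = \<beta> h)"
    using \<beta> by (intro exI[of _ "\<lambda>h. el (counit H h) (\<alpha> h)"]) simp
next
  fix H :: "('k, 'h) hopf" and \<phi> \<phi>' h
  assume *: "hopf_hom H trunc_hopf \<phi>" "hopf_hom H trunc_hopf \<phi>'" "h \<in> carrier H"
    "\<And>h. h \<in> carrier H \<Longrightarrow> snd (coords (\<phi> h)) = snd (coords (\<phi>' h)) \<and> fst (coords (\<phi> h)) = fst (coords (\<phi>' h))"
  then have "\<phi> h \<in> carrier trunc" "\<phi>' h \<in> carrier trunc" by (auto simp: hopf_hom_def k_linear_def)
  then obtain p q r s where "\<phi> h = el p q" "\<phi>' h = el r s" by (auto simp: carrier_trunc)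
  then show "\<phi> h = \<phi>' h" using *(4)[OF *(3)] by simp
qed

text \<open>For integer keys \<open>single_one\<close> would turn the unit of the group into the constant \<open>1\<close>.\<close>

declare single_one [simp del]

subsection \<open>Homomorphisms into the finite dual of a group algebra\<close>

text \<open>The algebra maps from \<open>H\<close> to the field, which are the grouplike elements of
  the finite dual.\<close>

definition characters :: "('k::field, 'h, 'm) hopf_scheme \<Rightarrow> ('h \<Rightarrow> 'k) set"
  where "characters H = {l \<in> carrier (dual_algebra H). l \<one>\<^bsub>H\<^esub> = 1 \<and>
    (\<forall>x\<in>carrier H. \<forall>y\<in>carrier H. l (x \<otimes>\<^bsub>H\<^esub> y) = l x * l y)}"

definition character_group :: "('k::field, 'h, 'm) hopf_scheme \<Rightarrow> ('h \<Rightarrow> 'k) monoid"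
  where "character_group H = \<lparr>carrier = characters H, monoid.mult = monoid.mult (dual_algebra H), one = \<one>\<^bsub>dual_algebra H\<^esub>\<rparr>"

context hopf_algebra
begin

lemma charactersD:
  assumes "l \<in> characters H"
  shows "l \<in> carrier (dual_algebra H)" "l \<in> extensional (carrier H)" "k_functional H l" "l \<one> = 1"
    "\<And>x y. \<lbrakk>x \<in> carrier H; y \<in> carrier H\<rbrakk> \<Longrightarrow> l (x \<otimes> y) = l x * l y"
  using assms by (auto simp: characters_def dual_carrier)

lemma counit_character: "\<one>\<^bsub>dual_algebra H\<^esub> \<in> characters H"
  by (simp add: characters_def dual_carrier dual_functional_const counit_one counit_mult)

lemma character_mult:
  assumes "l \<in> characters H" "m \<in> characters H"
  shows "l \<otimes>\<^bsub>dual_algebra H\<^esub> m \<in> characters H"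
proof -
  note l = charactersD[OF assms(1)] and m = charactersD[OF assms(2)]
  note bil = bil_mult[OF l(3) m(3)]
  have "(l \<otimes>\<^bsub>dual_algebra H\<^esub> m) (x \<otimes> y) = (l \<otimes>\<^bsub>dual_algebra H\<^esub> m) x * (l \<otimes>\<^bsub>dual_algebra H\<^esub> m) y"
    if xy: "x \<in> carrier H" "y \<in> carrier H" for x y
  proof -
    have "(l \<otimes>\<^bsub>dual_algebra H\<^esub> m) (x \<otimes> y) = sweed H x (\<lambda>a b. sweed H y (\<lambda>a' b'. (l a * m b) * (l a' * m b')))"
      using xy by (simp add: sweed_mult[OF bil] l(5) m(5) mult_ac cong: sweed_cong)
    then show ?thesis using xy by (simp add: sweed_cmult sweed_cmult_right)
  qed
  then show ?thesis
    unfolding characters_def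
    by (simp add: dual_carrier dual_functional[OF l(3) m(3)] sweed_one[OF bil] l(4) m(4))
qed

lemma character_inverse:
  assumes "l \<in> characters H"
  shows "(\<lambda>h\<in>carrier H. l (antipode H h)) \<in> characters H"
    "(\<lambda>h\<in>carrier H. l (antipode H h)) \<otimes>\<^bsub>dual_algebra H\<^esub> l = \<one>\<^bsub>dual_algebra H\<^esub>"
    "l \<otimes>\<^bsub>dual_algebra H\<^esub> (\<lambda>h\<in>carrier H. l (antipode H h)) = \<one>\<^bsub>dual_algebra H\<^esub>"
proof -
  note l = charactersD[OF assms]
  have "antipode H \<one> = \<one>"
  proof (rule functional_ext)
    fix f assume f: "k_functional H f"
    show "f (antipode H \<one>) = f \<one>"
      using sweed_antipode_l[OF f one_closed] sweed_one[OF bil_antipode_mult(1)[OF f]] by (simp add: counit_one)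
  qed simp_all
  then show "(\<lambda>h\<in>carrier H. l (antipode H h)) \<in> characters H"
    unfolding characters_def
    by (simp add: dual_carrier k_functional_def k_functionalD[OF l(3)] l(4,5) antipode_add antipode_scale antipode_mult)
  show "(\<lambda>h\<in>carrier H. l (antipode H h)) \<otimes>\<^bsub>dual_algebra H\<^esub> l = \<one>\<^bsub>dual_algebra H\<^esub>"
  proof (rule extensionalityI[of _ "carrier H"])
    fix h assume h: "h \<in> carrier H"
    then show "((\<lambda>h\<in>carrier H. l (antipode H h)) \<otimes>\<^bsub>dual_algebra H\<^esub> l) h = \<one>\<^bsub>dual_algebra H\<^esub> h"
      using sweed_antipode_l[OF l(3) h] by (simp add: l(4,5) cong: sweed_cong)
  qed simp_all
  show "l \<otimes>\<^bsub>dual_algebra H\<^esub> (\<lambda>h\<in>carrier H. l (antipode H h)) = \<one>\<^bsub>dual_algebra H\<^esub>"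
  proof (rule extensionalityI[of _ "carrier H"])
    fix h assume h: "h \<in> carrier H"
    then show "(l \<otimes>\<^bsub>dual_algebra H\<^esub> (\<lambda>h\<in>carrier H. l (antipode H h))) h = \<one>\<^bsub>dual_algebra H\<^esub> h"
      using sweed_antipode_r[OF l(3) h] by (simp add: l(4,5) cong: sweed_cong)
  qed simp_all
qed

lemma group_characters: "Group.group (character_group H)"
proof -
  interpret D: k_algebra "dual_algebra H" by (rule dual_algebra_algebra)
  show ?thesis
  proof (rule groupI)
    show "\<exists>m\<in>carrier (character_group H). m \<otimes>\<^bsub>character_group H\<^esub> l = \<one>\<^bsub>character_group H\<^esub>"
      if "l \<in> carrier (character_group H)" for l
      using character_inverse(1,2)[of l] that unfolding character_group_def by auto
  qed (simp_all add: character_group_def counit_character character_mult D.m_assoc charactersD(1))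
qed

end

text \<open>A homomorphism from \<open>G\<close> to the characters extends linearly to an algebra
  map from the group algebra to the dual of \<open>H\<close>. At a group element, which is
  grouplike, compatibility with the multiplication of \<open>H\<close> says that its image is a
  character.\<close>

theorem group_dual_hom:
  fixes H :: "('k::field, 'h, 'm) hopf_scheme" and G :: "('g, 'n) monoid_scheme"
  assumes "hopf_algebra H" "Group.group G" and u: "u \<in> hom G (character_group H)"
  obtains f where "hopf_hom H (finite_dual (group_hopf G)) f"
    "\<And>h g. \<lbrakk>h \<in> carrier H; g \<in> carrier G\<rbrakk> \<Longrightarrow> f h (Poly_Mapping.single g 1) = u g h"
proof -
  interpret H: hopf_algebra H by fact
  interpret G: Group.group G by fact
  let ?B = "group_hopf G :: ('k, 'g \<Rightarrow>\<^sub>0 'k) hopf" and ?D = "dual_algebra H"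
  interpret B: hopf_algebra ?B by (rule hopf_algebra_group_hopf[OF assms(2)])
  interpret D: k_algebra ?D by (rule H.dual_algebra_algebra)
  have u_closed: "u g \<in> characters H" if "g \<in> carrier G" for g
    using u that by (auto simp: hom_def character_group_def)
  have u_mult: "u (g \<otimes>\<^bsub>G\<^esub> g') = u g \<otimes>\<^bsub>?D\<^esub> u g'" if "g \<in> carrier G" "g' \<in> carrier G" for g g'
    using u that by (auto simp: hom_def character_group_def)
  have u_one: "u \<one>\<^bsub>G\<^esub> = \<one>\<^bsub>?D\<^esub>"
    using group_hom.hom_one[of G "character_group H" u] u assms(2) H.group_characters
    by (simp add: group_hom_def group_hom_axioms_def character_group_def)
  note uD = H.charactersD[OF u_closed]
  define F where "F f = (\<lambda>h\<in>carrier H. slift (\<lambda>g. u g h) f)" for f :: "'g \<Rightarrow>\<^sub>0 'k"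
  have carrier_B: "carrier ?B = {f. Poly_Mapping.keys f \<subseteq> carrier G}" by (rule group_hopf_carrier)
  have F_closed: "F f \<in> carrier ?D" if f: "f \<in> carrier ?B" for f
  proof -
    have k: "g \<in> carrier G" if "g \<in> Poly_Mapping.keys f" for g using f that by (auto simp: carrier_B)
    have "slift (\<lambda>g. u g (x \<oplus>\<^bsub>H\<^esub> y)) f = slift (\<lambda>g. u g x + u g y) f"
      "slift (\<lambda>g. u g (c \<odot>\<^bsub>H\<^esub> x)) f = slift (\<lambda>g. c * u g x) f"
      if "x \<in> carrier H" "y \<in> carrier H" for x y c
      using that k by (auto intro!: slift_cong simp: k_functionalD[OF uD(3)])
    then show ?thesis
      by (simp add: H.dual_carrier F_def k_functional_def slift_fun_add slift_cmult)
  qed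
  have F_single: "F (Poly_Mapping.single g 1) = u g" if "g \<in> carrier G" for g
    using uD(2)[OF that] by (intro extensionalityI[of _ "carrier H"]) (simp_all add: F_def)
  interpret dual_map H ?B F
  proof
    show "k_linear ?B ?D F"
      using F_closed by (auto simp: k_linear_def F_def group_hopf_def intro!: extensionalityI[of _ "carrier H"])
    show "F \<in> ring_hom ?B ?D"
    proof (rule ring_hom_memI)
      fix f f' assume ff: "f \<in> carrier ?B" "f' \<in> carrier ?B"
      show "F (f \<oplus>\<^bsub>?B\<^esub> f') = F f \<oplus>\<^bsub>?D\<^esub> F f'"
        by (rule extensionalityI[of _ "carrier H"]) (simp_all add: F_def group_hopf_def)
      show "F (f \<otimes>\<^bsub>?B\<^esub> f') = F f \<otimes>\<^bsub>?D\<^esub> F f'"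
      proof (rule extensionalityI[of _ "carrier H"])
        fix h assume h: "h \<in> carrier H"
        have k: "g \<in> carrier G" if "g \<in> Poly_Mapping.keys f \<or> g \<in> Poly_Mapping.keys f'" for g
          using ff that by (auto simp: carrier_B)
        have "(F f \<otimes>\<^bsub>?D\<^esub> F f') h = sweed H h (\<lambda>a b. slift (\<lambda>g. u g a) f * slift (\<lambda>g. u g b) f')"
          using h by (simp add: F_def cong: H.sweed_cong)
        also have "\<dots> = slift (\<lambda>g. slift (\<lambda>g'. sweed H h (\<lambda>a b. u g a * u g' b)) f') f"
          by (simp only: slift_mult sweed_slift_swap)
        also have "\<dots> = slift (\<lambda>g. slift (\<lambda>g'. u (g \<otimes>\<^bsub>G\<^esub> g') h) f') f"
          using h k by (intro slift_cong refl) (simp add: u_mult)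
        finally show "F (f \<otimes>\<^bsub>?B\<^esub> f') h = (F f \<otimes>\<^bsub>?D\<^esub> F f') h"
          using h by (simp add: F_def group_hopf_sel)
      qed (simp_all add: F_def)
    qed (use F_single[of "\<one>\<^bsub>G\<^esub>"] F_closed u_one in \<open>simp_all add: group_hopf_sel\<close>)
  qed
  have single: "multiplicative_at (Poly_Mapping.single g 1)" if "g \<in> carrier G" for g
    using that unfolding multiplicative_at_def
    by (simp add: F_single uD(4,5) sweed_group_hopf group_hopf_sel)
  have "multiplicative_at f" if "f \<in> carrier ?B" for f
  proof -
    have ss: "Poly_Mapping.single g 1 \<in> carrier ?B" if "g \<in> carrier G" for g
      using that by (simp add: carrier_B)
    \<comment> \<open>Group elements span the group algebra. Membership in the carrier is carried
      through the induction because closure under sums asks for it.\<close>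
    have "multiplicative_at (\<Sum>g\<in>S. fscale (c g) (Poly_Mapping.single g 1)) \<and>
        (\<Sum>g\<in>S. fscale (c g) (Poly_Mapping.single g 1)) \<in> carrier ?B"
      if "finite S" "S \<subseteq> carrier G" for S c
      using that
    proof (induction S)
      case empty
      have "multiplicative_at (0 \<odot>\<^bsub>?B\<^esub> \<one>\<^bsub>?B\<^esub>)"
        by (rule multiplicative_at_scale[OF B.one_closed multiplicative_at_one])
      then show ?case by (simp add: group_hopf_def)
    next
      case (insert g S)
      then have g: "g \<in> carrier G" and IH: "multiplicative_at (\<Sum>g\<in>S. fscale (c g) (Poly_Mapping.single g 1))"
        "(\<Sum>g\<in>S. fscale (c g) (Poly_Mapping.single g 1)) \<in> carrier ?B" by auto
      have ops: "fscale (c g) (Poly_Mapping.single g 1) = c g \<odot>\<^bsub>?B\<^esub> Poly_Mapping.single g 1"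
        "x + y = x \<oplus>\<^bsub>?B\<^esub> y" for x y by (simp_all add: group_hopf_def)
      have "c g \<odot>\<^bsub>?B\<^esub> Poly_Mapping.single g 1 \<in> carrier ?B" by (rule B.scale_closed[OF ss[OF g]])
      moreover have "multiplicative_at (c g \<odot>\<^bsub>?B\<^esub> Poly_Mapping.single g 1)"
        by (rule multiplicative_at_scale[OF ss[OF g] single[OF g]])
      ultimately show ?case
        unfolding sum.insert[OF insert.hyps] unfolding ops(1)[symmetric]
        unfolding ops(2) using IH multiplicative_at_add[of "fscale (c g) (Poly_Mapping.single g 1)"] B.M.add.m_closed
        by blast
    qed
    from this[of "Poly_Mapping.keys f" "Poly_Mapping.lookup f"] show ?thesis
      using flift_single_id[of f] that unfolding flift_def carrier_B by simp
  qed
  from hopf_hom_transpose[OF this] show ?thesis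
  proof (rule that)
    show "transpose h (Poly_Mapping.single g 1) = u g h" if "h \<in> carrier H" "g \<in> carrier G" for h g
      using that by (simp add: transpose_apply carrier_B F_single)
  qed
qed

lemma finite_dual_group_ext:
  fixes G :: "('g, 'n) monoid_scheme" and l m :: "('g \<Rightarrow>\<^sub>0 'k::field) \<Rightarrow> 'k"
  assumes "Group.group G" "l \<in> finite_dual_carrier (group_hopf G)" "m \<in> finite_dual_carrier (group_hopf G)"
    "\<And>g. g \<in> carrier G \<Longrightarrow> l (Poly_Mapping.single g 1) = m (Poly_Mapping.single g 1)"
  shows "l = m"
proof (rule extensionalityI[of _ "carrier (group_hopf G)"])
  have mon: "Group.monoid G" using assms(1) by (simp add: Group.group_def)
  fix f :: "'g \<Rightarrow>\<^sub>0 'k" assume "f \<in> carrier (group_hopf G)"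
  then have f: "Poly_Mapping.keys f \<subseteq> carrier G" by (simp add: group_hopf_carrier)
  have "slift (\<lambda>g. l (Poly_Mapping.single g 1)) f = slift (\<lambda>g. m (Poly_Mapping.single g 1)) f"
    using f assms(4) by (intro slift_cong) auto
  then show "l f = m f"
    using functional_monoid_algebra[OF mon, of l f] functional_monoid_algebra[OF mon, of m f]
      finite_dual_carrierD(2)[OF assms(2)] finite_dual_carrierD(2)[OF assms(3)] f
    by (simp only: group_hopf_sel)
qed (use assms(2,3) in \<open>simp_all add: finite_dual_carrierD\<close>)

subsection \<open>The finite dual of the infinite cyclic group\<close>

lemma hopf_algebra_Cinf: "hopf_algebra Cinf_hopf"
  unfolding Cinf_hopf_def by (rule hopf_algebra_group_hopf) simp

lemma hopf_algebra_Cinf_dual: "hopf_algebra (finite_dual Cinf_hopf)"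
  by (rule hopf_algebra.hopf_algebra_finite_dual[OF hopf_algebra_Cinf])

lemma carrier_Cinf: "carrier Cinf_hopf = UNIV"
  by (simp add: Cinf_hopf_def group_hopf_carrier)

lemma Cinf_mult_single:
  "Poly_Mapping.single m 1 \<otimes>\<^bsub>Cinf_hopf\<^esub> Poly_Mapping.single n 1 = Poly_Mapping.single (m + n) 1"
  by (simp add: Cinf_hopf_def group_hopf_sel)

lemma counit_Cinf_dual: "counit (finite_dual Cinf_hopf) l = l (Poly_Mapping.single 0 1)"
  by (simp add: finite_dual_sel Cinf_hopf_def group_hopf_sel)

lemma acts_by_psi4: "acts_by (finite_dual Cinf_hopf) psi4 (\<lambda>l. 0) (\<lambda>l. l (Poly_Mapping.single 1 1))"
  by (simp add: acts_by_def psi4_def bar1_el barx_el mult.commute)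

lemma action_psi4: "unital_hopf_action (finite_dual (Cinf_hopf :: ('k::field, _) hopf)) trunc psi4"
proof (rule trunc_actionI[OF hopf_algebra_Cinf_dual _ acts_by_psi4])
  interpret hopf_algebra "Cinf_hopf :: ('k, _) hopf" by (rule hopf_algebra_Cinf)
  have "sweed Cinf_hopf (Poly_Mapping.single 1 (1 :: 'k)) \<beta> = \<beta> (Poly_Mapping.single 1 1) (Poly_Mapping.single 1 1)" for \<beta>
    by (simp add: Cinf_hopf_def sweed_group_hopf)
  moreover have "counit Cinf_hopf (Poly_Mapping.single 1 (1 :: 'k)) = 1"
    by (simp add: Cinf_hopf_def group_hopf_sel)
  ultimately show "action_data (finite_dual (Cinf_hopf :: ('k, _) hopf)) (\<lambda>l. 0) (\<lambda>l. l (Poly_Mapping.single 1 1))"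
    unfolding action_data_def by (simp add: finite_dual_sel k_functional_def carrier_Cinf)
qed

lemma cosupp_psi4: "cosupp (finite_dual Cinf_hopf) trunc psi4 = {mop p 0 (q :: 'k::field) |p q. True}"
proof -
  interpret hopf_algebra "Cinf_hopf :: ('k, _) hopf" by (rule hopf_algebra_Cinf)
  have "\<exists>l\<in>carrier (finite_dual Cinf_hopf). mop p 0 q = mop (counit (finite_dual Cinf_hopf) l) 0 (l (Poly_Mapping.single 1 1))"
    for p q :: 'k
  proof -
    \<comment> \<open>A functional of period two in the exponent, hence induced from the quotient
      kC_2: it is \<open>p\<close> at the unit and \<open>q\<close> at the generator, and all its
      translates are combinations of the indicators \<open>?e\<close> and \<open>?o\<close> of even
      and odd exponents.\<close>
    let ?l = "slift (\<lambda>n :: int. if even n then p else q)"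
    let ?e = "slift (\<lambda>n :: int. if even n then 1 else 0) :: (int \<Rightarrow>\<^sub>0 'k) \<Rightarrow> 'k"
      and ?o = "slift (\<lambda>n :: int. if even n then 0 else 1) :: (int \<Rightarrow>\<^sub>0 'k) \<Rightarrow> 'k"
    have functional: "k_functional Cinf_hopf (slift f)" for f :: "int \<Rightarrow> 'k"
      by (simp add: Cinf_hopf_def group_hopf_sel k_functional_slift)
    have "?l \<in> finite_dual_carrier Cinf_hopf"
    proof (rule finite_dualI[of _ "{?e, ?o}"])
      show "?l \<in> extensional (carrier Cinf_hopf)" by (simp add: carrier_Cinf)
      fix b x y assume b: "\<And>g. g \<in> {?e, ?o} \<Longrightarrow> g b = 0"
      have eo: "?e b = 0" "?o b = 0" by (rule b, simp)+
      have zero: "slift (\<lambda>v. if even (m + v + n) then p else q) b = 0" for m n :: int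
      proof (cases "even (m + n)")
        case True
        have "slift (\<lambda>v. if even (m + v + n) then p else q) b =
            slift (\<lambda>v. p * (if even v then 1 else 0) + q * (if even v then 0 else 1)) b"
          using True by (intro slift_cong refl) auto
        also have "\<dots> = p * ?e b + q * ?o b" by (simp only: slift_fun_add slift_cmult)
        finally show ?thesis using eo by simp
      next
        case False
        have "slift (\<lambda>v. if even (m + v + n) then p else q) b =
            slift (\<lambda>v. q * (if even v then 1 else 0) + p * (if even v then 0 else 1)) b"
          using False by (intro slift_cong refl) auto
        also have "\<dots> = q * ?e b + p * ?o b" by (simp only: slift_fun_add slift_cmult)
        finally show ?thesis using eo by simp
      qed
      have "?l (x \<otimes>\<^bsub>Cinf_hopf\<^esub> b \<otimes>\<^bsub>Cinf_hopf\<^esub> y) =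
          slift (\<lambda>m. slift (\<lambda>n. slift (\<lambda>v. if even (m + v + n) then p else q) b) y) x"
        by (simp add: Cinf_hopf_def group_hopf_sel slift_swap[of _ y b])
      then show "?l (x \<otimes>\<^bsub>Cinf_hopf\<^esub> b \<otimes>\<^bsub>Cinf_hopf\<^esub> y) = 0" by (simp only: zero slift_fun_zero)
    qed (use functional in auto)
    then show ?thesis by (intro bexI[of _ ?l]) (simp_all add: counit_Cinf_dual finite_dual_sel(1))
  qed
  then show ?thesis unfolding cosupp_acts_by[OF acts_by_psi4] by fast
qed

lemma universal_psi4:
  "V_universal TYPE('h) trunc (cosupp (finite_dual (Cinf_hopf :: ('k::field, _) hopf)) trunc psi4)
    (finite_dual Cinf_hopf) psi4"
proof (rule V_universalI[OF action_psi4 acts_by_psi4])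
  fix H :: "('k, 'h) hopf" and \<alpha> \<beta>
  assume hopf: "hopf_algebra H" and data: "action_data H \<alpha> \<beta>"
    and V: "\<And>h. h \<in> carrier H \<Longrightarrow> mop (counit H h) (\<alpha> h) (\<beta> h) \<in> cosupp (finite_dual Cinf_hopf) trunc psi4"
  interpret H: hopf_algebra H by fact
  interpret X: Group.group "character_group H" by (rule H.group_characters)
  have \<alpha>: "\<alpha> h = 0" if "h \<in> carrier H" for h using V[OF that] by (auto simp: cosupp_psi4)
  let ?\<beta> = "restrict \<beta> (carrier H)"
  \<comment> \<open>Since the characters form a group, the single character \<beta> determines the
    homomorphism n \<mapsto> \<beta>^n from the infinite cyclic group.\<close>
  have \<beta>: "?\<beta> \<in> carrier (character_group H)"
    using data by (simp add: action_data_def character_group_def characters_def H.dual_carrier k_functional_def)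
  from X.hom_integer_group_pow[OF this]
  obtain f where f: "hopf_hom H (finite_dual (group_hopf integer_group)) f"
    "\<And>h g. \<lbrakk>h \<in> carrier H; g \<in> carrier integer_group\<rbrakk> \<Longrightarrow>
      f h (Poly_Mapping.single g 1) = (?\<beta> [^]\<^bsub>character_group H\<^esub> g) h"
    using group_dual_hom[OF hopf group_integer_group] by metis
  have "f h (Poly_Mapping.single 1 1) = \<beta> h" if "h \<in> carrier H" for h
    using f(2)[OF that, of 1] that \<beta> by simp
  then show "\<exists>\<phi>. hopf_hom H (finite_dual Cinf_hopf) \<phi> \<and>
      (\<forall>h\<in>carrier H. 0 = \<alpha> h \<and> \<phi> h (Poly_Mapping.single 1 1) = \<beta> h)"
    using f(1) \<alpha> unfolding Cinf_hopf_def by (intro exI[of _ f]) simp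
next
  fix H :: "('k, 'h) hopf" and \<phi> \<phi>' h
  assume *: "hopf_algebra H" "hopf_hom H (finite_dual Cinf_hopf) \<phi>" "hopf_hom H (finite_dual Cinf_hopf) \<phi>'"
    "\<And>h. h \<in> carrier H \<Longrightarrow> 0 = (0 :: 'k) \<and> \<phi> h (Poly_Mapping.single 1 1) = \<phi>' h (Poly_Mapping.single 1 1)"
    and h: "h \<in> carrier H"
  interpret two_dual_homs H "Cinf_hopf :: ('k, _) hopf" \<phi> \<phi>'
    by (intro two_dual_homs.intro two_dual_homs_axioms.intro * hopf_algebra_Cinf)
  have one: "agree_at (Poly_Mapping.single 1 1)" using *(4) by (simp add: agree_at_def)
  have nat: "agree_at (Poly_Mapping.single (int n) 1)" for n
  proof (induction n)
    case 0
    show ?case using agree_at_one by (simp add: Cinf_hopf_def group_hopf_sel)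
  next
    case (Suc n)
    then show ?case
      using agree_at_mult[OF _ _ one, of "Poly_Mapping.single (int n) 1"] by (simp add: carrier_Cinf Cinf_mult_single)
  qed
  have "agree_at (Poly_Mapping.single n 1)" for n
  proof (cases "n \<ge> 0")
    case True
    then show ?thesis using nat[of "nat n"] by simp
  next
    case False
    \<comment> \<open>Negative powers of the generator are antipodes of positive ones, where
      agreement is already known.\<close>
    have "antipode Cinf_hopf (Poly_Mapping.single (int (nat (- n))) 1) = Poly_Mapping.single n (1 :: 'k)"
      using False by (simp add: Cinf_hopf_def group_hopf_sel)
    then show ?thesis using agree_at_antipode[OF _ nat[of "nat (- n)"]] by (simp add: carrier_Cinf)
  qed
  then have "\<phi> h (Poly_Mapping.single n 1) = \<phi>' h (Poly_Mapping.single n 1)" for n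
    using h by (simp add: agree_at_def)
  then show "\<phi> h = \<phi>' h"
    using in_finite_dual h unfolding Cinf_hopf_def by (intro finite_dual_group_ext[OF group_integer_group]) auto
qed

subsection \<open>The cyclic group of order two\<close>

lemma carrier_C2_group: "carrier (integer_mod_group 2) = {0, 1}"
  by (auto simp: carrier_integer_mod_group)

lemma hopf_algebra_C2: "hopf_algebra C2_hopf"
  unfolding C2_hopf_def by (rule hopf_algebra_group_hopf) simp

lemma carrier_C2: "carrier C2_hopf = {f. Poly_Mapping.keys f \<subseteq> {0, 1}}"
  by (simp add: C2_hopf_def group_hopf_carrier carrier_C2_group)

lemma slift_C2: "f \<in> carrier C2_hopf \<Longrightarrow> slift F f = Poly_Mapping.lookup f 0 * F 0 + Poly_Mapping.lookup f 1 * F 1"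
  by (simp add: carrier_C2 slift_superset[of "{0, 1}"])

lemma single_C2 [simp]: "Poly_Mapping.single 0 c \<in> carrier C2_hopf" "Poly_Mapping.single 1 c \<in> carrier C2_hopf"
  by (simp_all add: carrier_C2)

lemma functional_C2:
  assumes "k_functional C2_hopf l" "f \<in> carrier C2_hopf"
  shows "l f = Poly_Mapping.lookup f 0 * l (Poly_Mapping.single 0 1) + Poly_Mapping.lookup f 1 * l (Poly_Mapping.single 1 1)"
proof -
  have "Group.monoid (integer_mod_group 2)" using group_integer_mod_group[of 2] by (simp add: Group.group_def)
  then have "l f = slift (\<lambda>g. l (Poly_Mapping.single g 1)) f"
    using assms by (intro functional_monoid_algebra[of "integer_mod_group 2"])
      (simp_all add: C2_hopf_def group_hopf_sel group_hopf_carrier)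
  then show ?thesis using slift_C2[OF assms(2), of "\<lambda>g. l (Poly_Mapping.single g 1)"] by simp
qed

lemma acts_by_psi4a:
  "acts_by C2_hopf psi4a (\<lambda>f. 0) (\<lambda>f. Poly_Mapping.lookup f 0 - Poly_Mapping.lookup f 1)"
  by (simp add: acts_by_def psi4a_def bar1_el barx_el mult.commute)

lemma action_psi4a: "unital_hopf_action (C2_hopf :: ('k::field, _) hopf) trunc psi4a"
proof (rule trunc_actionI[OF hopf_algebra_C2 _ acts_by_psi4a])
  have mult: "Poly_Mapping.lookup (f \<otimes>\<^bsub>C2_hopf\<^esub> g) 0 = Poly_Mapping.lookup f 0 * Poly_Mapping.lookup g 0
      + Poly_Mapping.lookup f 1 * Poly_Mapping.lookup g 1"
    "Poly_Mapping.lookup (f \<otimes>\<^bsub>C2_hopf\<^esub> g) 1 = Poly_Mapping.lookup f 0 * Poly_Mapping.lookup g 1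
      + Poly_Mapping.lookup f 1 * Poly_Mapping.lookup g 0"
    if "f \<in> carrier C2_hopf" "g \<in> carrier C2_hopf" for f g :: "int \<Rightarrow>\<^sub>0 'k"
    using that by (simp_all add: C2_hopf_def group_hopf_sel lookup_eq_slift[of "f \<otimes>\<^bsub>_\<^esub> g"])
      (simp_all add: slift_C2 flip: C2_hopf_def)
  show "action_data (C2_hopf :: ('k, _) hopf) (\<lambda>f. 0) (\<lambda>f. Poly_Mapping.lookup f 0 - Poly_Mapping.lookup f 1)"
    unfolding action_data_def using mult
    by (simp add: algebra_simps)
      (simp add: k_functional_def C2_hopf_def group_hopf_def lookup_add lookup_single algebra_simps)
qed

lemma cosupp_psi4a:
  assumes "(2 :: 'k::field) \<noteq> 0"
  shows "cosupp (C2_hopf :: ('k, _) hopf) trunc psi4a = {mop p 0 q |p q. True}"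
proof -
  have "\<exists>f\<in>carrier C2_hopf. mop p 0 q = mop (counit C2_hopf f) 0 (Poly_Mapping.lookup f 0 - Poly_Mapping.lookup f 1)"
    for p q :: 'k
  proof -
    \<comment> \<open>The generator acts by 1 and -1 on the two basis vectors, so the coefficients
      must have sum \<open>p\<close> and difference \<open>q\<close>.\<close>
    let ?f = "Poly_Mapping.single 0 ((p + q) / 2) + Poly_Mapping.single 1 ((p - q) / 2) :: int \<Rightarrow>\<^sub>0 'k"
    have "?f \<in> carrier C2_hopf"
      unfolding carrier_C2 by (auto dest!: subsetD[OF keys_add] split: if_splits)
    moreover have "(p + q) / 2 + (p - q) / 2 = p" "(p + q) / 2 - (p - q) / 2 = q"
      using assms by (simp_all flip: add_divide_distrib diff_divide_distrib mult_2)
    then have "counit C2_hopf ?f = p" "Poly_Mapping.lookup ?f 0 - Poly_Mapping.lookup ?f 1 = q"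
      by (simp_all add: C2_hopf_def group_hopf_sel lookup_add lookup_single)
    ultimately show ?thesis by (intro bexI[of _ ?f]) simp_all
  qed
  then show ?thesis unfolding cosupp_acts_by[OF acts_by_psi4a] by fast
qed

lemma C2_delta_apply: "f \<in> carrier C2_hopf \<Longrightarrow> C2_delta g f = Poly_Mapping.lookup f g"
  by (simp add: C2_delta_def)

text \<open>The group algebra is finite dimensional: its two coordinates have zero common kernel, so
  they serve as the finite family for every functional.\<close>

lemma finite_dual_C2:
  fixes l :: "(int \<Rightarrow>\<^sub>0 'k::field) \<Rightarrow> 'k"
  assumes "l \<in> extensional (carrier C2_hopf)" "k_functional C2_hopf l"
  shows "l \<in> finite_dual_carrier C2_hopf"
proof -
  interpret hopf_algebra "C2_hopf :: ('k, _) hopf" by (rule hopf_algebra_C2)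
  have lookup: "k_functional (C2_hopf :: ('k, _) hopf) (\<lambda>f. Poly_Mapping.lookup f n)" for n
    by (simp add: k_functional_def C2_hopf_def group_hopf_def lookup_add)
  show ?thesis
  proof (rule finite_dualI[OF assms, of "{\<lambda>f. Poly_Mapping.lookup f 0, \<lambda>f. Poly_Mapping.lookup f 1}"])
    fix b x y :: "int \<Rightarrow>\<^sub>0 'k" assume b: "b \<in> carrier C2_hopf"
        "\<And>g. g \<in> {\<lambda>f. Poly_Mapping.lookup f 0, \<lambda>f. Poly_Mapping.lookup f 1} \<Longrightarrow> g b = (0 :: 'k)"
      and xy: "x \<in> carrier C2_hopf" "y \<in> carrier C2_hopf"
    have "Poly_Mapping.lookup b 0 = 0" "Poly_Mapping.lookup b 1 = 0"
      using b(2)[of "\<lambda>f. Poly_Mapping.lookup f 0"] b(2)[of "\<lambda>f. Poly_Mapping.lookup f 1"] by simp_all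
    then have "b = 0" using b(1) by (intro fmap_eqI) (simp add: slift_C2)
    then have "b = \<zero>\<^bsub>C2_hopf\<^esub>" by (simp add: C2_hopf_def group_hopf_def)
    then show "l (x \<otimes>\<^bsub>C2_hopf\<^esub> b \<otimes>\<^bsub>C2_hopf\<^esub> y) = 0" using xy functional_zero[OF assms(2)] by simp
  qed (use lookup in auto)
qed

text \<open>The functional with value \<open>p\<close> at the unit of the group and \<open>q\<close>
  at its generator, that is, the element corresponding to the pair (p, q) under the
  transport.\<close>

definition C2_dual :: "'k::field \<Rightarrow> 'k \<Rightarrow> (int \<Rightarrow>\<^sub>0 'k) \<Rightarrow> 'k"
  where "C2_dual p q = (\<lambda>f\<in>carrier C2_hopf. p * Poly_Mapping.lookup f 0 + q * Poly_Mapping.lookup f 1)"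

lemma C2_dual_apply [simp]: "C2_dual p q (Poly_Mapping.single 0 1) = p" "C2_dual p q (Poly_Mapping.single 1 1) = q"
  by (simp_all add: C2_dual_def lookup_single)

lemma C2_dual_closed: "C2_dual p q \<in> finite_dual_carrier C2_hopf"
  by (rule finite_dual_C2)
    (simp_all add: C2_dual_def k_functional_def, simp add: C2_hopf_def group_hopf_def lookup_add algebra_simps
      order_trans[OF keys_add] order_trans[OF keys_fscale])

lemma C2_dual_eq:
  fixes l :: "(int \<Rightarrow>\<^sub>0 'k::field) \<Rightarrow> 'k"
  assumes "l \<in> finite_dual_carrier C2_hopf"
  shows "C2_dual (l (Poly_Mapping.single 0 1)) (l (Poly_Mapping.single 1 1)) = l"
proof (rule extensionalityI[of _ "carrier C2_hopf"])
  fix f :: "int \<Rightarrow>\<^sub>0 'k" assume f: "f \<in> carrier C2_hopf"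
  then show "C2_dual (l (Poly_Mapping.single 0 1)) (l (Poly_Mapping.single 1 1)) f = l f"
    unfolding functional_C2[OF finite_dual_carrierD(2)[OF assms] f] by (simp add: C2_dual_def mult.commute)
qed (use assms in \<open>simp_all add: C2_dual_def finite_dual_carrierD(1)\<close>)

lemma C2_dual_map:
  "(\<lambda>(p, q). p \<odot>\<^bsub>finite_dual C2_hopf\<^esub> C2_delta 0 \<oplus>\<^bsub>finite_dual C2_hopf\<^esub> q \<odot>\<^bsub>finite_dual C2_hopf\<^esub> C2_delta 1)
    = (\<lambda>(p, q). C2_dual p q)"
  by (auto simp: finite_dual_def C2_dual_def C2_delta_apply intro!: restrict_ext)

lemma bij_C2_dual: "bij_betw (\<lambda>(p, q). C2_dual p q) UNIV (carrier (finite_dual (C2_hopf :: ('k::field, _) hopf)))"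
  unfolding bij_betw_def
proof
  have "p = r \<and> q = s" if "C2_dual p q = C2_dual r s" for p q r s :: 'k
    using fun_cong[OF that, of "Poly_Mapping.single 0 1"] fun_cong[OF that, of "Poly_Mapping.single 1 1"] by simp
  then show "inj (\<lambda>(p, q). C2_dual p q :: (int \<Rightarrow>\<^sub>0 'k) \<Rightarrow> 'k)"
    by (intro injI) (simp add: case_prod_unfold prod_eq_iff)
  show "range (\<lambda>(p, q). C2_dual p q) = carrier (finite_dual C2_hopf)"
  proof (rule Set.set_eqI, rule iffI)
    fix l assume "l \<in> carrier (finite_dual C2_hopf)"
    then have "C2_dual (l (Poly_Mapping.single 0 1)) (l (Poly_Mapping.single 1 1)) = l"
      by (intro C2_dual_eq) (simp add: finite_dual_sel)
    then show "l \<in> range (\<lambda>(p, q). C2_dual p q)"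
      by (intro image_eqI[of _ _ "(l (Poly_Mapping.single 0 1), l (Poly_Mapping.single 1 1))"]) simp_all
  qed (clarsimp simp: finite_dual_sel C2_dual_closed)
qed

lemma kk_hopf_transport: "kk_hopf = transport_hopf UNIV (\<lambda>(p, q). C2_dual p q) (finite_dual C2_hopf)"
  by (simp add: kk_hopf_def C2_dual_map)

lemma inv_C2_dual:
  assumes "l \<in> finite_dual_carrier C2_hopf"
  shows "inv_into UNIV (\<lambda>(p, q). C2_dual p q) l = (l (Poly_Mapping.single 0 1), l (Poly_Mapping.single 1 1))"
  using bij_betw_inv_into_left[OF bij_C2_dual, of "(l (Poly_Mapping.single 0 1), l (Poly_Mapping.single 1 1))"]
  by (simp add: C2_dual_eq[OF assms])

lemma hopf_algebra_kk: "hopf_algebra kk_hopf"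
  unfolding kk_hopf_transport
  by (rule hopf_algebra_transport[OF hopf_algebra.hopf_algebra_finite_dual[OF hopf_algebra_C2] bij_C2_dual])

lemma C2_single_mult [simp]:
  "Poly_Mapping.single m 1 \<otimes>\<^bsub>C2_hopf\<^esub> Poly_Mapping.single n 1 = Poly_Mapping.single ((m + n) mod 2) 1"
  by (simp add: C2_hopf_def group_hopf_sel)

text \<open>Group elements are grouplike, so convolution of functionals multiplies their values
  there: the transported algebra structure is componentwise, and the counit, evaluation at the unit,
  is the first coordinate.\<close>

lemma kk_sel:
  fixes p q r s c :: "'k::field"
  shows "carrier kk_hopf = (UNIV :: ('k \<times> 'k) set)"
  "\<one>\<^bsub>kk_hopf\<^esub> = (1 :: 'k, 1)"
  "(p, q) \<oplus>\<^bsub>kk_hopf\<^esub> (r, s) = (p + r, q + s)"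
  "c \<odot>\<^bsub>kk_hopf\<^esub> (p, q) = (c * p, c * q)"
  "(p, q) \<otimes>\<^bsub>kk_hopf\<^esub> (r, s) = (p * r, q * s)"
  "counit kk_hopf (p, q) = p"
proof -
  interpret hopf_algebra "C2_hopf :: ('k, _) hopf" by (rule hopf_algebra_C2)
  note cl = finite_dual_closed[OF C2_dual_closed C2_dual_closed] finite_dual_one C2_dual_closed
  have sw: "sweed C2_hopf (Poly_Mapping.single n (1 :: 'k)) \<beta> = \<beta> (Poly_Mapping.single n 1) (Poly_Mapping.single n 1)" for n \<beta>
    by (simp add: C2_hopf_def sweed_group_hopf)
  have co: "counit C2_hopf (Poly_Mapping.single n (1 :: 'k)) = 1" for n
    by (simp add: C2_hopf_def group_hopf_sel)
  show "carrier kk_hopf = (UNIV :: ('k \<times> 'k) set)" by (simp add: kk_hopf_transport)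
  show "\<one>\<^bsub>kk_hopf\<^esub> = (1 :: 'k, 1)"
    by (simp add: kk_hopf_transport finite_dual_sel inv_C2_dual cl co)
  show "(p, q) \<oplus>\<^bsub>kk_hopf\<^esub> (r, s) = (p + r, q + s)" "c \<odot>\<^bsub>kk_hopf\<^esub> (p, q) = (c * p, c * q)"
    "(p, q) \<otimes>\<^bsub>kk_hopf\<^esub> (r, s) = (p * r, q * s)"
    by (simp_all add: kk_hopf_transport finite_dual_sel inv_C2_dual cl sw)
  show "counit kk_hopf (p, q) = p"
    using C2_dual_apply(1)[of p q] by (simp add: kk_hopf_transport finite_dual_sel) (simp add: C2_hopf_def group_hopf_sel)
qed

text \<open>As a function f on the group, the pair (p, q) has the coproduct (g, h) \<mapsto> f(gh);
  the four products of group elements give the values p, q, q, p.\<close>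

lemma sweed_kk:
  "sweed kk_hopf (p, q) (\<lambda>a b. (u * fst a + v * snd a) * (w * fst b + z * snd b)) =
    u * w * p + u * z * q + v * w * q + v * (z :: 'k::field) * p"
proof -
  interpret hopf_algebra "C2_hopf :: ('k, _) hopf" by (rule hopf_algebra_C2)
  interpret F: hopf_algebra "finite_dual (C2_hopf :: ('k, _) hopf)" by (rule hopf_algebra_finite_dual)
  let ?s0 = "Poly_Mapping.single 0 1 :: int \<Rightarrow>\<^sub>0 'k" and ?s1 = "Poly_Mapping.single 1 1 :: int \<Rightarrow>\<^sub>0 'k"
  note cong = F.sweed_cong[unfolded finite_dual_sel(1)]
  have "sweed kk_hopf (p, q) (\<lambda>a b. (u * fst a + v * snd a) * (w * fst b + z * snd b)) =
      sweed (finite_dual C2_hopf) (C2_dual p q) (\<lambda>l m. (u * l ?s0 + v * l ?s1) * (w * m ?s0 + z * m ?s1))"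
    unfolding kk_hopf_transport sweed_transport
    by (rule cong) (simp_all add: C2_dual_closed inv_C2_dual)
  also have "\<dots> = sweed (finite_dual C2_hopf) (C2_dual p q) (\<lambda>l m. (u * w) * (l ?s0 * m ?s0) + (u * z) * (l ?s0 * m ?s1)
      + (v * w) * (l ?s1 * m ?s0) + (v * z) * (l ?s1 * m ?s1))"
    by (simp add: algebra_simps)
  also have "\<dots> = u * w * p + u * z * q + v * w * q + v * z * p"
    by (simp only: sweed_linear comult_finite_dual(2)[OF C2_dual_closed] single_C2) simp
  finally show ?thesis .
qed

section \<open>The action of the function algebra of the group of order two in characteristic
  two\<close>

lemma acts_by_psi3: "acts_by kk_hopf (psi3 \<theta>) (\<lambda>h. \<theta> * (fst h + snd h)) snd"
  by (auto simp: acts_by_def psi3_def bar1_el barx_el kk_sel algebra_simps)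

text \<open>With \<alpha> = \<theta>(\<epsilon> + \<beta>) and \<beta>\<beta> = \<epsilon>, both
  convolution identities are multiples of 2(\<epsilon> + \<beta>).\<close>

lemma action_psi3:
  assumes two: "(2 :: 'k::field) = 0"
  shows "unital_hopf_action kk_hopf trunc (psi3 (\<theta> :: 'k))"
proof (rule trunc_actionI[OF hopf_algebra_kk _ acts_by_psi3])
  note dz = double_zero[OF two]
  have 1: "sweed kk_hopf h (\<lambda>a b. \<theta> * (fst a + snd a) * (\<theta> * (fst b + snd b))) = 0"
    and 2: "sweed kk_hopf h (\<lambda>a b. \<theta> * (fst a + snd a) * snd b) + sweed kk_hopf h (\<lambda>a b. snd a * (\<theta> * (fst b + snd b))) = 0" for h
  proof -
    obtain p q where h: "h = (p, q)" by (cases h)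
    have "sweed kk_hopf h (\<lambda>a b. \<theta> * (fst a + snd a) * (\<theta> * (fst b + snd b))) =
        (\<theta> * \<theta> * p + \<theta> * \<theta> * q) + (\<theta> * \<theta> * p + \<theta> * \<theta> * q)"
      using sweed_kk[of p q \<theta> \<theta> \<theta> \<theta>] by (simp add: h algebra_simps)
    then show "sweed kk_hopf h (\<lambda>a b. \<theta> * (fst a + snd a) * (\<theta> * (fst b + snd b))) = 0" by (simp only: dz)
    have "sweed kk_hopf h (\<lambda>a b. \<theta> * (fst a + snd a) * snd b) + sweed kk_hopf h (\<lambda>a b. snd a * (\<theta> * (fst b + snd b))) =
        (\<theta> * p + \<theta> * q) + (\<theta> * p + \<theta> * q)"
      using sweed_kk[of p q \<theta> \<theta> 0 1] sweed_kk[of p q 0 1 \<theta> \<theta>] by (simp add: h algebra_simps)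
    then show "sweed kk_hopf h (\<lambda>a b. \<theta> * (fst a + snd a) * snd b) + sweed kk_hopf h (\<lambda>a b. snd a * (\<theta> * (fst b + snd b))) = 0"
      by (simp only: dz)
  qed
  \<comment> \<open>The rule for \<alpha> on products; its two sides differ by 2\<theta>ps.\<close>
  have 3: "\<theta> * (p * r + q * s) = p * (\<theta> * (r + s)) + \<theta> * (p + q) * s" for p q r s
  proof -
    have "p * (\<theta> * (r + s)) + \<theta> * (p + q) * s = \<theta> * (p * r + q * s) + (\<theta> * p * s + \<theta> * p * s)"
      by (simp add: algebra_simps)
    then show ?thesis by (simp add: dz)
  qed
  show "action_data kk_hopf (\<lambda>h. \<theta> * (fst h + snd h)) snd"
    unfolding action_data_def using 1 2 3 dz[of 1]
    by (simp add: split_paired_all kk_sel k_functional_def algebra_simps del: mult_eq_0_iff one_add_one)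
qed

lemma cosupp_psi3: "cosupp kk_hopf trunc (psi3 \<theta>) = {mop p (\<theta> * (p + q)) q |p q. True}"
  unfolding cosupp_acts_by[OF acts_by_psi3] by (simp add: kk_sel split_paired_Ex)

lemma hopf_hom_transport:
  assumes "hopf_algebra H" "hopf_algebra G" "bij_betw g Z (carrier G)" "hopf_hom H G f"
  shows "hopf_hom H (transport_hopf Z g G) (\<lambda>h. inv_into Z g (f h))"
proof -
  have f: "x \<in> carrier H \<Longrightarrow> f x \<in> carrier G" "f \<one>\<^bsub>H\<^esub> = \<one>\<^bsub>G\<^esub>"
    "\<lbrakk>x \<in> carrier H; y \<in> carrier H\<rbrakk> \<Longrightarrow> f (x \<oplus>\<^bsub>H\<^esub> y) = f x \<oplus>\<^bsub>G\<^esub> f y"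
    "\<lbrakk>x \<in> carrier H; y \<in> carrier H\<rbrakk> \<Longrightarrow> f (x \<otimes>\<^bsub>H\<^esub> y) = f x \<otimes>\<^bsub>G\<^esub> f y"
    "x \<in> carrier H \<Longrightarrow> f (c \<odot>\<^bsub>H\<^esub> x) = c \<odot>\<^bsub>G\<^esub> f x"
    "x \<in> carrier H \<Longrightarrow> counit G (f x) = counit H x" for x y c
    using assms(4) by (auto simp: hopf_hom_def k_linear_def ring_hom_def)
  have gi: "g (inv_into Z g y) = y" "inv_into Z g y \<in> Z" if "y \<in> carrier G" for y
    using assms(3) that by (simp_all add: bij_betw_inv_into_right inv_into_into bij_betw_def)
  have T: "hopf_algebra (transport_hopf Z g G)" by (rule hopf_algebra_transport[OF assms(2,3)])
  show ?thesis
  proof (rule hopf_homI[OF assms(1) T])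
    fix x \<beta> assume x: "x \<in> carrier H" and \<beta>: "bil (transport_hopf Z g G) (transport_hopf Z g G) \<beta>"
    have lin: "k_functional G (\<lambda>a. l (inv_into Z g a))" if l: "k_functional (transport_hopf Z g G) l" for l
      unfolding k_functional_def
    proof (intro conjI ballI allI)
      fix a b assume "a \<in> carrier G" "b \<in> carrier G"
      then show "l (inv_into Z g (a \<oplus>\<^bsub>G\<^esub> b)) = l (inv_into Z g a) + l (inv_into Z g b)"
        using k_functionalD(1)[OF l, of "inv_into Z g a" "inv_into Z g b"] by (simp add: gi)
    next
      fix a c assume "a \<in> carrier G"
      then show "l (inv_into Z g (c \<odot>\<^bsub>G\<^esub> a)) = c * l (inv_into Z g a)"
        using k_functionalD(2)[OF l, of "inv_into Z g a" c] by (simp add: gi)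
    qed
    have "bil G G (\<lambda>a b. \<beta> (inv_into Z g a) (inv_into Z g b))"
      unfolding bil_def
    proof (intro conjI ballI)
      fix a assume "a \<in> carrier G"
      then show "k_functional G (\<lambda>b. \<beta> (inv_into Z g a) (inv_into Z g b))"
        "k_functional G (\<lambda>b. \<beta> (inv_into Z g b) (inv_into Z g a))"
        using \<beta> gi(2) by (auto simp: bil_def intro: lin[of "\<beta> (inv_into Z g a)"] lin[of "\<lambda>b. \<beta> b (inv_into Z g a)"])
    qed
    from hopf_hom_sweed[OF assms(4) x this]
    show "sweed (transport_hopf Z g G) (inv_into Z g (f x)) \<beta> = sweed H x (\<lambda>a b. \<beta> (inv_into Z g (f a)) (inv_into Z g (f b)))"
      using x by (simp add: sweed_transport gi f)
  qed (simp_all add: k_linear_def f gi)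
qed

text \<open>The cosupport forces \<alpha> = \<theta>(\<epsilon> + \<beta>), and then
  \<alpha>\<alpha> = 0 gives \<beta>\<beta> = \<epsilon> in characteristic two. So \<beta> is a
  character with trivial square, which amounts to a homomorphism from the group of order two to the
  characters.\<close>

lemma universal_psi3:
  assumes two: "(2 :: 'k::field) = 0" and \<theta>: "\<theta> \<noteq> 0"
  shows "V_universal TYPE('h) trunc (cosupp kk_hopf trunc (psi3 (\<theta> :: 'k))) kk_hopf (psi3 \<theta>)"
proof (rule V_universalI[OF action_psi3[OF two] acts_by_psi3])
  fix H :: "('k, 'h) hopf" and \<alpha> \<beta>
  assume hopf: "hopf_algebra H" and data: "action_data H \<alpha> \<beta>"
    and V: "\<And>h. h \<in> carrier H \<Longrightarrow> mop (counit H h) (\<alpha> h) (\<beta> h) \<in> cosupp kk_hopf trunc (psi3 \<theta>)"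
  interpret H: hopf_algebra H by fact
  note dz = double_zero[OF two]
  have \<alpha>: "\<alpha> h = \<theta> * (counit H h + \<beta> h)" if "h \<in> carrier H" for h
    using V[OF that] by (auto simp: cosupp_psi3)
  have \<beta>f: "k_functional H \<beta>" and conv: "\<And>h. h \<in> carrier H \<Longrightarrow> sweed H h (\<lambda>a b. \<alpha> a * \<alpha> b) = 0"
    using data by (auto simp: action_data_def)
  have \<beta>\<beta>: "sweed H h (\<lambda>a b. \<beta> a * \<beta> b) = counit H h" if h: "h \<in> carrier H" for h
  proof -
    have "0 = sweed H h (\<lambda>a b. \<alpha> a * \<alpha> b)" using conv[OF h] by simp
    also have "\<dots> = sweed H h (\<lambda>a b. (\<theta> * \<theta>) * (counit H a * counit H b + counit H a * \<beta> b + counit H b * \<beta> a + \<beta> a * \<beta> b))"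
      by (intro H.sweed_cong refl h) (simp only: \<alpha>, simp add: algebra_simps)
    also have "\<dots> = (\<theta> * \<theta>) * (counit H h + \<beta> h + \<beta> h + sweed H h (\<lambda>a b. \<beta> a * \<beta> b))"
      by (simp only: sweed_linear H.sweed_counit_l[OF H.counit_linear h] H.sweed_counit_l[OF \<beta>f h] H.sweed_counit_r[OF \<beta>f h])
    finally have "counit H h + (\<beta> h + \<beta> h) + sweed H h (\<lambda>a b. \<beta> a * \<beta> b) = 0" using \<theta> by (simp add: add.assoc)
    then have "counit H h + sweed H h (\<lambda>a b. \<beta> a * \<beta> b) = 0" by (simp add: dz)
    moreover have "counit H h + counit H h = 0" by (rule dz)
    ultimately show ?thesis by (metis add_left_imp_eq)
  qed
  let ?\<beta> = "restrict \<beta> (carrier H)"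
  have \<beta>: "?\<beta> \<in> characters H"
    using data by (simp add: action_data_def characters_def H.dual_carrier k_functional_def)
  have \<beta>2: "?\<beta> \<otimes>\<^bsub>dual_algebra H\<^esub> ?\<beta> = \<one>\<^bsub>dual_algebra H\<^esub>"
    by (rule extensionalityI[of _ "carrier H"]) (simp_all add: \<beta>\<beta> cong: H.sweed_cong)
  interpret D: k_algebra "dual_algebra H" by (rule H.dual_algebra_algebra)
  have "(\<lambda>n. if n = 0 then \<one>\<^bsub>dual_algebra H\<^esub> else ?\<beta>) \<in> hom (integer_mod_group 2) (character_group H)"
    using \<beta> \<beta>2 H.counit_character H.charactersD(1)[OF \<beta>]
    by (auto simp: hom_def carrier_C2_group character_group_def)
  from group_dual_hom[OF hopf group_integer_mod_group this]
  obtain f where f0: "hopf_hom H (finite_dual C2_hopf) f"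
    and f1: "\<And>h g. \<lbrakk>h \<in> carrier H; g \<in> {0, 1}\<rbrakk> \<Longrightarrow>
      f h (Poly_Mapping.single g 1) = (if g = 0 then \<one>\<^bsub>dual_algebra H\<^esub> else ?\<beta>) h"
    unfolding C2_hopf_def carrier_C2_group by metis
  have f: "hopf_hom H (finite_dual C2_hopf) f"
    "\<And>h. h \<in> carrier H \<Longrightarrow> f h (Poly_Mapping.single 0 1) = \<one>\<^bsub>dual_algebra H\<^esub> h"
    "\<And>h. h \<in> carrier H \<Longrightarrow> f h (Poly_Mapping.single 1 1) = ?\<beta> h"
    by (rule f0, subst f1, simp_all, subst f1, simp_all)
  let ?f = "\<lambda>h. inv_into UNIV (\<lambda>(p, q). C2_dual p q) (f h)"
  have "?f h = (counit H h, \<beta> h)" if h: "h \<in> carrier H" for h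
  proof -
    have "f h \<in> finite_dual_carrier C2_hopf" using f(1) h by (auto simp: hopf_hom_def k_linear_def finite_dual_sel)
    then show ?thesis using f(2,3)[OF h] h by (simp add: inv_C2_dual)
  qed
  moreover have "hopf_hom H kk_hopf ?f"
    unfolding kk_hopf_transport
    by (rule hopf_hom_transport[OF hopf hopf_algebra.hopf_algebra_finite_dual[OF hopf_algebra_C2] bij_C2_dual f(1)])
  ultimately show "\<exists>\<phi>. hopf_hom H kk_hopf \<phi> \<and> (\<forall>h\<in>carrier H. \<theta> * (fst (\<phi> h) + snd (\<phi> h)) = \<alpha> h \<and> snd (\<phi> h) = \<beta> h)"
    using \<alpha> by (intro exI[of _ ?f]) simp
next
  fix H :: "('k, 'h) hopf" and \<phi> \<phi>' h
  assume *: "hopf_hom H kk_hopf \<phi>" "hopf_hom H kk_hopf \<phi>'" "h \<in> carrier H"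
    "\<And>h. h \<in> carrier H \<Longrightarrow> \<theta> * (fst (\<phi> h) + snd (\<phi> h)) = \<theta> * (fst (\<phi>' h) + snd (\<phi>' h)) \<and> snd (\<phi> h) = snd (\<phi>' h)"
  \<comment> \<open>The first coordinate is the counit of \<open>kk_hopf\<close>, so every
    homomorphism has the same one.\<close>
  have "fst (\<phi> h) = counit H h" "fst (\<phi>' h) = counit H h"
    using *(1-3) kk_sel(6)[of "fst (\<phi> h)" "snd (\<phi> h)"] kk_sel(6)[of "fst (\<phi>' h)" "snd (\<phi>' h)"]
    by (simp_all add: hopf_hom_def)
  then show "\<phi> h = \<phi>' h" using *(4)[OF *(3)] by (simp add: prod_eq_iff)
qed

subsection \<open>Functionals on an algebra given by generators and relations\<close>

context presented
begin

lemma functional_cls: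
  assumes "k_functional Q l"
  shows "l (cls x) = slift (\<lambda>w. l (cls (word w))) x"
proof -
  have "k_functional free_algebra (\<lambda>x. l (cls x))" using assms by (simp only: functional_proj)
  then show ?thesis
    unfolding free_algebra_def word_def
    by (intro functional_monoid_algebra) (auto simp: Group.monoid_def)
qed

text \<open>Equality of cosets is tested by functionals on the quotient, for which the relators
  become rewrite rules between values at words; identities in a presented algebra are then proved by
  simplification.\<close>

lemma cls_eqI:
  assumes "\<And>l. k_functional Q l \<Longrightarrow> slift (\<lambda>w. l (cls (word w))) x = slift (\<lambda>w. l (cls (word w))) y"
  shows "cls x = cls y"
proof -
  interpret Q: k_algebra Q by (rule k_algebra_quot)
  show ?thesis
  proof (rule Q.functional_ext)
    fix l assume l: "k_functional Q l"
    show "l (cls x) = l (cls y)"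
      unfolding functional_cls[OF l, of x] functional_cls[OF l, of y] by (rule assms[OF l])
  qed simp_all
qed

text \<open>The relator stands inside an arbitrary word, so the resulting equations can be used to
  rewrite subwords.\<close>

lemma functional_relator:
  assumes l: "k_functional Q l" and r: "r \<in> R"
  shows "slift (\<lambda>w. l (cls (word (u @ w @ v)))) r = 0"
proof -
  interpret Q: k_algebra Q by (rule k_algebra_quot)
  have "cls (word u \<otimes>\<^bsub>free_algebra\<^esub> r \<otimes>\<^bsub>free_algebra\<^esub> word v) = cls (word u) \<otimes>\<^bsub>Q\<^esub> cls 0 \<otimes>\<^bsub>Q\<^esub> cls (word v)"
    unfolding Q_simps(3)[symmetric] cls_relator[OF r] ..
  also have "\<dots> = cls 0"
    using Q.r_null[of "cls (word u)"] Q.l_null[of "cls (word v)"] by (simp only: Q_simps(2,6))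
  finally have "l (cls (word u \<otimes>\<^bsub>free_algebra\<^esub> r \<otimes>\<^bsub>free_algebra\<^esub> word v)) = l (cls 0)" by simp
  then show ?thesis
    unfolding functional_cls[OF l, of "_ \<otimes>\<^bsub>_\<^esub> _"] functional_cls[OF l, of 0] by simp
qed

lemma presented_hom_functional:
  fixes A :: "('k, 'a, 'n) module_scheme" (structure)
  assumes "k_algebra A" and u: "\<And>g. u g \<in> carrier A"
    and rel: "\<And>r l. \<lbrakk>r \<in> R; k_functional A l\<rbrakk> \<Longrightarrow> slift (\<lambda>w. l (foldr (\<lambda>g x. u g \<otimes> x) w \<one>)) r = 0"
  obtains F where "k_linear Q A F" "F \<in> ring_hom Q A" "\<And>g. F (cls (word [g])) = u g"
proof -
  interpret A: k_algebra A by fact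
  have cl: "foldr (\<lambda>g x. u g \<otimes> x) w \<one> \<in> carrier A" for w
    by (induction w) (simp_all add: u)
  have "mlift A (\<lambda>w. foldr (\<lambda>g x. u g \<otimes> x) w \<one>) r = \<zero>" if r: "r \<in> R" for r
  proof (rule A.functional_ext)
    fix l assume l: "k_functional A l"
    show "l (mlift A (\<lambda>w. foldr (\<lambda>g x. u g \<otimes> x) w \<one>) r) = l \<zero>"
      by (subst A.functional_mlift[OF l]) (simp_all add: cl rel[OF r l] A.functional_zero[OF l])
  qed (simp_all add: cl A.mlift_closed)
  from presented_hom[OF assms(1) u this] show ?thesis using that by blast
qed

end

context presented_bialgebra
begin

lemma linear_P: "k_linear P A F \<longleftrightarrow> k_linear Q A F" and ring_hom_P: "F \<in> ring_hom P A \<longleftrightarrow> F \<in> ring_hom Q A"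
  by (simp_all add: k_linear_def ring_hom_def presented_hopf_def)

lemma P_induct [consumes 1, case_names one gen add scale]:
  assumes "z \<in> carrier P"
    and one: "K \<one>\<^bsub>P\<^esub>"
    and gen: "\<And>g x. \<lbrakk>x \<in> carrier P; K x\<rbrakk> \<Longrightarrow> K (cls (word [g]) \<otimes>\<^bsub>P\<^esub> x)"
    and add: "\<And>x y. \<lbrakk>x \<in> carrier P; y \<in> carrier P; K x; K y\<rbrakk> \<Longrightarrow> K (x \<oplus>\<^bsub>P\<^esub> y)"
    and scale: "\<And>c x. \<lbrakk>x \<in> carrier P; K x\<rbrakk> \<Longrightarrow> K (c \<odot>\<^bsub>P\<^esub> x)"
  shows "K z"
proof -
  have P: "carrier P = carrier Q" by (simp add: P_sel carrier_Q)
  have "z \<in> carrier Q" using assms(1) P by simp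
  then show ?thesis
  proof (induction rule: Q_induct)
    case one
    then show ?case using assms(2) by (simp only: P_sel)
  next
    case (gen g w)
    have "cls (word [g]) \<otimes>\<^bsub>P\<^esub> cls (word w) = cls (word (g # w))" by (simp add: P_sel)
    then show ?case using assms(3)[OF _ gen, of g] by (simp add: P_sel(1))
  next
    case (add x y)
    then show ?case using assms(4)[of x y] by (simp add: P presented_hopf_def)
  next
    case (scale c x)
    then show ?case using assms(5)[of x c] by (simp add: P presented_hopf_def)
  qed
qed

end

subsection \<open>Grouplike and skew primitive elements\<close>

context pre_hopf
begin

lemma hopf_at_grouplike:
  assumes x: "x \<in> carrier H" and sw: "\<And>\<beta>. bil H H \<beta> \<Longrightarrow> sweed H x \<beta> = \<beta> x x"
    and e: "counit H x = 1" and S: "antipode H x \<otimes> x = \<one>" "x \<otimes> antipode H x = \<one>"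
  shows "hopf_at x"
  unfolding hopf_at_def
proof (intro conjI allI impI)
  fix \<tau> assume \<tau>: "tril H H H \<tau>"
  have "bil H H (\<lambda>a1 a2. \<tau> a1 a2 x)" "bil H H (\<lambda>b1 b2. \<tau> x b1 b2)"
    using trilD[OF \<tau>] x by (simp_all add: bil_def k_functional_def)
  then show "sweed H x (\<lambda>a b. sweed H a (\<lambda>a1 a2. \<tau> a1 a2 b)) = sweed H x (\<lambda>a b. sweed H b (\<lambda>b1 b2. \<tau> a b1 b2))"
    by (simp add: sw[OF bil_coassoc(1)[OF \<tau>]] sw[OF bil_coassoc(2)[OF \<tau>]] sw)
next
  fix l assume l: "k_functional H l"
  show "sweed H x (\<lambda>a b. counit H a * l b) = l x" "sweed H x (\<lambda>a b. counit H b * l a) = l x"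
    "sweed H x (\<lambda>a b. l (antipode H a \<otimes> b)) = counit H x * l \<one>"
    "sweed H x (\<lambda>a b. l (a \<otimes> antipode H b)) = counit H x * l \<one>"
    by (simp_all add: sw[OF bil_basic(1)[OF l]] sw[OF bil_basic(2)[OF l]] sw[OF bil_basic(3)[OF l]] sw[OF bil_basic(4)[OF l]] e S)
qed

text \<open>Two grouplike elements \<open>a\<close> and \<open>b\<close> are allowed because the
  algebras to be treated place the nontrivial one on opposite sides: h \<otimes> c + 1 \<otimes> h
  against c \<otimes> v + v \<otimes> 1.\<close>

lemma hopf_at_skew_primitive:
  assumes x: "x \<in> carrier H" "a \<in> carrier H" "b \<in> carrier H"
    and sw: "\<And>\<beta>. bil H H \<beta> \<Longrightarrow> sweed H x \<beta> = \<beta> x a + \<beta> b x"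
      "\<And>\<beta>. bil H H \<beta> \<Longrightarrow> sweed H a \<beta> = \<beta> a a" "\<And>\<beta>. bil H H \<beta> \<Longrightarrow> sweed H b \<beta> = \<beta> b b"
    and e: "counit H x = 0" "counit H a = 1" "counit H b = 1"
    and S: "antipode H x \<otimes> a \<oplus> antipode H b \<otimes> x = \<zero>" "x \<otimes> antipode H a \<oplus> b \<otimes> antipode H x = \<zero>"
  shows "hopf_at x"
  unfolding hopf_at_def
proof (intro conjI allI impI)
  fix \<tau> assume \<tau>: "tril H H H \<tau>"
  have "bil H H (\<lambda>a1 a2. \<tau> a1 a2 y)" "bil H H (\<lambda>b1 b2. \<tau> y b1 b2)" if "y \<in> carrier H" for y
    using trilD[OF \<tau>] that by (simp_all add: bil_def k_functional_def)
  then show "sweed H x (\<lambda>a b. sweed H a (\<lambda>a1 a2. \<tau> a1 a2 b)) = sweed H x (\<lambda>a b. sweed H b (\<lambda>b1 b2. \<tau> a b1 b2))"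
    using x by (simp add: sw(1)[OF bil_coassoc(1)[OF \<tau>]] sw(1)[OF bil_coassoc(2)[OF \<tau>]] sw)
next
  fix l assume l: "k_functional H l"
  have "l (antipode H x \<otimes> a) + l (antipode H b \<otimes> x) = 0" "l (x \<otimes> antipode H a) + l (b \<otimes> antipode H x) = 0"
    using k_functionalD(1)[OF l, of "antipode H x \<otimes> a" "antipode H b \<otimes> x"]
      k_functionalD(1)[OF l, of "x \<otimes> antipode H a" "b \<otimes> antipode H x"] x
    by (simp_all add: S functional_zero[OF l])
  then show "sweed H x (\<lambda>a b. counit H a * l b) = l x" "sweed H x (\<lambda>a b. counit H b * l a) = l x"
    "sweed H x (\<lambda>a b. l (antipode H a \<otimes> b)) = counit H x * l \<one>"
    "sweed H x (\<lambda>a b. l (a \<otimes> antipode H b)) = counit H x * l \<one>"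
    by (simp_all add: sw(1)[OF bil_basic(1)[OF l]] sw(1)[OF bil_basic(2)[OF l]] sw(1)[OF bil_basic(3)[OF l]]
        sw(1)[OF bil_basic(4)[OF l]] e)
qed

end

subsection \<open>The Hopf algebra \<open>k\<langle>c,d,h\<rangle>/I\<^sub>0\<close>\<close>

abbreviation cdh_comult where
  "cdh_comult \<equiv> case_cdh (tens (word [GenC]) (word [GenC])) (tens (word [GenD]) (word [GenD]))
    (tens (word [GenH]) (word [GenC]) + tens (word []) (word [GenH]))"

abbreviation cdh_counit where "cdh_counit \<equiv> case_cdh 1 1 0"

abbreviation cdh_antipode where
  "cdh_antipode \<equiv> case_cdh (word [GenD]) (word [GenC]) (- word [GenH, GenD])"

abbreviation cdh_quot :: "('k::field, (cdh list \<Rightarrow>\<^sub>0 'k) set) module" where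
  "cdh_quot \<equiv> quot_algebra free_algebra (genideal free_algebra cdh_relators)"

abbreviation cdh_word :: "cdh list \<Rightarrow> (cdh list \<Rightarrow>\<^sub>0 'k::field) set" where
  "cdh_word w \<equiv> pres_class cdh_relators (word w)"

lemma cdh_relators_cases: "r \<in> cdh_relators \<longleftrightarrow> r = word [GenC, GenD] - word [] \<or> r = word [GenD, GenC] - word [] \<or>
      r = word [GenH, GenH] \<or> r = word [GenH, GenC] + word [GenC, GenH]"
  by (simp add: cdh_relators_def)

lemma cdh_relations:
  assumes l: "k_functional cdh_quot l"
  shows "l (cdh_word (u @ GenC # GenD # v)) = l (cdh_word (u @ v))"
    "l (cdh_word (u @ GenD # GenC # v)) = l (cdh_word (u @ v))"
    "l (cdh_word (u @ GenH # GenH # v)) = 0"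
    "l (cdh_word (u @ GenH # GenC # v)) = - l (cdh_word (u @ GenC # GenH # v))"
    "l (cdh_word (u @ GenD # GenH # v)) = - l (cdh_word (u @ GenH # GenD # v))"
proof -
  have r: "slift (\<lambda>w. l (cdh_word (u @ w @ v))) r = 0" if "r \<in> cdh_relators" for r u v
    by (rule presented.functional_relator[OF l that])
  note rel = r[of "word [GenC, GenD] - word []"] r[of "word [GenD, GenC] - word []"]
    r[of "word [GenH, GenH]"] r[of "word [GenH, GenC] + word [GenC, GenH]"]
  have 1: "l (cdh_word (u @ GenC # GenD # v)) = l (cdh_word (u @ v))" for u v
    using rel(1) by (simp add: cdh_relators_def)
  have 2: "l (cdh_word (u @ GenD # GenC # v)) = l (cdh_word (u @ v))" for u v
    using rel(2) by (simp add: cdh_relators_def)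
  have 3: "l (cdh_word (u @ GenH # GenH # v)) = 0" for u v
    using rel(3) by (simp add: cdh_relators_def)
  have 4: "l (cdh_word (u @ GenH # GenC # v)) = - l (cdh_word (u @ GenC # GenH # v))" for u v
    using rel(4)[of u v] by (simp add: cdh_relators_def add_eq_0_iff2)
  \<comment> \<open>The relation between d and h is derived: dh = dhcd = -dchd = -hd.\<close>
  have "l (cdh_word (u @ GenD # GenH # v)) = l (cdh_word ((u @ [GenD, GenH]) @ GenC # GenD # v))"
    unfolding 1 by simp
  also have "\<dots> = - l (cdh_word ((u @ [GenD]) @ GenC # GenH # GenD # v))"
    using 4[of "u @ [GenD]" "GenD # v"] by simp
  also have "\<dots> = - l (cdh_word (u @ GenH # GenD # v))" using 2[of u "GenH # GenD # v"] by simp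
  finally show "l (cdh_word (u @ GenD # GenH # v)) = - l (cdh_word (u @ GenH # GenD # v))" .
  show "l (cdh_word (u @ GenC # GenD # v)) = l (cdh_word (u @ v))"
    "l (cdh_word (u @ GenD # GenC # v)) = l (cdh_word (u @ v))"
    "l (cdh_word (u @ GenH # GenH # v)) = 0"
    "l (cdh_word (u @ GenH # GenC # v)) = - l (cdh_word (u @ GenC # GenH # v))"
    by (fact 1 2 3 4)+
qed

lemma presented_bialgebra_cdh: "presented_bialgebra (cdh_relators :: (cdh list \<Rightarrow>\<^sub>0 'k::field) set) cdh_comult cdh_counit cdh_antipode"
proof
  fix r :: "cdh list \<Rightarrow>\<^sub>0 'k" assume "r \<in> cdh_relators"
  note r = this[unfolded cdh_relators_cases]
  then show "slift (\<lambda>w. prod_list (map cdh_counit w)) r = 0" by auto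
  show "pres_class cdh_relators (flift (word_antipode cdh_antipode) r) = pres_class cdh_relators 0"
  proof (rule presented.cls_eqI)
    fix l :: "(cdh list \<Rightarrow>\<^sub>0 'k) set \<Rightarrow> 'k" assume l: "k_functional cdh_quot l"
    \<comment> \<open>The antipode sends hh to hdhd = -hhdd, and hc + ch to -dhd - hdd; these call
      for the relations inside longer words.\<close>
    note rel = cdh_relations[OF l, of "[]" "[]", simplified] cdh_relations(5)[OF l, of "[]" "[GenD]", simplified]
      cdh_relations(5)[OF l, of "[GenH]" "[GenD]", simplified] cdh_relations(3)[OF l, of "[]" "[GenD, GenD]", simplified]
    show "slift (\<lambda>w. l (cdh_word w)) (flift (word_antipode cdh_antipode) r) = slift (\<lambda>w. l (cdh_word w)) 0"
      using r by (auto simp: rel)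
  qed
  fix \<beta> :: "(cdh list \<Rightarrow>\<^sub>0 'k) set \<Rightarrow> (cdh list \<Rightarrow>\<^sub>0 'k) set \<Rightarrow> 'k" assume \<beta>: "bil cdh_quot cdh_quot \<beta>"
  \<comment> \<open>The relations are applied in one tensor factor at a time. For instance the
    square of h \<otimes> c + 1 \<otimes> h is hh \<otimes> cc + h \<otimes> (ch + hc) + 1 \<otimes>
    hh, where every term vanishes.\<close>
  have l: "k_functional cdh_quot (\<lambda>x. \<beta> x (cdh_word w))" "k_functional cdh_quot (\<lambda>y. \<beta> (cdh_word w) y)" for w
    using \<beta> by (simp_all add: bil_def presented.Q_simps(6))
  have rel: "\<beta> (cdh_word [GenC, GenD]) (cdh_word w) = \<beta> (cdh_word []) (cdh_word w)"
    "\<beta> (cdh_word [GenD, GenC]) (cdh_word w) = \<beta> (cdh_word []) (cdh_word w)"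
    "\<beta> (cdh_word [GenH, GenH]) (cdh_word w) = 0"
    "\<beta> (cdh_word [GenH, GenC]) (cdh_word w) = - \<beta> (cdh_word [GenC, GenH]) (cdh_word w)"
    "\<beta> (cdh_word w) (cdh_word [GenC, GenD]) = \<beta> (cdh_word w) (cdh_word [])"
    "\<beta> (cdh_word w) (cdh_word [GenD, GenC]) = \<beta> (cdh_word w) (cdh_word [])"
    "\<beta> (cdh_word w) (cdh_word [GenH, GenH]) = 0"
    "\<beta> (cdh_word w) (cdh_word [GenH, GenC]) = - \<beta> (cdh_word w) (cdh_word [GenC, GenH])" for w
    using cdh_relations[OF l(1)[of w], of "[]" "[]"] cdh_relations[OF l(2)[of w], of "[]" "[]"] by simp_all
  show "slift (\<lambda>(a, b). \<beta> (pres_class cdh_relators a) (pres_class cdh_relators b)) (flift (word_comult cdh_comult) r) = 0"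
    using r by (auto simp: rel)
qed

lemmas cdh_hopf_facts = presented_bialgebra_cdh[THEN presented_bialgebra.bil_P, folded cdh_hopf_def]
  presented_bialgebra_cdh[THEN presented_bialgebra.sweed_P, folded cdh_hopf_def]
  presented_bialgebra_cdh[THEN presented_bialgebra.counit_P, folded cdh_hopf_def]
  presented_bialgebra_cdh[THEN presented_bialgebra.antipode_P, folded cdh_hopf_def]
  and cdh_carrier_ops = presented_bialgebra.P_sel[OF presented_bialgebra_cdh, folded cdh_hopf_def]

lemma cdh_sweed:
  assumes "bil cdh_hopf cdh_hopf \<beta>"
  shows "sweed cdh_hopf cdh_c \<beta> = \<beta> cdh_c cdh_c"
    "sweed cdh_hopf (cdh_word [GenD]) \<beta> = \<beta> (cdh_word [GenD]) (cdh_word [GenD])"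
    "sweed cdh_hopf cdh_h \<beta> = \<beta> cdh_h cdh_c + \<beta> \<one>\<^bsub>cdh_hopf\<^esub> cdh_h"
  using assms by (simp_all add: cdh_hopf_facts cdh_c_def cdh_h_def cdh_carrier_ops)

lemma cdh_sel:
  "cdh_c \<in> carrier cdh_hopf" "cdh_h \<in> carrier cdh_hopf" "cdh_word w \<in> carrier cdh_hopf"
  "counit cdh_hopf cdh_c = 1" "counit cdh_hopf (cdh_word [GenD]) = 1" "counit cdh_hopf cdh_h = 0"
  "antipode cdh_hopf cdh_c = cdh_word [GenD]" "antipode cdh_hopf (cdh_word [GenD]) = cdh_c"
  "antipode cdh_hopf cdh_h = pres_class cdh_relators (- word [GenH, GenD])"
  by (simp_all add: cdh_c_def cdh_h_def cdh_carrier_ops cdh_hopf_facts)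

lemma cdh_mult:
  "cdh_c \<otimes>\<^bsub>cdh_hopf\<^esub> cdh_word [GenD] = \<one>\<^bsub>cdh_hopf :: ('k::field, _) hopf\<^esub>" "cdh_word [GenD] \<otimes>\<^bsub>cdh_hopf\<^esub> cdh_c = \<one>\<^bsub>cdh_hopf :: ('k::field, _) hopf\<^esub>"
  "cdh_h \<otimes>\<^bsub>cdh_hopf\<^esub> cdh_h = \<zero>\<^bsub>cdh_hopf :: ('k, _) hopf\<^esub>" "cdh_h \<otimes>\<^bsub>cdh_hopf\<^esub> cdh_c \<oplus>\<^bsub>cdh_hopf\<^esub> cdh_c \<otimes>\<^bsub>cdh_hopf\<^esub> cdh_h = \<zero>\<^bsub>cdh_hopf :: ('k, _) hopf\<^esub>"
  "antipode cdh_hopf cdh_h \<otimes>\<^bsub>cdh_hopf\<^esub> cdh_c \<oplus>\<^bsub>cdh_hopf\<^esub> cdh_h = \<zero>\<^bsub>cdh_hopf :: ('k, _) hopf\<^esub>"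
  "cdh_h \<otimes>\<^bsub>cdh_hopf\<^esub> cdh_word [GenD] \<oplus>\<^bsub>cdh_hopf\<^esub> antipode cdh_hopf cdh_h = \<zero>\<^bsub>cdh_hopf :: ('k, _) hopf\<^esub>"
proof -
  have eq: "pres_class cdh_relators x = pres_class cdh_relators y"
    if "\<And>l :: (cdh list \<Rightarrow>\<^sub>0 'k) set \<Rightarrow> 'k. \<lbrakk>l (cdh_word [GenC, GenD]) = l (cdh_word []); l (cdh_word [GenD, GenC]) = l (cdh_word []);
        l (cdh_word [GenH, GenH]) = 0; l (cdh_word [GenH, GenC]) = - l (cdh_word [GenC, GenH]);
        l (cdh_word [GenH, GenD, GenC]) = l (cdh_word [GenH])\<rbrakk> \<Longrightarrow>
      slift (\<lambda>w. l (cdh_word w)) x = slift (\<lambda>w. l (cdh_word w)) y" for x y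
  proof (rule presented.cls_eqI)
    fix l :: "(cdh list \<Rightarrow>\<^sub>0 'k) set \<Rightarrow> 'k" assume l: "k_functional cdh_quot l"
    show "slift (\<lambda>w. l (cdh_word w)) x = slift (\<lambda>w. l (cdh_word w)) y"
      using cdh_relations(1-4)[OF l, of "[]" "[]"] cdh_relations(2)[OF l, of "[GenH]" "[]"]
      by (intro that) simp_all
  qed
  show "cdh_c \<otimes>\<^bsub>cdh_hopf\<^esub> cdh_word [GenD] = \<one>\<^bsub>cdh_hopf :: ('k, _) hopf\<^esub>" "cdh_word [GenD] \<otimes>\<^bsub>cdh_hopf\<^esub> cdh_c = \<one>\<^bsub>cdh_hopf :: ('k, _) hopf\<^esub>"
    "cdh_h \<otimes>\<^bsub>cdh_hopf\<^esub> cdh_h = \<zero>\<^bsub>cdh_hopf :: ('k, _) hopf\<^esub>" "cdh_h \<otimes>\<^bsub>cdh_hopf\<^esub> cdh_c \<oplus>\<^bsub>cdh_hopf\<^esub> cdh_c \<otimes>\<^bsub>cdh_hopf\<^esub> cdh_h = \<zero>\<^bsub>cdh_hopf :: ('k, _) hopf\<^esub>"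
    "antipode cdh_hopf cdh_h \<otimes>\<^bsub>cdh_hopf\<^esub> cdh_c \<oplus>\<^bsub>cdh_hopf\<^esub> cdh_h = \<zero>\<^bsub>cdh_hopf :: ('k, _) hopf\<^esub>"
    "cdh_h \<otimes>\<^bsub>cdh_hopf\<^esub> cdh_word [GenD] \<oplus>\<^bsub>cdh_hopf\<^esub> antipode cdh_hopf cdh_h = \<zero>\<^bsub>cdh_hopf :: ('k, _) hopf\<^esub>"
    unfolding cdh_sel(9) unfolding cdh_c_def cdh_h_def cdh_carrier_ops
    by (rule eq, simp)+
qed

lemma hopf_algebra_cdh: "hopf_algebra cdh_hopf"
proof (rule presented_bialgebra.hopf_algebra_P[OF presented_bialgebra_cdh, folded cdh_hopf_def])
  interpret pre_hopf cdh_hopf by (rule presented_bialgebra.pre_hopf_P[OF presented_bialgebra_cdh, folded cdh_hopf_def])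
  fix g
  have S1: "antipode cdh_hopf \<one>\<^bsub>cdh_hopf\<^esub> = \<one>\<^bsub>cdh_hopf\<^esub>" by (rule antipode_one)
  show "hopf_at (cdh_word [g])"
  proof (cases g)
    case GenC
    then show ?thesis unfolding cdh_c_def[symmetric] GenC
      by (intro hopf_at_grouplike cdh_sweed cdh_sel) (simp_all add: cdh_sel cdh_mult)
  next
    case GenD
    then show ?thesis
      by (intro hopf_at_grouplike cdh_sweed cdh_sel) (simp_all add: cdh_sweed cdh_sel cdh_mult)
  next
    case GenH
    show ?thesis unfolding cdh_h_def[symmetric] GenH
      by (rule hopf_at_skew_primitive[of _ cdh_c "\<one>\<^bsub>cdh_hopf\<^esub>"])
        (simp_all add: cdh_sweed sweed_one cdh_sel(1-8) cdh_mult S1 counit_one)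
  qed
qed

subsection \<open>Coactions on the dual numbers\<close>

text \<open>The common pattern of \<open>rho5\<close> and \<open>rho5a\<close>: a grouplike
  \<open>c\<close> and an element \<open>g\<close> with coproduct g \<otimes> c + 1 \<otimes> g. In
  the Sweedler algebra the coproduct of v has the grouplike on the other side, and cv takes the part
  of \<open>g\<close>.\<close>

locale trunc_coaction = hopf_algebra B
  for B :: "('k::field, 'b, 'm) hopf_scheme" (structure) +
  fixes c g :: 'b and \<rho> :: "'k poly set \<Rightarrow> ('k poly set \<times> 'b \<Rightarrow>\<^sub>0 'k)"
  assumes closed: "c \<in> carrier B" "g \<in> carrier B"
    and sweed_c: "bil B B \<beta> \<Longrightarrow> sweed B c \<beta> = \<beta> c c"
    and sweed_g: "bil B B \<beta> \<Longrightarrow> sweed B g \<beta> = \<beta> g c + \<beta> \<one> g"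
    and counit_c: "counit B c = 1" and counit_g: "counit B g = 0"
    and g_g: "g \<otimes> g = \<zero>" and g_c: "g \<otimes> c \<oplus> c \<otimes> g = \<zero>"
    and \<rho>: "\<rho> (el p q) = fscale p (tens bar1 \<one>) + fscale q (tens bar1 g + tens barx c)"
begin

lemma unital_coaction: "unital_coaction B trunc \<rho>"
proof
  note \<rho>' = \<rho>[unfolded bar1_el barx_el]
  have keys: "Poly_Mapping.keys (\<rho> (el p q)) \<subseteq> {(el 1 0, \<one>), (el 1 0, g), (el 0 1, c)}" for p q
    unfolding \<rho>'
    by (intro order_trans[OF keys_add] Un_least order_trans[OF keys_fscale]) simp_all
  have "Poly_Mapping.keys (\<rho> a) \<subseteq> carrier trunc \<times> carrier B" if a: "a \<in> carrier trunc" for a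
  proof -
    obtain p q where "a = el p q" using a by (rule trunc_cases)
    moreover have "{(el 1 0, \<one>), (el 1 0, g), (el 0 1, c)} \<subseteq> carrier trunc \<times> carrier B" using closed by simp
    ultimately show ?thesis using order_trans[OF keys[of p q]] by simp
  qed
  then have "\<rho> \<in> carrier trunc \<rightarrow> tensor_carrier trunc B" by (simp add: tensor_carrier_def)
  moreover have "tensor_eq trunc B (\<rho> (a \<oplus>\<^bsub>trunc\<^esub> b)) (\<rho> a + \<rho> b)"
    "tensor_eq trunc B (\<rho> (r \<odot>\<^bsub>trunc\<^esub> a)) (fscale r (\<rho> a))"
    if "a \<in> carrier trunc" "b \<in> carrier trunc" for a b r
  proof -
    obtain p q where a: "a = el p q" using \<open>a \<in> _\<close> by (rule trunc_cases)
    obtain p' q' where b: "b = el p' q'" using \<open>b \<in> _\<close> by (rule trunc_cases)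
    show "tensor_eq trunc B (\<rho> (a \<oplus>\<^bsub>trunc\<^esub> b)) (\<rho> a + \<rho> b)"
      by (simp add: a b tensor_eq_iff \<rho>' algebra_simps)
    show "tensor_eq trunc B (\<rho> (r \<odot>\<^bsub>trunc\<^esub> a)) (fscale r (\<rho> a))"
      by (simp add: a tensor_eq_iff \<rho>' algebra_simps)
  qed
  ultimately show "tensor_linear trunc trunc B \<rho>"
    unfolding tensor_linear_def by (intro conjI ballI allI)
  \<comment> \<open>As x x = 0, the square of \<rho>(x) is 1 \<otimes> gg + x \<otimes> (gc + cg);
    the relations of the locale remove both terms.\<close>
  have b0: "\<beta> (el 0 0) b = 0" "\<beta> a \<zero> = 0" "\<beta> a (g \<otimes> c) + \<beta> a (c \<otimes> g) = 0"
    if \<beta>: "bil trunc B \<beta>" and ab: "a \<in> carrier trunc" "b \<in> carrier B" for \<beta> a b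
    using bilD(3)[OF \<beta>, of "el 0 0" b 0] bilD(4)[OF \<beta>, of a \<zero> 0] bilD(2)[OF \<beta>, of a "g \<otimes> c" "c \<otimes> g"] ab closed
    by (simp_all add: g_c)
  show "tensor_eq trunc B (\<rho> (a \<otimes>\<^bsub>trunc\<^esub> b)) (tmult trunc B (\<rho> a) (\<rho> b))"
    if "a \<in> carrier trunc" "b \<in> carrier trunc" for a b
    unfolding tensor_eq_iff
  proof (intro allI impI)
    fix \<beta> :: "'k poly set \<Rightarrow> 'b \<Rightarrow> 'k" assume \<beta>: "bil trunc B \<beta>"
    obtain p q where a: "a = el p q" using \<open>a \<in> _\<close> by (rule trunc_cases)
    obtain p' q' where b: "b = el p' q'" using \<open>b \<in> _\<close> by (rule trunc_cases)
    have "q * (q' * (\<beta> (el 0 1) (g \<otimes> c) + \<beta> (el 0 1) (c \<otimes> g))) = 0"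
      using b0(3)[OF \<beta>, of "el 0 1" \<one>] by simp
    then show "slift (\<lambda>(a, b). \<beta> a b) (\<rho> (a \<otimes>\<^bsub>trunc\<^esub> b)) = slift (\<lambda>(a, b). \<beta> a b) (tmult trunc B (\<rho> a) (\<rho> b))"
      using closed b0(1)[OF \<beta>, of "el 0 1" "c \<otimes> c"] b0(2)[OF \<beta>, of "el 1 0" \<one>] by (simp add: a b \<rho>' g_g algebra_simps)
  qed
  show "tensor3_eq trunc B B (flift (\<lambda>(a, h). tens_r (\<rho> a) h) (\<rho> a)) (flift (\<lambda>(a, h). tens_l a (comult B h)) (\<rho> a))"
    if "a \<in> carrier trunc" for a
    unfolding tensor3_eq_iff
  proof (intro allI impI)
    fix \<tau> :: "'k poly set \<Rightarrow> 'b \<Rightarrow> 'b \<Rightarrow> 'k" assume \<tau>: "tril trunc B B \<tau>"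
    obtain p q where a: "a = el p q" using \<open>a \<in> _\<close> by (rule trunc_cases)
    have "bil B B (\<tau> x)" if "x \<in> carrier trunc" for x
      using trilD[OF \<tau>] that by (simp add: bil_def k_functional_def)
    then have sw: "slift (\<lambda>(b, c). \<tau> x b c) (comult B \<one>) = \<tau> x \<one> \<one>"
      "slift (\<lambda>(b, c). \<tau> x b c) (comult B c) = \<tau> x c c"
      "slift (\<lambda>(b, c). \<tau> x b c) (comult B g) = \<tau> x g c + \<tau> x \<one> g"
      if "x \<in> carrier trunc" for x
      using that by (simp_all add: sweed_one sweed_c sweed_g flip: sweed_def)
    show "slift (\<lambda>(a, b, c). \<tau> a b c) (flift (\<lambda>(a, h). tens_r (\<rho> a) h) (\<rho> a)) =
        slift (\<lambda>(a, b, c). \<tau> a b c) (flift (\<lambda>(a, h). tens_l a (comult B h)) (\<rho> a))"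
      by (simp add: a \<rho>' sw algebra_simps)
  qed
  show "mlift trunc (\<lambda>(a, h). counit B h \<odot>\<^bsub>trunc\<^esub> a) (\<rho> a) = a" if "a \<in> carrier trunc" for a
  proof -
    obtain p q where a: "a = el p q" using \<open>a \<in> _\<close> by (rule trunc_cases)
    have Pi: "(\<lambda>(a, h). counit B h \<odot>\<^bsub>trunc\<^esub> a) \<in> Poly_Mapping.keys (\<rho> (el p q)) \<rightarrow> carrier trunc"
      using keys[of p q] by auto
    show ?thesis
    proof (rule tr.functional_ext)
      fix l :: "'k poly set \<Rightarrow> 'k" assume l: "k_functional trunc l"
      show "l (mlift trunc (\<lambda>(a, h). counit B h \<odot>\<^bsub>trunc\<^esub> a) (\<rho> a)) = l a"
        unfolding a tr.functional_mlift[OF l Pi]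
        by (simp add: \<rho>' counit_one counit_c counit_g functional_trunc[OF l, of p q] functional_trunc[OF l, of 0 0])
    qed (use that tr.mlift_closed[OF Pi] a in simp_all)
  qed
  show "tensor_eq trunc B (\<rho> \<one>\<^bsub>trunc\<^esub>) (tens \<one>\<^bsub>trunc\<^esub> \<one>)"
    by (simp add: \<rho>' tensor_eq_iff)
qed

lemma coact_check_el: "coact_check trunc \<rho> l (el p q) = el (p * l \<one> + q * l g) (q * l c)"
proof -
  note \<rho>' = \<rho>[unfolded bar1_el barx_el]
  have "Poly_Mapping.keys (\<rho> (el p q)) \<subseteq> {(el 1 0, \<one>), (el 1 0, g), (el 0 1, c)}"
    unfolding \<rho>'
    by (intro order_trans[OF keys_add] Un_least order_trans[OF keys_fscale]) simp_all
  then have Pi: "(\<lambda>(a, h). l h \<odot>\<^bsub>trunc\<^esub> a) \<in> Poly_Mapping.keys (\<rho> (el p q)) \<rightarrow> carrier trunc" by auto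
  show ?thesis
    unfolding coact_check_def
  proof (rule tr.functional_ext)
    fix m :: "'k poly set \<Rightarrow> 'k" assume m: "k_functional trunc m"
    show "m (mlift trunc (\<lambda>(a0, a1). l a1 \<odot>\<^bsub>trunc\<^esub> a0) (\<rho> (el p q))) = m (el (p * l \<one> + q * l g) (q * l c))"
      unfolding tr.functional_mlift[OF m Pi] functional_trunc[OF m, of "p * l \<one> + q * l g"]
      by (simp add: \<rho>' functional_trunc[OF m, of "l _" 0] functional_trunc[OF m, of 0 "l _"] algebra_simps)
  qed (use tr.mlift_closed[OF Pi] in simp_all)
qed

lemma acts_by_coact_check: "acts_by (finite_dual B) (coact_check trunc \<rho>) (\<lambda>l. l g) (\<lambda>l. l c)"
  by (simp add: acts_by_def coact_check_el finite_dual_sel mult.commute)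

text \<open>With \<alpha> and \<beta> the evaluations at \<open>g\<close> and \<open>c\<close>,
  their values on products of functionals follow from the coproducts of \<open>g\<close> and
  \<open>c\<close>, and the convolution identities read l(gg) = 0 and l(gc + cg) = 0.\<close>

lemma action_coact_check: "unital_hopf_action (finite_dual B) trunc (coact_check trunc \<rho>)"
proof (rule trunc_actionI[OF hopf_algebra_finite_dual _ acts_by_coact_check])
  have "l (g \<otimes> c) + l (c \<otimes> g) = 0" "l \<zero> = 0" if "l \<in> finite_dual_carrier B" for l
    using k_functionalD(1)[OF finite_dual_carrierD(2)[OF that], of "g \<otimes> c" "c \<otimes> g"] closed
      functional_zero[OF finite_dual_carrierD(2)[OF that]] by (simp_all add: g_c)
  moreover have "(l \<otimes>\<^bsub>dual_algebra B\<^esub> m) c = l c * m c" "(l \<otimes>\<^bsub>dual_algebra B\<^esub> m) g = l g * m c + l \<one> * m g"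
    if "l \<in> finite_dual_carrier B" "m \<in> finite_dual_carrier B" for l m
    using bil_mult[OF finite_dual_carrierD(2)[OF that(1)] finite_dual_carrierD(2)[OF that(2)]] closed
    by (simp_all add: sweed_c sweed_g)
  ultimately show "action_data (finite_dual B) (\<lambda>l. l g) (\<lambda>l. l c)"
    unfolding action_data_def
    using closed by (simp add: finite_dual_sel comult_finite_dual(2) counit_c counit_g g_g)
      (simp add: k_functional_def finite_dual_sel)
qed

end

lemma trunc_coaction_cdh: "trunc_coaction cdh_hopf cdh_c cdh_h rho5"
  by (intro trunc_coaction.intro hopf_algebra_cdh trunc_coaction_axioms.intro)
    (simp_all add: cdh_sel cdh_sweed cdh_mult rho5_def)

lemma psi5_coact_check: "psi5 = coact_check trunc rho5"
  by (rule ext) (rule psi5_def)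

lemmas acts_by_psi5 = trunc_coaction.acts_by_coact_check[OF trunc_coaction_cdh, folded psi5_coact_check]
  and action_psi5 = trunc_coaction.action_coact_check[OF trunc_coaction_cdh, folded psi5_coact_check]

text \<open>Coordinates are taken with respect to the basis \<open>1, c, v, cv\<close> of \<open>H\<^sub>4\<close>.  Sending \<open>c\<close> and \<open>d\<close> to \<open>c\<close>
  and \<open>h\<close> to \<open>v\<close> also makes this algebra a quotient of \<open>k\<langle>c,d,h\<rangle>/I\<^sub>0\<close>, in every characteristic.\<close>

definition sw_model :: "('k::field, 'k \<times> 'k \<times> 'k \<times> 'k) module"
  where "sw_model = \<lparr>
    carrier = UNIV,
    monoid.mult = (\<lambda>(p, q, r, s) (p', q', r', s').
      (p * p' + q * q', p * q' + q * p', r * p' + p * r' + q * s' - s * q', p * s' + s * p' + q * r' - r * q')),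
    one = (1, 0, 0, 0), ring.zero = (0, 0, 0, 0),
    add = (\<lambda>(p, q, r, s) (p', q', r', s'). (p + p', q + q', r + r', s + s')),
    module.smult = (\<lambda>c (p, q, r, s). (c * p, c * q, c * r, c * s))\<rparr>"

lemma sw_model_sel [simp]:
  "carrier sw_model = UNIV" "\<one>\<^bsub>sw_model\<^esub> = (1, 0, 0, 0)" "\<zero>\<^bsub>sw_model\<^esub> = (0, 0, 0, 0)"
  "(p, q, r, s) \<otimes>\<^bsub>sw_model\<^esub> (p', q', r', s') =
    (p * p' + q * q', p * q' + q * p', r * p' + p * r' + q * s' - s * q', p * s' + s * p' + q * r' - r * q')"
  "(p, q, r, s) \<oplus>\<^bsub>sw_model\<^esub> (p', q', r', s') = (p + p', q + q', r + r', s + s')"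
  "c \<odot>\<^bsub>sw_model\<^esub> (p, q, r, s) = (c * p, c * q, c * r, c * s)"
  by (simp_all add: sw_model_def)

lemma k_algebra_sw_model: "k_algebra (sw_model :: ('k::field, _) module)"
  by (rule k_algebraI) (auto simp: algebra_simps)

lemma functional_sw_model_minus:
  fixes l :: "'k \<times> 'k \<times> 'k \<times> 'k \<Rightarrow> 'k::field"
  assumes "k_functional sw_model l"
  shows "l (0, 0, 0, 0) = 0" "l (0, 0, 0, - 1) = - l (0, 0, 0, 1)"
  using k_functionalD(2)[OF assms, of "(0, 0, 0, 0)" 0] k_functionalD(2)[OF assms, of "(0, 0, 0, 1)" "- 1"] by simp_all

text \<open>A functional that factors through an algebra map to a finite dimensional algebra lies in
  the finite dual; the four coordinates of the model are the family of the membership test.\<close>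

lemma finite_dual_sw_model:
  fixes H :: "('k::field, 'h, 'm) hopf_scheme"
  assumes "hopf_algebra H" and F: "k_linear H sw_model F" "F \<in> ring_hom H sw_model"
  shows "(\<lambda>z\<in>carrier H. case F z of (p, q, r, s) \<Rightarrow> u * p + v * q + w * r + x * s) \<in> finite_dual_carrier H"
proof -
  interpret H: hopf_algebra H by fact
  have add: "F (y \<oplus>\<^bsub>H\<^esub> z) = F y \<oplus>\<^bsub>sw_model\<^esub> F z" and mult: "F (y \<otimes>\<^bsub>H\<^esub> z) = F y \<otimes>\<^bsub>sw_model\<^esub> F z"
    and scale: "F (t \<odot>\<^bsub>H\<^esub> y) = t \<odot>\<^bsub>sw_model\<^esub> F y" if "y \<in> carrier H" "z \<in> carrier H" for y z t
    using F that by (auto simp: k_linear_def ring_hom_def)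
  let ?f = "\<lambda>u v w x z. case F z of (p, q, r, s) \<Rightarrow> u * p + v * q + w * r + x * s"
  have f: "k_functional H (?f u v w x)" for u v w x
    unfolding k_functional_def
    by (auto simp: add scale split: prod.split) (simp_all add: algebra_simps)
  show ?thesis
  proof (rule H.finite_dualI[of _ "{?f 1 0 0 0, ?f 0 1 0 0, ?f 0 0 1 0, ?f 0 0 0 1}"])
    show "k_functional H (restrict (?f u v w x) (carrier H))"
      using f[of u v w x] by (simp add: k_functional_def)
    fix b y z assume b: "b \<in> carrier H" "\<And>g. g \<in> {?f 1 0 0 0, ?f 0 1 0 0, ?f 0 0 1 0, ?f 0 0 0 1} \<Longrightarrow> g b = 0"
      and yz: "y \<in> carrier H" "z \<in> carrier H"
    obtain p q r s where Fb: "F b = (p, q, r, s)" by (cases "F b") auto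
    have "F b = (0, 0, 0, 0)"
      using b(2)[of "?f 1 0 0 0"] b(2)[of "?f 0 1 0 0"] b(2)[of "?f 0 0 1 0"] b(2)[of "?f 0 0 0 1"] by (simp add: Fb)
    moreover obtain p q r s where "F y = (p, q, r, s)" by (cases "F y") auto
    moreover obtain p q r s where "F z = (p, q, r, s)" by (cases "F z") auto
    ultimately show "restrict (?f u v w x) (carrier H) (y \<otimes>\<^bsub>H\<^esub> b \<otimes>\<^bsub>H\<^esub> z) = 0"
      using b(1) yz by (simp add: mult)
  qed (use f[of 1 0 0 0] f[of 0 1 0 0] f[of 0 0 1 0] f[of 0 0 0 1] in auto)
qed

text \<open>The images of 1, c and h in the model are distinct basis vectors, so values there can be
  prescribed independently. This is what makes the cosupport of \<open>psi5\<close> consist of all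
  upper triangular matrices.\<close>

lemma finite_dual_cdh_values:
  obtains l where "l \<in> finite_dual_carrier cdh_hopf" "l \<one>\<^bsub>cdh_hopf\<^esub> = p" "l cdh_h = q" "l cdh_c = (r :: 'k::field)"
proof -
  interpret hopf_algebra "cdh_hopf :: ('k, _) hopf" by (rule hopf_algebra_cdh)
  note presented.presented_hom_functional[OF k_algebra_sw_model, of "case_cdh (0, 1, 0, 0) (0, 1, 0, 0) (0, 0, 1, 0)"
      "cdh_relators :: (cdh list \<Rightarrow>\<^sub>0 'k) set"]
  moreover have "slift (\<lambda>w. l (foldr (\<lambda>g. (\<otimes>\<^bsub>sw_model\<^esub>) (case_cdh (0, 1, 0, 0) (0, 1, 0, 0) (0, 0, 1, 0) g)) w \<one>\<^bsub>sw_model\<^esub>)) r = 0"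
    if "r \<in> cdh_relators" "k_functional sw_model l" for r and l :: "'k \<times> 'k \<times> 'k \<times> 'k \<Rightarrow> 'k"
    using that(1) functional_sw_model_minus[OF that(2)] by (auto simp: cdh_relators_cases)
  ultimately obtain F :: "(cdh list \<Rightarrow>\<^sub>0 'k) set \<Rightarrow> _" where F: "k_linear cdh_quot sw_model F" "F \<in> ring_hom cdh_quot sw_model"
    "\<And>g. F (cdh_word [g]) = case_cdh (0, 1, 0, 0) (0, 1, 0, 0) (0, 0, 1, 0) g" by auto
  note P = F(1)[folded presented_bialgebra.linear_P[OF presented_bialgebra_cdh], folded cdh_hopf_def]
    F(2)[folded presented_bialgebra.ring_hom_P[OF presented_bialgebra_cdh], folded cdh_hopf_def]
  have v: "F \<one>\<^bsub>cdh_hopf\<^esub> = (1, 0, 0, 0)" "F cdh_h = (0, 0, 1, 0)" "F cdh_c = (0, 1, 0, 0)"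
    using ring_hom_one[OF P(2)] F(3)[of GenC] F(3)[of GenH] by (simp_all add: cdh_c_def cdh_h_def)
  show ?thesis
    \<comment> \<open>Coefficients are listed in the order 1, c, v, cv, so the value
      \<open>r\<close> at c precedes the value \<open>q\<close> at h.\<close>
    by (rule that[OF finite_dual_sw_model[OF hopf_algebra_cdh P, of p r q 0]]) (simp_all add: v cdh_sel)
qed

lemma cosupp_psi5: "cosupp (finite_dual cdh_hopf) trunc psi5 = {mop p q (r :: 'k::field) |p q r. True}"
proof -
  have "\<exists>l\<in>carrier (finite_dual cdh_hopf). mop p q r = mop (counit (finite_dual cdh_hopf) l) (l cdh_h) (l cdh_c)" for p q r :: 'k
  proof -
    obtain l where "l \<in> finite_dual_carrier cdh_hopf" "l \<one>\<^bsub>cdh_hopf\<^esub> = p" "l cdh_h = q" "l cdh_c = r"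
      by (rule finite_dual_cdh_values)
    then show ?thesis by (intro bexI[of _ l]) (simp_all add: finite_dual_sel)
  qed
  then show ?thesis unfolding cosupp_acts_by[OF acts_by_psi5] by fast
qed

lemma universal_psi5:
  "V_universal TYPE('h) trunc (cosupp (finite_dual (cdh_hopf :: ('k::field, _) hopf)) trunc psi5)
    (finite_dual cdh_hopf) psi5"
proof (rule V_universalI[OF action_psi5 acts_by_psi5])
  fix H :: "('k, 'h) hopf" and \<alpha> \<beta>
  assume hopf: "hopf_algebra H" and data: "action_data H \<alpha> \<beta>"
  interpret H: hopf_algebra H by fact
  let ?D = "dual_algebra H"
  interpret D: k_algebra ?D by (rule H.dual_algebra_algebra)
  \<comment> \<open>These become the images of h, c and d.\<close>
  define a b b' where "a = restrict \<alpha> (carrier H)" and "b = restrict \<beta> (carrier H)"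
    and "b' = (\<lambda>h\<in>carrier H. b (antipode H h))"
  have b: "b \<in> characters H" and a: "a \<in> carrier ?D"
    using data by (simp_all add: a_def b_def action_data_def characters_def H.dual_carrier k_functional_def)
  note b' = H.character_inverse[OF b, folded b'_def]
  note bD = H.charactersD(1)[OF b] H.charactersD(1)[OF b'(1)]
  have aa: "a \<otimes>\<^bsub>?D\<^esub> a = \<zero>\<^bsub>?D\<^esub>" and ab: "a \<otimes>\<^bsub>?D\<^esub> b \<oplus>\<^bsub>?D\<^esub> b \<otimes>\<^bsub>?D\<^esub> a = \<zero>\<^bsub>?D\<^esub>"
    using data by (auto intro!: extensionalityI[of _ "carrier H"] simp: action_data_def a_def b_def cong: H.sweed_cong)
  have cl: "case_cdh b b' a g \<in> carrier ?D" for g using a bD by (cases g) simp_all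
  have "slift (\<lambda>w. l (foldr (\<lambda>g. (\<otimes>\<^bsub>?D\<^esub>) (case_cdh b b' a g)) w \<one>\<^bsub>?D\<^esub>)) r = 0"
    if "r \<in> cdh_relators" "k_functional ?D l" for r and l :: "('h \<Rightarrow> 'k) \<Rightarrow> 'k"
    using that(1) k_functionalD(1)[OF that(2), of "a \<otimes>\<^bsub>?D\<^esub> b" "b \<otimes>\<^bsub>?D\<^esub> a"] a bD
    by (auto simp: cdh_relators_cases b' aa ab D.functional_zero[OF that(2)])
  then obtain F where F: "k_linear cdh_quot ?D F" "F \<in> ring_hom cdh_quot ?D"
    "\<And>g. F (cdh_word [g]) = case_cdh b b' a g"
    by (rule presented.presented_hom_functional[where A = ?D and u = "case_cdh b b' a"
      and R = "cdh_relators :: (cdh list \<Rightarrow>\<^sub>0 'k) set", OF D.k_algebra_axioms cl]) blast+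
  interpret dual_map H cdh_hopf F
    using F(1,2) by (intro dual_map.intro hopf hopf_algebra_cdh dual_map_axioms.intro)
      (simp_all only: presented_bialgebra.linear_P[OF presented_bialgebra_cdh, folded cdh_hopf_def]
        presented_bialgebra.ring_hom_P[OF presented_bialgebra_cdh, folded cdh_hopf_def])
  have Fv: "F cdh_c = b" "F cdh_h = a" "F (cdh_word [GenD]) = b'"
    using F(3)[of GenC] F(3)[of GenH] F(3)[of GenD] by (simp_all add: cdh_c_def cdh_h_def)
  have gen: "multiplicative_at (cdh_word [g])" for g
  proof (cases g)
    case GenC
    show ?thesis unfolding GenC cdh_c_def[symmetric] multiplicative_at_def
      by (simp add: cdh_sweed(1)[OF bil_F] cdh_sel Fv H.charactersD(4,5)[OF b])
  next
    case GenD
    then show ?thesis unfolding multiplicative_at_def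
      by (simp add: cdh_sweed(2)[OF bil_F] cdh_sel Fv H.charactersD(4,5)[OF b'(1)])
  next
    case GenH
    \<comment> \<open>The coproduct h \<otimes> c + 1 \<otimes> h turns the condition into the rule
      for \<alpha> on products.\<close>
    show ?thesis unfolding GenH cdh_h_def[symmetric] multiplicative_at_def
      using data by (simp add: cdh_sweed(3)[OF bil_F] cdh_sel Fv F_one action_data_def) (simp add: a_def b_def)
  qed
  have "multiplicative_at z" if "z \<in> carrier cdh_hopf" for z
    using that
  proof (induction rule: presented_bialgebra.P_induct[OF presented_bialgebra_cdh, folded cdh_hopf_def, consumes 1])
    case 1
    show ?case by (rule multiplicative_at_one)
  next
    case (2 g x)
    then show ?case by (intro multiplicative_at_mult gen cdh_sel)
  next
    case (3 x y)
    then show ?case by (intro multiplicative_at_add)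
  next
    case (4 c x)
    then show ?case by (intro multiplicative_at_scale)
  qed
  from hopf_hom_transpose[OF this]
  show "\<exists>\<phi>. hopf_hom H (finite_dual cdh_hopf) \<phi> \<and> (\<forall>h\<in>carrier H. \<phi> h cdh_h = \<alpha> h \<and> \<phi> h cdh_c = \<beta> h)"
    by (intro exI[of _ transpose]) (simp add: transpose_apply cdh_sel Fv a_def b_def)
next
  fix H :: "('k, 'h) hopf" and \<phi> \<phi>' h
  assume *: "hopf_algebra H" "hopf_hom H (finite_dual cdh_hopf) \<phi>" "hopf_hom H (finite_dual cdh_hopf) \<phi>'"
    "\<And>h. h \<in> carrier H \<Longrightarrow> \<phi> h cdh_h = \<phi>' h cdh_h \<and> \<phi> h cdh_c = \<phi>' h (cdh_c :: (cdh list \<Rightarrow>\<^sub>0 'k) set)"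
    and h: "h \<in> carrier H"
  interpret two_dual_homs H "cdh_hopf :: ('k, _) hopf" \<phi> \<phi>'
    by (intro two_dual_homs.intro two_dual_homs_axioms.intro * hopf_algebra_cdh)
  have c: "agree_at cdh_c" and "agree_at cdh_h" using *(4) by (simp_all add: agree_at_def)
  \<comment> \<open>The generator d is the antipode of c.\<close>
  moreover have "agree_at (cdh_word [GenD])"
    using agree_at_antipode[OF _ c] by (simp add: cdh_sel)
  ultimately have gen: "agree_at (cdh_word [g])" for g
    by (cases g) (simp_all add: cdh_c_def cdh_h_def)
  have "agree_at z" if "z \<in> carrier cdh_hopf" for z
    using that
  proof (induction rule: presented_bialgebra.P_induct[OF presented_bialgebra_cdh, folded cdh_hopf_def, consumes 1])
    case 1
    show ?case by (rule agree_at_one)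
  next
    case (2 g x)
    then show ?case by (intro agree_at_mult gen cdh_sel)
  next
    case (3 x y)
    then show ?case by (intro agree_at_add)
  next
    case (4 c x)
    then show ?case by (intro agree_at_scale)
  qed
  then show "\<phi> h = \<phi>' h" using h by (rule agree_all)
qed

subsection \<open>The Sweedler algebra\<close>

abbreviation sw_comult where
  "sw_comult \<equiv> case_cv (tens (word [SwC]) (word [SwC])) (tens (word [SwC]) (word [SwV]) + tens (word [SwV]) (word []))"

abbreviation sw_counit where "sw_counit \<equiv> case_cv 1 0"

abbreviation sw_antipode where "sw_antipode \<equiv> case_cv (word [SwC]) (- word [SwC, SwV])"

abbreviation sw_quot :: "('k::field, (cv list \<Rightarrow>\<^sub>0 'k) set) module" where
  "sw_quot \<equiv> quot_algebra free_algebra (genideal free_algebra sweedler_relators)"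

abbreviation sw_word :: "cv list \<Rightarrow> (cv list \<Rightarrow>\<^sub>0 'k::field) set" where
  "sw_word w \<equiv> pres_class sweedler_relators (word w)"

lemma sw_relators_cases: "r \<in> sweedler_relators \<longleftrightarrow>
    r = word [SwC, SwC] - word [] \<or> r = word [SwV, SwV] \<or> r = word [SwV, SwC] + word [SwC, SwV]"
  by (simp add: sweedler_relators_def)

lemma sw_relations:
  assumes l: "k_functional sw_quot l"
  shows "l (sw_word (u @ SwC # SwC # v)) = l (sw_word (u @ v))"
    "l (sw_word (u @ SwV # SwV # v)) = 0"
    "l (sw_word (u @ SwV # SwC # v)) = - l (sw_word (u @ SwC # SwV # v))"
  using presented.functional_relator[OF l, of "word [SwC, SwC] - word []" u v]
    presented.functional_relator[OF l, of "word [SwV, SwV]" u v]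
    presented.functional_relator[OF l, of "word [SwV, SwC] + word [SwC, SwV]" u v]
  by (simp_all add: sw_relators_cases add_eq_0_iff2)

text \<open>Reductions to the basis 1, c, v, cv of the words that arise from products of basis
  elements and from the images of the relators.\<close>

lemma sw_normal_form:
  assumes l: "k_functional sw_quot l"
  shows "l (sw_word [SwC, SwC]) = l (sw_word [])" "l (sw_word [SwV, SwV]) = 0"
    "l (sw_word [SwV, SwC]) = - l (sw_word [SwC, SwV])" "l (sw_word [SwC, SwC, SwV]) = l (sw_word [SwV])"
    "l (sw_word [SwC, SwV, SwC]) = - l (sw_word [SwV])" "l (sw_word [SwC, SwV, SwV]) = 0"
    "l (sw_word [SwV, SwC, SwV]) = 0" "l (sw_word [SwC, SwV, SwC, SwV]) = 0"
  using sw_relations[OF l, of "[]" "[]"] sw_relations(1,3)[OF l, of "[]" "[SwV]"] sw_relations(2,3)[OF l, of "[SwC]" "[]"]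
    sw_relations(3)[OF l, of "[SwC]" "[SwV]"] sw_relations(2)[OF l, of "[SwC, SwC]" "[]"]
  by simp_all

lemma presented_bialgebra_sweedler:
  "presented_bialgebra (sweedler_relators :: (cv list \<Rightarrow>\<^sub>0 'k::field) set) sw_comult sw_counit sw_antipode"
proof
  fix r :: "cv list \<Rightarrow>\<^sub>0 'k" assume "r \<in> sweedler_relators"
  note r = this[unfolded sw_relators_cases]
  then show "slift (\<lambda>w. prod_list (map sw_counit w)) r = 0" by auto
  show "pres_class sweedler_relators (flift (word_antipode sw_antipode) r) = pres_class sweedler_relators 0"
  proof (rule presented.cls_eqI)
    fix l :: "(cv list \<Rightarrow>\<^sub>0 'k) set \<Rightarrow> 'k" assume l: "k_functional sw_quot l"
    show "slift (\<lambda>w. l (sw_word w)) (flift (word_antipode sw_antipode) r) = slift (\<lambda>w. l (sw_word w)) 0"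
      using r by (auto simp: sw_normal_form[OF l])
  qed
  fix \<beta> :: "(cv list \<Rightarrow>\<^sub>0 'k) set \<Rightarrow> (cv list \<Rightarrow>\<^sub>0 'k) set \<Rightarrow> 'k" assume \<beta>: "bil sw_quot sw_quot \<beta>"
  have l: "k_functional sw_quot (\<lambda>x. \<beta> x (sw_word w))" "k_functional sw_quot (\<lambda>y. \<beta> (sw_word w) y)" for w
    using \<beta> by (simp_all add: bil_def presented.Q_simps(6))
  have rel: "\<beta> (sw_word [SwC, SwC]) (sw_word w) = \<beta> (sw_word []) (sw_word w)"
    "\<beta> (sw_word [SwV, SwV]) (sw_word w) = 0"
    "\<beta> (sw_word [SwV, SwC]) (sw_word w) = - \<beta> (sw_word [SwC, SwV]) (sw_word w)"
    "\<beta> (sw_word w) (sw_word [SwC, SwC]) = \<beta> (sw_word w) (sw_word [])"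
    "\<beta> (sw_word w) (sw_word [SwV, SwV]) = 0"
    "\<beta> (sw_word w) (sw_word [SwV, SwC]) = - \<beta> (sw_word w) (sw_word [SwC, SwV])" for w
    using sw_normal_form[OF l(1)[of w]] sw_normal_form[OF l(2)[of w]] by simp_all
  show "slift (\<lambda>(a, b). \<beta> (pres_class sweedler_relators a) (pres_class sweedler_relators b)) (flift (word_comult sw_comult) r) = 0"
    using r by (auto simp: rel)
qed

lemmas sweedler_facts = presented_bialgebra_sweedler[THEN presented_bialgebra.bil_P, folded sweedler_def]
  presented_bialgebra_sweedler[THEN presented_bialgebra.sweed_P, folded sweedler_def]
  presented_bialgebra_sweedler[THEN presented_bialgebra.counit_P, folded sweedler_def]
  presented_bialgebra_sweedler[THEN presented_bialgebra.antipode_P, folded sweedler_def]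
  and sweedler_ops = presented_bialgebra.P_sel[OF presented_bialgebra_sweedler, folded sweedler_def]

definition sw_el :: "'k::field \<Rightarrow> 'k \<Rightarrow> 'k \<Rightarrow> 'k \<Rightarrow> (cv list \<Rightarrow>\<^sub>0 'k) set"
  where "sw_el p q r s = pres_class sweedler_relators
    (fscale p (word []) + fscale q (word [SwC]) + fscale r (word [SwV]) + fscale s (word [SwC, SwV]))"

lemma sw_word_el: "sw_word [] = sw_el 1 0 0 0" "sw_word [SwC] = sw_el 0 1 0 0" "sw_word [SwV] = sw_el 0 0 1 0"
    "sw_word [SwC, SwV] = sw_el 0 0 0 1" "sw_word [SwC, SwC] = sw_el 1 0 0 0"
  unfolding sw_el_def by (rule presented.cls_eqI, simp add: sw_normal_form)+

lemma sw_el_simps [simp]: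
  "\<one>\<^bsub>sweedler\<^esub> = sw_el 1 0 0 0" "\<zero>\<^bsub>sweedler\<^esub> = sw_el 0 0 0 0" "sw_c = sw_el 0 1 0 0" "sw_v = sw_el 0 0 1 0"
  "sw_el p q r s \<oplus>\<^bsub>sweedler\<^esub> sw_el p' q' r' s' = sw_el (p + p') (q + q') (r + r') (s + s')"
  "c \<odot>\<^bsub>sweedler\<^esub> sw_el p q r s = sw_el (c * p) (c * q) (c * r) (c * s)"
  "sw_el p q r s \<otimes>\<^bsub>sweedler\<^esub> sw_el p' q' r' s' = sw_el (p * p' + q * q') (p * q' + q * p')
    (r * p' + p * r' + q * s' - s * q') (p * s' + s * p' + q * r' - r * q')"
  "sw_el p q r s \<in> carrier sweedler" "counit sweedler (sw_el p q r s) = p + q"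
proof -
  show "\<one>\<^bsub>sweedler\<^esub> = sw_el 1 0 0 0" "\<zero>\<^bsub>sweedler\<^esub> = sw_el 0 0 0 0" "sw_c = sw_el 0 1 0 0" "sw_v = sw_el 0 0 1 0"
    unfolding sweedler_ops sw_c_def sw_v_def sw_el_def by (rule arg_cong[where f = "pres_class _"], rule fmap_eqI, simp)+
  show "sw_el p q r s \<oplus>\<^bsub>sweedler\<^esub> sw_el p' q' r' s' = sw_el (p + p') (q + q') (r + r') (s + s')"
    "c \<odot>\<^bsub>sweedler\<^esub> sw_el p q r s = sw_el (c * p) (c * q) (c * r) (c * s)"
    unfolding sw_el_def sweedler_ops by (rule arg_cong[where f = "pres_class _"], rule fmap_eqI, simp add: algebra_simps)+
  show "sw_el p q r s \<otimes>\<^bsub>sweedler\<^esub> sw_el p' q' r' s' = sw_el (p * p' + q * q') (p * q' + q * p')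
    (r * p' + p * r' + q * s' - s * q') (p * s' + s * p' + q * r' - r * q')"
    unfolding sw_el_def sweedler_ops by (rule presented.cls_eqI) (simp add: sw_normal_form algebra_simps)
  show "sw_el p q r s \<in> carrier sweedler" by (simp add: sw_el_def sweedler_ops)
  show "counit sweedler (sw_el p q r s) = p + q" by (simp add: sw_el_def sweedler_facts)
qed

lemma sw_el_sum: "sw_el p q r s = p \<odot>\<^bsub>sweedler\<^esub> \<one>\<^bsub>sweedler\<^esub> \<oplus>\<^bsub>sweedler\<^esub> q \<odot>\<^bsub>sweedler\<^esub> sw_c
    \<oplus>\<^bsub>sweedler\<^esub> r \<odot>\<^bsub>sweedler\<^esub> sw_v \<oplus>\<^bsub>sweedler\<^esub> s \<odot>\<^bsub>sweedler\<^esub> (sw_c \<otimes>\<^bsub>sweedler\<^esub> sw_v)"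
  by simp

lemma hopf_algebra_sweedler: "hopf_algebra (sweedler :: ('k::field, _) hopf)"
proof (rule presented_bialgebra.hopf_algebra_P[OF presented_bialgebra_sweedler, folded sweedler_def])
  interpret pre_hopf "sweedler :: ('k, _) hopf"
    by (rule presented_bialgebra.pre_hopf_P[OF presented_bialgebra_sweedler, folded sweedler_def])
  have "antipode sweedler (sw_word [SwC]) = (sw_word [SwC] :: (cv list \<Rightarrow>\<^sub>0 'k) set)" by (simp add: sweedler_facts)
  moreover have "antipode sweedler (sw_word [SwV]) = sw_el 0 0 0 (- 1 :: 'k)"
    unfolding sweedler_facts sw_el_def by (rule presented.cls_eqI) simp
  ultimately have S: "antipode sweedler (sw_el 0 1 0 (0 :: 'k)) = sw_el 0 1 0 0" "antipode sweedler (sw_el 0 0 1 (0 :: 'k)) = sw_el 0 0 0 (- 1)"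
    by (simp_all only: sw_word_el)
  have sw: "sweed sweedler (sw_el 0 1 0 (0 :: 'k)) \<beta> = \<beta> (sw_el 0 1 0 0) (sw_el 0 1 0 0)"
    "sweed sweedler (sw_el 0 0 1 (0 :: 'k)) \<beta> = \<beta> (sw_el 0 0 1 0) (sw_el 1 0 0 0) + \<beta> (sw_el 0 1 0 0) (sw_el 0 0 1 0)"
    if "bil sweedler sweedler \<beta>" for \<beta>
    unfolding sw_word_el[symmetric] using that by (simp_all add: sweedler_facts)
  show "hopf_at (sw_word [g])" for g :: cv
  proof (cases g)
    case SwC
    show ?thesis unfolding SwC sw_word_el by (rule hopf_at_grouplike) (simp_all add: sw S)
  next
    case SwV
    have "antipode sweedler (sw_el 1 0 0 (0 :: 'k)) = sw_el 1 0 0 0" using antipode_one by simp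
    then show ?thesis unfolding SwV sw_word_el
      by (intro hopf_at_skew_primitive[of _ "\<one>\<^bsub>sweedler\<^esub>" sw_c])
        (use sweed_one in \<open>simp_all add: sw S\<close>)
  qed
qed

text \<open>Linear independence of 1, c, v, cv: the algebra map to the concrete model reads off the
  coordinates.\<close>

lemma sw_el_eq_iff [simp]: "sw_el p q r s = sw_el p' q' r' s' \<longleftrightarrow> p = p' \<and> q = q' \<and> r = r' \<and> s = (s' :: 'k::field)"
proof -
  note presented.presented_hom_functional[OF k_algebra_sw_model, of "case_cv (0, 1, 0, 0) (0, 0, 1, 0)"
      "sweedler_relators :: (cv list \<Rightarrow>\<^sub>0 'k) set"]
  moreover have "slift (\<lambda>w. l (foldr (\<lambda>g. (\<otimes>\<^bsub>sw_model\<^esub>) (case_cv (0, 1, 0, 0) (0, 0, 1, 0) g)) w \<one>\<^bsub>sw_model\<^esub>)) r = 0"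
    if "r \<in> sweedler_relators" "k_functional sw_model l" for r and l :: "'k \<times> 'k \<times> 'k \<times> 'k \<Rightarrow> 'k"
    using that(1) functional_sw_model_minus[OF that(2)] by (auto simp: sw_relators_cases)
  ultimately obtain F :: "(cv list \<Rightarrow>\<^sub>0 'k) set \<Rightarrow> _" where F: "k_linear sw_quot sw_model F" "F \<in> ring_hom sw_quot sw_model"
    "\<And>g. F (sw_word [g]) = case_cv (0, 1, 0, 0) (0, 0, 1, 0) g" by auto
  note P = F(1)[folded presented_bialgebra.linear_P[OF presented_bialgebra_sweedler], folded sweedler_def]
    F(2)[folded presented_bialgebra.ring_hom_P[OF presented_bialgebra_sweedler], folded sweedler_def]
  have ops: "F \<one>\<^bsub>sweedler\<^esub> = (1, 0, 0, 0)"
    "\<And>x y. \<lbrakk>x \<in> carrier sweedler; y \<in> carrier sweedler\<rbrakk> \<Longrightarrow> F (x \<oplus>\<^bsub>sweedler\<^esub> y) = F x \<oplus>\<^bsub>sw_model\<^esub> F y"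
    "\<And>x y. \<lbrakk>x \<in> carrier sweedler; y \<in> carrier sweedler\<rbrakk> \<Longrightarrow> F (x \<otimes>\<^bsub>sweedler\<^esub> y) = F x \<otimes>\<^bsub>sw_model\<^esub> F y"
    "\<And>c x. x \<in> carrier sweedler \<Longrightarrow> F (c \<odot>\<^bsub>sweedler\<^esub> x) = c \<odot>\<^bsub>sw_model\<^esub> F x"
    using P by (auto simp: k_linear_def ring_hom_def simp del: sw_el_simps)
  have gens: "F sw_c = (0, 1, 0, 0)" "F sw_v = (0, 0, 1, 0)"
    using F(3)[of SwC] F(3)[of SwV] by (simp_all add: sw_c_def sw_v_def del: sw_el_simps)
  interpret hopf_algebra "sweedler :: ('k, _) hopf" by (rule hopf_algebra_sweedler)
  have cl: "sw_c \<in> carrier (sweedler :: ('k, _) hopf)" "sw_v \<in> carrier (sweedler :: ('k, _) hopf)" by simp_all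
  have "F (sw_el p q r s) = (p, q, r, s)" for p q r s
    unfolding sw_el_sum using cl by (simp add: ops gens del: sw_el_simps)
  then show ?thesis by (metis prod.inject)
qed

lemma carrier_sweedler: "carrier sweedler = {sw_el p q r s |p q r s. True}"
proof (rule Set.set_eqI, rule iffI)
  fix z assume "z \<in> carrier sweedler"
  then show "z \<in> {sw_el p q r s |p q r s. True}"
  proof (induction rule: presented_bialgebra.P_induct[OF presented_bialgebra_sweedler, folded sweedler_def, consumes 1])
    case (2 g x)
    then show ?case by (cases g) (auto simp: sw_word_el)
  qed auto
qed auto

lemma sw_coords_el [simp]: "sw_coords (sw_el p q r s) = (p, q, r, s)"
proof -
  have "sw_coords (sw_el p q r s) = (THE x. case x of (p', q', r', s') \<Rightarrow> sw_el p q r s = sw_el p' q' r' s')"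
    unfolding sw_coords_def sw_el_sum[symmetric] ..
  also have "\<dots> = (p, q, r, s)" by (rule the_equality) auto
  finally show ?thesis .
qed

lemma sweed_sw_el:
  assumes "bil sweedler sweedler \<beta>"
  shows "sweed sweedler (sw_el p q r s) \<beta> = p * \<beta> (sw_el 1 0 0 0) (sw_el 1 0 0 0) + q * \<beta> (sw_el 0 1 0 0) (sw_el 0 1 0 0)
    + r * (\<beta> (sw_el 0 1 0 0) (sw_el 0 0 1 0) + \<beta> (sw_el 0 0 1 0) (sw_el 1 0 0 0))
    + s * (\<beta> (sw_el 1 0 0 0) (sw_el 0 0 0 1) + \<beta> (sw_el 0 0 0 1) (sw_el 0 1 0 0))"
proof -
  have "sweed sweedler (sw_el p q r s) \<beta> = p * \<beta> (sw_word []) (sw_word []) + q * \<beta> (sw_word [SwC]) (sw_word [SwC])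
    + r * (\<beta> (sw_word [SwC]) (sw_word [SwV]) + \<beta> (sw_word [SwV]) (sw_word []))
    + s * (\<beta> (sw_word [SwC, SwC]) (sw_word [SwC, SwV]) + \<beta> (sw_word [SwC, SwV]) (sw_word [SwC]))"
    unfolding sw_el_def using assms by (simp add: sweedler_facts)
  then show ?thesis by (simp only: sw_word_el)
qed

lemma sw_xi_el [simp]: "sw_xi (sw_el p q r s) (sw_el p' q' r' s') =
    p * (p' + q') + q * (p' - q') + r * (s' - r') + s * (r' + s')"
  by (simp add: sw_xi_def)

text \<open>The pairing (z, y) \<mapsto> \<open>sw_xi z y\<close> is symmetric, so \<xi> is its own
  transpose on the carrier. It is an algebra map to the convolution algebra, and the theorem on
  transposes then shows it to be a Hopf algebra homomorphism.\<close>

lemma sw_xi_finite_dual: "hopf_hom sweedler (finite_dual sweedler) (sw_xi :: (cv list \<Rightarrow>\<^sub>0 'k::field) set \<Rightarrow> _)"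
proof -
  interpret H: hopf_algebra "sweedler :: ('k, _) hopf" by (rule hopf_algebra_sweedler)
  note ext = extensionalityI[of _ "carrier sweedler"]
  have ex [simp]: "sw_xi z \<in> extensional (carrier sweedler)" for z :: "(cv list \<Rightarrow>\<^sub>0 'k) set"
    by (simp add: sw_xi_def case_prod_unfold)
  have fn: "k_functional sweedler (sw_xi z)" if "z \<in> carrier sweedler" for z :: "(cv list \<Rightarrow>\<^sub>0 'k) set"
    using that by (auto simp: k_functional_def carrier_sweedler algebra_simps)
  interpret dual_map sweedler sweedler "sw_xi :: (cv list \<Rightarrow>\<^sub>0 'k::field) set \<Rightarrow> _"
  proof
    show "k_linear sweedler (dual_algebra sweedler) (sw_xi :: (cv list \<Rightarrow>\<^sub>0 'k) set \<Rightarrow> _)"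
      unfolding k_linear_def
      by (auto simp: H.dual_carrier fn intro!: ext) (auto simp: carrier_sweedler algebra_simps)
    show "sw_xi \<in> ring_hom (sweedler :: ('k, _) hopf) (dual_algebra sweedler)"
    proof (rule ring_hom_memI)
      fix y z :: "(cv list \<Rightarrow>\<^sub>0 'k) set" assume yz: "y \<in> carrier sweedler" "z \<in> carrier sweedler"
      show "sw_xi (y \<otimes>\<^bsub>sweedler\<^esub> z) = sw_xi y \<otimes>\<^bsub>dual_algebra sweedler\<^esub> sw_xi z"
      proof (rule ext)
        fix x :: "(cv list \<Rightarrow>\<^sub>0 'k) set" assume x: "x \<in> carrier sweedler"
        have "(sw_xi y \<otimes>\<^bsub>dual_algebra sweedler\<^esub> sw_xi z) x = sweed sweedler x (\<lambda>a b. sw_xi y a * sw_xi z b)"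
          using x by simp
        also have "\<dots> = sw_xi (y \<otimes>\<^bsub>sweedler\<^esub> z) x"
        proof -
          obtain p q r s where "x = sw_el p q r s" using x by (auto simp: carrier_sweedler)
          moreover obtain p' q' r' s' where "y = sw_el p' q' r' s'" using yz by (auto simp: carrier_sweedler)
          moreover obtain p'' q'' r'' s'' where "z = sw_el p'' q'' r'' s''" using yz by (auto simp: carrier_sweedler)
          ultimately show ?thesis
            using sweed_sw_el[OF H.bil_mult[OF fn[OF yz(1)] fn[OF yz(2)]], of p q r s] by (simp add: algebra_simps)
        qed
        finally show "sw_xi (y \<otimes>\<^bsub>sweedler\<^esub> z) x = (sw_xi y \<otimes>\<^bsub>dual_algebra sweedler\<^esub> sw_xi z) x" by simp
      qed simp_all
      show "sw_xi (y \<oplus>\<^bsub>sweedler\<^esub> z) = sw_xi y \<oplus>\<^bsub>dual_algebra sweedler\<^esub> sw_xi z"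
        using yz by (auto intro!: ext) (auto simp: carrier_sweedler algebra_simps)
    next
      show "sw_xi \<one>\<^bsub>sweedler\<^esub> = (\<one>\<^bsub>dual_algebra sweedler\<^esub> :: (cv list \<Rightarrow>\<^sub>0 'k) set \<Rightarrow> 'k)"
        by (auto intro!: ext) (auto simp: carrier_sweedler)
    qed (simp add: H.dual_carrier fn)
  qed
  have "multiplicative_at z" if z: "z \<in> carrier sweedler" for z
    unfolding multiplicative_at_def
  proof (intro conjI ballI)
    show "sw_xi z \<one>\<^bsub>sweedler\<^esub> = counit sweedler z" using z by (auto simp: carrier_sweedler)
    fix x y :: "(cv list \<Rightarrow>\<^sub>0 'k) set" assume xy: "x \<in> carrier sweedler" "y \<in> carrier sweedler"
    show "sw_xi z (x \<otimes>\<^bsub>sweedler\<^esub> y) = sweed sweedler z (\<lambda>a b. sw_xi a x * sw_xi b y)"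
    proof -
      obtain p q r s where "z = sw_el p q r s" using z by (auto simp: carrier_sweedler)
      moreover obtain p' q' r' s' where "x = sw_el p' q' r' s'" using xy by (auto simp: carrier_sweedler)
      moreover obtain p'' q'' r'' s'' where "y = sw_el p'' q'' r'' s''" using xy by (auto simp: carrier_sweedler)
      ultimately show ?thesis using sweed_sw_el[OF bil_F[OF xy], of p q r s] by (simp add: algebra_simps)
    qed
  qed
  from hopf_hom_transpose[OF this] have "hopf_hom sweedler (finite_dual sweedler) transpose" .
  moreover have "transpose = restrict sw_xi (carrier sweedler)"
    by (auto simp: transpose_def intro!: restrict_ext ext) (auto simp: carrier_sweedler algebra_simps)
  ultimately have "hopf_hom sweedler (finite_dual sweedler) (restrict sw_xi (carrier (sweedler :: ('k, _) hopf)))" by simp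
  then show ?thesis
    using hopf_hom_cong[OF H.hopf_algebra_axioms, of "restrict sw_xi (carrier sweedler)" sw_xi] by simp
qed

lemma hopf_iso_sw_xi:
  assumes two: "(2 :: 'k::field) \<noteq> 0"
  shows "hopf_iso (sweedler :: ('k, _) hopf) (finite_dual sweedler) sw_xi"
  unfolding hopf_iso_def bij_betw_def
proof (intro conjI)
  interpret H: hopf_algebra "sweedler :: ('k, _) hopf" by (rule hopf_algebra_sweedler)
  \<comment> \<open>On coordinates \<xi> consists of two maps (x, y) \<mapsto> (x + y, x - y),
    inverted by halving sums and differences.\<close>
  have half: "(x + y) / 2 + (x - y) / 2 = x" "(x + y) / 2 - (x - y) / 2 = y" for x y :: 'k
    using two by (simp_all flip: add_divide_distrib diff_divide_distrib mult_2)
  show hom: "hopf_hom (sweedler :: ('k, _) hopf) (finite_dual sweedler) sw_xi" by (rule sw_xi_finite_dual)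
  have inj: "x = x' \<and> y = y'" if "x + y = x' + y'" "x - y = x' - y'" for x y x' y' :: 'k
    using half[of x y] half[of x' y'] half[of y x] half[of y' x'] that by (metis add.commute diff_add_cancel half)
  show "inj_on sw_xi (carrier (sweedler :: ('k, _) hopf))"
  proof (rule inj_onI)
    fix y z :: "(cv list \<Rightarrow>\<^sub>0 'k) set" assume yz: "y \<in> carrier sweedler" "z \<in> carrier sweedler" and eq: "sw_xi y = sw_xi z"
    obtain p q r s where y: "y = sw_el p q r s" using yz by (auto simp: carrier_sweedler)
    obtain p' q' r' s' where z: "z = sw_el p' q' r' s'" using yz by (auto simp: carrier_sweedler)
    from fun_cong[OF eq, of "sw_el 1 0 0 0"] fun_cong[OF eq, of "sw_el 0 1 0 0"]
      fun_cong[OF eq, of "sw_el 0 0 0 1"] fun_cong[OF eq, of "sw_el 0 0 1 0"]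
    have "p + q = p' + q'" "p - q = p' - q'" "s + r = s' + r'" "s - r = s' - r'"
      by (simp_all add: y z add.commute)
    then show "y = z" using inj[of p q p' q'] inj[of s r s' r'] by (simp add: y z)
  qed
  show "sw_xi ` carrier (sweedler :: ('k, _) hopf) = carrier (finite_dual sweedler)"
  proof (rule Set.set_eqI, rule iffI)
    fix l :: "(cv list \<Rightarrow>\<^sub>0 'k) set \<Rightarrow> 'k" assume "l \<in> sw_xi ` carrier sweedler"
    then show "l \<in> carrier (finite_dual sweedler)" using hom by (auto simp: hopf_hom_def k_linear_def)
  next
    fix l :: "(cv list \<Rightarrow>\<^sub>0 'k) set \<Rightarrow> 'k" assume "l \<in> carrier (finite_dual sweedler)"
    then have l: "k_functional sweedler l" "l \<in> extensional (carrier sweedler)"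
      by (simp_all add: finite_dual_sel finite_dual_carrierD)
    let ?a = "l (sw_el 1 0 0 0)" and ?b = "l (sw_el 0 1 0 0)" and ?c = "l (sw_el 0 0 1 0)" and ?d = "l (sw_el 0 0 0 1)"
    let ?z = "sw_el ((?a + ?b) / 2) ((?a - ?b) / 2) ((?d - ?c) / 2) ((?d + ?c) / 2)"
    have "sw_xi ?z = l"
    proof (rule extensionalityI[of _ "carrier sweedler"])
      fix y :: "(cv list \<Rightarrow>\<^sub>0 'k) set" assume "y \<in> carrier sweedler"
      then obtain p q r s where y: "y = sw_el p q r s" by (auto simp: carrier_sweedler)
      have "l y = p * ?a + q * ?b + r * ?c + s * ?d"
        using k_functionalD(1)[OF l(1), of "sw_el p q r 0" "sw_el 0 0 0 s"] k_functionalD(1)[OF l(1), of "sw_el p q 0 0" "sw_el 0 0 r 0"]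
          k_functionalD(1)[OF l(1), of "sw_el p 0 0 0" "sw_el 0 q 0 0"] k_functionalD(2)[OF l(1), of "sw_el 1 0 0 0" p]
          k_functionalD(2)[OF l(1), of "sw_el 0 1 0 0" q] k_functionalD(2)[OF l(1), of "sw_el 0 0 1 0" r]
          k_functionalD(2)[OF l(1), of "sw_el 0 0 0 1" s] by (simp add: y)
      also have "\<dots> = p * ((?a + ?b) / 2 + (?a - ?b) / 2) + q * ((?a + ?b) / 2 - (?a - ?b) / 2)
          + r * ((?d + ?c) / 2 - (?d - ?c) / 2) + s * ((?d + ?c) / 2 + (?d - ?c) / 2)"
        by (simp only: half)
      also have "\<dots> = sw_xi ?z y" unfolding y sw_xi_el by (simp only: algebra_simps)
      finally show "sw_xi ?z y = l y" ..
    qed (use l in \<open>simp_all add: sw_xi_def\<close>)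
    then show "l \<in> sw_xi ` carrier sweedler" by (intro image_eqI[of _ _ ?z]) simp_all
  qed
qed

section \<open>The action and the coaction of the Sweedler algebra\<close>

lemma trunc_coaction_sweedler: "trunc_coaction sweedler sw_c (sw_c \<otimes>\<^bsub>sweedler\<^esub> sw_v) rho5a"
  by (intro trunc_coaction.intro hopf_algebra_sweedler trunc_coaction_axioms.intro)
    (simp_all add: sweed_sw_el rho5a_def add.commute)

definition sw_alpha :: "(cv list \<Rightarrow>\<^sub>0 'k::field) set \<Rightarrow> 'k"
  where "sw_alpha z = (case sw_coords z of (p, q, r, s) \<Rightarrow> r + s)"

definition sw_beta :: "(cv list \<Rightarrow>\<^sub>0 'k::field) set \<Rightarrow> 'k"
  where "sw_beta z = (case sw_coords z of (p, q, r, s) \<Rightarrow> p - q)"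

lemma acts_by_psi5a: "acts_by sweedler psi5a sw_alpha sw_beta"
  by (auto simp: acts_by_def psi5a_def sw_alpha_def sw_beta_def carrier_sweedler bar1_el barx_el mult.commute)

lemma action_psi5a: "unital_hopf_action (sweedler :: ('k::field, _) hopf) trunc psi5a"
proof (rule trunc_actionI[OF hopf_algebra_sweedler _ acts_by_psi5a])
  interpret H: hopf_algebra "sweedler :: ('k, _) hopf" by (rule hopf_algebra_sweedler)
  have el: "sw_alpha (sw_el p q r s) = r + s" "sw_beta (sw_el p q r s) = p - q" for p q r s :: 'k
    by (simp_all add: sw_alpha_def sw_beta_def)
  have f: "k_functional sweedler (sw_alpha :: _ \<Rightarrow> 'k)" "k_functional sweedler (sw_beta :: _ \<Rightarrow> 'k)"
    by (auto simp: k_functional_def carrier_sweedler el algebra_simps)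
  note sw = sweed_sw_el[OF H.bil_mult[OF f(1,1)]] sweed_sw_el[OF H.bil_mult[OF f]]
    sweed_sw_el[OF H.bil_mult[OF f(2,1)]]
  show "action_data (sweedler :: ('k, _) hopf) sw_alpha sw_beta"
    unfolding action_data_def using f
    by (auto simp: carrier_sweedler sw el) (auto simp: algebra_simps)
qed

lemma cosupp_psi5a:
  assumes two: "(2 :: 'k::field) \<noteq> 0"
  shows "cosupp (sweedler :: ('k, _) hopf) trunc psi5a = {mop p q r |p q r. True}"
proof -
  have "\<exists>z\<in>carrier sweedler. mop p q r = mop (counit sweedler z) (sw_alpha z) (sw_beta z)" for p q r :: 'k
  proof -
    \<comment> \<open>The elements 1 and c act with diagonals (1, 1) and (1, -1) and produce the
      diagonal entries; v produces the upper right one.\<close>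
    have "(p + r) / 2 + (p - r) / 2 = p" "(p + r) / 2 - (p - r) / 2 = r"
      using two by (simp_all flip: add_divide_distrib diff_divide_distrib mult_2)
    then show ?thesis
      by (intro bexI[of _ "sw_el ((p + r) / 2) ((p - r) / 2) q 0"]) (simp_all add: sw_alpha_def sw_beta_def)
  qed
  then show ?thesis unfolding cosupp_acts_by[OF acts_by_psi5a] by fast
qed

text \<open>The coaction evaluates \<xi>(z) at 1, cv and c, where it takes the values p + q, r + s
  and p - q, which are the coefficients in \<open>psi5a\<close>.\<close>

lemma psi5a_coact_check:
  fixes z :: "(cv list \<Rightarrow>\<^sub>0 'k::field) set"
  assumes "z \<in> carrier sweedler" "a \<in> carrier trunc"
  shows "psi5a z a = coact_check trunc rho5a (sw_xi z) a"
proof -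
  obtain p q r s where z: "z = sw_el p q r s" using assms(1) by (auto simp: carrier_sweedler)
  obtain u v where a: "a = el u v" using assms(2) by (rule trunc_cases)
  show ?thesis
    unfolding a trunc_coaction.coact_check_el[OF trunc_coaction_sweedler]
    by (simp add: z psi5a_def bar1_el barx_el algebra_simps)
qed

section \<open>The five classes of actions and their universality\<close>

theorem theorem5p5:
  fixes \<theta> :: "'k::field"
  assumes "\<theta> \<noteq> 0"
  shows
    "(\<forall>(H :: ('k, 'h) hopf) \<psi>. unital_hopf_action H trunc \<psi> \<longrightarrow>
        equivalent_actions H trunc \<psi> field_hopf trunc psi1
      \<or> CHAR('k) = 2 \<and> equivalent_actions H trunc \<psi> trunc_hopf trunc psi2
      \<or> CHAR('k) = 2 \<and> equivalent_actions H trunc \<psi> kk_hopf trunc (psi3 \<theta>)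
      \<or> equivalent_actions H trunc \<psi> (finite_dual Cinf_hopf) trunc psi4
      \<or> equivalent_actions H trunc \<psi> (finite_dual cdh_hopf) trunc psi5)
   \<and> (unital_hopf_action (field_hopf :: ('k, 'k) hopf) trunc psi1
      \<and> cosupp field_hopf trunc psi1 =
          {f \<in> End_k trunc. \<exists>p::'k. f = (\<lambda>a\<in>carrier trunc. p \<odot>\<^bsub>trunc\<^esub> a)}
      \<and> operator_dim trunc (cosupp (field_hopf :: ('k, 'k) hopf) trunc psi1) 1
      \<and> V_universal TYPE('h) trunc (cosupp (field_hopf :: ('k, 'k) hopf) trunc psi1)
          field_hopf psi1)
   \<and> (CHAR('k) = 2 \<longrightarrow>
        unital_hopf_action (trunc_hopf :: ('k, _) hopf) trunc psi2
      \<and> cosupp trunc_hopf trunc psi2 =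
          {f \<in> End_k trunc. \<exists>p q::'k. has_matrix f p q
                                                  0 p}
      \<and> V_universal TYPE('h) trunc (cosupp (trunc_hopf :: ('k, _) hopf) trunc psi2)
          trunc_hopf psi2)
   \<and> (CHAR('k) = 2 \<longrightarrow>
        unital_hopf_action kk_hopf trunc (psi3 \<theta>)
      \<and> cosupp kk_hopf trunc (psi3 \<theta>) =
          {f \<in> End_k trunc. \<exists>p q. has_matrix f p (\<theta> * (p + q))
                                              0 q}
      \<and> V_universal TYPE('h) trunc (cosupp kk_hopf trunc (psi3 \<theta>)) kk_hopf (psi3 \<theta>))
   \<and> (unital_hopf_action (finite_dual (Cinf_hopf :: ('k, _) hopf)) trunc psi4
      \<and> cosupp (finite_dual Cinf_hopf) trunc psi4 =
          {f \<in> End_k trunc. \<exists>p q::'k. has_matrix f p 0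
                                                  0 q}
      \<and> operator_dim trunc (cosupp (finite_dual (Cinf_hopf :: ('k, _) hopf)) trunc psi4) 2
      \<and> V_universal TYPE('h) trunc (cosupp (finite_dual (Cinf_hopf :: ('k, _) hopf)) trunc psi4)
          (finite_dual Cinf_hopf) psi4
      \<and> (CHAR('k) \<noteq> 2 \<longrightarrow>
            unital_hopf_action (C2_hopf :: ('k, _) hopf) trunc psi4a
          \<and> equivalent_actions (C2_hopf :: ('k, _) hopf) trunc psi4a
              (finite_dual Cinf_hopf) trunc psi4))
   \<and> (unital_coaction (cdh_hopf :: ('k, _) hopf) trunc rho5
      \<and> unital_hopf_action (finite_dual (cdh_hopf :: ('k, _) hopf)) trunc psi5
      \<and> cosupp (finite_dual cdh_hopf) trunc psi5 =
          {f \<in> End_k trunc. \<exists>p q r::'k. has_matrix f p q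
                                                    0 r}
      \<and> operator_dim trunc (cosupp (finite_dual (cdh_hopf :: ('k, _) hopf)) trunc psi5) 3
      \<and> V_universal TYPE('h) trunc (cosupp (finite_dual (cdh_hopf :: ('k, _) hopf)) trunc psi5)
          (finite_dual cdh_hopf) psi5
      \<and> (CHAR('k) \<noteq> 2 \<longrightarrow>
            unital_hopf_action (sweedler :: ('k, _) hopf) trunc psi5a
          \<and> equivalent_actions (sweedler :: ('k, _) hopf) trunc psi5a
              (finite_dual cdh_hopf) trunc psi5
          \<and> unital_coaction (sweedler :: ('k, _) hopf) trunc rho5a
          \<and> hopf_iso (sweedler :: ('k, _) hopf) (finite_dual sweedler) sw_xi
          \<and> (\<forall>Z \<in> carrier (sweedler :: ('k, _) hopf). \<forall>a \<in> carrier trunc.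
                psi5a Z a = coact_check trunc rho5a (sw_xi Z) a)))"
proof -
  have k2: "(2 :: 'k) = 0" if "CHAR('k) = 2" using that by (simp only: char_two_iff)
  have k2': "(2 :: 'k) \<noteq> 0" if "CHAR('k) \<noteq> 2" using that by (simp only: char_two_iff not_False_eq_True)
  have End: "{mop p (u p r) r |p r. True} \<subseteq> End_k trunc" "{mop p q r |p q r :: 'k. True} \<subseteq> End_k trunc"
    "{mop p q p |p q :: 'k. True} \<subseteq> End_k trunc" "{mop p 0 p |p :: 'k. True} \<subseteq> End_k trunc" for u :: "'k \<Rightarrow> 'k \<Rightarrow> 'k"
    using mop_End by blast+
  have scalar: "mop p 0 p = (\<lambda>a\<in>carrier trunc. p \<odot>\<^bsub>trunc\<^esub> a)" for p :: 'k
    by (rule trunc_ext) simp_all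
  have classification: "equivalent_actions H trunc \<psi> field_hopf trunc psi1
      \<or> CHAR('k) = 2 \<and> equivalent_actions H trunc \<psi> trunc_hopf trunc psi2
      \<or> CHAR('k) = 2 \<and> equivalent_actions H trunc \<psi> kk_hopf trunc (psi3 \<theta>)
      \<or> equivalent_actions H trunc \<psi> (finite_dual Cinf_hopf) trunc psi4
      \<or> equivalent_actions H trunc \<psi> (finite_dual cdh_hopf) trunc psi5"
    if "unital_hopf_action H trunc \<psi>" for H :: "('k, 'h) hopf" and \<psi>
  proof -
    interpret unital_hopf_action H trunc \<psi> by fact
    obtain \<alpha> \<beta> where data: "action_data H \<alpha> \<beta>" "acts_by H \<psi> \<alpha> \<beta>" by (rule trunc_actionE[OF hopf_action_axioms])
    note eq = equivalent_if_cosupp_eq[where ?H1.0 = H and ?\<psi>1.0 = \<psi>]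
    from cosupp_classification[OF hopf_algebra_axioms data] show ?thesis
    proof (elim disjE conjE exE)
      assume *: "cosupp H trunc \<psi> = {mop p 0 p |p. True}"
      have "equivalent_actions H trunc \<psi> field_hopf trunc psi1"
        by (rule eq) (unfold * cosupp_psi1, rule refl, rule End)
      then show ?thesis by (rule disjI1)
    next
      assume 2: "CHAR('k) = 2" and *: "cosupp H trunc \<psi> = {mop p q p |p q. True}"
      have "equivalent_actions H trunc \<psi> trunc_hopf trunc psi2"
        by (rule eq) (unfold * cosupp_psi2, rule refl, rule End)
      then show ?thesis using 2 by (intro disjI2[OF disjI1] conjI)
    next
      fix \<gamma> assume 2: "CHAR('k) = 2" and \<gamma>: "\<gamma> \<noteq> 0" and *: "cosupp H trunc \<psi> = {mop p (\<gamma> * (p + q)) q |p q. True}"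
      have "equivalent_actions H trunc \<psi> kk_hopf trunc (psi3 \<theta>)"
      \<comment> \<open>The cosupports with different \<gamma> form a single class: rescaling x by
        \<gamma>/\<theta> carries \<gamma> to the prescribed \<theta>.\<close>
      proof (rule equivalent_rescale[where s = "\<gamma> / \<theta>" and u = "\<lambda>p r. \<theta> * (p + r)"])
        show "cosupp H trunc \<psi> = {mop p (\<gamma> / \<theta> * (\<theta> * (p + r))) r |p r. True}"
          using assms by (simp add: *)
      qed (use \<gamma> assms in \<open>simp_all add: cosupp_psi3\<close>)
      then show ?thesis using 2 by (intro disjI2[OF disjI2[OF disjI1]] conjI)
    next
      assume *: "cosupp H trunc \<psi> = {mop p 0 q |p q. True}"
      have "equivalent_actions H trunc \<psi> (finite_dual Cinf_hopf) trunc psi4"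
        by (rule eq) (unfold * cosupp_psi4, rule refl, rule End)
      then show ?thesis by (intro disjI2[OF disjI2[OF disjI2[OF disjI1]]])
    next
      assume *: "cosupp H trunc \<psi> = {mop p q r |p q r. True}"
      have "equivalent_actions H trunc \<psi> (finite_dual cdh_hopf) trunc psi5"
        by (rule eq) (unfold * cosupp_psi5, rule refl, rule End)
      then show ?thesis by (intro disjI2[OF disjI2[OF disjI2[OF disjI2]]])
    qed
  qed
  have V1: "cosupp field_hopf trunc psi1 = {f \<in> End_k trunc. \<exists>p::'k. f = (\<lambda>a\<in>carrier trunc. p \<odot>\<^bsub>trunc\<^esub> a)}"
    unfolding cosupp_psi1 scalar[symmetric] using mop_End by blast
  have V2: "cosupp trunc_hopf trunc psi2 = {f \<in> End_k trunc. \<exists>p q::'k. has_matrix f p q 0 p}"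
    and V3: "cosupp kk_hopf trunc (psi3 \<theta>) = {f \<in> End_k trunc. \<exists>p q. has_matrix f p (\<theta> * (p + q)) 0 q}"
    and V4: "cosupp (finite_dual Cinf_hopf) trunc psi4 = {f \<in> End_k trunc. \<exists>p q::'k. has_matrix f p 0 0 q}"
    and V5: "cosupp (finite_dual cdh_hopf) trunc psi5 = {f \<in> End_k trunc. \<exists>p q r::'k. has_matrix f p q 0 r}"
    unfolding cosupp_psi2 cosupp_psi3 cosupp_psi4 cosupp_psi5 using End_has_matrix_iff by blast+
  have eq4: "equivalent_actions (C2_hopf :: ('k, _) hopf) trunc psi4a (finite_dual Cinf_hopf) trunc psi4"
    and eq5: "equivalent_actions (sweedler :: ('k, _) hopf) trunc psi5a (finite_dual cdh_hopf) trunc psi5"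
    if "CHAR('k) \<noteq> 2"
    by (rule equivalent_if_cosupp_eq; unfold cosupp_psi4a[OF k2'[OF that]] cosupp_psi5a[OF k2'[OF that]] cosupp_psi4 cosupp_psi5;
        (rule refl End))+
  show ?thesis
    by (intro conjI allI impI ballI classification V1 V2 V3 V4 V5 eq4 eq5 action_psi1 action_psi2 action_psi3 action_psi4 action_psi4a
        action_psi5 action_psi5a universal_psi1 universal_psi2 universal_psi3 universal_psi4 universal_psi5 k2 k2' assms
        operator_dim_mop(1)[folded cosupp_psi1] operator_dim_mop(2)[folded cosupp_psi4] operator_dim_mop(3)[folded cosupp_psi5]
        trunc_coaction.unital_coaction[OF trunc_coaction_cdh] trunc_coaction.unital_coaction[OF trunc_coaction_sweedler]
        hopf_iso_sw_xi psi5a_coact_check)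
qed

end
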